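(* Let $R$ be a ring with unity and let $\mathcal{X}$ be a semibrick of left $R$-modules such that every $X\in\mathcal{X}$ has projective dimension at most one. (a) Let $Y$ be an $R$-module and let $Y=Y_{\mathcal{X}}(1)\hookrightarrow Y_{\mathcal{X}}(2)\hookrightarrow Y_{\mathcal{X}}(3)\hookrightarrow\cdots$ be a chain of $\mathcal{X}$-universal inclusions. Then, for each $j\ge 1$, the induced chain $Y_{\mathcal{X}}(j+1)/Y_{\mathcal{X}}(j)\hookrightarrow Y_{\mathcal{X}}(j+2)/Y_{\mathcal{X}}(j)\hookrightarrow\cdots$ is also a chain of $\mathcal{X}$-universal inclusions. (b) Let $Y\in\mathrm{Add}(\mathcal{X})$ and let $r\in\mathbb{N}$, $r\ge1$. Then the modules $Y_{\mathcal{X}}(i)$, $i\le r$ (with $Y_{\mathcal{X}}(0)=0$), form the $\mathcal{X}$-socle filtration of $Y_{\mathcal{X}}(r)$.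
   Context: A brick is a finitely presented left $R$-module whose endomorphism ring is a division ring. A semibrick is a class $\mathcal{X}$ of pairwise non-isomorphic bricks with $\mathrm{Hom}(X,X')=0$ for distinct $X,X'\in\mathcal{X}$. $\mathrm{Add}(\mathcal{X})$ is the class of modules isomorphic to direct summands of direct sums of modules in $\mathcal{X}$. $\mathcal{X}$-universal sequences: let $Y$ be a module. For each $X\in\mathcal{X}$, $\mathrm{Ext}^1(X,Y)$ is a left $\mathrm{End}(X)$-module (acting by pull-back; compositions written from left to right). Choose a basis $(0\to Y\to M_{X,i}\to X\to 0)_{i\in I_X}$ over the division ring $\mathrm{End}(X)$. The $\mathcal{X}$-universal short exact sequence $0\to Y\to M\to\bigoplus_{X\in\mathcal{X}}X^{(I_X)}\to 0$ starting from $Y$ is the push-out of $0\to\bigoplus_{X}Y^{(I_X)}\to\bigoplus_{X,i}M_{X,i}\to\bigoplus_{X}X^{(I_X)}\to 0$ along the summation map $\bigoplus_X Y^{(I_X)}\to Y$. An inclusion $\alpha:Y\hookrightarrow M$ is an $\mathcal{X}$-universal inclusion if $0\to Y\to M\to M/\mathrm{Im}\,\alpha\to0$ is (isomorphic, via an isomorphism that is the identity on $Y$, to) an $\mathcal{X}$-universal short exact sequence starting from $Y$. Given $Y$, set $Y_{\mathcal{X}}(1)=Y$ and recursively let $Y_{\mathcal{X}}(i)\hookrightarrow Y_{\mathcal{X}}(i+1)$ be an $\mathcal{X}$-universal inclusion. $\mathcal{X}$-socle filtration: for a module $N$ put $\mathrm{soc}_{\mathcal{X}}N=\sum_{X\in\mathcal{X},\,f\in\mathrm{Hom}(X,N)}\mathrm{Im}\,f$.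 For a module $M$ admitting a (transfinite, continuous) filtration with consecutive factors isomorphic to modules in $\mathcal{X}$, the $\mathcal{X}$-socle filtration $(V_\lambda)$ is defined by $V_0=0$, $V_{\lambda+1}$ the preimage of $\mathrm{soc}_{\mathcal{X}}(M/V_\lambda)$ under $M\to M/V_\lambda$, and $V_\lambda=\bigcup_{\alpha<\lambda}V_\alpha$ for limit ordinals $\lambda$; once $V_\lambda=M$, all later terms equal $M$. *)

theory Defs
  imports "HOL-Algebra.Module" "HOL-Algebra.AbelCoset"
begin

section \<open>Left modules over a (not necessarily commutative) ring\<close>

text \<open>
  The locale \<^locale>\<open>module\<close> requires a commutative base ring, so only its record type is reused.
  The fields \<^const>\<open>mult\<close> and \<^const>\<open>one\<close> which a module inherits from the ring record carry no
  meaning; they are left undefined in all constructions.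
\<close>

locale left_module = R?: ring R + M?: abelian_group M
  for R :: "('r, 'z) ring_scheme" (structure) and M :: "('r, 'm) module" (structure) +
  assumes smult_closed:
      "\<lbrakk>a \<in> carrier R; x \<in> carrier M\<rbrakk> \<Longrightarrow> a \<odot>\<^bsub>M\<^esub> x \<in> carrier M"
    and smult_l_distr:
      "\<lbrakk>a \<in> carrier R; b \<in> carrier R; x \<in> carrier M\<rbrakk> \<Longrightarrow>
        (a \<oplus>\<^bsub>R\<^esub> b) \<odot>\<^bsub>M\<^esub> x = a \<odot>\<^bsub>M\<^esub> x \<oplus>\<^bsub>M\<^esub> b \<odot>\<^bsub>M\<^esub> x"
    and smult_r_distr:
      "\<lbrakk>a \<in> carrier R; x \<in> carrier M; y \<in> carrier M\<rbrakk> \<Longrightarrow>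
        a \<odot>\<^bsub>M\<^esub> (x \<oplus>\<^bsub>M\<^esub> y) = a \<odot>\<^bsub>M\<^esub> x \<oplus>\<^bsub>M\<^esub> a \<odot>\<^bsub>M\<^esub> y"
    and smult_assoc:
      "\<lbrakk>a \<in> carrier R; b \<in> carrier R; x \<in> carrier M\<rbrakk> \<Longrightarrow>
        (a \<otimes>\<^bsub>R\<^esub> b) \<odot>\<^bsub>M\<^esub> x = a \<odot>\<^bsub>M\<^esub> (b \<odot>\<^bsub>M\<^esub> x)"
    and smult_one:
      "x \<in> carrier M \<Longrightarrow> \<one>\<^bsub>R\<^esub> \<odot>\<^bsub>M\<^esub> x = x"

text \<open>Homomorphisms are extensional, so that equality of functions is equality of homomorphisms.\<close>

definition mod_hom ::
  "('r, 'z) ring_scheme \<Rightarrow> ('r, 'm) module \<Rightarrow> ('r, 'n) module \<Rightarrow> ('m \<Rightarrow> 'n) set" where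
  "mod_hom R M N = {h \<in> carrier M \<rightarrow>\<^sub>E carrier N.
     (\<forall>x\<in>carrier M. \<forall>y\<in>carrier M. h (x \<oplus>\<^bsub>M\<^esub> y) = h x \<oplus>\<^bsub>N\<^esub> h y) \<and>
     (\<forall>a\<in>carrier R. \<forall>x\<in>carrier M. h (a \<odot>\<^bsub>M\<^esub> x) = a \<odot>\<^bsub>N\<^esub> h x)}"

definition mod_iso ::
  "('r, 'z) ring_scheme \<Rightarrow> ('r, 'm) module \<Rightarrow> ('r, 'n) module \<Rightarrow> ('m \<Rightarrow> 'n) set" where
  "mod_iso R M N = {h \<in> mod_hom R M N. bij_betw h (carrier M) (carrier N)}"

definition isomorphic ::
  "('r, 'z) ring_scheme \<Rightarrow> ('r, 'm) module \<Rightarrow> ('r, 'n) module \<Rightarrow> bool" where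
  "isomorphic R M N \<longleftrightarrow> mod_iso R M N \<noteq> {}"

definition submod_of :: "('r, 'm) module \<Rightarrow> 'm set \<Rightarrow> ('r, 'm) module" where
  "submod_of M N = M\<lparr>carrier := N\<rparr>"

definition quot_mod :: "('r, 'm) module \<Rightarrow> 'm set \<Rightarrow> ('r, 'm set) module" where
  "quot_mod M N = \<lparr>carrier = a_rcosets\<^bsub>M\<^esub> N, mult = undefined, one = undefined,
     zero = N, add = set_add M,
     smult = (\<lambda>a C. N <+>\<^bsub>M\<^esub> (\<lambda>c. a \<odot>\<^bsub>M\<^esub> c) ` C)\<rparr>"

definition quot_proj :: "('r, 'm) module \<Rightarrow> 'm set \<Rightarrow> 'm \<Rightarrow> 'm set" where
  "quot_proj M N = (\<lambda>x\<in>carrier M. N +>\<^bsub>M\<^esub> x)"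

text \<open>The map \<open>M/N \<rightarrow> M'/N'\<close>, \<open>N + x \<mapsto> N' + f x\<close>, induced by \<open>f : M \<rightarrow> M'\<close> with \<open>f N \<subseteq> N'\<close>.\<close>

definition quot_map ::
  "('r, 'm) module \<Rightarrow> 'm set \<Rightarrow> ('r, 'n) module \<Rightarrow> 'n set \<Rightarrow> ('m \<Rightarrow> 'n) \<Rightarrow> 'm set \<Rightarrow> 'n set" where
  "quot_map M N M' N' f = (\<lambda>C\<in>carrier (quot_mod M N). N' <+>\<^bsub>M'\<^esub> f ` C)"

definition mod_span :: "('r, 'z) ring_scheme \<Rightarrow> ('r, 'm) module \<Rightarrow> 'm set \<Rightarrow> 'm set" where
  "mod_span R M S = \<Inter>{N. submodule N R M \<and> S \<subseteq> N}"

definition mod_prod :: "('r, 'm) module \<Rightarrow> ('r, 'n) module \<Rightarrow> ('r, 'm \<times> 'n) module" where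
  "mod_prod M N = \<lparr>carrier = carrier M \<times> carrier N, mult = undefined, one = undefined,
     zero = (\<zero>\<^bsub>M\<^esub>, \<zero>\<^bsub>N\<^esub>),
     add = (\<lambda>u v. (fst u \<oplus>\<^bsub>M\<^esub> fst v, snd u \<oplus>\<^bsub>N\<^esub> snd v)),
     smult = (\<lambda>a u. (a \<odot>\<^bsub>M\<^esub> fst u, a \<odot>\<^bsub>N\<^esub> snd u))\<rparr>"

definition direct_sum :: "'i set \<Rightarrow> ('i \<Rightarrow> ('r, 'm) module) \<Rightarrow> ('r, 'i \<Rightarrow> 'm) module" where
  "direct_sum I M =
     \<lparr>carrier = {v \<in> \<Pi>\<^sub>E i\<in>I. carrier (M i). finite {i \<in> I. v i \<noteq> \<zero>\<^bsub>M i\<^esub>}},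
      mult = undefined, one = undefined,
      zero = (\<lambda>i\<in>I. \<zero>\<^bsub>M i\<^esub>),
      add = (\<lambda>u v. \<lambda>i\<in>I. u i \<oplus>\<^bsub>M i\<^esub> v i),
      smult = (\<lambda>a v. \<lambda>i\<in>I. a \<odot>\<^bsub>M i\<^esub> v i)\<rparr>"

definition summation_map :: "'i set \<Rightarrow> ('r, 'm) module \<Rightarrow> ('i \<Rightarrow> 'm) \<Rightarrow> 'm" where
  "summation_map I M =
     (\<lambda>v\<in>carrier (direct_sum I (\<lambda>_. M)). finsum M v {i \<in> I. v i \<noteq> \<zero>\<^bsub>M\<^esub>})"

definition regular_mod :: "('r, 'z) ring_scheme \<Rightarrow> ('r, 'r) module" where
  "regular_mod R = \<lparr>carrier = carrier R, mult = undefined, one = undefined,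
     zero = \<zero>\<^bsub>R\<^esub>, add = add R, smult = mult R\<rparr>"

definition free_mod :: "('r, 'z) ring_scheme \<Rightarrow> 'i set \<Rightarrow> ('r, 'i \<Rightarrow> 'r) module" where
  "free_mod R I = direct_sum I (\<lambda>_. regular_mod R)"

definition finitely_presented :: "('r, 'z) ring_scheme \<Rightarrow> ('r, 'm) module \<Rightarrow> bool" where
  "finitely_presented R M \<longleftrightarrow> left_module R M \<and>
     (\<exists>(m::nat) (n::nat) f g.
        f \<in> mod_hom R (free_mod R {..<m}) (free_mod R {..<n}) \<and>
        g \<in> mod_hom R (free_mod R {..<n}) M \<and>
        g ` carrier (free_mod R {..<n}) = carrier M \<and>
        f ` carrier (free_mod R {..<m}) = a_kernel (free_mod R {..<n}) M g)"


section \<open>Short exact sequences\<close>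

record ('r, 'y, 'e, 'x) ses =
  ses_left :: "('r, 'y) module"
  ses_mid :: "('r, 'e) module"
  ses_right :: "('r, 'x) module"
  ses_inj :: "'y \<Rightarrow> 'e"
  ses_proj :: "'e \<Rightarrow> 'x"

definition short_exact :: "('r, 'z) ring_scheme \<Rightarrow> ('r, 'y, 'e, 'x) ses \<Rightarrow> bool" where
  "short_exact R s \<longleftrightarrow>
     left_module R (ses_left s) \<and> left_module R (ses_mid s) \<and> left_module R (ses_right s) \<and>
     ses_inj s \<in> mod_hom R (ses_left s) (ses_mid s) \<and>
     ses_proj s \<in> mod_hom R (ses_mid s) (ses_right s) \<and>
     inj_on (ses_inj s) (carrier (ses_left s)) \<and>
     ses_inj s ` carrier (ses_left s) = a_kernel (ses_mid s) (ses_right s) (ses_proj s) \<and>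
     ses_proj s ` carrier (ses_mid s) = carrier (ses_right s)"

text \<open>Isomorphism of short exact sequences which is the identity on the left-hand term.\<close>

definition ses_iso_under ::
  "('r, 'z) ring_scheme \<Rightarrow> ('r, 'y, 'e, 'x) ses \<Rightarrow> ('r, 'y, 'f, 'w) ses \<Rightarrow> bool" where
  "ses_iso_under R s t \<longleftrightarrow> ses_left s = ses_left t \<and>
     (\<exists>\<phi> \<in> mod_iso R (ses_mid s) (ses_mid t). \<exists>\<psi> \<in> mod_iso R (ses_right s) (ses_right t).
        (\<forall>y\<in>carrier (ses_left s). \<phi> (ses_inj s y) = ses_inj t y) \<and>
        (\<forall>e\<in>carrier (ses_mid s). ses_proj t (\<phi> e) = \<psi> (ses_proj s e)))"

text \<open>Equivalence of extensions: the identity on both end terms.\<close>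

definition ses_equiv ::
  "('r, 'z) ring_scheme \<Rightarrow> ('r, 'y, 'e, 'x) ses \<Rightarrow> ('r, 'y, 'f, 'x) ses \<Rightarrow> bool" where
  "ses_equiv R s t \<longleftrightarrow> ses_left s = ses_left t \<and> ses_right s = ses_right t \<and>
     (\<exists>\<phi> \<in> mod_iso R (ses_mid s) (ses_mid t).
        (\<forall>y\<in>carrier (ses_left s). \<phi> (ses_inj s y) = ses_inj t y) \<and>
        (\<forall>e\<in>carrier (ses_mid s). ses_proj t (\<phi> e) = ses_proj s e))"

definition ses_sum ::
  "'i set \<Rightarrow> ('i \<Rightarrow> ('r, 'y, 'e, 'x) ses) \<Rightarrow> ('r, 'i \<Rightarrow> 'y, 'i \<Rightarrow> 'e, 'i \<Rightarrow> 'x) ses" where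
  "ses_sum I s =
     (let A = direct_sum I (\<lambda>i. ses_left (s i)); E = direct_sum I (\<lambda>i. ses_mid (s i)) in
     \<lparr>ses_left = A, ses_mid = E, ses_right = direct_sum I (\<lambda>i. ses_right (s i)),
      ses_inj = (\<lambda>v\<in>carrier A. \<lambda>i\<in>I. ses_inj (s i) (v i)),
      ses_proj = (\<lambda>v\<in>carrier E. \<lambda>i\<in>I. ses_proj (s i) (v i))\<rparr>)"

text \<open>Pull-back of \<open>s\<close> along \<open>f : W \<rightarrow> ses_right s\<close>.\<close>

definition ses_pullback ::
  "('r, 'w) module \<Rightarrow> ('w \<Rightarrow> 'x) \<Rightarrow> ('r, 'y, 'e, 'x) ses \<Rightarrow> ('r, 'y, 'e \<times> 'w, 'w) ses" where
  "ses_pullback W f s =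
     (let P = {(e, w). e \<in> carrier (ses_mid s) \<and> w \<in> carrier W \<and> ses_proj s e = f w} in
     \<lparr>ses_left = ses_left s, ses_mid = submod_of (mod_prod (ses_mid s) W) P, ses_right = W,
      ses_inj = (\<lambda>y\<in>carrier (ses_left s). (ses_inj s y, \<zero>\<^bsub>W\<^esub>)),
      ses_proj = (\<lambda>u\<in>P. snd u)\<rparr>)"

text \<open>
  Push-out of \<open>s\<close> along \<open>g : ses_left s \<rightarrow> Z\<close>, as a quotient of \<open>Z \<times> ses_mid s\<close>; the projection sends
  the coset of \<open>(z, e)\<close> to the image of \<open>e\<close>.
\<close>

definition ses_pushout ::
  "('r, 'w) module \<Rightarrow> ('y \<Rightarrow> 'w) \<Rightarrow> ('r, 'y, 'e, 'x) ses \<Rightarrow> ('r, 'w, ('w \<times> 'e) set, 'x) ses" where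
  "ses_pushout Z g s =
     (let P = mod_prod Z (ses_mid s);
          K = (\<lambda>y. (g y, \<ominus>\<^bsub>ses_mid s\<^esub> ses_inj s y)) ` carrier (ses_left s) in
     \<lparr>ses_left = Z, ses_mid = quot_mod P K, ses_right = ses_right s,
      ses_inj = (\<lambda>z\<in>carrier Z. K +>\<^bsub>P\<^esub> (z, \<zero>\<^bsub>ses_mid s\<^esub>)),
      ses_proj = (\<lambda>C\<in>carrier (quot_mod P K). the_elem ((\<lambda>(z, e). ses_proj s e) ` C))\<rparr>)"

definition split_ses :: "('r, 'x) module \<Rightarrow> ('r, 'y) module \<Rightarrow> ('r, 'y, 'y \<times> 'x, 'x) ses" where
  "split_ses X Y = \<lparr>ses_left = Y, ses_mid = mod_prod Y X, ses_right = X,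
      ses_inj = (\<lambda>y\<in>carrier Y. (y, \<zero>\<^bsub>X\<^esub>)),
      ses_proj = (\<lambda>u\<in>carrier Y \<times> carrier X. snd u)\<rparr>"

text \<open>
  The Baer sum: pull back \<open>s \<oplus> t\<close> along the diagonal of the right-hand term, then push out along the
  codiagonal of the left-hand term.
\<close>

definition baer_sum ::
  "('r, 'y, 'e, 'x) ses \<Rightarrow> ('r, 'y, 'e, 'x) ses \<Rightarrow>
     ('r, 'y, ('y \<times> ((bool \<Rightarrow> 'e) \<times> 'x)) set, 'x) ses" where
  "baer_sum s t =
     ses_pushout (ses_left s) (summation_map UNIV (ses_left s))
       (ses_pullback (ses_right s) (\<lambda>x\<in>carrier (ses_right s). \<lambda>_. x)
         (ses_sum UNIV (\<lambda>b. if b then s else t)))"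


section \<open>Projective dimension at most one\<close>

text \<open>
  HOL formulas cannot quantify over types, so the lifting property is stated for test modules in fixed
  types. These are large enough to include the canonical epimorphism from the free module on the
  carrier of \<open>P\<close> onto \<open>P\<close>; hence the property implies that \<open>P\<close> is a direct summand of a free module,
  and so the lifting property for test modules in all types.
\<close>

definition projective :: "('r, 'z) ring_scheme \<Rightarrow> ('r, 'p) module \<Rightarrow> bool" where
  "projective R P \<longleftrightarrow> left_module R P \<and>
     (\<forall>(M :: ('r, 'p \<Rightarrow> 'r) module) (N :: ('r, 'p) module).
        left_module R M \<longrightarrow> left_module R N \<longrightarrow>
        (\<forall>g \<in> mod_hom R M N. \<forall>h \<in> mod_hom R P N. g ` carrier M = carrier N \<longrightarrow>
           (\<exists>k \<in> mod_hom R P M. \<forall>x\<in>carrier P. g (k x) = h x)))"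

text \<open>
  The terms of the resolution live in the type of the free module on the carrier of \<open>X\<close>. This is no
  restriction: by Schanuel's lemma, if some projective resolution of length one exists, then the kernel
  of the canonical epimorphism from that free module onto \<open>X\<close> is projective.
\<close>

definition proj_dim_le_one :: "('r, 'z) ring_scheme \<Rightarrow> ('r, 'x) module \<Rightarrow> bool" where
  "proj_dim_le_one R X \<longleftrightarrow>
     (\<exists>s :: ('r, 'x \<Rightarrow> 'r, 'x \<Rightarrow> 'r, 'x) ses. short_exact R s \<and> ses_right s = X \<and>
        projective R (ses_left s) \<and> projective R (ses_mid s))"


section \<open>Semibricks\<close>

text \<open>Compositions are written from left to right: \<open>f \<otimes> g\<close> is first \<open>f\<close>, then \<open>g\<close>.\<close>

definition End_ring :: "('r, 'z) ring_scheme \<Rightarrow> ('r, 'm) module \<Rightarrow> ('m \<Rightarrow> 'm) ring" where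
  "End_ring R M = \<lparr>carrier = mod_hom R M M,
     mult = (\<lambda>f g. compose (carrier M) g f), one = (\<lambda>x\<in>carrier M. x),
     zero = (\<lambda>x\<in>carrier M. \<zero>\<^bsub>M\<^esub>), add = (\<lambda>f g. \<lambda>x\<in>carrier M. f x \<oplus>\<^bsub>M\<^esub> g x)\<rparr>"

definition division_ring :: "('r, 'z) ring_scheme \<Rightarrow> bool" where
  "division_ring D \<longleftrightarrow> ring D \<and> \<one>\<^bsub>D\<^esub> \<noteq> \<zero>\<^bsub>D\<^esub> \<and> Units D = carrier D - {\<zero>\<^bsub>D\<^esub>}"

definition brick :: "('r, 'z) ring_scheme \<Rightarrow> ('r, 'x) module \<Rightarrow> bool" where
  "brick R X \<longleftrightarrow> finitely_presented R X \<and> division_ring (End_ring R X)"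

definition semibrick :: "('r, 'z) ring_scheme \<Rightarrow> ('r, 'x) module set \<Rightarrow> bool" where
  "semibrick R \<X> \<longleftrightarrow> (\<forall>X\<in>\<X>. brick R X) \<and>
     (\<forall>X\<in>\<X>. \<forall>X'\<in>\<X>. X \<noteq> X' \<longrightarrow>
        \<not> isomorphic R X X' \<and> mod_hom R X X' = {\<lambda>x\<in>carrier X. \<zero>\<^bsub>X'\<^esub>})"

text \<open>
  The index type \<open>'y \<times> nat\<close> is no restriction: if \<open>Y\<close> is a direct summand of a direct sum, then it is
  also a direct summand of the partial sum over those indices at which some element of \<open>Y\<close> has a
  nonzero coordinate, and there are at most \<open>\<bar>Y\<bar> \<sqdot> \<aleph>\<^sub>0\<close> of them.
\<close>

definition Add :: "('r, 'z) ring_scheme \<Rightarrow> ('r, 'x) module set \<Rightarrow> ('r, 'y) module set" where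
  "Add R \<X> = {Y. left_module R Y \<and>
     (\<exists>(I :: ('y \<times> nat) set) F. (\<forall>i\<in>I. F i \<in> \<X>) \<and>
        (\<exists>s \<in> mod_hom R Y (direct_sum I F). \<exists>p \<in> mod_hom R (direct_sum I F) Y.
           \<forall>y\<in>carrier Y. p (s y) = y))}"


section \<open>Ext and universal extensions\<close>

text \<open>
  Every extension of \<open>X\<close> by \<open>Y\<close> is equivalent to one whose middle term has carrier in the type
  \<open>'y \<times> 'x\<close>, so classes of extensions are formed there. The argument of \<open>ext_class\<close> may have its middle
  term in any type.
\<close>

definition ext_class ::
  "('r, 'z) ring_scheme \<Rightarrow> ('r, 'y, 'e, 'x) ses \<Rightarrow> ('r, 'y, 'y \<times> 'x, 'x) ses set" where
  "ext_class R s = {t. short_exact R t \<and> ses_equiv R s t}"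

text \<open>\<open>Ext\<^sup>1(X, Y)\<close> as a left module over the endomorphism ring of \<open>X\<close>.\<close>

definition Ext1 ::
  "('r, 'z) ring_scheme \<Rightarrow> ('r, 'x) module \<Rightarrow> ('r, 'y) module \<Rightarrow>
     ('x \<Rightarrow> 'x, ('r, 'y, 'y \<times> 'x, 'x) ses set) module" where
  "Ext1 R X Y =
     \<lparr>carrier = ext_class R ` {s :: ('r, 'y, 'y \<times> 'x, 'x) ses.
                 short_exact R s \<and> ses_left s = Y \<and> ses_right s = X},
      mult = undefined, one = undefined,
      zero = ext_class R (split_ses X Y),
      add = (\<lambda>c d. \<Union>s\<in>c. \<Union>t\<in>d. ext_class R (baer_sum s t)),
      smult = (\<lambda>f c. \<Union>s\<in>c. ext_class R (ses_pullback X f s))\<rparr>"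

definition basis :: "('d, 'z) ring_scheme \<Rightarrow> ('d, 'v) module \<Rightarrow> 'v set \<Rightarrow> bool" where
  "basis D V B \<longleftrightarrow> B \<subseteq> carrier V \<and>
     (\<forall>A a. finite A \<longrightarrow> A \<subseteq> B \<longrightarrow> a \<in> A \<rightarrow> carrier D \<longrightarrow>
        finsum V (\<lambda>b. a b \<odot>\<^bsub>V\<^esub> b) A = \<zero>\<^bsub>V\<^esub> \<longrightarrow> (\<forall>b\<in>A. a b = \<zero>\<^bsub>D\<^esub>)) \<and>
     (\<forall>v\<in>carrier V. \<exists>A a. finite A \<and> A \<subseteq> B \<and> a \<in> A \<rightarrow> carrier D \<and>
        v = finsum V (\<lambda>b. a b \<odot>\<^bsub>V\<^esub> b) A)"

text \<open>
  A choice of bases is a family \<open>B\<close> of sets of classes together with a representative \<open>E X b\<close> of every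
  basis element; thus \<open>I\<^sub>X\<close> is \<open>B X\<close> and \<open>M\<^bsub>X,b\<^esub>\<close> is the middle term of \<open>E X b\<close>.
\<close>

definition ext_bases ::
  "('r, 'z) ring_scheme \<Rightarrow> ('r, 'x) module set \<Rightarrow> ('r, 'y) module \<Rightarrow>
     (('r, 'x) module \<Rightarrow> ('r, 'y, 'y \<times> 'x, 'x) ses set set) \<Rightarrow>
     (('r, 'x) module \<Rightarrow> ('r, 'y, 'y \<times> 'x, 'x) ses set \<Rightarrow> ('r, 'y, 'y \<times> 'x, 'x) ses) \<Rightarrow> bool" where
  "ext_bases R \<X> Y B E \<longleftrightarrow>
     (\<forall>X\<in>\<X>. basis (End_ring R X) (Ext1 R X Y) (B X) \<and> (\<forall>b\<in>B X. E X b \<in> b))"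

definition universal_ses ::
  "('r, 'x) module set \<Rightarrow> ('r, 'y) module \<Rightarrow>
     (('r, 'x) module \<Rightarrow> ('r, 'y, 'y \<times> 'x, 'x) ses set set) \<Rightarrow>
     (('r, 'x) module \<Rightarrow> ('r, 'y, 'y \<times> 'x, 'x) ses set \<Rightarrow> ('r, 'y, 'y \<times> 'x, 'x) ses) \<Rightarrow>
     ('r, 'y,
      ('y \<times> (('r, 'x) module \<times> ('r, 'y, 'y \<times> 'x, 'x) ses set \<Rightarrow> 'y \<times> 'x)) set,
      ('r, 'x) module \<times> ('r, 'y, 'y \<times> 'x, 'x) ses set \<Rightarrow> 'x) ses" where
  "universal_ses \<X> Y B E =
     (let J = (SIGMA X:\<X>. B X) in
      ses_pushout Y (summation_map J Y) (ses_sum J (\<lambda>(X, b). E X b)))"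

definition universal_inclusion ::
  "('r, 'z) ring_scheme \<Rightarrow> ('r, 'x) module set \<Rightarrow> ('r, 'y) module \<Rightarrow> ('r, 'm) module \<Rightarrow>
     ('y \<Rightarrow> 'm) \<Rightarrow> bool" where
  "universal_inclusion R \<X> Y M \<alpha> \<longleftrightarrow>
     left_module R Y \<and> left_module R M \<and> \<alpha> \<in> mod_hom R Y M \<and> inj_on \<alpha> (carrier Y) \<and>
     (\<exists>B E. ext_bases R \<X> Y B E \<and>
        ses_iso_under R
          \<lparr>ses_left = Y, ses_mid = M, ses_right = quot_mod M (\<alpha> ` carrier Y),
           ses_inj = \<alpha>, ses_proj = quot_proj M (\<alpha> ` carrier Y)\<rparr>
          (universal_ses \<X> Y B E))"

text \<open>A chain \<open>Y\<^sub>1 \<rightarrow> Y\<^sub>2 \<rightarrow> \<dots>\<close> with maps \<open>\<alpha>\<^sub>i : Y\<^sub>i \<rightarrow> Y\<^sub>i\<^sub>+\<^sub>1\<close>; the values at index 0 are irrelevant.\<close>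

definition universal_chain ::
  "('r, 'z) ring_scheme \<Rightarrow> ('r, 'x) module set \<Rightarrow> (nat \<Rightarrow> ('r, 'm) module) \<Rightarrow>
     (nat \<Rightarrow> 'm \<Rightarrow> 'm) \<Rightarrow> bool" where
  "universal_chain R \<X> Y \<alpha> \<longleftrightarrow>
     (\<forall>i\<ge>1. universal_inclusion R \<X> (Y i) (Y (Suc i)) (\<alpha> i))"

text \<open>The composite \<open>Y\<^sub>j \<rightarrow> Y\<^sub>j\<^sub>+\<^sub>k\<close> of the maps of a chain.\<close>

primrec chain_comp :: "(nat \<Rightarrow> 'm \<Rightarrow> 'm) \<Rightarrow> nat \<Rightarrow> nat \<Rightarrow> 'm \<Rightarrow> 'm" where
  "chain_comp \<alpha> j 0 = id"
| "chain_comp \<alpha> j (Suc k) = \<alpha> (j + k) \<circ> chain_comp \<alpha> j k"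

text \<open>The image of \<open>Y\<^sub>j\<close> in \<open>Y\<^sub>n\<close>, for \<open>j \<le> n\<close>.\<close>

definition chain_image ::
  "(nat \<Rightarrow> ('r, 'm) module) \<Rightarrow> (nat \<Rightarrow> 'm \<Rightarrow> 'm) \<Rightarrow> nat \<Rightarrow> nat \<Rightarrow> 'm set" where
  "chain_image Y \<alpha> j n = chain_comp \<alpha> j (n - j) ` carrier (Y j)"

text \<open>\<open>induced_chain_mod Y \<alpha> j k\<close> is \<open>Y\<^sub>j\<^sub>+\<^sub>k / Y\<^sub>j\<close>.\<close>

definition induced_chain_mod ::
  "(nat \<Rightarrow> ('r, 'm) module) \<Rightarrow> (nat \<Rightarrow> 'm \<Rightarrow> 'm) \<Rightarrow> nat \<Rightarrow> nat \<Rightarrow> ('r, 'm set) module" where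
  "induced_chain_mod Y \<alpha> j k = quot_mod (Y (j + k)) (chain_image Y \<alpha> j (j + k))"

definition induced_chain_map ::
  "(nat \<Rightarrow> ('r, 'm) module) \<Rightarrow> (nat \<Rightarrow> 'm \<Rightarrow> 'm) \<Rightarrow> nat \<Rightarrow> nat \<Rightarrow> 'm set \<Rightarrow> 'm set" where
  "induced_chain_map Y \<alpha> j k =
     quot_map (Y (j + k)) (chain_image Y \<alpha> j (j + k))
       (Y (j + Suc k)) (chain_image Y \<alpha> j (j + Suc k)) (\<alpha> (j + k))"


section \<open>Socle filtrations\<close>

definition socle ::
  "('r, 'z) ring_scheme \<Rightarrow> ('r, 'x) module set \<Rightarrow> ('r, 'm) module \<Rightarrow> 'm set" where
  "socle R \<X> N = mod_span R N (\<Union>X\<in>\<X>. \<Union>f\<in>mod_hom R X N. f ` carrier X)"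

text \<open>
  A transfinite continuous filtration with factors in \<open>\<X>\<close>, given by the set \<open>\<F>\<close> of its terms. If the
  members of \<open>\<X>\<close> are nonzero (as bricks are), a filtration is strictly increasing, so this set, which
  is well-ordered by inclusion, determines it. Every nonzero term is either a limit, hence the union of
  the earlier terms, or has an immediate predecessor \<open>K\<close>.
\<close>

definition filtration_by ::
  "('r, 'z) ring_scheme \<Rightarrow> ('r, 'x) module set \<Rightarrow> ('r, 'm) module \<Rightarrow> 'm set set \<Rightarrow> bool" where
  "filtration_by R \<X> M \<F> \<longleftrightarrow>
     (\<forall>N\<in>\<F>. submodule N R M) \<and>
     (\<forall>\<S>\<subseteq>\<F>. \<S> \<noteq> {} \<longrightarrow> (\<exists>N\<in>\<S>. \<forall>K\<in>\<S>. N \<subseteq> K)) \<and>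
     {\<zero>\<^bsub>M\<^esub>} \<in> \<F> \<and> carrier M \<in> \<F> \<and>
     (\<forall>N\<in>\<F>. N \<noteq> {\<zero>\<^bsub>M\<^esub>} \<longrightarrow>
        N = \<Union>{K \<in> \<F>. K \<subset> N} \<or>
        (\<exists>K\<in>\<F>. K \<subset> N \<and> (\<forall>L\<in>\<F>. L \<subset> N \<longrightarrow> L \<subseteq> K) \<and>
           (\<exists>X\<in>\<X>. isomorphic R (quot_mod (submod_of M N) K) X)))"

definition filtered_by ::
  "('r, 'z) ring_scheme \<Rightarrow> ('r, 'x) module set \<Rightarrow> ('r, 'm) module \<Rightarrow> bool" where
  "filtered_by R \<X> M \<longleftrightarrow> left_module R M \<and> (\<exists>\<F>. filtration_by R \<X> M \<F>)"

text \<open>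
  The elements of the well-ordered index type play the role of the ordinals below its order type; the
  three clauses concern zero, successors and limits. As in the usual definition, the socle filtration
  is only considered for modules that are filtered by \<open>\<X>\<close>.
\<close>

definition socle_filtration ::
  "('r, 'z) ring_scheme \<Rightarrow> ('r, 'x) module set \<Rightarrow> ('r, 'm) module \<Rightarrow>
     ('o::wellorder \<Rightarrow> 'm set) \<Rightarrow> bool" where
  "socle_filtration R \<X> M V \<longleftrightarrow> filtered_by R \<X> M \<and>
     (\<forall>l. (\<forall>k. l \<le> k) \<longrightarrow> V l = {\<zero>\<^bsub>M\<^esub>}) \<and>
     (\<forall>k l. k < l \<and> (\<forall>i<l. i \<le> k) \<longrightarrow>
        V l = {x \<in> carrier M. quot_proj M (V k) x \<in> socle R \<X> (quot_mod M (V k))}) \<and>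
     (\<forall>l. (\<exists>k. k < l) \<and> (\<forall>k<l. \<exists>i. k < i \<and> i < l) \<longrightarrow> V l = (\<Union>k\<in>{..<l}. V k))"

text \<open>
  The terms \<open>0, Y\<^sub>1, \<dots>, Y\<^sub>r = M\<close> inside \<open>M = Y\<^sub>r\<close>, continued by \<open>M\<close>.
\<close>

definition chain_filtration ::
  "(nat \<Rightarrow> ('r, 'm) module) \<Rightarrow> (nat \<Rightarrow> 'm \<Rightarrow> 'm) \<Rightarrow> nat \<Rightarrow> nat \<Rightarrow> 'm set" where
  "chain_filtration Y \<alpha> r i =
     (if i = 0 then {\<zero>\<^bsub>Y r\<^esub>} else if i \<le> r then chain_image Y \<alpha> i r else carrier (Y r))"

end

theory Submission
  imports Defs
begin

text \<open>
  Let \<open>0 \<rightarrow> P\<^sub>1 \<rightarrow> P\<^sub>0 \<rightarrow> X \<rightarrow> 0\<close> be a projective resolution. An extension of \<open>X\<close> by \<open>Y\<close> is determined by a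
  cocycle \<open>P\<^sub>1 \<rightarrow> Y\<close>, up to maps that extend to \<open>P\<^sub>0\<close>. In these terms an inclusion \<open>Y \<rightarrow> M\<close> is universal if and
  only if \<open>M/Y\<close> is a direct sum of members of \<open>\<X>\<close> and, for every \<open>X \<in> \<X>\<close>, (i) every map \<open>X \<rightarrow> M\<close> lands in \<open>Y\<close>
  and (ii) every map \<open>P\<^sub>1 \<rightarrow> Y\<close> extends to a map \<open>P\<^sub>0 \<rightarrow> M\<close>; that is, \<open>Hom(X, M/Y) \<rightarrow> Ext\<^sup>1(X, Y)\<close> is bijective.

  By (i), every map \<open>X \<rightarrow> Y(n)\<close> lands in \<open>Y(1)\<close>. A map \<open>X \<rightarrow> Y(n)/Y(j)\<close> lifts to \<open>P\<^sub>0 \<rightarrow> Y(n)\<close> and restricts to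
  \<open>P\<^sub>1 \<rightarrow> Y(j)\<close>; by (ii) it can be corrected by a map \<open>P\<^sub>0 \<rightarrow> Y(j+1)\<close> so as to factor through \<open>X\<close>, hence it lands in
  \<open>Y(j+1)/Y(j)\<close>. This gives (i) for the induced chain as well as the socle of \<open>Y(r)/Y(j)\<close>, and (ii) for
  the induced chain follows because \<open>P\<^sub>1\<close> is projective.
\<close>

section \<open>Linear maps and exactness\<close>

text \<open>The characterisation in the overview is used in both directions: it is extracted from
  the given chain and then certifies the quotient chain, whose modules have another carrier type and
  whose bases of Ext must be produced from scratch. An element of \<open>Ext1\<close> is a set of
  sequences with middle term in one fixed type, which push-outs, pull-backs and Baer sums leave; a
  cocycle stays in Hom(P1, Y), where addition is pointwise and End(X) acts by composition with
  lifted endomorphisms. The properties of a semibrick enter when a map from X to a direct sum of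
  members of \<open>\<X>\<close> is analysed: finitely many coordinates are nonzero, and these
  belong to copies of X, so the map is a finite family of coefficients in End(X). Invertibility of
  nonzero endomorphisms serves another purpose. The definition of a socle filtration also demands
  some transfinite filtration of Y(r) with factors in \<open>\<X>\<close>; for a module in Add it is
  built from all maps X \<rightarrow> Y. By invertibility a nonzero one is a split monomorphism, so
  adding the images one at a time contributes each time nothing or a full copy of X.\<close>

lemma left_module_abelian_group: "left_module R M \<Longrightarrow> abelian_group M"
  by (simp add: left_module_def)

lemma left_module_ring: "left_module R M \<Longrightarrow> ring R"
  by (simp add: left_module_def)

lemma left_moduleI:
  assumes "ring R" "abelian_group M"
    and "\<And>a x. a \<in> carrier R \<Longrightarrow> x \<in> carrier M \<Longrightarrow> a \<odot>\<^bsub>M\<^esub> x \<in> carrier M"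
    and "\<And>a b x. a \<in> carrier R \<Longrightarrow> b \<in> carrier R \<Longrightarrow> x \<in> carrier M \<Longrightarrow>
        (a \<oplus>\<^bsub>R\<^esub> b) \<odot>\<^bsub>M\<^esub> x = a \<odot>\<^bsub>M\<^esub> x \<oplus>\<^bsub>M\<^esub> b \<odot>\<^bsub>M\<^esub> x"
    and "\<And>a x y. a \<in> carrier R \<Longrightarrow> x \<in> carrier M \<Longrightarrow> y \<in> carrier M \<Longrightarrow>
        a \<odot>\<^bsub>M\<^esub> (x \<oplus>\<^bsub>M\<^esub> y) = a \<odot>\<^bsub>M\<^esub> x \<oplus>\<^bsub>M\<^esub> a \<odot>\<^bsub>M\<^esub> y"
    and "\<And>a b x. a \<in> carrier R \<Longrightarrow> b \<in> carrier R \<Longrightarrow> x \<in> carrier M \<Longrightarrow>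
        (a \<otimes>\<^bsub>R\<^esub> b) \<odot>\<^bsub>M\<^esub> x = a \<odot>\<^bsub>M\<^esub> (b \<odot>\<^bsub>M\<^esub> x)"
    and "\<And>x. x \<in> carrier M \<Longrightarrow> \<one>\<^bsub>R\<^esub> \<odot>\<^bsub>M\<^esub> x = x"
  shows "left_module R M"
  using assms by (simp add: left_module_def left_module_axioms_def)

lemma (in abelian_group) minus_self_zero [simp]: "\<ominus> \<zero> = \<zero>"
  by (simp add: a_inv_def)

lemma (in abelian_group) add_minus_cancel:
  "x \<in> carrier G \<Longrightarrow> y \<in> carrier G \<Longrightarrow> y \<oplus> (x \<ominus> y) = x"
  by (simp add: minus_eq a_lcomm[of y x] r_neg)

lemma (in abelian_group) minus_zero_iff:
  "x \<in> carrier G \<Longrightarrow> y \<in> carrier G \<Longrightarrow> x \<ominus> y = \<zero> \<longleftrightarrow> x = y"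
  by (metis add_minus_cancel minus_eq r_neg r_zero)

lemma (in abelian_group) add_zero_iff:
  "x \<in> carrier G \<Longrightarrow> y \<in> carrier G \<Longrightarrow> x \<oplus> y = \<zero> \<longleftrightarrow> x = \<ominus> y"
  by (metis l_neg minus_equality)

lemma left_module_smult_zero:
  assumes "left_module R M" "a \<in> carrier R"
  shows "a \<odot>\<^bsub>M\<^esub> \<zero>\<^bsub>M\<^esub> = \<zero>\<^bsub>M\<^esub>"
proof -
  interpret M: abelian_group M using assms(1) by (rule left_module_abelian_group)
  have c: "a \<odot>\<^bsub>M\<^esub> \<zero>\<^bsub>M\<^esub> \<in> carrier M" using assms by (simp add: left_module.smult_closed)
  have "a \<odot>\<^bsub>M\<^esub> \<zero>\<^bsub>M\<^esub> = a \<odot>\<^bsub>M\<^esub> \<zero>\<^bsub>M\<^esub> \<oplus>\<^bsub>M\<^esub> a \<odot>\<^bsub>M\<^esub> \<zero>\<^bsub>M\<^esub>"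
    using left_module.smult_r_distr[OF assms, of "\<zero>\<^bsub>M\<^esub>" "\<zero>\<^bsub>M\<^esub>"] by simp
  then show ?thesis using c by (metis M.add.l_cancel_one')
qed

lemma left_module_smult_neg:
  assumes "left_module R M" "a \<in> carrier R" "x \<in> carrier M"
  shows "a \<odot>\<^bsub>M\<^esub> (\<ominus>\<^bsub>M\<^esub> x) = \<ominus>\<^bsub>M\<^esub> (a \<odot>\<^bsub>M\<^esub> x)"
proof -
  interpret M: abelian_group M using assms(1) by (rule left_module_abelian_group)
  have "a \<odot>\<^bsub>M\<^esub> (\<ominus>\<^bsub>M\<^esub> x) \<oplus>\<^bsub>M\<^esub> a \<odot>\<^bsub>M\<^esub> x = a \<odot>\<^bsub>M\<^esub> (\<ominus>\<^bsub>M\<^esub> x \<oplus>\<^bsub>M\<^esub> x)"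
    using left_module.smult_r_distr[OF assms(1,2), of "\<ominus>\<^bsub>M\<^esub> x" x] assms(3) by simp
  also have "\<dots> = \<zero>\<^bsub>M\<^esub>" using assms by (simp add: M.l_neg left_module_smult_zero)
  finally show ?thesis using assms by (simp add: M.add_zero_iff left_module.smult_closed)
qed

text \<open>\<open>mod_hom\<close> without extensionality: composites, sums and lambda abstractions
  are again linear without being restricted to the carrier, and \<open>lin_restrict\<close> returns
  to \<open>mod_hom\<close>.\<close>

definition lin :: "('r, 'z) ring_scheme \<Rightarrow> ('r, 'm) module \<Rightarrow> ('r, 'n) module \<Rightarrow> ('m \<Rightarrow> 'n) \<Rightarrow> bool"
  where "lin R M N f \<longleftrightarrow> f \<in> carrier M \<rightarrow> carrier N \<and>
     (\<forall>x\<in>carrier M. \<forall>y\<in>carrier M. f (x \<oplus>\<^bsub>M\<^esub> y) = f x \<oplus>\<^bsub>N\<^esub> f y) \<and>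
     (\<forall>a\<in>carrier R. \<forall>x\<in>carrier M. f (a \<odot>\<^bsub>M\<^esub> x) = a \<odot>\<^bsub>N\<^esub> f x)"

lemma mod_hom_iff: "f \<in> mod_hom R M N \<longleftrightarrow> lin R M N f \<and> f \<in> extensional (carrier M)"
  by (auto simp: mod_hom_def lin_def PiE_def)

lemma mod_hom_lin: "f \<in> mod_hom R M N \<Longrightarrow> lin R M N f"
  by (simp add: mod_hom_iff)

lemma linI:
  assumes "\<And>x. x \<in> carrier M \<Longrightarrow> f x \<in> carrier N"
    and "\<And>x y. x \<in> carrier M \<Longrightarrow> y \<in> carrier M \<Longrightarrow> f (x \<oplus>\<^bsub>M\<^esub> y) = f x \<oplus>\<^bsub>N\<^esub> f y"
    and "\<And>a x. a \<in> carrier R \<Longrightarrow> x \<in> carrier M \<Longrightarrow> f (a \<odot>\<^bsub>M\<^esub> x) = a \<odot>\<^bsub>N\<^esub> f x"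
  shows "lin R M N f"
  using assms by (simp add: lin_def)

lemma lin_closed: "lin R M N f \<Longrightarrow> x \<in> carrier M \<Longrightarrow> f x \<in> carrier N"
  by (auto simp: lin_def)

lemma lin_add:
  "lin R M N f \<Longrightarrow> x \<in> carrier M \<Longrightarrow> y \<in> carrier M \<Longrightarrow> f (x \<oplus>\<^bsub>M\<^esub> y) = f x \<oplus>\<^bsub>N\<^esub> f y"
  by (simp add: lin_def)

lemma lin_smult:
  "lin R M N f \<Longrightarrow> a \<in> carrier R \<Longrightarrow> x \<in> carrier M \<Longrightarrow> f (a \<odot>\<^bsub>M\<^esub> x) = a \<odot>\<^bsub>N\<^esub> f x"
  by (simp add: lin_def)

lemma lin_cong:
  assumes "left_module R M" "\<And>x. x \<in> carrier M \<Longrightarrow> f x = g x"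
  shows "lin R M N f \<longleftrightarrow> lin R M N g"
proof -
  interpret M: abelian_group M using assms(1) by (rule left_module_abelian_group)
  show ?thesis using assms by (auto simp: lin_def left_module.smult_closed Pi_def)
qed

lemma lin_restrict:
  assumes "left_module R M" "lin R M N f"
  shows "restrict f (carrier M) \<in> mod_hom R M N"
  using assms lin_cong[of R M "restrict f (carrier M)" f N] by (simp add: mod_hom_iff)

lemma lin_restrict_iso:
  "left_module R M \<Longrightarrow> lin R M N f \<Longrightarrow> bij_betw f (carrier M) (carrier N) \<Longrightarrow>
    restrict f (carrier M) \<in> mod_iso R M N"
  by (simp add: mod_iso_def lin_restrict bij_betw_restrict_eq)

lemma lin_comp: "lin R M N f \<Longrightarrow> lin R N K g \<Longrightarrow> lin R M K (\<lambda>x. g (f x))"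
  by (auto simp: lin_def Pi_def)

lemma lin_id: "lin R M M (\<lambda>x. x)"
  by (simp add: lin_def)

lemma lin_zero:
  assumes "left_module R M" "left_module R N" "lin R M N f"
  shows "f \<zero>\<^bsub>M\<^esub> = \<zero>\<^bsub>N\<^esub>"
proof -
  interpret M: abelian_group M using assms(1) by (rule left_module_abelian_group)
  interpret N: abelian_group N using assms(2) by (rule left_module_abelian_group)
  have "f \<zero>\<^bsub>M\<^esub> = f \<zero>\<^bsub>M\<^esub> \<oplus>\<^bsub>N\<^esub> f \<zero>\<^bsub>M\<^esub>"
    using lin_add[OF assms(3), of "\<zero>\<^bsub>M\<^esub>" "\<zero>\<^bsub>M\<^esub>"] by simp
  then show ?thesis using lin_closed[OF assms(3), of "\<zero>\<^bsub>M\<^esub>"] by (metis N.add.l_cancel_one' M.zero_closed)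
qed

lemma lin_neg:
  assumes "left_module R M" "left_module R N" "lin R M N f" "x \<in> carrier M"
  shows "f (\<ominus>\<^bsub>M\<^esub> x) = \<ominus>\<^bsub>N\<^esub> f x"
proof -
  interpret M: abelian_group M using assms(1) by (rule left_module_abelian_group)
  interpret N: abelian_group N using assms(2) by (rule left_module_abelian_group)
  have "f (\<ominus>\<^bsub>M\<^esub> x) \<oplus>\<^bsub>N\<^esub> f x = \<zero>\<^bsub>N\<^esub>"
    using lin_add[OF assms(3), of "\<ominus>\<^bsub>M\<^esub> x" x] assms(4) lin_zero[OF assms(1-3)] by (simp add: M.l_neg)
  then show ?thesis using assms by (simp add: N.add_zero_iff lin_closed)
qed

lemma lin_minus:
  assumes "left_module R M" "left_module R N" "lin R M N f" "x \<in> carrier M" "y \<in> carrier M"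
  shows "f (x \<ominus>\<^bsub>M\<^esub> y) = f x \<ominus>\<^bsub>N\<^esub> f y"
proof -
  interpret M: abelian_group M using assms(1) by (rule left_module_abelian_group)
  show ?thesis using assms by (simp add: a_minus_def lin_add lin_neg)
qed

lemma lin_zero_map:
  assumes "left_module R N"
  shows "lin R M N (\<lambda>x. \<zero>\<^bsub>N\<^esub>)"
proof -
  interpret N: abelian_group N using assms by (rule left_module_abelian_group)
  show ?thesis using assms by (auto intro!: linI simp: left_module_smult_zero)
qed

lemma lin_add_map:
  assumes "left_module R N" "lin R M N f" "lin R M N g"
  shows "lin R M N (\<lambda>x. f x \<oplus>\<^bsub>N\<^esub> g x)"
proof -
  interpret N: abelian_group N using assms(1) by (rule left_module_abelian_group)
  show ?thesis using assms
    by (intro linI)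
      (auto simp: lin_closed lin_add lin_smult N.a_ac left_module.smult_r_distr)
qed

lemma lin_minus_map:
  assumes "left_module R N" "lin R M N f" "lin R M N g"
  shows "lin R M N (\<lambda>x. f x \<ominus>\<^bsub>N\<^esub> g x)"
proof -
  interpret N: abelian_group N using assms(1) by (rule left_module_abelian_group)
  show ?thesis using assms
    by (intro linI)
      (auto simp: lin_closed lin_add lin_smult N.a_ac left_module.smult_r_distr N.minus_eq N.minus_add
        left_module_smult_neg)
qed

lemma lin_finsum:
  assumes "left_module R M" "left_module R N" "lin R M N f" "\<And>i. i \<in> A \<Longrightarrow> g i \<in> carrier M"
  shows "f (finsum M g A) = finsum N (\<lambda>i. f (g i)) A"
proof -
  interpret M: abelian_group M using assms(1) by (rule left_module_abelian_group)
  interpret N: abelian_group N using assms(2) by (rule left_module_abelian_group)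
  show ?thesis using assms(4)
  proof (induct A rule: infinite_finite_induct)
    case (insert a A)
    then have "g \<in> A \<rightarrow> carrier M" "g a \<in> carrier M" "(\<lambda>i. f (g i)) \<in> A \<rightarrow> carrier N" "f (g a) \<in> carrier N"
      using assms(3) by (auto simp: lin_closed)
    with insert show ?case
      by (simp add: lin_add[OF assms(3)])
  qed (simp_all add: lin_zero[OF assms(1-3)])
qed

lemma finsum_smult:
  assumes "left_module R N" "a \<in> carrier R" "\<And>i. i \<in> A \<Longrightarrow> g i \<in> carrier N"
  shows "finsum N (\<lambda>i. a \<odot>\<^bsub>N\<^esub> g i) A = a \<odot>\<^bsub>N\<^esub> finsum N g A"
proof -
  interpret N: abelian_group N using assms(1) by (rule left_module_abelian_group)
  show ?thesis using assms(3)
  proof (induct A rule: infinite_finite_induct)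
    case (insert i A)
    then have "g \<in> A \<rightarrow> carrier N" "g i \<in> carrier N" "(\<lambda>i. a \<odot>\<^bsub>N\<^esub> g i) \<in> A \<rightarrow> carrier N"
      "a \<odot>\<^bsub>N\<^esub> g i \<in> carrier N"
      using assms by (auto simp: left_module.smult_closed)
    with insert assms show ?case by (simp add: left_module.smult_r_distr)
  qed (simp_all add: left_module_smult_zero[OF assms(1,2)])
qed

lemma lin_finsum_map:
  assumes "left_module R N" "\<And>i. i \<in> A \<Longrightarrow> lin R M N (f i)"
  shows "lin R M N (\<lambda>x. finsum N (\<lambda>i. f i x) A)"
proof -
  interpret N: abelian_group N using assms(1) by (rule left_module_abelian_group)
  have c: "(\<lambda>i. f i x) \<in> A \<rightarrow> carrier N" if "x \<in> carrier M" for x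
    using that by (auto simp: lin_closed[OF assms(2)])
  show ?thesis
  proof (rule linI)
    fix x y assume xy: "x \<in> carrier M" "y \<in> carrier M"
    have "finsum N (\<lambda>i. f i (x \<oplus>\<^bsub>M\<^esub> y)) A = finsum N (\<lambda>i. f i x \<oplus>\<^bsub>N\<^esub> f i y) A"
      using xy by (intro N.finsum_cong') (auto simp: lin_add[OF assms(2)] lin_closed[OF assms(2)])
    then show "finsum N (\<lambda>i. f i (x \<oplus>\<^bsub>M\<^esub> y)) A = finsum N (\<lambda>i. f i x) A \<oplus>\<^bsub>N\<^esub> finsum N (\<lambda>i. f i y) A"
      using xy c by (simp add: N.finsum_addf)
  next
    fix a x assume ax: "a \<in> carrier R" "x \<in> carrier M"
    have "finsum N (\<lambda>i. f i (a \<odot>\<^bsub>M\<^esub> x)) A = finsum N (\<lambda>i. a \<odot>\<^bsub>N\<^esub> f i x) A"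
      using ax assms(1)
      by (intro N.finsum_cong')
        (auto simp: lin_smult[OF assms(2)] lin_closed[OF assms(2)] left_module.smult_closed)
    then show "finsum N (\<lambda>i. f i (a \<odot>\<^bsub>M\<^esub> x)) A = a \<odot>\<^bsub>N\<^esub> finsum N (\<lambda>i. f i x) A"
      using ax by (simp add: finsum_smult[OF assms(1)] lin_closed[OF assms(2)])
  qed (use c in simp)
qed

lemma lin_inj_iff:
  assumes "left_module R M" "left_module R N" "lin R M N f"
  shows "inj_on f (carrier M) \<longleftrightarrow> (\<forall>x\<in>carrier M. f x = \<zero>\<^bsub>N\<^esub> \<longrightarrow> x = \<zero>\<^bsub>M\<^esub>)"
proof -
  interpret M: abelian_group M using assms(1) by (rule left_module_abelian_group)
  interpret N: abelian_group N using assms(2) by (rule left_module_abelian_group)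
  show ?thesis
  proof
    assume "inj_on f (carrier M)"
    then show "\<forall>x\<in>carrier M. f x = \<zero>\<^bsub>N\<^esub> \<longrightarrow> x = \<zero>\<^bsub>M\<^esub>"
      using lin_zero[OF assms] by (metis M.zero_closed inj_onD)
  next
    assume *: "\<forall>x\<in>carrier M. f x = \<zero>\<^bsub>N\<^esub> \<longrightarrow> x = \<zero>\<^bsub>M\<^esub>"
    show "inj_on f (carrier M)"
    proof (rule inj_onI)
      fix x y assume xy: "x \<in> carrier M" "y \<in> carrier M" "f x = f y"
      then have "f (x \<ominus>\<^bsub>M\<^esub> y) = \<zero>\<^bsub>N\<^esub>"
        using assms by (simp add: lin_minus N.minus_zero_iff lin_closed)
      with * xy show "x = y" by (metis M.minus_zero_iff M.minus_closed)
    qed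
  qed
qed

lemma lin_inv_into:
  assumes "left_module R M" "left_module R N" "lin R M N f" "bij_betw f (carrier M) (carrier N)"
  shows "lin R N M (inv_into (carrier M) f)"
proof -
  interpret M: abelian_group M using assms(1) by (rule left_module_abelian_group)
  let ?g = "inv_into (carrier M) f"
  have g: "?g y \<in> carrier M" "f (?g y) = y" if "y \<in> carrier N" for y
    using that assms(4) by (auto simp: bij_betw_def inv_into_into f_inv_into_f)
  have gf: "?g (f x) = x" if "x \<in> carrier M" for x
    using that assms(4) by (simp add: bij_betw_def)
  show ?thesis
  proof (rule linI)
    fix x y assume "x \<in> carrier N" "y \<in> carrier N"
    then show "?g (x \<oplus>\<^bsub>N\<^esub> y) = ?g x \<oplus>\<^bsub>M\<^esub> ?g y"
      using gf[of "?g x \<oplus>\<^bsub>M\<^esub> ?g y"] g assms by (simp add: lin_add)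
  next
    fix a x assume "a \<in> carrier R" "x \<in> carrier N"
    then show "?g (a \<odot>\<^bsub>N\<^esub> x) = a \<odot>\<^bsub>M\<^esub> ?g x"
      using gf[of "a \<odot>\<^bsub>M\<^esub> ?g x"] g assms by (simp add: lin_smult left_module.smult_closed)
  qed (use g in simp)
qed

text \<open>Preimages under \<open>e\<close> are picked by \<open>inv_into\<close>. Two preimages of
  one element differ by an element of the kernel of \<open>e\<close>, where \<open>f\<close>
  vanishes, so the choice does not matter and linearity of \<open>g\<close> can be tested on
  elements \<open>e p\<close>.\<close>

lemma lin_factor:
  assumes "left_module R P" "left_module R X" "left_module R M"
    and e: "lin R P X e" "e ` carrier P = carrier X"
    and f: "lin R P M f" "\<And>p. p \<in> carrier P \<Longrightarrow> e p = \<zero>\<^bsub>X\<^esub> \<Longrightarrow> f p = \<zero>\<^bsub>M\<^esub>"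
  obtains g where "lin R X M g" "\<And>p. p \<in> carrier P \<Longrightarrow> g (e p) = f p"
proof -
  interpret P: abelian_group P using assms(1) by (rule left_module_abelian_group)
  interpret X: abelian_group X using assms(2) by (rule left_module_abelian_group)
  interpret M: abelian_group M using assms(3) by (rule left_module_abelian_group)
  define g where "g x = f (inv_into (carrier P) e x)" for x
  have ge: "g (e p) = f p" if p: "p \<in> carrier P" for p
  proof -
    let ?q = "inv_into (carrier P) e (e p)"
    have q: "?q \<in> carrier P" "e ?q = e p" using p by (auto simp: inv_into_into f_inv_into_f)
    then have "e (?q \<ominus>\<^bsub>P\<^esub> p) = \<zero>\<^bsub>X\<^esub>"
      using assms p by (simp add: lin_minus X.minus_zero_iff lin_closed)
    then have "f (?q \<ominus>\<^bsub>P\<^esub> p) = \<zero>\<^bsub>M\<^esub>" using f(2) p q by simp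
    then show ?thesis using assms p q by (simp add: lin_minus M.minus_zero_iff lin_closed g_def)
  qed
  have "lin R X M g"
  proof (rule linI)
    fix x assume "x \<in> carrier X"
    then obtain p where "p \<in> carrier P" "x = e p" using e(2) by blast
    then show "g x \<in> carrier M" using ge f(1) by (simp add: lin_closed)
  next
    fix x y assume "x \<in> carrier X" "y \<in> carrier X"
    then obtain p q where "p \<in> carrier P" "x = e p" "q \<in> carrier P" "y = e q" using e(2) by blast
    then show "g (x \<oplus>\<^bsub>X\<^esub> y) = g x \<oplus>\<^bsub>M\<^esub> g y"
      using ge[of p] ge[of q] ge[of "p \<oplus>\<^bsub>P\<^esub> q"] f(1) e(1) by (simp add: lin_add)
  next
    fix a x assume a: "a \<in> carrier R" and "x \<in> carrier X"
    then obtain p where "p \<in> carrier P" "x = e p" using e(2) by blast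
    then show "g (a \<odot>\<^bsub>X\<^esub> x) = a \<odot>\<^bsub>M\<^esub> g x"
      using ge[of p] ge[of "a \<odot>\<^bsub>P\<^esub> p"] f(1) e(1) a assms(1)
      by (simp add: lin_smult left_module.smult_closed)
  qed
  with ge that show thesis by blast
qed

text \<open>Apart from the existence of negatives the module axioms are equations, and all of them
  pass to the image under a surjection that respects the operations. So \<open>Q\<close> may be an
  arbitrary record, and quotients and transported structures become modules without a separate
  verification. The zero of \<open>Q\<close> is a record field, hence the condition that
  \<open>p\<close> maps zero to it.\<close>

lemma left_module_image:
  assumes "left_module R M" "lin R M Q p" "p ` carrier M = carrier Q" "p \<zero>\<^bsub>M\<^esub> = \<zero>\<^bsub>Q\<^esub>"
  shows "left_module R Q"
proof -
  interpret M: abelian_group M using assms(1) by (rule left_module_abelian_group)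
  have ex: "\<exists>m\<in>carrier M. x = p m" if "x \<in> carrier Q" for x using that assms(3) by auto
  note add = lin_add[OF assms(2), symmetric] and sm = lin_smult[OF assms(2), symmetric]
    and cl = lin_closed[OF assms(2)]
  note msm = left_module.smult_closed[OF assms(1)]
  show ?thesis
  proof (rule left_moduleI)
    show "ring R" using assms(1) by (rule left_module_ring)
    show "abelian_group Q"
    proof (rule abelian_groupI)
      fix x assume "x \<in> carrier Q"
      then obtain m where "m \<in> carrier M" "x = p m" using ex by blast
      then show "\<exists>y\<in>carrier Q. y \<oplus>\<^bsub>Q\<^esub> x = \<zero>\<^bsub>Q\<^esub>"
        using assms(4) by (intro bexI[of _ "p (\<ominus>\<^bsub>M\<^esub> m)"]) (simp_all add: add cl M.l_neg)
    qed (use cl assms(4) in \<open>auto dest!: ex simp: add M.a_ac simp flip: assms(4)\<close>)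
  qed (use left_module_ring[OF assms(1)] in \<open>auto dest!: ex simp: add sm cl msm ring.ring_simprules(1,5,6) left_module.smult_one[OF assms(1)] left_module.smult_l_distr[OF assms(1)]
      left_module.smult_r_distr[OF assms(1)] left_module.smult_assoc[OF assms(1)]\<close>)
qed

section \<open>Transport of structure, exact sequences and the five lemma\<close>

definition transport :: "('r, 'm) module \<Rightarrow> ('m \<Rightarrow> 'n) \<Rightarrow> ('r, 'n) module" where
  "transport M p = \<lparr>carrier = p ` carrier M, mult = undefined, one = undefined, zero = p \<zero>\<^bsub>M\<^esub>,
     add = (\<lambda>u v. p (inv_into (carrier M) p u \<oplus>\<^bsub>M\<^esub> inv_into (carrier M) p v)),
     smult = (\<lambda>a u. p (a \<odot>\<^bsub>M\<^esub> inv_into (carrier M) p u))\<rparr>"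

lemma transport_carrier [simp]: "carrier (transport M p) = p ` carrier M"
  and transport_zero [simp]: "\<zero>\<^bsub>transport M p\<^esub> = p \<zero>\<^bsub>M\<^esub>"
  by (simp_all add: transport_def)

lemma transport_lin: "inj_on p (carrier M) \<Longrightarrow> lin R M (transport M p) p"
  by (rule linI) (simp_all add: transport_def)

lemma transport_left_module:
  assumes "left_module R M" "inj_on p (carrier M)"
  shows "left_module R (transport M p)"
  by (rule left_module_image[OF assms(1) transport_lin[OF assms(2)]]) simp_all

text \<open>\<open>short_exact\<close> with its components as separate arguments, \<open>lin\<close>
  in place of \<open>mod_hom\<close>, and the kernel condition stated for elements;
  \<open>short_exact_iff\<close> translates.\<close>

definition exact ::
  "('r, 'z) ring_scheme \<Rightarrow> ('r, 'y) module \<Rightarrow> ('r, 'e) module \<Rightarrow> ('r, 'x) module \<Rightarrow>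
     ('y \<Rightarrow> 'e) \<Rightarrow> ('e \<Rightarrow> 'x) \<Rightarrow> bool" where
  "exact R A M Q a b \<longleftrightarrow> left_module R A \<and> left_module R M \<and> left_module R Q \<and>
     lin R A M a \<and> lin R M Q b \<and> inj_on a (carrier A) \<and>
     (\<forall>m\<in>carrier M. b m = \<zero>\<^bsub>Q\<^esub> \<longleftrightarrow> m \<in> a ` carrier A) \<and> b ` carrier M = carrier Q"

lemma exactD:
  assumes "exact R A M Q a b"
  shows "left_module R A" "left_module R M" "left_module R Q" "lin R A M a" "lin R M Q b"
    "inj_on a (carrier A)" "b ` carrier M = carrier Q"
    "\<And>m. m \<in> carrier M \<Longrightarrow> b m = \<zero>\<^bsub>Q\<^esub> \<longleftrightarrow> m \<in> a ` carrier A"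
    "\<And>x. x \<in> carrier A \<Longrightarrow> b (a x) = \<zero>\<^bsub>Q\<^esub>"
    "\<And>q. q \<in> carrier Q \<Longrightarrow> \<exists>m\<in>carrier M. b m = q"
  using assms unfolding exact_def by (auto simp: lin_closed)
    (metis imageE)

lemma short_exact_iff:
  "short_exact R s \<longleftrightarrow> exact R (ses_left s) (ses_mid s) (ses_right s) (ses_inj s) (ses_proj s) \<and>
     ses_inj s \<in> extensional (carrier (ses_left s)) \<and> ses_proj s \<in> extensional (carrier (ses_mid s))"
  unfolding short_exact_def exact_def mod_hom_iff a_kernel_def' by (auto simp: lin_closed)

text \<open>The kernel of \<open>b\<close> is the image of the injection \<open>a\<close>, so values
  of \<open>f\<close> can be pulled back along \<open>a\<close>; linearity of \<open>g\<close> is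
  checked after applying \<open>a\<close>.\<close>

lemma exact_factor_left:
  assumes ex: "exact R A M Q a b" and P: "left_module R P" and f: "lin R P M f"
    and z: "\<And>p. p \<in> carrier P \<Longrightarrow> b (f p) = \<zero>\<^bsub>Q\<^esub>"
  obtains g where "lin R P A g" "\<And>p. p \<in> carrier P \<Longrightarrow> a (g p) = f p"
proof -
  note E = exactD[OF ex]
  interpret A: abelian_group A using E(1) by (rule left_module_abelian_group)
  define g where "g p = inv_into (carrier A) a (f p)" for p
  have g: "g p \<in> carrier A" "a (g p) = f p" if "p \<in> carrier P" for p
  proof -
    have "f p \<in> a ` carrier A" using E(8)[of "f p"] z[OF that] lin_closed[OF f that] by simp
    then show "g p \<in> carrier A" "a (g p) = f p" by (simp_all add: g_def inv_into_into f_inv_into_f)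
  qed
  interpret P: abelian_group P using P by (rule left_module_abelian_group)
  have "lin R P A g"
  proof (rule linI)
    fix x y assume xy: "x \<in> carrier P" "y \<in> carrier P"
    then have "a (g (x \<oplus>\<^bsub>P\<^esub> y)) = a (g x \<oplus>\<^bsub>A\<^esub> g y)"
      using g E(4) f by (simp add: lin_add)
    then show "g (x \<oplus>\<^bsub>P\<^esub> y) = g x \<oplus>\<^bsub>A\<^esub> g y" using xy g E(6) by (meson inj_onD A.a_closed P.a_closed)
  next
    fix r x assume rx: "r \<in> carrier R" "x \<in> carrier P"
    note cl = left_module.smult_closed[OF P] left_module.smult_closed[OF E(1)]
    from rx have "a (g (r \<odot>\<^bsub>P\<^esub> x)) = a (r \<odot>\<^bsub>A\<^esub> g x)"
      using g E(4) f cl by (simp add: lin_smult)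
    then show "g (r \<odot>\<^bsub>P\<^esub> x) = r \<odot>\<^bsub>A\<^esub> g x" using rx g E(6) cl by (meson inj_onD)
  qed (use g in simp)
  with g that show thesis by blast
qed

text \<open>Both extensions have the same left-hand term \<open>A\<close>, on which \<open>f\<close>
  is the identity. Injectivity goes through that of \<open>g\<close> and \<open>a'\<close>; for
  surjectivity the error \<open>y\<close> minus \<open>f m\<close> lies in the kernel of
  \<open>b'\<close> and hence comes from \<open>A\<close>.\<close>

lemma five_lemma:
  assumes ex: "exact R A M Q a b" and ex': "exact R A M' Q' a' b'"
    and f: "lin R M M' f" and g: "bij_betw g (carrier Q) (carrier Q')" "lin R Q Q' g"
    and fa: "\<And>x. x \<in> carrier A \<Longrightarrow> f (a x) = a' x"
    and bf: "\<And>m. m \<in> carrier M \<Longrightarrow> b' (f m) = g (b m)"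
  shows "bij_betw f (carrier M) (carrier M')"
proof -
  note E = exactD[OF ex] and E' = exactD[OF ex']
  interpret A: abelian_group A using E(1) by (rule left_module_abelian_group)
  interpret M: abelian_group M using E(2) by (rule left_module_abelian_group)
  interpret M': abelian_group M' using E'(2) by (rule left_module_abelian_group)
  interpret Q': abelian_group Q' using E'(3) by (rule left_module_abelian_group)
  have g0: "g q = \<zero>\<^bsub>Q'\<^esub> \<Longrightarrow> q = \<zero>\<^bsub>Q\<^esub>" if "q \<in> carrier Q" for q
    using lin_inj_iff[OF E(3) E'(3) g(2)] g(1) that by (auto simp: bij_betw_def)
  have "inj_on f (carrier M)"
    unfolding lin_inj_iff[OF E(2) E'(2) f]
  proof (intro ballI impI)
    fix m assume m: "m \<in> carrier M" "f m = \<zero>\<^bsub>M'\<^esub>"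
    then have "g (b m) = \<zero>\<^bsub>Q'\<^esub>" using bf[of m] lin_zero[OF E'(2,3,5)] by simp
    then have "b m = \<zero>\<^bsub>Q\<^esub>" using g0 m lin_closed[OF E(5)] by simp
    then obtain x where x: "x \<in> carrier A" "m = a x" using E(8) m by blast
    then have "a' x = \<zero>\<^bsub>M'\<^esub>" using fa m by simp
    then have "x = \<zero>\<^bsub>A\<^esub>" using x E'(6) lin_inj_iff[OF E'(1,2,4)] by blast
    then show "m = \<zero>\<^bsub>M\<^esub>" using x lin_zero[OF E(1,2,4)] by simp
  qed
  moreover have "f ` carrier M = carrier M'"
  proof
    show "f ` carrier M \<subseteq> carrier M'" using f by (auto simp: lin_closed)
    show "carrier M' \<subseteq> f ` carrier M"
    proof
      fix y assume y: "y \<in> carrier M'"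
      then have "b' y \<in> g ` carrier Q" using g(1) lin_closed[OF E'(5)] by (simp add: bij_betw_def)
      then obtain m where m: "m \<in> carrier M" "b' y = g (b m)" using E(10) by blast
      then have fm: "f m \<in> carrier M'" using f by (simp add: lin_closed)
      have "b' (y \<ominus>\<^bsub>M'\<^esub> f m) = b' y \<ominus>\<^bsub>Q'\<^esub> b' (f m)"
        using lin_minus[OF E'(2,3,5) y fm] .
      moreover have "b' y = b' (f m)" using m bf by simp
      ultimately have "b' (y \<ominus>\<^bsub>M'\<^esub> f m) = \<zero>\<^bsub>Q'\<^esub>"
        using lin_closed[OF E'(5) fm] by (simp add: Q'.minus_zero_iff)
      then obtain x where x: "x \<in> carrier A" "y \<ominus>\<^bsub>M'\<^esub> f m = a' x"
        using E'(8)[of "y \<ominus>\<^bsub>M'\<^esub> f m"] y fm by auto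
      have "f (m \<oplus>\<^bsub>M\<^esub> a x) = f m \<oplus>\<^bsub>M'\<^esub> (y \<ominus>\<^bsub>M'\<^esub> f m)"
        using x m fa lin_closed[OF E(4)] f by (simp add: lin_add)
      then have "f (m \<oplus>\<^bsub>M\<^esub> a x) = y" using M'.add_minus_cancel y fm by simp
      then show "y \<in> f ` carrier M" using x m lin_closed[OF E(4)] by (metis M.a_closed imageI)
    qed
  qed
  ultimately show ?thesis by (simp add: bij_betw_def)
qed

section \<open>Submodules, quotients and direct sums\<close>

text \<open>Closure under negatives is derived from - x = (- 1) x, which rests on 0 x = 0.\<close>

lemma submoduleI':
  assumes "left_module R M" "N \<subseteq> carrier M" "\<zero>\<^bsub>M\<^esub> \<in> N"
    and "\<And>x y. x \<in> N \<Longrightarrow> y \<in> N \<Longrightarrow> x \<oplus>\<^bsub>M\<^esub> y \<in> N"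
    and "\<And>a x. a \<in> carrier R \<Longrightarrow> x \<in> N \<Longrightarrow> a \<odot>\<^bsub>M\<^esub> x \<in> N"
  shows "submodule N R M"
proof -
  interpret M: abelian_group M using assms(1) by (rule left_module_abelian_group)
  interpret R: ring R using assms(1) by (rule left_module_ring)
  have "\<ominus>\<^bsub>M\<^esub> x \<in> N" if "x \<in> N" for x
  proof -
    have x: "x \<in> carrier M" using that assms(2) by blast
    have "(\<ominus>\<^bsub>R\<^esub> \<one>\<^bsub>R\<^esub>) \<odot>\<^bsub>M\<^esub> x \<oplus>\<^bsub>M\<^esub> \<one>\<^bsub>R\<^esub> \<odot>\<^bsub>M\<^esub> x = \<zero>\<^bsub>R\<^esub> \<odot>\<^bsub>M\<^esub> x"
      using left_module.smult_l_distr[OF assms(1), of "\<ominus>\<^bsub>R\<^esub> \<one>\<^bsub>R\<^esub>" "\<one>\<^bsub>R\<^esub>" x] x by (simp add: R.l_neg)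
    moreover have "\<zero>\<^bsub>R\<^esub> \<odot>\<^bsub>M\<^esub> x = \<zero>\<^bsub>M\<^esub>"
      using left_module.smult_l_distr[OF assms(1), of "\<zero>\<^bsub>R\<^esub>" "\<zero>\<^bsub>R\<^esub>" x] x
        left_module.smult_closed[OF assms(1), of "\<zero>\<^bsub>R\<^esub>" x]
      by (metis M.add.l_cancel_one' R.l_zero R.zero_closed)
    ultimately have "(\<ominus>\<^bsub>R\<^esub> \<one>\<^bsub>R\<^esub>) \<odot>\<^bsub>M\<^esub> x = \<ominus>\<^bsub>M\<^esub> x"
      using x left_module.smult_one[OF assms(1) x] left_module.smult_closed[OF assms(1)]
      by (simp add: M.add_zero_iff)
    then show ?thesis using assms(5)[of "\<ominus>\<^bsub>R\<^esub> \<one>\<^bsub>R\<^esub>" x] that by simp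
  qed
  then show ?thesis using assms
    by (auto intro!: submodule.intro subgroup.intro submodule_axioms.intro simp: a_inv_def)
qed

lemma submoduleD:
  assumes "left_module R M" "submodule N R M"
  shows "N \<subseteq> carrier M" "\<zero>\<^bsub>M\<^esub> \<in> N" "\<And>x y. x \<in> N \<Longrightarrow> y \<in> N \<Longrightarrow> x \<oplus>\<^bsub>M\<^esub> y \<in> N"
    "\<And>a x. a \<in> carrier R \<Longrightarrow> x \<in> N \<Longrightarrow> a \<odot>\<^bsub>M\<^esub> x \<in> N" "\<And>x. x \<in> N \<Longrightarrow> \<ominus>\<^bsub>M\<^esub> x \<in> N"
    "\<And>x y. x \<in> N \<Longrightarrow> y \<in> N \<Longrightarrow> x \<ominus>\<^bsub>M\<^esub> y \<in> N"
proof -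
  interpret N: subgroup N "add_monoid M" using assms(2) by (rule submodule.axioms)
  interpret M: abelian_group M using assms(1) by (rule left_module_abelian_group)
  show "N \<subseteq> carrier M" using N.subset by simp
  show "\<zero>\<^bsub>M\<^esub> \<in> N" using N.one_closed by simp
  show *: "\<And>x y. x \<in> N \<Longrightarrow> y \<in> N \<Longrightarrow> x \<oplus>\<^bsub>M\<^esub> y \<in> N" using N.m_closed by simp
  show "\<And>a x. a \<in> carrier R \<Longrightarrow> x \<in> N \<Longrightarrow> a \<odot>\<^bsub>M\<^esub> x \<in> N"
    using assms(2) by (rule submodule.smult_closed)
  show **: "\<And>x. x \<in> N \<Longrightarrow> \<ominus>\<^bsub>M\<^esub> x \<in> N" using N.m_inv_closed by (simp add: a_inv_def)
  show "\<And>x y. x \<in> N \<Longrightarrow> y \<in> N \<Longrightarrow> x \<ominus>\<^bsub>M\<^esub> y \<in> N" using * ** by (simp add: a_minus_def)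
qed

lemma submodule_image:
  assumes "left_module R M" "left_module R N" "lin R M N f" "submodule K R M"
  shows "submodule (f ` K) R N"
proof -
  note K = submoduleD[OF assms(1,4)]
  note f = lin_closed[OF assms(3)] lin_add[OF assms(3), symmetric] lin_smult[OF assms(3), symmetric]
  show ?thesis
  proof (rule submoduleI'[OF assms(2)])
    show "f ` K \<subseteq> carrier N" using K(1) f(1) by blast
    show "\<zero>\<^bsub>N\<^esub> \<in> f ` K" using K(2) lin_zero[OF assms(1-3)] by (metis imageI)
  next
    fix x y assume "x \<in> f ` K" "y \<in> f ` K"
    then obtain u v where "u \<in> K" "v \<in> K" "x = f u" "y = f v" by blast
    then show "x \<oplus>\<^bsub>N\<^esub> y \<in> f ` K" using K(1,3) f(2)[of u v] by (auto simp: subset_iff)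
  next
    fix a x assume "a \<in> carrier R" "x \<in> f ` K"
    then obtain u where "u \<in> K" "x = f u" by blast
    then show "a \<odot>\<^bsub>N\<^esub> x \<in> f ` K" using \<open>a \<in> carrier R\<close> K(1,4) f(3)[of a u] by (auto simp: subset_iff)
  qed
qed

lemma submodule_carrier: "left_module R M \<Longrightarrow> submodule (carrier M) R M"
  using abelian_groupE(1,2)[OF left_module_abelian_group]
  by (intro submoduleI') (auto simp: left_module.smult_closed)

lemma submodule_vimage:
  assumes "left_module R M" "left_module R N" "lin R M N f" "submodule K R N"
  shows "submodule {x \<in> carrier M. f x \<in> K} R M"
proof -
  interpret M: abelian_group M using assms(1) by (rule left_module_abelian_group)
  show ?thesis
    using assms submoduleD[OF assms(2,4)]
    by (intro submoduleI') (auto simp: lin_zero lin_add lin_smult left_module.smult_closed)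
qed

lemma submodule_zero: "left_module R M \<Longrightarrow> submodule {\<zero>\<^bsub>M\<^esub>} R M"
  using abelian_groupE(2,5)[OF left_module_abelian_group, of R M]
  by (intro submoduleI') (auto simp: left_module_smult_zero)

lemma submodule_finsum:
  assumes "left_module R M" "submodule N R M" "\<And>i. i \<in> A \<Longrightarrow> f i \<in> N"
  shows "finsum M f A \<in> N"
proof -
  interpret M: abelian_group M using assms(1) by (rule left_module_abelian_group)
  note N = submoduleD[OF assms(1,2)]
  show ?thesis using assms(3)
  proof (induct A rule: infinite_finite_induct)
    case (insert a A)
    then have "f \<in> A \<rightarrow> carrier M" "f a \<in> carrier M" using N(1) by auto
    with insert N(3) show ?case by simp
  qed (use N(2) in simp_all)
qed

lemma submod_of_simps [simp]:
  "carrier (submod_of M N) = N" "\<zero>\<^bsub>submod_of M N\<^esub> = \<zero>\<^bsub>M\<^esub>" "add (submod_of M N) = add M"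
  "smult (submod_of M N) = smult M"
  by (simp_all add: submod_of_def)

lemma submod_of_left_module:
  assumes "left_module R M" "submodule N R M"
  shows "left_module R (submod_of M N)"
proof -
  note N = submoduleD[OF assms]
  interpret M: abelian_group M using assms(1) by (rule left_module_abelian_group)
  have c: "x \<in> carrier M" if "x \<in> N" for x using that N(1) by blast
  show ?thesis
  proof (rule left_moduleI)
    show "ring R" using assms(1) by (rule left_module_ring)
    show "abelian_group (submod_of M N)"
    proof (rule abelian_groupI)
      fix x assume "x \<in> carrier (submod_of M N)"
      then show "\<exists>y\<in>carrier (submod_of M N). y \<oplus>\<^bsub>submod_of M N\<^esub> x = \<zero>\<^bsub>submod_of M N\<^esub>"
        using N(5)[of x] c[of x] M.l_neg[of x] by auto
    qed (use N(2,3) in \<open>auto simp: M.a_ac c\<close>)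
  qed (use assms(1) N in \<open>auto simp: c left_module.smult_one left_module.smult_l_distr
      left_module.smult_r_distr left_module.smult_assoc\<close>)
qed

lemma quot_mod_simps [simp]:
  "carrier (quot_mod M N) = a_rcosets\<^bsub>M\<^esub> N" "\<zero>\<^bsub>quot_mod M N\<^esub> = N" "add (quot_mod M N) = set_add M"
  by (simp_all add: quot_mod_def)

lemma submodule_abelian_subgroup:
  assumes "left_module R M" "submodule N R M"
  shows "abelian_subgroup N M"
  using left_module_abelian_group[OF assms(1)] submodule.axioms(1)[OF assms(2)]
  by (intro abelian_subgroupI3 additive_subgroupI)

text \<open>Scalar multiplication on \<open>quot_mod\<close> and the map \<open>quot_map\<close>
  both send a coset C to N' + f(C), and this evaluates them. The assumption on \<open>f\<close> is
  additivity, because multiplication by a scalar is not linear over a noncommutative ring.\<close>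

lemma coset_set_add_image:
  assumes "left_module R M" "submodule N R M" "left_module R M'" "submodule N' R M'"
    and "\<And>x y. x \<in> carrier M \<Longrightarrow> y \<in> carrier M \<Longrightarrow> f (x \<oplus>\<^bsub>M\<^esub> y) = f x \<oplus>\<^bsub>M'\<^esub> f y"
    and "\<And>x. x \<in> N \<Longrightarrow> f x \<in> N'" and x: "x \<in> carrier M" "f x \<in> carrier M'"
  shows "N' <+>\<^bsub>M'\<^esub> f ` (N +>\<^bsub>M\<^esub> x) = N' +>\<^bsub>M'\<^esub> f x"
proof -
  interpret M: abelian_group M using assms(1) by (rule left_module_abelian_group)
  interpret M': abelian_group M' using assms(3) by (rule left_module_abelian_group)
  note N = submoduleD[OF assms(1,2)] and N' = submoduleD[OF assms(3,4)]
  have 1: "\<exists>h''\<in>N'. h' \<oplus>\<^bsub>M'\<^esub> f (h \<oplus>\<^bsub>M\<^esub> x) = h'' \<oplus>\<^bsub>M'\<^esub> f x" if h: "h' \<in> N'" "h \<in> N" for h h'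
  proof (rule bexI)
    show "h' \<oplus>\<^bsub>M'\<^esub> f h \<in> N'" using h assms(6) N'(3) by blast
    have "h \<in> carrier M" "h' \<in> carrier M'" "f h \<in> carrier M'" using h N(1) N'(1) assms(6) by auto
    then show "h' \<oplus>\<^bsub>M'\<^esub> f (h \<oplus>\<^bsub>M\<^esub> x) = h' \<oplus>\<^bsub>M'\<^esub> f h \<oplus>\<^bsub>M'\<^esub> f x"
      using x assms(5) by (simp add: M'.a_assoc)
  qed
  have 2: "\<exists>h\<in>N. h' \<oplus>\<^bsub>M'\<^esub> f x = h' \<oplus>\<^bsub>M'\<^esub> f (h \<oplus>\<^bsub>M\<^esub> x)" if "h' \<in> N'" for h'
    using N(2) x by (intro bexI[of _ "\<zero>\<^bsub>M\<^esub>"]) simp_all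
  show ?thesis unfolding set_add_def' a_r_coset_def' using 1 2 by fast
qed

lemma quot_proj_apply: "x \<in> carrier M \<Longrightarrow> quot_proj M N x = N +>\<^bsub>M\<^esub> x"
  by (simp add: quot_proj_def)

lemma quot_proj_image: "quot_proj M N ` carrier M = carrier (quot_mod M N)"
  by (auto simp: quot_proj_def A_RCOSETS_def')

lemma quot_proj_lin:
  assumes "left_module R M" "submodule N R M"
  shows "lin R M (quot_mod M N) (quot_proj M N)"
proof -
  interpret M: abelian_group M using assms(1) by (rule left_module_abelian_group)
  interpret N: abelian_subgroup N M using submodule_abelian_subgroup[OF assms] .
  note D = submoduleD[OF assms]
  show ?thesis
  proof (rule linI)
    show "quot_proj M N x \<in> carrier (quot_mod M N)" if "x \<in> carrier M" for x
      using that quot_proj_image[of M N] by (metis imageI)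
    show "quot_proj M N (x \<oplus>\<^bsub>M\<^esub> y) = quot_proj M N x \<oplus>\<^bsub>quot_mod M N\<^esub> quot_proj M N y"
      if "x \<in> carrier M" "y \<in> carrier M" for x y
      using that by (simp add: quot_proj_apply N.a_rcos_sum)
    show "quot_proj M N (a \<odot>\<^bsub>M\<^esub> x) = a \<odot>\<^bsub>quot_mod M N\<^esub> quot_proj M N x"
      if "a \<in> carrier R" "x \<in> carrier M" for a x
    proof -
      have "a \<odot>\<^bsub>M\<^esub> x \<in> carrier M" using left_module.smult_closed[OF assms(1)] that .
      moreover have "N <+>\<^bsub>M\<^esub> (\<lambda>x. a \<odot>\<^bsub>M\<^esub> x) ` (N +>\<^bsub>M\<^esub> x) = N +>\<^bsub>M\<^esub> (a \<odot>\<^bsub>M\<^esub> x)"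
        using that D(4) left_module.smult_r_distr[OF assms(1)] calculation
        by (intro coset_set_add_image[OF assms assms]) auto
      ultimately show ?thesis using that(2) by (simp only: quot_proj_apply) (simp add: quot_mod_def)
    qed
  qed
qed

lemma quot_mod_left_module:
  assumes "left_module R M" "submodule N R M"
  shows "left_module R (quot_mod M N)"
proof (rule left_module_image[OF assms(1) quot_proj_lin[OF assms] quot_proj_image])
  interpret M: abelian_group M using assms(1) by (rule left_module_abelian_group)
  interpret N: abelian_subgroup N M using submodule_abelian_subgroup[OF assms] .
  show "quot_proj M N \<zero>\<^bsub>M\<^esub> = \<zero>\<^bsub>quot_mod M N\<^esub>"
    using submoduleD[OF assms] by (simp add: quot_proj_apply N.a_rcos_const)
qed

lemma quot_proj_zero_iff:
  assumes "left_module R M" "submodule N R M" "x \<in> carrier M"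
  shows "quot_proj M N x = \<zero>\<^bsub>quot_mod M N\<^esub> \<longleftrightarrow> x \<in> N"
proof -
  interpret M: abelian_group M using assms(1) by (rule left_module_abelian_group)
  interpret N: abelian_subgroup N M using submodule_abelian_subgroup[OF assms(1,2)] .
  show ?thesis using assms(3) N.a_rcos_const N.a_rcos_self by (auto simp: quot_proj_apply)
qed

lemma quot_exact:
  assumes "left_module R A" "left_module R M" "lin R A M a" "inj_on a (carrier A)"
  shows "exact R A M (quot_mod M (a ` carrier A)) a (quot_proj M (a ` carrier A))"
proof -
  have s: "submodule (a ` carrier A) R M"
    using submodule_image[OF assms(1-3) submodule_carrier[OF assms(1)]] .
  show ?thesis unfolding exact_def
    using assms quot_mod_left_module[OF assms(2) s] quot_proj_lin[OF assms(2) s]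
      quot_proj_zero_iff[OF assms(2) s] quot_proj_image[of M "a ` carrier A"]
    by auto
qed

section \<open>Products and direct sums\<close>

lemma mod_prod_simps [simp]:
  "carrier (mod_prod M N) = carrier M \<times> carrier N" "\<zero>\<^bsub>mod_prod M N\<^esub> = (\<zero>\<^bsub>M\<^esub>, \<zero>\<^bsub>N\<^esub>)"
  "u \<oplus>\<^bsub>mod_prod M N\<^esub> v = (fst u \<oplus>\<^bsub>M\<^esub> fst v, snd u \<oplus>\<^bsub>N\<^esub> snd v)"
  "a \<odot>\<^bsub>mod_prod M N\<^esub> u = (a \<odot>\<^bsub>M\<^esub> fst u, a \<odot>\<^bsub>N\<^esub> snd u)"
  by (simp_all add: mod_prod_def)

lemma mod_prod_left_module:
  assumes "left_module R M" "left_module R N"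
  shows "left_module R (mod_prod M N)"
proof -
  interpret M: abelian_group M using assms(1) by (rule left_module_abelian_group)
  interpret N: abelian_group N using assms(2) by (rule left_module_abelian_group)
  show ?thesis
  proof (rule left_moduleI)
    show "ring R" using assms(1) by (rule left_module_ring)
    show "abelian_group (mod_prod M N)"
    proof (rule abelian_groupI)
      fix x assume "x \<in> carrier (mod_prod M N)"
      then show "\<exists>y\<in>carrier (mod_prod M N). y \<oplus>\<^bsub>mod_prod M N\<^esub> x = \<zero>\<^bsub>mod_prod M N\<^esub>"
        by (intro bexI[of _ "(\<ominus>\<^bsub>M\<^esub> fst x, \<ominus>\<^bsub>N\<^esub> snd x)"]) (auto simp: M.l_neg N.l_neg)
    qed (auto simp: M.a_ac N.a_ac)
  qed (use assms in \<open>auto simp: left_module.smult_closed left_module.smult_one left_module.smult_l_distr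
      left_module.smult_r_distr left_module.smult_assoc\<close>)
qed

lemma direct_sum_simps [simp]:
  "\<zero>\<^bsub>direct_sum I M\<^esub> = (\<lambda>i\<in>I. \<zero>\<^bsub>M i\<^esub>)"
  "u \<oplus>\<^bsub>direct_sum I M\<^esub> v = (\<lambda>i\<in>I. u i \<oplus>\<^bsub>M i\<^esub> v i)"
  "a \<odot>\<^bsub>direct_sum I M\<^esub> v = (\<lambda>i\<in>I. a \<odot>\<^bsub>M i\<^esub> v i)"
  by (simp_all add: direct_sum_def)

lemma direct_sum_carrier:
  "v \<in> carrier (direct_sum I M) \<longleftrightarrow>
     (\<forall>i\<in>I. v i \<in> carrier (M i)) \<and> v \<in> extensional I \<and> finite {i \<in> I. v i \<noteq> \<zero>\<^bsub>M i\<^esub>}"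
  by (auto simp: direct_sum_def PiE_def)

lemma direct_sum_left_module:
  assumes "ring R" "\<And>i. i \<in> I \<Longrightarrow> left_module R (M i)"
  shows "left_module R (direct_sum I M)"
proof -
  have ag: "abelian_group (M i)" if "i \<in> I" for i using assms(2)[OF that] by (rule left_module_abelian_group)
  note g = abelian_groupE[OF ag] and lm = assms(2)
  have cl: "u \<oplus>\<^bsub>direct_sum I M\<^esub> v \<in> carrier (direct_sum I M)"
    if "u \<in> carrier (direct_sum I M)" "v \<in> carrier (direct_sum I M)" for u v
  proof -
    have "{i \<in> I. u i \<oplus>\<^bsub>M i\<^esub> v i \<noteq> \<zero>\<^bsub>M i\<^esub>} \<subseteq> {i \<in> I. u i \<noteq> \<zero>\<^bsub>M i\<^esub>} \<union> {i \<in> I. v i \<noteq> \<zero>\<^bsub>M i\<^esub>}"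
      using g(2,5) by auto
    then have "finite {i \<in> I. u i \<oplus>\<^bsub>M i\<^esub> v i \<noteq> \<zero>\<^bsub>M i\<^esub>}"
      using that by (auto simp: direct_sum_carrier intro: finite_subset)
    then show ?thesis using that g(1) by (auto simp: direct_sum_carrier cong: conj_cong)
  qed
  have sm: "a \<odot>\<^bsub>direct_sum I M\<^esub> v \<in> carrier (direct_sum I M)"
    if "a \<in> carrier R" "v \<in> carrier (direct_sum I M)" for a v
  proof -
    have "{i \<in> I. a \<odot>\<^bsub>M i\<^esub> v i \<noteq> \<zero>\<^bsub>M i\<^esub>} \<subseteq> {i \<in> I. v i \<noteq> \<zero>\<^bsub>M i\<^esub>}"
      using left_module_smult_zero[OF lm that(1)] by auto
    then have "finite {i \<in> I. a \<odot>\<^bsub>M i\<^esub> v i \<noteq> \<zero>\<^bsub>M i\<^esub>}"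
      using that by (auto simp: direct_sum_carrier intro: finite_subset)
    then show ?thesis using that left_module.smult_closed[OF lm]
      by (auto simp: direct_sum_carrier cong: conj_cong)
  qed
  have ng: "(\<lambda>i\<in>I. \<ominus>\<^bsub>M i\<^esub> v i) \<in> carrier (direct_sum I M)" if "v \<in> carrier (direct_sum I M)" for v
  proof -
    have "{i \<in> I. \<ominus>\<^bsub>M i\<^esub> v i \<noteq> \<zero>\<^bsub>M i\<^esub>} \<subseteq> {i \<in> I. v i \<noteq> \<zero>\<^bsub>M i\<^esub>}"
      using abelian_group.minus_self_zero[OF ag] by auto
    then have "finite {i \<in> I. \<ominus>\<^bsub>M i\<^esub> v i \<noteq> \<zero>\<^bsub>M i\<^esub>}"
      using that by (auto simp: direct_sum_carrier intro: finite_subset)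
    then show ?thesis using that abelian_group.a_inv_closed[OF ag]
      by (auto simp: direct_sum_carrier cong: conj_cong)
  qed
  show ?thesis
  proof (rule left_moduleI[OF assms(1) abelian_groupI])
    show "\<zero>\<^bsub>direct_sum I M\<^esub> \<in> carrier (direct_sum I M)"
      using g(2) by (auto simp: direct_sum_carrier cong: conj_cong)
    fix x assume x: "x \<in> carrier (direct_sum I M)"
    show "\<exists>y\<in>carrier (direct_sum I M). y \<oplus>\<^bsub>direct_sum I M\<^esub> x = \<zero>\<^bsub>direct_sum I M\<^esub>"
      using x abelian_group.l_neg[OF ag]
      by (intro bexI[OF _ ng[OF x]]) (auto simp: direct_sum_carrier intro!: restrict_ext)
    show "\<zero>\<^bsub>direct_sum I M\<^esub> \<oplus>\<^bsub>direct_sum I M\<^esub> x = x"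
      using x g(5) by (auto simp: direct_sum_carrier intro!: extensionalityI[of _ I])
    show "\<one>\<^bsub>R\<^esub> \<odot>\<^bsub>direct_sum I M\<^esub> x = x"
      using x left_module.smult_one[OF lm] by (auto simp: direct_sum_carrier intro!: extensionalityI[of _ I])
  qed (use cl sm g(3,4) in \<open>auto simp: direct_sum_carrier left_module.smult_l_distr[OF lm]
      left_module.smult_r_distr[OF lm] left_module.smult_assoc[OF lm] intro!: restrict_ext\<close>)
qed

lemma direct_sum_coord_lin: "i \<in> I \<Longrightarrow> lin R (direct_sum I M) (M i) (\<lambda>v. v i)"
  by (rule linI) (auto simp: direct_sum_carrier)

definition ds_in :: "'i set \<Rightarrow> ('i \<Rightarrow> ('r, 'm) module) \<Rightarrow> 'i \<Rightarrow> 'm \<Rightarrow> 'i \<Rightarrow> 'm" where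
  "ds_in I M i x = (\<lambda>j\<in>I. if j = i then x else \<zero>\<^bsub>M j\<^esub>)"

lemma ds_in_lin:
  assumes "\<And>i. i \<in> I \<Longrightarrow> left_module R (M i)" "i \<in> I"
  shows "lin R (M i) (direct_sum I M) (ds_in I M i)"
proof -
  note g = abelian_groupE[OF left_module_abelian_group[OF assms(1)]]
  have fin: "finite {j \<in> I. (if j = i then x else \<zero>\<^bsub>M j\<^esub>) \<noteq> \<zero>\<^bsub>M j\<^esub>}" for x
    by (rule finite_subset[of _ "{i}"]) auto
  show ?thesis
    using fin g assms left_module_smult_zero[OF assms(1)]
    by (intro linI) (auto simp: ds_in_def direct_sum_carrier cong: conj_cong intro!: restrict_ext)
qed

text \<open>The map out of the direct sum with components \<open>\<phi> i\<close>, that is, its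
  universal property. The sum runs over the support of \<open>v\<close>, since \<open>finsum\<close>
  over an infinite index set is zero by convention.\<close>

definition ds_map :: "'i set \<Rightarrow> ('i \<Rightarrow> ('r, 'm) module) \<Rightarrow> ('r, 'n) module \<Rightarrow> ('i \<Rightarrow> 'm \<Rightarrow> 'n) \<Rightarrow>
    ('i \<Rightarrow> 'm) \<Rightarrow> 'n" where
  "ds_map I M N \<phi> v = finsum N (\<lambda>i. \<phi> i (v i)) {i \<in> I. v i \<noteq> \<zero>\<^bsub>M i\<^esub>}"

text \<open>Outside the support the summands are zero, so any finite index set containing the
  support gives the same sum. This is needed for additivity, where two vectors and their sum have
  different supports.\<close>

lemma ds_map_eq:
  assumes "\<And>i. i \<in> I \<Longrightarrow> left_module R (M i)" "left_module R N"
    "\<And>i. i \<in> I \<Longrightarrow> lin R (M i) N (\<phi> i)" "v \<in> carrier (direct_sum I M)"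
    "finite A" "A \<subseteq> I" "\<And>i. i \<in> I \<Longrightarrow> i \<notin> A \<Longrightarrow> v i = \<zero>\<^bsub>M i\<^esub>"
  shows "ds_map I M N \<phi> v = finsum N (\<lambda>i. \<phi> i (v i)) A"
proof -
  interpret N: abelian_group N using assms(2) by (rule left_module_abelian_group)
  have A: "i \<in> I" if "i \<in> A" for i using that assms(6) by blast
  show ?thesis unfolding ds_map_def
  proof (rule N.add.finprod_mono_neutral_cong_left[OF assms(5)])
    show "(\<lambda>i. \<phi> i (v i)) \<in> A \<rightarrow> carrier N"
      using assms(4) lin_closed[OF assms(3)] A by (auto simp: direct_sum_carrier)
  qed (use assms(7) A lin_zero[OF assms(1) assms(2) assms(3)] in auto)
qed

lemma ds_map_lin:
  assumes "ring R" "\<And>i. i \<in> I \<Longrightarrow> left_module R (M i)" "left_module R N"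
    "\<And>i. i \<in> I \<Longrightarrow> lin R (M i) N (\<phi> i)"
  shows "lin R (direct_sum I M) N (ds_map I M N \<phi>)"
proof -
  interpret N: abelian_group N using assms(3) by (rule left_module_abelian_group)
  have DS: "left_module R (direct_sum I M)" using direct_sum_left_module[OF assms(1,2)] .
  interpret D: abelian_group "direct_sum I M" using DS by (rule left_module_abelian_group)
  have eq: "ds_map I M N \<phi> v = finsum N (\<lambda>i. \<phi> i (v i)) A"
    if "v \<in> carrier (direct_sum I M)" "finite A" "A \<subseteq> I" "\<And>i. i \<in> I \<Longrightarrow> i \<notin> A \<Longrightarrow> v i = \<zero>\<^bsub>M i\<^esub>" for v A
    using assms(2-4) that by (rule ds_map_eq)
  \<comment> \<open>The union of three supports; a common index set turns linearity of
    \<open>ds_map\<close> into linearity of a finite sum of linear maps.\<close>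
  have *: "\<exists>A. finite A \<and> A \<subseteq> I \<and> (\<forall>i\<in>I. i \<notin> A \<longrightarrow> u i = \<zero>\<^bsub>M i\<^esub> \<and> v i = \<zero>\<^bsub>M i\<^esub> \<and> w i = \<zero>\<^bsub>M i\<^esub>)"
    if "u \<in> carrier (direct_sum I M)" "v \<in> carrier (direct_sum I M)" "w \<in> carrier (direct_sum I M)" for u v w
    using that by (intro exI[of _ "{i \<in> I. u i \<noteq> \<zero>\<^bsub>M i\<^esub>} \<union> {i \<in> I. v i \<noteq> \<zero>\<^bsub>M i\<^esub>} \<union> {i \<in> I. w i \<noteq> \<zero>\<^bsub>M i\<^esub>}"])
      (auto simp: direct_sum_carrier)
  have lf: "lin R (direct_sum I M) N (\<lambda>v. finsum N (\<lambda>i. \<phi> i (v i)) A)" if "A \<subseteq> I" for A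
  proof (rule lin_finsum_map[OF assms(3)])
    fix i assume "i \<in> A"
    then have "i \<in> I" using that by blast
    then show "lin R (direct_sum I M) N (\<lambda>v. \<phi> i (v i))"
      using lin_comp[OF direct_sum_coord_lin[of i I R M]] assms(4) by blast
  qed
  show ?thesis
  proof (rule linI)
    fix x y assume xy: "x \<in> carrier (direct_sum I M)" "y \<in> carrier (direct_sum I M)"
    then obtain A where A: "finite A" "A \<subseteq> I"
      "\<And>i. i \<in> I \<Longrightarrow> i \<notin> A \<Longrightarrow> x i = \<zero>\<^bsub>M i\<^esub> \<and> y i = \<zero>\<^bsub>M i\<^esub> \<and> (x \<oplus>\<^bsub>direct_sum I M\<^esub> y) i = \<zero>\<^bsub>M i\<^esub>"
      using *[OF xy D.a_closed[OF xy]] by metis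
    have e: "ds_map I M N \<phi> v = finsum N (\<lambda>i. \<phi> i (v i)) A" if "v \<in> {x, y, x \<oplus>\<^bsub>direct_sum I M\<^esub> y}" for v
      by (rule eq[OF _ A(1,2)]) (use that xy D.a_closed[OF xy] A(3) in blast)+
    show "ds_map I M N \<phi> (x \<oplus>\<^bsub>direct_sum I M\<^esub> y) = ds_map I M N \<phi> x \<oplus>\<^bsub>N\<^esub> ds_map I M N \<phi> y"
      using lin_add[OF lf[OF A(2)] xy] A(3) by (simp only: e insertI1 insertI2)
  next
    fix x assume x: "x \<in> carrier (direct_sum I M)"
    then obtain A where A: "finite A" "A \<subseteq> I" "\<And>i. i \<in> I \<Longrightarrow> i \<notin> A \<Longrightarrow> x i = \<zero>\<^bsub>M i\<^esub>"
      using *[OF x x x] by metis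
    show "ds_map I M N \<phi> x \<in> carrier N"
      using lin_closed[OF lf[OF A(2)] x] by (subst eq[OF x A])
  next
    fix a x assume a: "a \<in> carrier R" and x: "x \<in> carrier (direct_sum I M)"
    note ax = left_module.smult_closed[OF DS a x]
    from x ax obtain A where A: "finite A" "A \<subseteq> I"
      "\<And>i. i \<in> I \<Longrightarrow> i \<notin> A \<Longrightarrow> x i = \<zero>\<^bsub>M i\<^esub> \<and> (a \<odot>\<^bsub>direct_sum I M\<^esub> x) i = \<zero>\<^bsub>M i\<^esub>"
      using *[OF x ax ax] by metis
    have e: "ds_map I M N \<phi> v = finsum N (\<lambda>i. \<phi> i (v i)) A" if "v \<in> {x, a \<odot>\<^bsub>direct_sum I M\<^esub> x}" for v
      by (rule eq[OF _ A(1,2)]) (use that x ax A(3) in blast)+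
    show "ds_map I M N \<phi> (a \<odot>\<^bsub>direct_sum I M\<^esub> x) = a \<odot>\<^bsub>N\<^esub> ds_map I M N \<phi> x"
      using lin_smult[OF lf[OF A(2)] a x] A(3) by (simp only: e insertI1 insertI2)
  qed
qed

lemma ds_map_in:
  assumes "\<And>i. i \<in> I \<Longrightarrow> left_module R (M i)" "left_module R N"
    "\<And>i. i \<in> I \<Longrightarrow> lin R (M i) N (\<phi> i)" "i \<in> I" "x \<in> carrier (M i)"
  shows "ds_map I M N \<phi> (ds_in I M i x) = \<phi> i x"
proof -
  interpret N: abelian_group N using assms(2) by (rule left_module_abelian_group)
  have "ds_in I M i x \<in> carrier (direct_sum I M)"
    using lin_closed[OF ds_in_lin[of I R M]] assms(1,4,5) by blast
  then have "ds_map I M N \<phi> (ds_in I M i x) = finsum N (\<lambda>j. \<phi> j (ds_in I M i x j)) {i}"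
    using assms(4) by (intro ds_map_eq[OF assms(1-3)]) (auto simp: ds_in_def)
  also have "\<dots> = \<phi> i (ds_in I M i x i)"
    using lin_closed[OF assms(3)[OF assms(4)] assms(5)] assms(4) by (simp add: ds_in_def)
  finally show ?thesis using assms(4) by (simp add: ds_in_def)
qed

lemma direct_sum_decomp:
  assumes "ring R" "\<And>i. i \<in> I \<Longrightarrow> left_module R (M i)" "v \<in> carrier (direct_sum I M)"
    "finite A" "A \<subseteq> I" "\<And>i. i \<in> I \<Longrightarrow> i \<notin> A \<Longrightarrow> v i = \<zero>\<^bsub>M i\<^esub>"
  shows "v = finsum (direct_sum I M) (\<lambda>i. ds_in I M i (v i)) A"
proof -
  have DS: "left_module R (direct_sum I M)" using direct_sum_left_module[OF assms(1,2)] .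
  interpret D: abelian_group "direct_sum I M" using DS by (rule left_module_abelian_group)
  have c: "ds_in I M i (v i) \<in> carrier (direct_sum I M)" if "i \<in> A" for i
  proof -
    have "i \<in> I" using that assms(5) by blast
    then show ?thesis using lin_closed[OF ds_in_lin[of I R M i]] assms(2,3) by (simp add: direct_sum_carrier)
  qed
  have fc: "finsum (direct_sum I M) (\<lambda>i. ds_in I M i (v i)) A \<in> carrier (direct_sum I M)"
    using c by simp
  show ?thesis
  proof (rule extensionalityI[of _ I])
    fix j assume j: "j \<in> I"
    interpret Mj: abelian_group "M j" using assms(2)[OF j] by (rule left_module_abelian_group)
    have vj: "v j \<in> carrier (M j)" using assms(3) j by (simp add: direct_sum_carrier)
    have "finsum (direct_sum I M) (\<lambda>i. ds_in I M i (v i)) A j = finsum (M j) (\<lambda>i. ds_in I M i (v i) j) A"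
      using lin_finsum[OF DS assms(2)[OF j] direct_sum_coord_lin[OF j], of A] c by simp
    also have "\<dots> = finsum (M j) (\<lambda>i. if j = i then v j else \<zero>\<^bsub>M j\<^esub>) A"
      using j vj by (intro Mj.finsum_cong') (auto simp: ds_in_def)
    also have "\<dots> = v j"
    proof (cases "j \<in> A")
      case True
      then show ?thesis using assms(4) vj by (subst Mj.finsum_singleton[of j A "\<lambda>_. v j"]) auto
    next
      case False
      then have "finsum (M j) (\<lambda>i. if j = i then v j else \<zero>\<^bsub>M j\<^esub>) A = \<zero>\<^bsub>M j\<^esub>"
        by (intro Mj.add.finprod_one_eqI) auto
      then show ?thesis using assms(6) j False by simp
    qed
    finally show "v j = finsum (direct_sum I M) (\<lambda>i. ds_in I M i (v i)) A j" by simp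
  qed (use assms(3) fc in \<open>simp_all add: direct_sum_carrier\<close>)
qed

text \<open>Induction principle for direct sums: a vector is the finite sum of its coordinate
  inclusions and \<open>K\<close> is closed under finite sums, so only the images of the summands
  have to be checked. With \<open>K\<close> zero it shows that maps vanish or agree.\<close>

lemma lin_direct_sum_in_submodule:
  assumes "ring R" "\<And>i. i \<in> I \<Longrightarrow> left_module R (M i)" "left_module R N" "lin R (direct_sum I M) N f"
    "submodule K R N" "\<And>i x. i \<in> I \<Longrightarrow> x \<in> carrier (M i) \<Longrightarrow> f (ds_in I M i x) \<in> K"
    "v \<in> carrier (direct_sum I M)"
  shows "f v \<in> K"
proof -
  have DS: "left_module R (direct_sum I M)" using direct_sum_left_module[OF assms(1,2)] .
  let ?A = "{i \<in> I. v i \<noteq> \<zero>\<^bsub>M i\<^esub>}"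
  have v: "\<And>i. i \<in> I \<Longrightarrow> v i \<in> carrier (M i)" "finite ?A" using assms(7) by (auto simp: direct_sum_carrier)
  have "v = finsum (direct_sum I M) (\<lambda>i. ds_in I M i (v i)) ?A"
    using v(2) by (intro direct_sum_decomp[OF assms(1,2,7)]) auto
  then have "f v = f (finsum (direct_sum I M) (\<lambda>i. ds_in I M i (v i)) ?A)" by simp
  also have "\<dots> = finsum N (\<lambda>i. f (ds_in I M i (v i))) ?A"
    using v lin_closed[OF ds_in_lin[of I R M]] assms(2) by (intro lin_finsum[OF DS assms(3,4)]) auto
  also have "\<dots> \<in> K" using v(1) assms(6) by (intro submodule_finsum[OF assms(3,5)]) auto
  finally show ?thesis .
qed

section \<open>Finite presentation and projectivity\<close>

lemma regular_mod_left_module: "ring R \<Longrightarrow> left_module R (regular_mod R)"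
proof -
  assume "ring R"
  then interpret R: ring R .
  show ?thesis
  proof (rule left_moduleI)
    show "abelian_group (regular_mod R)"
      by (rule abelian_groupI) (auto simp: regular_mod_def R.a_ac intro: bexI[of _ "\<ominus>\<^bsub>R\<^esub> _"] R.l_neg)
  qed (auto simp: regular_mod_def R.ring_axioms R.l_distr R.r_distr R.m_assoc)
qed

lemma regular_mod_lin:
  assumes "left_module R N" "n \<in> carrier N"
  shows "lin R (regular_mod R) N (\<lambda>r. r \<odot>\<^bsub>N\<^esub> n)"
  using assms
  by (intro linI) (auto simp: regular_mod_def left_module.smult_closed left_module.smult_l_distr left_module.smult_assoc)

text \<open>The images of the finitely many generators have finite supports, and a coordinate that
  vanishes on all generators vanishes on the whole of \<open>X\<close>.\<close>

lemma finitely_presented_coords: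
  assumes fp: "finitely_presented R X" and F: "\<And>j. j \<in> J \<Longrightarrow> left_module R (F j)"
    and f: "lin R X (direct_sum J F) f"
  shows "finite {j \<in> J. \<exists>x\<in>carrier X. f x j \<noteq> \<zero>\<^bsub>F j\<^esub>}"
proof -
  have X: "left_module R X" using fp by (simp add: finitely_presented_def)
  then have R: "ring R" by (rule left_module_ring)
  interpret R: ring R using R .
  obtain n :: nat and g where g': "g \<in> mod_hom R (free_mod R {..<n}) X"
    and gs: "g ` carrier (free_mod R {..<n}) = carrier X"
    using fp unfolding finitely_presented_def by auto
  note g = mod_hom_lin[OF g'] gs
  note rm = regular_mod_left_module[OF R]
  let ?e = "\<lambda>k. ds_in {..<n} (\<lambda>_. regular_mod R) k \<one>\<^bsub>R\<^esub>"
  let ?S = "\<Union>k<n. {j \<in> J. f (g (?e k)) j \<noteq> \<zero>\<^bsub>F j\<^esub>}"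
  have e: "?e k \<in> carrier (free_mod R {..<n})" if "k < n" for k
    using lin_closed[OF ds_in_lin[of "{..<n}" R "\<lambda>_. regular_mod R" k], of "\<one>\<^bsub>R\<^esub>"] rm that
    by (simp add: free_mod_def regular_mod_def)
  have fgc: "f (g (?e k)) \<in> carrier (direct_sum J F)" if "k < n" for k
    using lin_closed[OF f lin_closed[OF g(1) e[OF that]]] .
  then have "finite ?S" by (auto simp: direct_sum_carrier)
  moreover have "{j \<in> J. \<exists>x\<in>carrier X. f x j \<noteq> \<zero>\<^bsub>F j\<^esub>} \<subseteq> ?S"
  proof
    fix j assume "j \<in> {j \<in> J. \<exists>x\<in>carrier X. f x j \<noteq> \<zero>\<^bsub>F j\<^esub>}"
    then obtain x where j: "j \<in> J" and x: "x \<in> carrier X" "f x j \<noteq> \<zero>\<^bsub>F j\<^esub>" by blast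
    from x(1) g(2) obtain v where "v \<in> carrier (free_mod R {..<n})" "x = g v" by (metis imageE)
    with x(2) have v: "v \<in> carrier (free_mod R {..<n})" "f (g v) j \<noteq> \<zero>\<^bsub>F j\<^esub>" by auto
    have l: "lin R (free_mod R {..<n}) (F j) (\<lambda>v. f (g v) j)"
      using lin_comp[OF lin_comp[OF g(1) f] direct_sum_coord_lin[OF j]] .
    show "j \<in> ?S"
    proof (rule ccontr)
      assume nj: "j \<notin> ?S"
      have "f (g v) j \<in> {\<zero>\<^bsub>F j\<^esub>}"
      proof (rule lin_direct_sum_in_submodule[OF R _ F[OF j] l[unfolded free_mod_def] submodule_zero[OF F[OF j]]])
        show "v \<in> carrier (direct_sum {..<n} (\<lambda>_. regular_mod R))" using v(1) by (simp add: free_mod_def)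
        fix k x assume k: "k \<in> {..<n}" and x: "x \<in> carrier (regular_mod R)"
        have "ds_in {..<n} (\<lambda>_. regular_mod R) k x = x \<odot>\<^bsub>free_mod R {..<n}\<^esub> ?e k"
          using x by (auto simp: ds_in_def free_mod_def regular_mod_def intro!: restrict_ext)
        then have "f (g (ds_in {..<n} (\<lambda>_. regular_mod R) k x)) j = x \<odot>\<^bsub>F j\<^esub> f (g (?e k)) j"
          using lin_smult[OF l, of x "?e k"] e k x by (simp add: regular_mod_def)
        also have "\<dots> = \<zero>\<^bsub>F j\<^esub>"
          using nj k j x left_module_smult_zero[OF F[OF j]] by (simp add: regular_mod_def)
        finally show "f (g (ds_in {..<n} (\<lambda>_. regular_mod R) k x)) j \<in> {\<zero>\<^bsub>F j\<^esub>}" by simp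
      qed (rule rm)
      with v(2) show False by simp
    qed
  qed
  ultimately show ?thesis by (rule rev_finite_subset)
qed

text \<open>\<open>projective\<close> speaks about test modules of two fixed types; here
  \<open>M\<close> and \<open>N\<close> have any type. The epimorphism \<open>e\<close> from the
  free module on the carrier of \<open>P\<close> does belong to the test types, which yields a
  section \<open>s\<close>. On the free module a lift is obtained by choosing a preimage
  \<open>c p\<close> of \<open>h p\<close> for each basis element, and composing it with
  \<open>s\<close> gives the required map.\<close>

lemma projective_lift:
  assumes P: "projective R P" and M: "left_module R M" and N: "left_module R N"
    and g: "lin R M N g" "g ` carrier M = carrier N" and h: "lin R P N h"
  obtains k where "lin R P M k" "\<And>x. x \<in> carrier P \<Longrightarrow> g (k x) = h x"
proof -
  have LP: "left_module R P" using P by (simp add: projective_def)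
  then have R: "ring R" by (rule left_module_ring)
  interpret R: ring R using R .
  note rm = regular_mod_left_module[OF R]
  define F where "F = free_mod R (carrier P)"
  have F: "left_module R F" unfolding F_def free_mod_def using rm by (rule direct_sum_left_module[OF R])
  define e where "e = ds_map (carrier P) (\<lambda>_. regular_mod R) P (\<lambda>p r. r \<odot>\<^bsub>P\<^esub> p)"
  have e: "lin R F P e" unfolding F_def free_mod_def e_def
    using rm LP regular_mod_lin[OF LP] by (intro ds_map_lin[OF R]) auto
  have one: "\<one>\<^bsub>R\<^esub> \<in> carrier (regular_mod R)" by (simp add: regular_mod_def)
  let ?b = "\<lambda>p. ds_in (carrier P) (\<lambda>_. regular_mod R) p \<one>\<^bsub>R\<^esub>"
  have b: "?b p \<in> carrier F" if "p \<in> carrier P" for p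
    unfolding F_def free_mod_def
    using lin_closed[OF ds_in_lin[of "carrier P" R "\<lambda>_. regular_mod R" p]] rm one that by auto
  have eb: "e (?b p) = p" if "p \<in> carrier P" for p
  proof -
    have "e (?b p) = \<one>\<^bsub>R\<^esub> \<odot>\<^bsub>P\<^esub> p" unfolding e_def
      using rm LP regular_mod_lin[OF LP] that one by (intro ds_map_in) auto
    then show ?thesis using left_module.smult_one[OF LP that] by simp
  qed
  have es: "e ` carrier F = carrier P"
  proof
    show "e ` carrier F \<subseteq> carrier P" using e by (auto simp: lin_closed)
    show "carrier P \<subseteq> e ` carrier F" using eb b by (metis image_eqI subsetI)
  qed
  have re: "restrict e (carrier F) \<in> mod_hom R F P" using lin_restrict[OF F e] .
  have ri: "restrict (\<lambda>x. x) (carrier P) \<in> mod_hom R P P" using lin_restrict[OF LP lin_id] .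
  have "\<exists>k \<in> mod_hom R P F. \<forall>x\<in>carrier P. restrict e (carrier F) (k x) = restrict (\<lambda>x. x) (carrier P) x"
    using P F LP re ri es unfolding projective_def by (metis (no_types, lifting) image_restrict_eq)
  then obtain s where s: "lin R P F s" "\<And>x. x \<in> carrier P \<Longrightarrow> e (s x) = x"
    using mod_hom_lin lin_closed by (metis (no_types, lifting) restrict_apply')
  define c where "c p = inv_into (carrier M) g (h p)" for p
  have c: "c p \<in> carrier M" "g (c p) = h p" if "p \<in> carrier P" for p
    using that g(2) lin_closed[OF h that] by (auto simp: c_def inv_into_into f_inv_into_f)
  define l where "l = ds_map (carrier P) (\<lambda>_. regular_mod R) M (\<lambda>p r. r \<odot>\<^bsub>M\<^esub> c p)"
  have l: "lin R F M l" unfolding F_def free_mod_def l_def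
    using rm M regular_mod_lin[OF M] c by (intro ds_map_lin[OF R]) auto
  have gl: "g (l v) = h (e v)" if v: "v \<in> carrier F" for v
  proof -
    interpret N: abelian_group N using N by (rule left_module_abelian_group)
    let ?A = "{p \<in> carrier P. v p \<noteq> \<zero>\<^bsub>regular_mod R\<^esub>}"
    have vc: "v p \<in> carrier R" if "p \<in> carrier P" for p
      using v that unfolding F_def free_mod_def direct_sum_carrier by (simp add: regular_mod_def)
    have "g (l v) = finsum N (\<lambda>p. g (v p \<odot>\<^bsub>M\<^esub> c p)) ?A"
      unfolding l_def ds_map_def using vc c left_module.smult_closed[OF M]
      by (intro lin_finsum[OF M N g(1)]) auto
    also have "\<dots> = finsum N (\<lambda>p. h (v p \<odot>\<^bsub>P\<^esub> p)) ?A"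
      using vc c left_module.smult_closed[OF LP] left_module.smult_closed[OF N] lin_closed[OF h]
      by (intro N.finsum_cong') (auto simp: lin_smult[OF g(1)] lin_smult[OF h])
    also have "\<dots> = h (e v)"
      unfolding e_def ds_map_def using vc left_module.smult_closed[OF LP]
      by (intro lin_finsum[OF LP N h, symmetric]) auto
    finally show ?thesis .
  qed
  show thesis
  proof (rule that)
    show "lin R P M (\<lambda>x. l (s x))" using lin_comp[OF s(1) l] .
    show "g (l (s x)) = h x" if "x \<in> carrier P" for x
      using gl[OF lin_closed[OF s(1) that]] s(2)[OF that] by simp
  qed
qed

section \<open>Push-outs, pull-backs and sums of short exact sequences\<close>

text \<open>An \<open>x\<close> with the same image in \<open>X\<close> as \<open>u\<close> leaves a
  remainder in the kernel of \<open>w\<close>, which is the image of \<open>z\<close>.\<close>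

lemma pushout_generate:
  assumes ex: "exact R A E X a b" and ex': "exact R Z W X z w"
    and m: "lin R E W m" "\<And>x. x \<in> carrier E \<Longrightarrow> w (m x) = b x" and u: "u \<in> carrier W"
  shows "\<exists>t\<in>carrier Z. \<exists>x\<in>carrier E. u = z t \<oplus>\<^bsub>W\<^esub> m x"
proof -
  note D = exactD[OF ex] and D' = exactD[OF ex']
  interpret W: abelian_group W using D'(2) by (rule left_module_abelian_group)
  interpret X: abelian_group X using D'(3) by (rule left_module_abelian_group)
  obtain x where x: "x \<in> carrier E" "b x = w u" using D(10) lin_closed[OF D'(5) u] by blast
  have mx: "m x \<in> carrier W" using lin_closed[OF m(1) x(1)] .
  have "w (u \<ominus>\<^bsub>W\<^esub> m x) = \<zero>\<^bsub>X\<^esub>"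
    using lin_minus[OF D'(2,3,5) u mx] m(2)[OF x(1)] x(2) lin_closed[OF D'(5) u] by (simp add: X.minus_zero_iff)
  then obtain t where t: "t \<in> carrier Z" "u \<ominus>\<^bsub>W\<^esub> m x = z t"
    using D'(8)[of "u \<ominus>\<^bsub>W\<^esub> m x"] u mx by auto
  have "u = z t \<oplus>\<^bsub>W\<^esub> m x"
    using W.add_minus_cancel[OF u mx] t lin_closed[OF D'(4) t(1)] mx by (simp add: W.a_comm)
  then show ?thesis using t x by blast
qed

text \<open>A morphism of extensions that is the identity on the right-hand term is a push-out
  square, so the universal property holds for every such diagram and not just for the quotient built
  by \<open>ses_pushout\<close>. Below, the upper row is a projective resolution in one application
  and a direct sum of extensions in another.\<close>

lemma pushout_univ:
  assumes ex: "exact R A E X a b" and ex': "exact R Z W X z w" and g: "lin R A Z g"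
    and m: "lin R E W m" "\<And>x. x \<in> carrier E \<Longrightarrow> w (m x) = b x" "\<And>y. y \<in> carrier A \<Longrightarrow> m (a y) = z (g y)"
    and M: "left_module R M" and al: "lin R Z M \<alpha>" and mu: "lin R E M \<mu>"
    and c: "\<And>y. y \<in> carrier A \<Longrightarrow> \<mu> (a y) = \<alpha> (g y)"
  obtains \<Phi> where "lin R W M \<Phi>" "\<And>t. t \<in> carrier Z \<Longrightarrow> \<Phi> (z t) = \<alpha> t"
    "\<And>x. x \<in> carrier E \<Longrightarrow> \<Phi> (m x) = \<mu> x"
proof -
  note D = exactD[OF ex] and D' = exactD[OF ex']
  interpret W: abelian_group W using D'(2) by (rule left_module_abelian_group)
  interpret X: abelian_group X using D'(3) by (rule left_module_abelian_group)
  interpret M: abelian_group M using M by (rule left_module_abelian_group)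
  interpret Z: abelian_group Z using D'(1) by (rule left_module_abelian_group)
  interpret E: abelian_group E using D(2) by (rule left_module_abelian_group)
  have P: "left_module R (mod_prod Z E)" using mod_prod_left_module[OF D'(1) D(2)] .
  have lf: "lin R (mod_prod Z E) Z fst" and ls: "lin R (mod_prod Z E) E snd" by (auto intro!: linI)
  have l1: "lin R (mod_prod Z E) W (\<lambda>u. z (fst u) \<oplus>\<^bsub>W\<^esub> m (snd u))"
    by (rule lin_add_map[OF D'(2) lin_comp[OF lf D'(4)] lin_comp[OF ls m(1)]])
  have l2: "lin R (mod_prod Z E) M (\<lambda>u. \<alpha> (fst u) \<oplus>\<^bsub>M\<^esub> \<mu> (snd u))"
    by (rule lin_add_map[OF M lin_comp[OF lf al] lin_comp[OF ls mu]])
  have sj: "(\<lambda>u. z (fst u) \<oplus>\<^bsub>W\<^esub> m (snd u)) ` carrier (mod_prod Z E) = carrier W"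
  proof
    show "(\<lambda>u. z (fst u) \<oplus>\<^bsub>W\<^esub> m (snd u)) ` carrier (mod_prod Z E) \<subseteq> carrier W"
      using lin_closed[OF l1] by blast
    show "carrier W \<subseteq> (\<lambda>u. z (fst u) \<oplus>\<^bsub>W\<^esub> m (snd u)) ` carrier (mod_prod Z E)"
    proof
      fix u assume "u \<in> carrier W"
      then obtain t x where "t \<in> carrier Z" "x \<in> carrier E" "u = z t \<oplus>\<^bsub>W\<^esub> m x"
        using pushout_generate[OF ex ex' m(1,2)] by blast
      then show "u \<in> (\<lambda>u. z (fst u) \<oplus>\<^bsub>W\<^esub> m (snd u)) ` carrier (mod_prod Z E)"
        by (intro image_eqI[of _ _ "(t, x)"]) auto
    qed
  qed
  \<comment> \<open>A pair (t, x) mapped to zero satisfies x = a y and t = - g y for some y, so its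
    image in \<open>M\<close> is \<mu> (a y) - \<alpha> (g y) = 0.\<close>
  have ker: "\<alpha> (fst p) \<oplus>\<^bsub>M\<^esub> \<mu> (snd p) = \<zero>\<^bsub>M\<^esub>"
    if p: "p \<in> carrier (mod_prod Z E)" "z (fst p) \<oplus>\<^bsub>W\<^esub> m (snd p) = \<zero>\<^bsub>W\<^esub>" for p
  proof -
    obtain t x where tx: "p = (t, x)" "t \<in> carrier Z" "x \<in> carrier E" using p(1) by auto
    have zt: "z t \<in> carrier W" "m x \<in> carrier W" using tx lin_closed[OF D'(4)] lin_closed[OF m(1)] by auto
    have "w (z t \<oplus>\<^bsub>W\<^esub> m x) = b x"
      using lin_add[OF D'(5) zt] D'(9)[OF tx(2)] m(2)[OF tx(3)] lin_closed[OF D(5) tx(3)] by simp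
    then have "b x = \<zero>\<^bsub>X\<^esub>" using p(2) tx(1) lin_zero[OF D'(2,3,5)] by simp
    then obtain y where y: "y \<in> carrier A" "x = a y" using D(8)[OF tx(3)] by blast
    have gy: "g y \<in> carrier Z" using lin_closed[OF g y(1)] .
    have "z (t \<oplus>\<^bsub>Z\<^esub> g y) = \<zero>\<^bsub>W\<^esub>" using p(2) tx y m(3) gy by (simp add: lin_add[OF D'(4)])
    then have "t \<oplus>\<^bsub>Z\<^esub> g y = \<zero>\<^bsub>Z\<^esub>"
      using lin_inj_iff[OF D'(1,2,4)] D'(6) tx gy by blast
    then have "\<alpha> (t \<oplus>\<^bsub>Z\<^esub> g y) = \<zero>\<^bsub>M\<^esub>" using lin_zero[OF D'(1) M al] by simp
    then show ?thesis using tx y c gy by (simp add: lin_add[OF al])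
  qed
  obtain \<Phi> where Ph: "lin R W M \<Phi>"
    "\<And>p. p \<in> carrier (mod_prod Z E) \<Longrightarrow> \<Phi> (z (fst p) \<oplus>\<^bsub>W\<^esub> m (snd p)) = \<alpha> (fst p) \<oplus>\<^bsub>M\<^esub> \<mu> (snd p)"
    using lin_factor[OF P D'(2) M l1 sj l2 ker] by blast
  show thesis
  proof (rule that[OF Ph(1)])
    fix t assume t: "t \<in> carrier Z"
    then show "\<Phi> (z t) = \<alpha> t"
      using Ph(2)[of "(t, \<zero>\<^bsub>E\<^esub>)"] lin_zero[OF D(2) D'(2) m(1)] lin_zero[OF D(2) M mu]
        lin_closed[OF D'(4) t] lin_closed[OF al t] by simp
  next
    fix x assume x: "x \<in> carrier E"
    then show "\<Phi> (m x) = \<mu> x"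
      using Ph(2)[of "(\<zero>\<^bsub>Z\<^esub>, x)"] lin_zero[OF D'(1,2,4)] lin_zero[OF D'(1) M al]
        lin_closed[OF m(1) x] lin_closed[OF mu x] by simp
  qed
qed

text \<open>The second claim records the canonical map from the old middle term to the new one.
  Together with exactness it is the interface through which later proofs use the push-out, by way of
  \<open>pushout_generate\<close> and \<open>pushout_univ\<close>.\<close>

lemma pushout_exact:
  assumes s: "short_exact R s" and Z: "left_module R Z" and g: "lin R (ses_left s) Z g"
  shows "short_exact R (ses_pushout Z g s)"
    and "\<exists>m. lin R (ses_mid s) (ses_mid (ses_pushout Z g s)) m \<and>
      (\<forall>y\<in>carrier (ses_left s). m (ses_inj s y) = ses_inj (ses_pushout Z g s) (g y)) \<and>
      (\<forall>x\<in>carrier (ses_mid s). ses_proj (ses_pushout Z g s) (m x) = ses_proj s x)"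
proof -
  define A E X a b where "A = ses_left s" "E = ses_mid s" "X = ses_right s" "a = ses_inj s" "b = ses_proj s"
  note defs = this
  have ex: "exact R A E X a b" using s by (simp add: short_exact_iff defs)
  note D = exactD[OF ex]
  have g: "lin R A Z g" using g by (simp add: defs)
  interpret A: abelian_group A using D(1) by (rule left_module_abelian_group)
  interpret E: abelian_group E using D(2) by (rule left_module_abelian_group)
  interpret X: abelian_group X using D(3) by (rule left_module_abelian_group)
  interpret Z: abelian_group Z using Z by (rule left_module_abelian_group)
  define P where "P = mod_prod Z E"
  have P: "left_module R P" unfolding P_def using mod_prod_left_module[OF Z D(2)] .
  interpret P: abelian_group P using P by (rule left_module_abelian_group)
  define kap where "kap y = (g y, \<ominus>\<^bsub>E\<^esub> a y)" for y
  have kap: "lin R A P kap"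
    using D(4) g left_module_smult_neg[OF D(2)] E.minus_add
    by (auto intro!: linI simp: kap_def P_def lin_closed lin_add lin_smult)
  define K where "K = kap ` carrier A"
  have K: "submodule K R P" unfolding K_def using submodule_image[OF D(1) P kap submodule_carrier[OF D(1)]] .
  define W where "W = quot_mod P K"
  have W: "left_module R W" unfolding W_def using quot_mod_left_module[OF P K] .
  interpret W: abelian_group W using W by (rule left_module_abelian_group)
  define q where "q = quot_proj P K"
  have q: "lin R P W q" unfolding q_def W_def using quot_proj_lin[OF P K] .
  have qs: "q ` carrier P = carrier W" unfolding q_def W_def by (rule quot_proj_image)
  have q0: "q x = \<zero>\<^bsub>W\<^esub> \<longleftrightarrow> x \<in> K" if "x \<in> carrier P" for x
    unfolding q_def W_def using quot_proj_zero_iff[OF P K that] .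
  have l1: "lin R Z P (\<lambda>z. (z, \<zero>\<^bsub>E\<^esub>))"
    unfolding P_def using left_module_smult_zero[OF D(2)] by (auto intro!: linI)
  have l2: "lin R E P (\<lambda>x. (\<zero>\<^bsub>Z\<^esub>, x))"
    unfolding P_def using left_module_smult_zero[OF Z] by (auto intro!: linI)
  have l3: "lin R P E snd" unfolding P_def by (auto intro!: linI)
  have kK: "b (snd p) = \<zero>\<^bsub>X\<^esub>" if "p \<in> K" for p
  proof -
    from that obtain y where y: "y \<in> carrier A" "p = kap y" by (auto simp: K_def)
    then show ?thesis using lin_neg[OF D(2,3,5) lin_closed[OF D(4) y(1)]] D(9)[OF y(1)] by (simp add: kap_def)
  qed
  \<comment> \<open>The projection prescribed by \<open>ses_pushout\<close>; \<open>the_elem\<close>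
    is justified by \<open>wq\<close>, since the image under \<open>b\<close> of the second
    component is constant on cosets of \<open>K\<close>.\<close>
  define w where "w = (\<lambda>C\<in>carrier W. the_elem ((\<lambda>(z, e). b e) ` C))"
  have wq: "w (q p) = b (snd p)" if p: "p \<in> carrier P" for p
  proof -
    interpret KK: abelian_subgroup K P using submodule_abelian_subgroup[OF P K] .
    have cp: "b (snd p) \<in> carrier X" using lin_closed[OF D(5) lin_closed[OF l3 p]] .
    have "(\<lambda>(z, e). b e) ` q p = {b (snd p)}"
    proof
      show "{b (snd p)} \<subseteq> (\<lambda>(z, e). b e) ` q p"
        using KK.a_rcos_self[OF p] p by (auto simp: q_def quot_proj_apply split_def)
      show "(\<lambda>(z, e). b e) ` q p \<subseteq> {b (snd p)}"
      proof
        fix c assume "c \<in> (\<lambda>(z, e). b e) ` q p"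
        then obtain k where k: "k \<in> K" "c = b (snd (k \<oplus>\<^bsub>P\<^esub> p))"
          using p by (auto simp: q_def quot_proj_apply a_r_coset_def' split_def)
        have kc: "k \<in> carrier P" using k submoduleD(1)[OF P K] by blast
        have "c = b (snd k) \<oplus>\<^bsub>X\<^esub> b (snd p)"
          using k lin_add[OF lin_comp[OF l3 D(5)] kc p] by simp
        then show "c \<in> {b (snd p)}" using kK[OF k(1)] cp by simp
      qed
    qed
    then show ?thesis using lin_closed[OF q p] by (simp add: w_def)
  qed
  have w: "lin R W X w"
  proof -
    obtain w' where w': "lin R W X w'" "\<And>p. p \<in> carrier P \<Longrightarrow> w' (q p) = b (snd p)"
      using lin_factor[OF P W D(3) q qs lin_comp[OF l3 D(5)]] kK q0 by blast
    have "w u = w' u" if "u \<in> carrier W" for u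
    proof -
      from that qs obtain p where "p \<in> carrier P" "u = q p" by (metis imageE)
      then show ?thesis using wq w'(2) by simp
    qed
    then show ?thesis using lin_cong[OF W, of w w' X] w'(1) by simp
  qed
  define z where "z = (\<lambda>t\<in>carrier Z. q (t, \<zero>\<^bsub>E\<^esub>))"
  have z: "lin R Z W z"
    using lin_comp[OF l1 q] lin_cong[OF Z, of z "\<lambda>t. q (t, \<zero>\<^bsub>E\<^esub>)" W] by (simp add: z_def)
  have tP: "(t, \<zero>\<^bsub>E\<^esub>) \<in> carrier P" if "t \<in> carrier Z" for t using that by (simp add: P_def)
  \<comment> \<open>Adding the relation \<open>kap y\<close> moves \<open>a y\<close> into the left
    component.\<close>
  have qm: "q (t, a y) = q (t \<oplus>\<^bsub>Z\<^esub> g y, \<zero>\<^bsub>E\<^esub>)" if ty: "t \<in> carrier Z" "y \<in> carrier A" for t y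
  proof -
    have gy: "g y \<in> carrier Z" "a y \<in> carrier E" using lin_closed[OF g ty(2)] lin_closed[OF D(4) ty(2)] .
    have p1: "(t, a y) \<in> carrier P" using ty gy by (simp add: P_def)
    have p2: "kap y \<in> carrier P" using lin_closed[OF kap ty(2)] .
    have "(t, a y) \<oplus>\<^bsub>P\<^esub> kap y = (t \<oplus>\<^bsub>Z\<^esub> g y, \<zero>\<^bsub>E\<^esub>)" using ty gy by (simp add: P_def kap_def E.r_neg)
    moreover have "q ((t, a y) \<oplus>\<^bsub>P\<^esub> kap y) = q (t, a y) \<oplus>\<^bsub>W\<^esub> q (kap y)" using lin_add[OF q p1 p2] .
    moreover have "q (kap y) = \<zero>\<^bsub>W\<^esub>" using q0[OF p2] ty by (auto simp: K_def)
    ultimately show ?thesis using lin_closed[OF q p1] by simp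
  qed
  have zi: "inj_on z (carrier Z)"
    unfolding lin_inj_iff[OF Z W z]
  proof (intro ballI impI)
    fix t assume t: "t \<in> carrier Z" "z t = \<zero>\<^bsub>W\<^esub>"
    then have "(t, \<zero>\<^bsub>E\<^esub>) \<in> K" using q0[OF tP] by (simp add: z_def)
    then obtain y where y: "y \<in> carrier A" "t = g y" "\<zero>\<^bsub>E\<^esub> = \<ominus>\<^bsub>E\<^esub> a y" by (auto simp: K_def kap_def)
    have ay: "a y \<in> carrier E" using lin_closed[OF D(4) y(1)] .
    have "a y = \<zero>\<^bsub>E\<^esub>" using y(3) ay by (metis E.minus_minus E.minus_self_zero)
    then have "y = \<zero>\<^bsub>A\<^esub>" using lin_inj_iff[OF D(1,2,4)] D(6) y(1) by blast
    then show "t = \<zero>\<^bsub>Z\<^esub>" using y(2) lin_zero[OF D(1) Z g] by simp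
  qed
  have ker: "w u = \<zero>\<^bsub>X\<^esub> \<longleftrightarrow> u \<in> z ` carrier Z" if u: "u \<in> carrier W" for u
  proof
    assume wu: "w u = \<zero>\<^bsub>X\<^esub>"
    from u qs obtain p where p: "p \<in> carrier P" "u = q p" by (metis imageE)
    obtain t x where tx: "p = (t, x)" "t \<in> carrier Z" "x \<in> carrier E" using p(1) by (auto simp: P_def)
    then have "b x = \<zero>\<^bsub>X\<^esub>" using wq[OF p(1)] wu p(2) by simp
    then obtain y where y: "y \<in> carrier A" "x = a y" using D(8)[OF tx(3)] by blast
    have "t \<oplus>\<^bsub>Z\<^esub> g y \<in> carrier Z" using tx lin_closed[OF g y(1)] by simp
    moreover have "u = z (t \<oplus>\<^bsub>Z\<^esub> g y)"
      using p(2) tx y qm[OF tx(2) y(1)] calculation by (simp add: z_def)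
    ultimately show "u \<in> z ` carrier Z" by blast
  next
    assume "u \<in> z ` carrier Z"
    then obtain t where t: "t \<in> carrier Z" "u = q (t, \<zero>\<^bsub>E\<^esub>)" by (auto simp: z_def)
    then show "w u = \<zero>\<^bsub>X\<^esub>" using wq[OF tP[OF t(1)]] lin_zero[OF D(2,3,5)] by simp
  qed
  have m: "lin R E W (\<lambda>x. q (\<zero>\<^bsub>Z\<^esub>, x))" using lin_comp[OF l2 q] .
  have P2: "(\<zero>\<^bsub>Z\<^esub>, x) \<in> carrier P" if "x \<in> carrier E" for x using that by (simp add: P_def)
  have sj: "w ` carrier W = carrier X"
  proof
    show "w ` carrier W \<subseteq> carrier X" using lin_closed[OF w] by blast
    show "carrier X \<subseteq> w ` carrier W"
    proof
      fix x assume "x \<in> carrier X"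
      then obtain v where v: "v \<in> carrier E" "b v = x" using D(10) by blast
      then show "x \<in> w ` carrier W"
        using wq[OF P2[OF v(1)]] lin_closed[OF q P2[OF v(1)]] by (intro image_eqI[of _ _ "q (\<zero>\<^bsub>Z\<^esub>, v)"]) auto
    qed
  qed
  have eq: "ses_pushout Z g s = \<lparr>ses_left = Z, ses_mid = W, ses_right = X, ses_inj = z, ses_proj = w\<rparr>"
  proof -
    have "z = (\<lambda>t\<in>carrier Z. K +>\<^bsub>P\<^esub> (t, \<zero>\<^bsub>E\<^esub>))"
      unfolding z_def q_def using tP by (intro restrict_ext) (simp add: quot_proj_apply)
    then show ?thesis
      unfolding ses_pushout_def Let_def w_def W_def K_def P_def kap_def defs by simp
  qed
  show "short_exact R (ses_pushout Z g s)"
    unfolding short_exact_iff eq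
    using Z W D(3) z w zi ker sj by (simp add: exact_def z_def w_def)
  show "\<exists>m. lin R (ses_mid s) (ses_mid (ses_pushout Z g s)) m \<and>
      (\<forall>y\<in>carrier (ses_left s). m (ses_inj s y) = ses_inj (ses_pushout Z g s) (g y)) \<and>
      (\<forall>x\<in>carrier (ses_mid s). ses_proj (ses_pushout Z g s) (m x) = ses_proj s x)"
    unfolding eq defs(1)[symmetric] defs(2)[symmetric] defs(4)[symmetric] defs(5)[symmetric]
    using m qm[of "\<zero>\<^bsub>Z\<^esub>"] wq[OF P2] lin_closed[OF g]
    by (intro exI[of _ "\<lambda>x. q (\<zero>\<^bsub>Z\<^esub>, x)"]) (simp add: z_def)
qed

lemma ses_pushout_simps [simp]:
  "ses_left (ses_pushout Z g s) = Z" "ses_right (ses_pushout Z g s) = ses_right s"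
  by (simp_all add: ses_pushout_def Let_def)

lemma pullback_exact:
  assumes s: "short_exact R s" and W: "left_module R W" and f: "lin R W (ses_right s) f"
  shows "short_exact R (ses_pullback W f s)"
proof -
  define A E X a b where "A = ses_left s" "E = ses_mid s" "X = ses_right s" "a = ses_inj s" "b = ses_proj s"
  note defs = this
  have ex: "exact R A E X a b" using s by (simp add: short_exact_iff defs)
  note D = exactD[OF ex]
  have f: "lin R W X f" using f by (simp add: defs)
  interpret A: abelian_group A using D(1) by (rule left_module_abelian_group)
  interpret E: abelian_group E using D(2) by (rule left_module_abelian_group)
  interpret X: abelian_group X using D(3) by (rule left_module_abelian_group)
  interpret W: abelian_group W using W by (rule left_module_abelian_group)
  define Q where "Q = {(e, w). e \<in> carrier E \<and> w \<in> carrier W \<and> b e = f w}"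
  have P: "left_module R (mod_prod E W)" using mod_prod_left_module[OF D(2) W] .
  have Q: "submodule Q R (mod_prod E W)"
    using D(5) f lin_zero[OF D(2,3,5)] lin_zero[OF W D(3) f]
      left_module.smult_closed[OF D(2)] left_module.smult_closed[OF W]
    by (intro submoduleI'[OF P]) (auto simp: Q_def lin_add lin_smult)
  define M where "M = submod_of (mod_prod E W) Q"
  have M: "left_module R M" unfolding M_def using submod_of_left_module[OF P Q] .
  have cM: "carrier M = Q" by (simp add: M_def)
  define z where "z = (\<lambda>y\<in>carrier A. (a y, \<zero>\<^bsub>W\<^esub>))"
  define w where "w = (\<lambda>u\<in>Q. snd u)"
  have z: "lin R A M z"
    using D(4,9) lin_zero[OF W D(3) f] left_module.smult_closed[OF D(1)] left_module_smult_zero[OF W]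
    by (auto intro!: linI simp: z_def M_def Q_def lin_closed lin_add lin_smult)
  have w: "lin R M W w"
    using submoduleD(3,4)[OF P Q] by (auto intro!: linI simp: w_def M_def Q_def)
  have zi: "inj_on z (carrier A)" using D(6) by (auto simp: inj_on_def z_def)
  have ker: "w u = \<zero>\<^bsub>W\<^esub> \<longleftrightarrow> u \<in> z ` carrier A" if uM: "u \<in> carrier M" for u
  proof -
    obtain x v where u: "u = (x, v)" "x \<in> carrier E" "v \<in> carrier W" "b x = f v"
      using uM by (cases u) (auto simp: cM Q_def)
    have "u \<in> z ` carrier A \<longleftrightarrow> v = \<zero>\<^bsub>W\<^esub> \<and> x \<in> a ` carrier A" using u(1) by (auto simp: z_def)
    also have "\<dots> \<longleftrightarrow> v = \<zero>\<^bsub>W\<^esub>" using D(8)[OF u(2)] u(4) lin_zero[OF W D(3) f] by auto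
    finally show ?thesis using uM u(1) by (simp add: cM w_def)
  qed
  have sj: "w ` carrier M = carrier W"
  proof
    show "w ` carrier M \<subseteq> carrier W" using lin_closed[OF w] by blast
    show "carrier W \<subseteq> w ` carrier M"
    proof
      fix v assume v: "v \<in> carrier W"
      then obtain x where "x \<in> carrier E" "b x = f v" using D(10) lin_closed[OF f] by blast
      then show "v \<in> w ` carrier M"
        using v by (intro image_eqI[of _ _ "(x, v)"]) (auto simp: cM w_def Q_def)
    qed
  qed
  have eq: "ses_pullback W f s = \<lparr>ses_left = A, ses_mid = M, ses_right = W, ses_inj = z, ses_proj = w\<rparr>"
    unfolding ses_pullback_def Let_def M_def Q_def z_def w_def defs by simp
  show ?thesis
    unfolding short_exact_iff eq using D(1) M W z w zi ker sj cM by (simp add: exact_def z_def w_def)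
qed

lemma ses_pullback_simps [simp]:
  "ses_left (ses_pullback W f s) = ses_left s" "ses_right (ses_pullback W f s) = W"
  by (simp_all add: ses_pullback_def Let_def)

lemma direct_sum_map_lin:
  assumes "\<And>i. i \<in> I \<Longrightarrow> left_module R (M i)" "\<And>i. i \<in> I \<Longrightarrow> left_module R (N i)"
    "\<And>i. i \<in> I \<Longrightarrow> lin R (M i) (N i) (\<phi> i)"
  shows "lin R (direct_sum I M) (direct_sum I N) (\<lambda>v. \<lambda>i\<in>I. \<phi> i (v i))"
proof (rule linI)
  fix v assume v: "v \<in> carrier (direct_sum I M)"
  have "{i \<in> I. \<phi> i (v i) \<noteq> \<zero>\<^bsub>N i\<^esub>} \<subseteq> {i \<in> I. v i \<noteq> \<zero>\<^bsub>M i\<^esub>}"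
    using lin_zero[OF assms] by auto
  then have "finite {i \<in> I. \<phi> i (v i) \<noteq> \<zero>\<^bsub>N i\<^esub>}"
    using v by (auto simp: direct_sum_carrier intro: finite_subset)
  then show "(\<lambda>i\<in>I. \<phi> i (v i)) \<in> carrier (direct_sum I N)"
    using v lin_closed[OF assms(3)] by (auto simp: direct_sum_carrier cong: conj_cong)
qed (auto simp: direct_sum_carrier lin_add[OF assms(3)] lin_smult[OF assms(3)] intro!: restrict_ext)

lemma ses_sum_exact:
  assumes R: "ring R" and s: "\<And>i. i \<in> I \<Longrightarrow> short_exact R (s i)"
  shows "short_exact R (ses_sum I s)"
proof -
  let ?A = "\<lambda>i. ses_left (s i)" and ?E = "\<lambda>i. ses_mid (s i)" and ?X = "\<lambda>i. ses_right (s i)"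
  have ex: "exact R (?A i) (?E i) (?X i) (ses_inj (s i)) (ses_proj (s i))" if "i \<in> I" for i
    using s[OF that] by (simp add: short_exact_iff)
  note D = exactD[OF ex]
  have A: "left_module R (direct_sum I ?A)" and E: "left_module R (direct_sum I ?E)"
    and X: "left_module R (direct_sum I ?X)"
    by (rule direct_sum_left_module[OF R]; simp add: D)+
  define z where "z = (\<lambda>v\<in>carrier (direct_sum I ?A). \<lambda>i\<in>I. ses_inj (s i) (v i))"
  define w where "w = (\<lambda>v\<in>carrier (direct_sum I ?E). \<lambda>i\<in>I. ses_proj (s i) (v i))"
  have z: "lin R (direct_sum I ?A) (direct_sum I ?E) z"
    using direct_sum_map_lin[of I R ?A ?E "\<lambda>i. ses_inj (s i)"] D(1,2,4)
      lin_cong[OF A, of z "\<lambda>v. \<lambda>i\<in>I. ses_inj (s i) (v i)"] by (simp add: z_def)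
  have w: "lin R (direct_sum I ?E) (direct_sum I ?X) w"
    using direct_sum_map_lin[of I R ?E ?X "\<lambda>i. ses_proj (s i)"] D(2,3,5)
      lin_cong[OF E, of w "\<lambda>v. \<lambda>i\<in>I. ses_proj (s i) (v i)"] by (simp add: w_def)
  have inj0: "ses_inj (s i) y = \<zero>\<^bsub>?E i\<^esub> \<longleftrightarrow> y = \<zero>\<^bsub>?A i\<^esub>" if "i \<in> I" "y \<in> carrier (?A i)" for i y
    using lin_inj_iff[OF D(1,2,4)[OF that(1)]] D(6)[OF that(1)] that(2) lin_zero[OF D(1,2,4)[OF that(1)]] by blast
  have zi: "inj_on z (carrier (direct_sum I ?A))"
    unfolding lin_inj_iff[OF A E z]
  proof (intro ballI impI)
    fix v assume v: "v \<in> carrier (direct_sum I ?A)" "z v = \<zero>\<^bsub>direct_sum I ?E\<^esub>"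
    have "v i = \<zero>\<^bsub>?A i\<^esub>" if "i \<in> I" for i
      using fun_cong[OF v(2), of i] v(1) that inj0[OF that] by (simp add: z_def direct_sum_carrier)
    then show "v = \<zero>\<^bsub>direct_sum I ?A\<^esub>" using v(1)
      by (intro extensionalityI[of _ I]) (auto simp: direct_sum_carrier)
  qed
  have ker: "w u = \<zero>\<^bsub>direct_sum I ?X\<^esub> \<longleftrightarrow> u \<in> z ` carrier (direct_sum I ?A)"
    if u: "u \<in> carrier (direct_sum I ?E)" for u
  proof
    assume wu: "w u = \<zero>\<^bsub>direct_sum I ?X\<^esub>"
    have "\<exists>y\<in>carrier (?A i). u i = ses_inj (s i) y" if "i \<in> I" for i
      using fun_cong[OF wu, of i] u that D(8)[OF that, of "u i"] by (auto simp: w_def direct_sum_carrier)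
    then obtain y where y: "\<And>i. i \<in> I \<Longrightarrow> y i \<in> carrier (?A i)" "\<And>i. i \<in> I \<Longrightarrow> u i = ses_inj (s i) (y i)"
      by metis
    \<comment> \<open>Injectivity in each coordinate gives the preimages the same support as
      \<open>u\<close>.\<close>
    have "y i = \<zero>\<^bsub>?A i\<^esub> \<longleftrightarrow> u i = \<zero>\<^bsub>?E i\<^esub>" if "i \<in> I" for i
      using inj0[OF that y(1)[OF that]] y(2)[OF that] by simp
    then have "{i \<in> I. y i \<noteq> \<zero>\<^bsub>?A i\<^esub>} = {i \<in> I. u i \<noteq> \<zero>\<^bsub>?E i\<^esub>}" by blast
    then have fy: "finite {i \<in> I. y i \<noteq> \<zero>\<^bsub>?A i\<^esub>}" using u by (simp add: direct_sum_carrier)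
    have yc: "restrict y I \<in> carrier (direct_sum I ?A)"
      unfolding direct_sum_carrier using y(1) fy by (auto cong: conj_cong)
    have "u = z (restrict y I)"
      using yc y(2) u by (intro extensionalityI[of _ I]) (auto simp: z_def direct_sum_carrier)
    then show "u \<in> z ` carrier (direct_sum I ?A)" using yc by blast
  next
    assume "u \<in> z ` carrier (direct_sum I ?A)"
    then obtain v where v: "v \<in> carrier (direct_sum I ?A)" "u = z v" by blast
    then show "w u = \<zero>\<^bsub>direct_sum I ?X\<^esub>"
      using u D(9) by (auto simp: w_def z_def direct_sum_carrier intro!: restrict_ext)
  qed
  have sj: "w ` carrier (direct_sum I ?E) = carrier (direct_sum I ?X)"
  proof
    show "w ` carrier (direct_sum I ?E) \<subseteq> carrier (direct_sum I ?X)" using lin_closed[OF w] by blast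
    show "carrier (direct_sum I ?X) \<subseteq> w ` carrier (direct_sum I ?E)"
    proof
      fix x assume x: "x \<in> carrier (direct_sum I ?X)"
      \<comment> \<open>Zero is chosen as the preimage of zero; otherwise the coordinatewise
        preimages need not have finite support.\<close>
      have "\<exists>v\<in>carrier (?E i). ses_proj (s i) v = x i \<and> (x i = \<zero>\<^bsub>?X i\<^esub> \<longrightarrow> v = \<zero>\<^bsub>?E i\<^esub>)" if "i \<in> I" for i
      proof (cases "x i = \<zero>\<^bsub>?X i\<^esub>")
        case True
        then show ?thesis using lin_zero[OF D(2,3,5)[OF that]]
            abelian_groupE(2)[OF left_module_abelian_group[OF D(2)[OF that]]] by auto
      next
        case False
        then show ?thesis using D(10)[OF that, of "x i"] x that by (auto simp: direct_sum_carrier)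
      qed
      then obtain v where v: "\<And>i. i \<in> I \<Longrightarrow> v i \<in> carrier (?E i)" "\<And>i. i \<in> I \<Longrightarrow> ses_proj (s i) (v i) = x i"
        "\<And>i. i \<in> I \<Longrightarrow> x i = \<zero>\<^bsub>?X i\<^esub> \<Longrightarrow> v i = \<zero>\<^bsub>?E i\<^esub>"
        by metis
      have "finite {i \<in> I. v i \<noteq> \<zero>\<^bsub>?E i\<^esub>}"
        by (rule finite_subset[of _ "{i \<in> I. x i \<noteq> \<zero>\<^bsub>?X i\<^esub>}"]) (use v(3) x in \<open>auto simp: direct_sum_carrier\<close>)
      then have vc: "restrict v I \<in> carrier (direct_sum I ?E)"
        unfolding direct_sum_carrier using v(1) by (auto cong: conj_cong)
      have "x = w (restrict v I)"
        using vc v(2) x by (intro extensionalityI[of _ I]) (auto simp: w_def direct_sum_carrier)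
      then show "x \<in> w ` carrier (direct_sum I ?E)" using vc by blast
    qed
  qed
  have eq: "ses_sum I s = \<lparr>ses_left = direct_sum I ?A, ses_mid = direct_sum I ?E,
      ses_right = direct_sum I ?X, ses_inj = z, ses_proj = w\<rparr>"
    by (simp add: ses_sum_def Let_def z_def w_def)
  show ?thesis
    unfolding short_exact_iff eq using A E X z w zi ker sj by (simp add: exact_def) (simp add: z_def w_def)
qed

lemma ses_sum_simps [simp]:
  "ses_left (ses_sum I s) = direct_sum I (\<lambda>i. ses_left (s i))"
  "ses_mid (ses_sum I s) = direct_sum I (\<lambda>i. ses_mid (s i))"
  "ses_right (ses_sum I s) = direct_sum I (\<lambda>i. ses_right (s i))"
  by (simp_all add: ses_sum_def Let_def)

lemma split_ses_exact:
  assumes X: "left_module R X" and Y: "left_module R Y"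
  shows "short_exact R (split_ses X Y)"
proof -
  interpret X: abelian_group X using X by (rule left_module_abelian_group)
  interpret Y: abelian_group Y using Y by (rule left_module_abelian_group)
  define z where "z = (\<lambda>y\<in>carrier Y. (y, \<zero>\<^bsub>X\<^esub>))"
  define w where "w = (\<lambda>u\<in>carrier Y \<times> carrier X. snd u)"
  have z: "lin R Y (mod_prod Y X) z"
    using left_module.smult_closed[OF Y] left_module_smult_zero[OF X] by (auto intro!: linI simp: z_def)
  have w: "lin R (mod_prod Y X) X w"
    using left_module.smult_closed[OF Y] left_module.smult_closed[OF X] by (auto intro!: linI simp: w_def)
  have zi: "inj_on z (carrier Y)" by (auto simp: inj_on_def z_def)
  have ker: "\<forall>u\<in>carrier (mod_prod Y X). w u = \<zero>\<^bsub>X\<^esub> \<longleftrightarrow> u \<in> z ` carrier Y"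
    by (auto simp: w_def z_def)
  have sj: "w ` carrier (mod_prod Y X) = carrier X"
    using Y.zero_closed by (force simp: w_def)
  show ?thesis
    unfolding short_exact_iff split_ses_def
    using X Y mod_prod_left_module[OF Y X] z w zi ker sj
    by (simp add: exact_def flip: z_def w_def) (simp add: z_def w_def)
qed

lemma summation_map_ds_map:
  "v \<in> carrier (direct_sum I (\<lambda>_. M)) \<Longrightarrow> summation_map I M v = ds_map I (\<lambda>_. M) M (\<lambda>_ x. x) v"
  by (simp add: summation_map_def ds_map_def)

lemma summation_map_lin:
  assumes "left_module R M"
  shows "lin R (direct_sum I (\<lambda>_. M)) M (summation_map I M)"
proof -
  have R: "ring R" using assms by (rule left_module_ring)
  have l: "lin R (direct_sum I (\<lambda>_. M)) M (ds_map I (\<lambda>_. M) M (\<lambda>_ x. x))"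
    using assms lin_id by (intro ds_map_lin[OF R]) auto
  have DS: "left_module R (direct_sum I (\<lambda>_. M))" using assms by (intro direct_sum_left_module[OF R]) auto
  show ?thesis
    using lin_cong[OF DS, of "summation_map I M" "ds_map I (\<lambda>_. M) M (\<lambda>_ x. x)" M] l
    by (simp add: summation_map_ds_map)
qed

lemma summation_map_in:
  assumes "left_module R M" "i \<in> I" "x \<in> carrier M"
  shows "summation_map I M (ds_in I (\<lambda>_. M) i x) = x"
proof -
  have "ds_in I (\<lambda>_. M) i x \<in> carrier (direct_sum I (\<lambda>_. M))"
    using lin_closed[OF ds_in_lin[of I R "\<lambda>_. M" i]] assms by auto
  then show ?thesis
    using ds_map_in[of I R "\<lambda>_. M" M "\<lambda>_ x. x" i x] assms lin_id by (auto simp: summation_map_ds_map)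
qed

section \<open>Extension classes as cocycles on a projective resolution\<close>

text \<open>By the five lemma a morphism of extensions that is the identity at both ends is
  bijective, so only a linear map of the middle terms has to be supplied.\<close>

lemma ses_equivI:
  assumes s: "short_exact R s" and t: "short_exact R t"
    and eq: "ses_left s = ses_left t" "ses_right s = ses_right t"
    and f: "lin R (ses_mid s) (ses_mid t) f" "\<And>y. y \<in> carrier (ses_left s) \<Longrightarrow> f (ses_inj s y) = ses_inj t y"
      "\<And>x. x \<in> carrier (ses_mid s) \<Longrightarrow> ses_proj t (f x) = ses_proj s x"
  shows "ses_equiv R s t"
proof -
  have es: "exact R (ses_left t) (ses_mid s) (ses_right t) (ses_inj s) (ses_proj s)"
    and et: "exact R (ses_left t) (ses_mid t) (ses_right t) (ses_inj t) (ses_proj t)"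
    using s t eq by (simp_all add: short_exact_iff)
  note D = exactD[OF es]
  have "bij_betw f (carrier (ses_mid s)) (carrier (ses_mid t))"
    using f eq by (intro five_lemma[OF es et, where g = "\<lambda>x. x"]) (auto simp: lin_id bij_betw_def)
  then have "restrict f (carrier (ses_mid s)) \<in> mod_iso R (ses_mid s) (ses_mid t)"
    using lin_restrict[OF D(2) f(1)] by (simp add: mod_iso_def bij_betw_restrict_eq)
  moreover have "ses_inj s y \<in> carrier (ses_mid s)" if "y \<in> carrier (ses_left s)" for y
    using lin_closed[OF D(4)] that eq by simp
  ultimately show ?thesis unfolding ses_equiv_def using eq f(2,3)
    by (intro conjI bexI[of _ "restrict f (carrier (ses_mid s))"]) auto
qed

text \<open>A set-theoretic section \<sigma> of the projection \<open>b\<close> embeds the middle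
  term by sending u to the pair of u - \<sigma> (b u), read in the left-hand term, and b u; the
  module structure is carried along. Extension classes are formed in the type of such pairs, whereas
  push-outs and Baer sums live in larger types.\<close>

lemma ses_equiv_small:
  fixes s :: "('r, 'y, 'e, 'x) ses"
  assumes s: "short_exact R s"
  shows "\<exists>t :: ('r, 'y, 'y \<times> 'x, 'x) ses. short_exact R t \<and> ses_equiv R s t"
proof -
  define A E X a b where "A = ses_left s" "E = ses_mid s" "X = ses_right s" "a = ses_inj s" "b = ses_proj s"
  note defs = this
  have ex: "exact R A E X a b" using s by (simp add: short_exact_iff defs)
  note D = exactD[OF ex]
  interpret E: abelian_group E using D(2) by (rule left_module_abelian_group)
  interpret X: abelian_group X using D(3) by (rule left_module_abelian_group)
  define \<sigma> where "\<sigma> = inv_into (carrier E) b"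
  have \<sigma>: "\<sigma> x \<in> carrier E" "b (\<sigma> x) = x" if "x \<in> carrier X" for x
    using that D(7) by (auto simp: \<sigma>_def inv_into_into f_inv_into_f)
  define p where "p u = (inv_into (carrier A) a (u \<ominus>\<^bsub>E\<^esub> \<sigma> (b u)), b u)" for u
  have p: "\<exists>y\<in>carrier A. u \<ominus>\<^bsub>E\<^esub> \<sigma> (b u) = a y \<and> fst (p u) = y" if u: "u \<in> carrier E" for u
  proof -
    have bu: "b u \<in> carrier X" using lin_closed[OF D(5) u] .
    have "b (u \<ominus>\<^bsub>E\<^esub> \<sigma> (b u)) = \<zero>\<^bsub>X\<^esub>"
      using lin_minus[OF D(2,3,5) u \<sigma>(1)[OF bu]] \<sigma>(2)[OF bu] bu by (simp add: X.minus_zero_iff)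
    then obtain y where y: "y \<in> carrier A" "u \<ominus>\<^bsub>E\<^esub> \<sigma> (b u) = a y"
      using D(8)[of "u \<ominus>\<^bsub>E\<^esub> \<sigma> (b u)"] u \<sigma>(1)[OF bu] by auto
    then show ?thesis using D(6) by (auto simp: p_def)
  qed
  have pi: "inj_on p (carrier E)"
  proof (rule inj_onI)
    fix u v assume uv: "u \<in> carrier E" "v \<in> carrier E" "p u = p v"
    then have buv: "b u = b v" by (simp add: p_def)
    have c: "\<sigma> (b v) \<in> carrier E" using \<sigma>(1) lin_closed[OF D(5) uv(2)] by blast
    have "u \<ominus>\<^bsub>E\<^esub> \<sigma> (b v) = v \<ominus>\<^bsub>E\<^esub> \<sigma> (b v)" using p[OF uv(1)] p[OF uv(2)] uv(3) buv by auto
    then show "u = v" using E.add_minus_cancel[OF uv(1) c] E.add_minus_cancel[OF uv(2) c] by simp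
  qed
  define T where "T = transport E p"
  have T: "left_module R T" "lin R E T p" unfolding T_def
    using transport_left_module[OF D(2) pi] transport_lin[OF pi] by auto
  have cT: "carrier T = p ` carrier E" by (simp add: T_def)
  have bp: "bij_betw p (carrier E) (carrier T)" using pi cT by (simp add: bij_betw_def)
  let ?q = "inv_into (carrier E) p"
  have q: "lin R T E ?q" using lin_inv_into[OF D(2) T bp] .
  have qp: "?q (p u) = u" if "u \<in> carrier E" for u using that pi by simp
  define t :: "('r, 'y, 'y \<times> 'x, 'x) ses" where "t = \<lparr>ses_left = A, ses_mid = T, ses_right = X,
     ses_inj = (\<lambda>y\<in>carrier A. p (a y)), ses_proj = (\<lambda>u\<in>carrier T. b (?q u))\<rparr>"
  have "exact R A T X (\<lambda>y. p (a y)) (\<lambda>u. b (?q u))"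
    unfolding exact_def
  proof (intro conjI D T ballI)
    show "lin R A T (\<lambda>y. p (a y))" using lin_comp[OF D(4) T(2)] .
    show "lin R T X (\<lambda>u. b (?q u))" using lin_comp[OF q D(5)] .
    show "inj_on (\<lambda>y. p (a y)) (carrier A)"
      using D(6) pi lin_closed[OF D(4)] by (meson inj_onD inj_onI)
    show "(\<lambda>u. b (?q u)) ` carrier T = carrier X" using D(7) qp by (auto simp: cT image_image)
    fix u assume "u \<in> carrier T"
    then obtain v where v: "v \<in> carrier E" "u = p v" by (auto simp: cT)
    have "u \<in> (\<lambda>y. p (a y)) ` carrier A \<longleftrightarrow> v \<in> a ` carrier A"
    proof
      assume "u \<in> (\<lambda>y. p (a y)) ` carrier A"
      then obtain y where y: "y \<in> carrier A" "p v = p (a y)" using v by auto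
      then have "v = a y" using inj_onD[OF pi y(2) v(1)] lin_closed[OF D(4)] by blast
      then show "v \<in> a ` carrier A" using y by blast
    qed (use v in auto)
    then show "(b (?q u) = \<zero>\<^bsub>X\<^esub>) = (u \<in> (\<lambda>y. p (a y)) ` carrier A)" using D(8)[OF v(1)] v qp by simp
  qed
  then have ext: "exact R A T X (\<lambda>y\<in>carrier A. p (a y)) (\<lambda>u\<in>carrier T. b (?q u))"
    unfolding exact_def using lin_cong[OF D(1), of "\<lambda>y\<in>carrier A. p (a y)" "\<lambda>y. p (a y)"]
      lin_cong[OF T(1), of "\<lambda>u\<in>carrier T. b (?q u)" "\<lambda>u. b (?q u)"]
    by (simp add: inj_on_restrict_eq)
  then have t: "short_exact R t" by (simp add: short_exact_iff t_def)
  moreover have "ses_equiv R s t"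
  proof (rule ses_equivI[OF s t, where f = p])
    show "ses_left s = ses_left t" "ses_right s = ses_right t" by (simp_all add: t_def defs)
    show "lin R (ses_mid s) (ses_mid t) p" using T(2) by (simp add: t_def defs)
    show "p (ses_inj s y) = ses_inj t y" if "y \<in> carrier (ses_left s)" for y
      using that by (simp add: t_def defs)
    show "ses_proj t (p x) = ses_proj s x" if "x \<in> carrier (ses_mid s)" for x
      using that qp[of x] cT by (simp add: t_def defs)
  qed
  ultimately show ?thesis by blast
qed

locale resolution =
  fixes R :: "('r, 'z) ring_scheme" and X :: "('r, 'x) module" and P1 :: "('r, 'p) module"
    and P0 :: "('r, 'q) module" and i :: "'p \<Rightarrow> 'q" and e :: "'q \<Rightarrow> 'x"
  assumes res_exact: "exact R P1 P0 X i e" and proj1: "projective R P1" and proj0: "projective R P0"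
begin

lemmas res = exactD[OF res_exact]

lemma R_ring: "ring R"
  using res(1) by (rule left_module_ring)

text \<open>\<open>k\<close> lifts the identity of \<open>X\<close> to a map from the resolution to
  \<open>s\<close>, and \<open>h\<close> is its part on \<open>P1\<close>. Modulo restrictions of
  maps from \<open>P0\<close>, such \<open>h\<close> make up Hom(P1, Y)/Hom(P0, Y) = Ext^1(X,
  Y).\<close>

definition cocycle :: "('r, 'y, 'e, 'x) ses \<Rightarrow> ('p \<Rightarrow> 'y) \<Rightarrow> bool" where
  "cocycle s h \<longleftrightarrow> lin R P1 (ses_left s) h \<and>
     (\<exists>k. lin R P0 (ses_mid s) k \<and> (\<forall>p\<in>carrier P0. ses_proj s (k p) = e p) \<and>
        (\<forall>q\<in>carrier P1. k (i q) = ses_inj s (h q)))"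

lemma cocycle_cong:
  assumes "cocycle s h" "\<And>q. q \<in> carrier P1 \<Longrightarrow> h q = h' q"
  shows "cocycle s h'"
  using assms lin_cong[OF res(1) assms(2)] by (simp add: cocycle_def)

text \<open>Projectivity of \<open>P0\<close> lifts \<open>e\<close> along the projection of
  \<open>s\<close>; on \<open>P1\<close> the lift has image in the kernel.\<close>

lemma cocycle_exists:
  assumes s: "short_exact R s" "ses_right s = X"
  shows "\<exists>h. cocycle s h"
proof -
  have ex: "exact R (ses_left s) (ses_mid s) X (ses_inj s) (ses_proj s)"
    using s by (simp add: short_exact_iff)
  note D = exactD[OF ex]
  obtain k where k: "lin R P0 (ses_mid s) k" "\<And>p. p \<in> carrier P0 \<Longrightarrow> ses_proj s (k p) = e p"
    using projective_lift[OF proj0 D(2,3,5,7) res(5)] by blast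
  obtain h where h: "lin R P1 (ses_left s) h" "\<And>q. q \<in> carrier P1 \<Longrightarrow> ses_inj s (h q) = k (i q)"
    using exact_factor_left[OF ex res(1) lin_comp[OF res(4) k(1)]] k(2) res(9) lin_closed[OF res(4)] by metis
  show ?thesis unfolding cocycle_def by (intro exI[of _ h] conjI exI[of _ k]) (auto simp: h k)
qed

text \<open>The difference of two lifts of \<open>e\<close> lands in the left-hand term and gives
  \<open>r\<close>.\<close>

lemma cocycle_unique:
  assumes s: "short_exact R s" "ses_right s = X" and h: "cocycle s h" "cocycle s h'"
  shows "\<exists>r. lin R P0 (ses_left s) r \<and> (\<forall>q\<in>carrier P1. h q = h' q \<oplus>\<^bsub>ses_left s\<^esub> r (i q))"
proof -
  have ex: "exact R (ses_left s) (ses_mid s) X (ses_inj s) (ses_proj s)"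
    using s by (simp add: short_exact_iff)
  note D = exactD[OF ex]
  interpret A: abelian_group "ses_left s" using D(1) by (rule left_module_abelian_group)
  interpret E: abelian_group "ses_mid s" using D(2) by (rule left_module_abelian_group)
  interpret X: abelian_group X using D(3) by (rule left_module_abelian_group)
  obtain k k' where k: "lin R P0 (ses_mid s) k" "\<And>p. p \<in> carrier P0 \<Longrightarrow> ses_proj s (k p) = e p"
      "\<And>q. q \<in> carrier P1 \<Longrightarrow> k (i q) = ses_inj s (h q)"
    and k': "lin R P0 (ses_mid s) k'" "\<And>p. p \<in> carrier P0 \<Longrightarrow> ses_proj s (k' p) = e p"
      "\<And>q. q \<in> carrier P1 \<Longrightarrow> k' (i q) = ses_inj s (h' q)"
    and hl: "lin R P1 (ses_left s) h" "lin R P1 (ses_left s) h'"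
    using h by (auto simp: cocycle_def)
  have d: "lin R P0 (ses_mid s) (\<lambda>p. k p \<ominus>\<^bsub>ses_mid s\<^esub> k' p)" using lin_minus_map[OF D(2) k(1) k'(1)] .
  have "ses_proj s (k p \<ominus>\<^bsub>ses_mid s\<^esub> k' p) = \<zero>\<^bsub>X\<^esub>" if p: "p \<in> carrier P0" for p
    using lin_minus[OF D(2,3,5) lin_closed[OF k(1) p] lin_closed[OF k'(1) p]] k(2)[OF p] k'(2)[OF p]
      lin_closed[OF res(5) p] by (simp add: X.minus_zero_iff)
  then obtain r where r: "lin R P0 (ses_left s) r"
    "\<And>p. p \<in> carrier P0 \<Longrightarrow> ses_inj s (r p) = k p \<ominus>\<^bsub>ses_mid s\<^esub> k' p"
    using exact_factor_left[OF ex res(2) d] by blast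
  have "h q = h' q \<oplus>\<^bsub>ses_left s\<^esub> r (i q)" if q: "q \<in> carrier P1" for q
  proof -
    have iq: "i q \<in> carrier P0" using lin_closed[OF res(4) q] .
    note c = lin_closed[OF hl(1) q] lin_closed[OF hl(2) q] lin_closed[OF r(1) iq]
    have "ses_inj s (h' q \<oplus>\<^bsub>ses_left s\<^esub> r (i q)) = k' (i q) \<oplus>\<^bsub>ses_mid s\<^esub> (k (i q) \<ominus>\<^bsub>ses_mid s\<^esub> k' (i q))"
      using c r(2)[OF iq] k'(3)[OF q] by (simp add: lin_add[OF D(4)])
    also have "\<dots> = k (i q)" using E.add_minus_cancel lin_closed[OF k(1) iq] lin_closed[OF k'(1) iq] by blast
    also have "\<dots> = ses_inj s (h q)" using k(3)[OF q] .
    finally show ?thesis using c D(6) by (metis A.a_closed inj_onD)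
  qed
  then show ?thesis using r(1) by blast
qed

text \<open>Adding \<open>r\<close>, composed with the inclusion, to a lift of \<open>e\<close>
  gives another lift; this is the converse of \<open>cocycle_unique\<close>.\<close>

lemma cocycle_shift:
  assumes s: "short_exact R s" "ses_right s = X" and h: "cocycle s h" and r: "lin R P0 (ses_left s) r"
  shows "cocycle s (\<lambda>q. h q \<oplus>\<^bsub>ses_left s\<^esub> r (i q))"
proof -
  have ex: "exact R (ses_left s) (ses_mid s) X (ses_inj s) (ses_proj s)"
    using s by (simp add: short_exact_iff)
  note D = exactD[OF ex]
  interpret X: abelian_group X using D(3) by (rule left_module_abelian_group)
  obtain k where k: "lin R P0 (ses_mid s) k" "\<And>p. p \<in> carrier P0 \<Longrightarrow> ses_proj s (k p) = e p"
      "\<And>q. q \<in> carrier P1 \<Longrightarrow> k (i q) = ses_inj s (h q)" and hl: "lin R P1 (ses_left s) h"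
    using h by (auto simp: cocycle_def)
  have "lin R P1 (ses_left s) (\<lambda>q. h q \<oplus>\<^bsub>ses_left s\<^esub> r (i q))"
    using lin_add_map[OF D(1) hl lin_comp[OF res(4) r]] .
  moreover have "lin R P0 (ses_mid s) (\<lambda>p. k p \<oplus>\<^bsub>ses_mid s\<^esub> ses_inj s (r p))"
    using lin_add_map[OF D(2) k(1) lin_comp[OF r D(4)]] .
  moreover have "ses_proj s (k p \<oplus>\<^bsub>ses_mid s\<^esub> ses_inj s (r p)) = e p" if p: "p \<in> carrier P0" for p
    using lin_add[OF D(5) lin_closed[OF k(1) p] lin_closed[OF D(4) lin_closed[OF r p]]] k(2)[OF p]
      D(9)[OF lin_closed[OF r p]] lin_closed[OF res(5) p] by simp
  moreover have "k (i q) \<oplus>\<^bsub>ses_mid s\<^esub> ses_inj s (r (i q)) = ses_inj s (h q \<oplus>\<^bsub>ses_left s\<^esub> r (i q))"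
    if q: "q \<in> carrier P1" for q
    using k(3)[OF q] lin_add[OF D(4) lin_closed[OF hl q] lin_closed[OF r lin_closed[OF res(4) q]]] by simp
  ultimately show ?thesis unfolding cocycle_def
    by (intro conjI exI[of _ "\<lambda>p. k p \<oplus>\<^bsub>ses_mid s\<^esub> ses_inj s (r p)"]) auto
qed

lemma cocycle_equiv:
  assumes "ses_equiv R s t" "short_exact R s" "ses_right s = X" "cocycle s h"
  shows "cocycle t h"
proof -
  obtain f where f: "lin R (ses_mid s) (ses_mid t) f" "\<And>y. y \<in> carrier (ses_left s) \<Longrightarrow> f (ses_inj s y) = ses_inj t y"
    "\<And>x. x \<in> carrier (ses_mid s) \<Longrightarrow> ses_proj t (f x) = ses_proj s x" "ses_left s = ses_left t"
    using assms(1) by (auto simp: ses_equiv_def mod_iso_def mod_hom_iff)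
  obtain k where k: "lin R P0 (ses_mid s) k" "\<And>p. p \<in> carrier P0 \<Longrightarrow> ses_proj s (k p) = e p"
      "\<And>q. q \<in> carrier P1 \<Longrightarrow> k (i q) = ses_inj s (h q)" and hl: "lin R P1 (ses_left s) h"
    using assms(4) by (auto simp: cocycle_def)
  show ?thesis unfolding cocycle_def
    using hl f(4) lin_comp[OF k(1) f(1)] f(3)[OF lin_closed[OF k(1)]] k(2,3) f(2)[OF lin_closed[OF hl]]
    by (intro conjI exI[of _ "\<lambda>p. f (k p)"]) auto
qed

text \<open>A cocycle presents \<open>s\<close> as the push-out of the resolution along
  \<open>h\<close>, so a map out of its middle term amounts to maps \<alpha> and \<open>n\<close>
  that agree on \<open>P1\<close>. The data \<pi> and \<iota> determine in addition the map induced
  on quotients.\<close>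

lemma cocycle_univ:
  assumes s: "short_exact R s" "ses_right s = X" and h: "cocycle s h"
    and M: "left_module R M" and al: "lin R (ses_left s) M \<alpha>" and n: "lin R P0 M n"
    and c: "\<And>q. q \<in> carrier P1 \<Longrightarrow> n (i q) = \<alpha> (h q)"
    and N: "left_module R N" and pr: "lin R M N \<pi>" and io: "lin R X N \<iota>"
    and pal: "\<And>y. y \<in> carrier (ses_left s) \<Longrightarrow> \<pi> (\<alpha> y) = \<zero>\<^bsub>N\<^esub>"
    and pn: "\<And>p. p \<in> carrier P0 \<Longrightarrow> \<pi> (n p) = \<iota> (e p)"
  obtains \<mu> where "lin R (ses_mid s) M \<mu>" "\<And>y. y \<in> carrier (ses_left s) \<Longrightarrow> \<mu> (ses_inj s y) = \<alpha> y"
    "\<And>x. x \<in> carrier (ses_mid s) \<Longrightarrow> \<pi> (\<mu> x) = \<iota> (ses_proj s x)"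
proof -
  have ex: "exact R (ses_left s) (ses_mid s) X (ses_inj s) (ses_proj s)"
    using s by (simp add: short_exact_iff)
  note D = exactD[OF ex]
  interpret N: abelian_group N using N by (rule left_module_abelian_group)
  obtain k where k: "lin R P0 (ses_mid s) k" "\<And>p. p \<in> carrier P0 \<Longrightarrow> ses_proj s (k p) = e p"
      "\<And>q. q \<in> carrier P1 \<Longrightarrow> k (i q) = ses_inj s (h q)" and hl: "lin R P1 (ses_left s) h"
    using h by (auto simp: cocycle_def)
  obtain \<mu> where mu: "lin R (ses_mid s) M \<mu>" "\<And>t. t \<in> carrier (ses_left s) \<Longrightarrow> \<mu> (ses_inj s t) = \<alpha> t"
    "\<And>x. x \<in> carrier P0 \<Longrightarrow> \<mu> (k x) = n x"
    using pushout_univ[OF res_exact ex hl k M al n c] by blast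
  have "\<pi> (\<mu> x) = \<iota> (ses_proj s x)" if x: "x \<in> carrier (ses_mid s)" for x
  proof -
    obtain t p where t: "t \<in> carrier (ses_left s)" "p \<in> carrier P0" "x = ses_inj s t \<oplus>\<^bsub>ses_mid s\<^esub> k p"
      using pushout_generate[OF res_exact ex k(1,2) x] by blast
    note cl = lin_closed[OF D(4) t(1)] lin_closed[OF k(1) t(2)]
    have "\<pi> (\<mu> x) = \<pi> (\<alpha> t) \<oplus>\<^bsub>N\<^esub> \<pi> (n p)"
      using lin_add[OF lin_comp[OF mu(1) pr] cl] t mu(2,3) by simp
    moreover have "\<iota> (ses_proj s x) = \<iota> (ses_proj s (ses_inj s t)) \<oplus>\<^bsub>N\<^esub> \<iota> (ses_proj s (k p))"
      using lin_add[OF lin_comp[OF D(5) io] cl] t by simp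
    moreover have "\<iota> (ses_proj s (ses_inj s t)) = \<zero>\<^bsub>N\<^esub>" using D(9)[OF t(1)] lin_zero[OF D(3) N io] by simp
    ultimately show ?thesis using pal[OF t(1)] pn[OF t(2)] k(2)[OF t(2)] by simp
  qed
  with mu that show thesis by blast
qed

text \<open>Both extensions are push-outs of the resolution along the same \<open>h\<close>. The
  comparison map comes from \<open>cocycle_univ\<close> with the middle term of \<open>t\<close> as
  target and the identity of \<open>X\<close> on quotients.\<close>

lemma equiv_of_cocycle:
  assumes s: "short_exact R s" "ses_right s = X" and t: "short_exact R t" "ses_right t = X"
    and eq: "ses_left s = ses_left t" and h: "cocycle s h" "cocycle t h"
  shows "ses_equiv R s t"
proof -
  have ext: "exact R (ses_left t) (ses_mid t) X (ses_inj t) (ses_proj t)"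
    using t by (simp add: short_exact_iff)
  note D = exactD[OF ext]
  obtain k where k: "lin R P0 (ses_mid t) k" "\<And>p. p \<in> carrier P0 \<Longrightarrow> ses_proj t (k p) = e p"
      "\<And>q. q \<in> carrier P1 \<Longrightarrow> k (i q) = ses_inj t (h q)"
    using h(2) by (auto simp: cocycle_def)
  obtain \<mu> where "lin R (ses_mid s) (ses_mid t) \<mu>" "\<And>y. y \<in> carrier (ses_left s) \<Longrightarrow> \<mu> (ses_inj s y) = ses_inj t y"
    "\<And>x. x \<in> carrier (ses_mid s) \<Longrightarrow> ses_proj t (\<mu> x) = ses_proj s x"
    using cocycle_univ[OF s h(1) D(2) _ k(1) k(3) D(3) D(5) lin_id _ k(2)] D(4,9) eq by metis
  then show ?thesis using ses_equivI[OF s(1) t(1) eq] s(2) t(2) by metis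
qed

lemma cocycle_pushout:
  assumes s: "short_exact R s" and Z: "left_module R Z" and g: "lin R (ses_left s) Z g" and h: "cocycle s h"
  shows "cocycle (ses_pushout Z g s) (\<lambda>q. g (h q))"
proof -
  obtain m where m: "lin R (ses_mid s) (ses_mid (ses_pushout Z g s)) m"
    "\<And>y. y \<in> carrier (ses_left s) \<Longrightarrow> m (ses_inj s y) = ses_inj (ses_pushout Z g s) (g y)"
    "\<And>x. x \<in> carrier (ses_mid s) \<Longrightarrow> ses_proj (ses_pushout Z g s) (m x) = ses_proj s x"
    using pushout_exact(2)[OF s Z g] by blast
  obtain k where k: "lin R P0 (ses_mid s) k" "\<And>p. p \<in> carrier P0 \<Longrightarrow> ses_proj s (k p) = e p"
      "\<And>q. q \<in> carrier P1 \<Longrightarrow> k (i q) = ses_inj s (h q)" and hl: "lin R P1 (ses_left s) h"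
    using h by (auto simp: cocycle_def)
  show ?thesis unfolding cocycle_def
    using lin_comp[OF hl g] lin_comp[OF k(1) m(1)] m(3)[OF lin_closed[OF k(1)]] k(2,3) m(2)[OF lin_closed[OF hl]]
    by (intro conjI exI[of _ "\<lambda>p. m (k p)"]) auto
qed

text \<open>A chain map over \<open>f\<close>, determined only up to homotopy; \<open>f\<close> acts
  on extension classes through composition of cocycles with \<open>f1\<close>, whichever lift is
  taken.\<close>

definition lifts_to :: "('x \<Rightarrow> 'x) \<Rightarrow> ('q \<Rightarrow> 'q) \<Rightarrow> ('p \<Rightarrow> 'p) \<Rightarrow> bool" where
  "lifts_to f f0 f1 \<longleftrightarrow> lin R P0 P0 f0 \<and> lin R P1 P1 f1 \<and>
     (\<forall>p\<in>carrier P0. e (f0 p) = f (e p)) \<and> (\<forall>q\<in>carrier P1. f0 (i q) = i (f1 q))"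

lemma lift_exists:
  assumes f: "lin R X X f"
  shows "\<exists>f0 f1. lifts_to f f0 f1"
proof -
  obtain f0 where f0: "lin R P0 P0 f0" "\<And>p. p \<in> carrier P0 \<Longrightarrow> e (f0 p) = f (e p)"
    using projective_lift[OF proj0 res(2,3,5,7) lin_comp[OF res(5) f]] by blast
  have "e (f0 (i q)) = \<zero>\<^bsub>X\<^esub>" if "q \<in> carrier P1" for q
    using f0(2)[OF lin_closed[OF res(4) that]] res(9)[OF that] lin_zero[OF res(3,3) f] by simp
  then obtain f1 where f1: "lin R P1 P1 f1" "\<And>q. q \<in> carrier P1 \<Longrightarrow> i (f1 q) = f0 (i q)"
    using exact_factor_left[OF res_exact res(1) lin_comp[OF res(4) f0(1)]] by blast
  show ?thesis unfolding lifts_to_def by (intro exI[of _ f0] exI[of _ f1]) (auto simp: f0 f1)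
qed

text \<open>The lift into the fibre product sends p to the pair (k (f0 p), e p).\<close>

lemma cocycle_pullback:
  assumes s: "short_exact R s" "ses_right s = X" and f: "lin R X X f" "lifts_to f f0 f1" and h: "cocycle s h"
  shows "cocycle (ses_pullback X f s) (\<lambda>q. h (f1 q))"
proof -
  obtain k where k: "lin R P0 (ses_mid s) k" "\<And>p. p \<in> carrier P0 \<Longrightarrow> ses_proj s (k p) = e p"
      "\<And>q. q \<in> carrier P1 \<Longrightarrow> k (i q) = ses_inj s (h q)" and hl: "lin R P1 (ses_left s) h"
    using h by (auto simp: cocycle_def)
  have F: "lin R P0 P0 f0" "lin R P1 P1 f1" "\<And>p. p \<in> carrier P0 \<Longrightarrow> e (f0 p) = f (e p)"
    "\<And>q. q \<in> carrier P1 \<Longrightarrow> f0 (i q) = i (f1 q)" using f(2) by (auto simp: lifts_to_def)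
  note kf = lin_comp[OF F(1) k(1)]
  have P: "k (f0 p) \<in> carrier (ses_mid s)" "e p \<in> carrier X" "ses_proj s (k (f0 p)) = f (e p)"
    if "p \<in> carrier P0" for p
    using that lin_closed[OF kf] lin_closed[OF res(5)] k(2)[OF lin_closed[OF F(1)]] F(3) by auto
  have "lin R P0 (ses_mid (ses_pullback X f s)) (\<lambda>p. (k (f0 p), e p))"
    using P by (auto simp: ses_pullback_def Let_def lin_add[OF kf] lin_smult[OF kf] lin_add[OF res(5)]
        lin_smult[OF res(5)] intro!: linI)
  moreover have "ses_proj (ses_pullback X f s) (k (f0 p), e p) = e p" if "p \<in> carrier P0" for p
    using that P by (simp add: ses_pullback_def Let_def)
  moreover have "(k (f0 (i q)), e (i q)) = ses_inj (ses_pullback X f s) (h (f1 q))" if "q \<in> carrier P1" for q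
    using that F(4) k(3)[OF lin_closed[OF F(2)]] res(9) lin_closed[OF hl] lin_closed[OF F(2)]
    by (simp add: ses_pullback_def Let_def)
  ultimately show ?thesis unfolding cocycle_def
    using lin_comp[OF F(2) hl] by (intro conjI exI[of _ "\<lambda>p. (k (f0 p), e p)"]) auto
qed

text \<open>The pair of lifts \<open>k\<close>, \<open>k'\<close>, indexed by \<open>bool\<close>,
  is a lift into the pull-back along the diagonal, and its cocycle is the pair of \<open>h\<close>
  and \<open>h'\<close>. The push-out along summation then adds the two entries.\<close>

lemma baer_sum_cocycle:
  assumes s: "short_exact R s" "ses_left s = Y" "ses_right s = X"
    and t: "short_exact R t" "ses_left t = Y" "ses_right t = X"
    and h: "cocycle s h" "cocycle t h'"
  shows "short_exact R (baer_sum s t)" "cocycle (baer_sum s t) (\<lambda>q. h q \<oplus>\<^bsub>Y\<^esub> h' q)"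
proof -
  define u where "u = (\<lambda>b. if b then s else t)"
  define su where "su = ses_sum UNIV u"
  define dg where "dg = (\<lambda>x\<in>carrier X. \<lambda>_::bool. x)"
  have Y: "left_module R Y" using s by (auto simp: short_exact_def)
  interpret Y: abelian_group Y using Y by (rule left_module_abelian_group)
  have ul: "(\<lambda>b. ses_left (u b)) = (\<lambda>_. Y)" "(\<lambda>b. ses_right (u b)) = (\<lambda>_. X)"
    using s t by (auto simp: u_def)
  have lr: "ses_left su = direct_sum UNIV (\<lambda>_. Y)" "ses_right su = direct_sum UNIV (\<lambda>_. X)"
    by (simp_all add: su_def ul)
  have su: "short_exact R su" unfolding su_def using s t by (intro ses_sum_exact R_ring) (auto simp: u_def)
  have dg: "lin R X (ses_right su) dg"
    unfolding lr using abelian_groupE(1)[OF left_module_abelian_group[OF res(3)]] left_module.smult_closed[OF res(3)]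
    by (auto intro!: linI simp: dg_def direct_sum_carrier)
  define pb where "pb = ses_pullback X dg su"
  have pb: "short_exact R pb" unfolding pb_def using pullback_exact[OF su res(3) dg] .
  have pbl: "ses_left pb = direct_sum UNIV (\<lambda>_. Y)" by (simp add: pb_def lr)
  have sm: "lin R (ses_left pb) Y (summation_map UNIV Y)" unfolding pbl using summation_map_lin[OF Y] .
  have bs: "baer_sum s t = ses_pushout Y (summation_map UNIV Y) pb"
    by (simp add: baer_sum_def pb_def su_def dg_def u_def s)
  show "short_exact R (baer_sum s t)" unfolding bs using pushout_exact(1)[OF pb Y sm] .
  obtain k k' where k: "lin R P0 (ses_mid s) k" "\<And>p. p \<in> carrier P0 \<Longrightarrow> ses_proj s (k p) = e p"
      "\<And>q. q \<in> carrier P1 \<Longrightarrow> k (i q) = ses_inj s (h q)"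
    and k': "lin R P0 (ses_mid t) k'" "\<And>p. p \<in> carrier P0 \<Longrightarrow> ses_proj t (k' p) = e p"
      "\<And>q. q \<in> carrier P1 \<Longrightarrow> k' (i q) = ses_inj t (h' q)"
    and hl: "lin R P1 Y h" "lin R P1 Y h'"
    using h s t by (auto simp: cocycle_def)
  define H where "H q = (\<lambda>b. if b then h q else h' q)" for q
  define K where "K p = (\<lambda>b. if b then k p else k' p)" for p
  have Hl: "lin R P1 (direct_sum UNIV (\<lambda>_. Y)) H"
    using hl by (auto intro!: linI simp: H_def direct_sum_carrier lin_closed lin_add lin_smult)
  have Kl: "lin R P0 (direct_sum UNIV (\<lambda>b. ses_mid (u b))) K"
    using k(1) k'(1) by (auto intro!: linI simp: K_def u_def direct_sum_carrier lin_closed lin_add lin_smult)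
  have Kp: "ses_proj su (K p) = dg (e p)" if p: "p \<in> carrier P0" for p
    using lin_closed[OF Kl p] k(2)[OF p] k'(2)[OF p] lin_closed[OF res(5) p]
    by (auto simp: su_def ses_sum_def Let_def dg_def K_def u_def)
  have Ki: "K (i q) = ses_inj su (H q)" if q: "q \<in> carrier P1" for q
  proof -
    have "ses_inj su (H q) = (\<lambda>b. ses_inj (u b) (H q b))"
      using lin_closed[OF Hl q] by (simp add: su_def ses_sum_def Let_def ul restrict_UNIV)
    then show ?thesis using k(3)[OF q] k'(3)[OF q] by (auto simp: K_def H_def u_def)
  qed
  have "cocycle pb H"
  proof -
    have "lin R P0 (ses_mid pb) (\<lambda>p. (K p, e p))"
      using Kl res(5) Kp
      by (auto simp: pb_def ses_pullback_def Let_def su_def lin_closed lin_add lin_smult intro!: linI)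
    moreover have "ses_proj pb (K p, e p) = e p" if "p \<in> carrier P0" for p
      using lin_closed[OF Kl that] lin_closed[OF res(5) that] Kp[OF that]
      by (simp add: pb_def ses_pullback_def Let_def su_def)
    moreover have "(K (i q), e (i q)) = ses_inj pb (H q)" if "q \<in> carrier P1" for q
      using Ki[OF that] res(9)[OF that] lin_closed[OF Hl that]
      by (simp add: pb_def ses_pullback_def Let_def lr)
    ultimately show ?thesis unfolding cocycle_def pbl
      using Hl by (intro conjI exI[of _ "\<lambda>p. (K p, e p)"]) auto
  qed
  then have "cocycle (baer_sum s t) (\<lambda>q. summation_map UNIV Y (H q))"
    unfolding bs using cocycle_pushout[OF pb Y sm] by blast
  then show "cocycle (baer_sum s t) (\<lambda>q. h q \<oplus>\<^bsub>Y\<^esub> h' q)"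
  proof (rule cocycle_cong)
    fix q assume q: "q \<in> carrier P1"
    note c = lin_closed[OF hl(1) q] lin_closed[OF hl(2) q]
    \<comment> \<open>The sum over the support is extended to both indices.\<close>
    have "summation_map UNIV Y (H q) = finsum Y (H q) UNIV"
      using ds_map_eq[of UNIV R "\<lambda>_. Y" Y "\<lambda>_ x. x" "H q" UNIV] lin_closed[OF Hl q] Y lin_id
      by (auto simp: summation_map_ds_map)
    also have "\<dots> = h q \<oplus>\<^bsub>Y\<^esub> h' q"
      using c by (simp add: UNIV_bool H_def Y.a_comm)
    finally show "summation_map UNIV Y (H q) = h q \<oplus>\<^bsub>Y\<^esub> h' q" .
  qed
qed

lemma split_ses_cocycle:
  assumes Y: "left_module R Y"
  shows "cocycle (split_ses X Y) (\<lambda>_. \<zero>\<^bsub>Y\<^esub>)"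
proof -
  interpret Y: abelian_group Y using Y by (rule left_module_abelian_group)
  have "lin R P0 (mod_prod Y X) (\<lambda>p. (\<zero>\<^bsub>Y\<^esub>, e p))"
    using res(5) left_module_smult_zero[OF Y] by (auto intro!: linI simp: lin_closed lin_add lin_smult)
  then show ?thesis unfolding cocycle_def split_ses_def
    using lin_zero_map[OF Y] lin_closed[OF res(5)] res(9)
    by (intro conjI exI[of _ "\<lambda>p. (\<zero>\<^bsub>Y\<^esub>, e p)"]) auto
qed

definition cls :: "('r, 'y) module \<Rightarrow> ('p \<Rightarrow> 'y) \<Rightarrow> ('r, 'y, 'y \<times> 'x, 'x) ses set" where
  "cls Y h = {t. short_exact R t \<and> ses_left t = Y \<and> ses_right t = X \<and> cocycle t h}"

text \<open>An extension is equivalent to \<open>s\<close> precisely when it has the cocycle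
  \<open>h\<close> of \<open>s\<close>, by \<open>cocycle_equiv\<close> in one direction and
  \<open>equiv_of_cocycle\<close> in the other. The middle term of \<open>s\<close> may have any
  type, so the class of a push-out or Baer sum can be read off from its cocycle.\<close>

lemma ext_class_cls:
  fixes s :: "('r, 'y, 'e, 'x) ses"
  assumes "short_exact R s" "ses_left s = Y" "ses_right s = X" "cocycle s h"
  shows "ext_class R s = cls Y h"
proof -
  have "short_exact R t \<and> ses_equiv R s t \<longleftrightarrow> short_exact R t \<and> ses_left t = Y \<and> ses_right t = X \<and> cocycle t h"
    for t :: "('r, 'y, 'y \<times> 'x, 'x) ses"
    using assms cocycle_equiv[of s t h] equiv_of_cocycle[of s t h] by (auto simp: ses_equiv_def)
  then show ?thesis by (simp add: ext_class_def cls_def)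
qed

text \<open>The resolution, viewed as an extension of \<open>X\<close> by \<open>P1\<close>, has the
  identity as a cocycle. Its push-out along \<open>h\<close> has cocycle \<open>h\<close> and is
  then replaced by an equivalent sequence of the right type.\<close>

lemma cls_nonempty:
  fixes Y :: "('r, 'y) module"
  assumes Y: "left_module R Y" and h: "lin R P1 Y h"
  shows "\<exists>t. t \<in> cls Y h"
proof -
  define s0 where "s0 = \<lparr>ses_left = P1, ses_mid = P0, ses_right = X,
    ses_inj = restrict i (carrier P1), ses_proj = restrict e (carrier P0)\<rparr>"
  have s0: "short_exact R s0"
    unfolding short_exact_iff s0_def
    using res_exact lin_cong[OF res(1), of "restrict i (carrier P1)" i P0]
      lin_cong[OF res(2), of "restrict e (carrier P0)" e X]
    by (simp add: exact_def inj_on_restrict_eq)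
  have c0: "cocycle s0 (\<lambda>q. q)"
    unfolding cocycle_def s0_def using lin_id[of R P1] lin_id[of R P0] lin_closed[OF res(4)]
    by (auto intro!: exI[of _ "\<lambda>p. p"])
  have h': "lin R (ses_left s0) Y h" using h by (simp add: s0_def)
  have po: "short_exact R (ses_pushout Y h s0)" using pushout_exact(1)[OF s0 Y h'] .
  have c: "cocycle (ses_pushout Y h s0) h" using cocycle_pushout[OF s0 Y h' c0] by simp
  obtain t :: "('r, 'y, 'y \<times> 'x, 'x) ses" where t: "short_exact R t" "ses_equiv R (ses_pushout Y h s0) t"
    using ses_equiv_small[OF po] by blast
  have "cocycle t h" using cocycle_equiv[OF t(2) po _ c] by (simp add: s0_def)
  moreover have "ses_left t = Y" "ses_right t = X" using t(2) by (simp_all add: ses_equiv_def s0_def)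
  ultimately show ?thesis using t(1) unfolding cls_def by blast
qed

text \<open>A sequence in both classes has both cocycles, which \<open>cocycle_unique\<close>
  compares; conversely \<open>cocycle_shift\<close> puts a representative of one class into the
  other.\<close>

lemma cls_eq_iff:
  assumes Y: "left_module R Y" and h: "lin R P1 Y h" "lin R P1 Y h'"
  shows "cls Y h = cls Y h' \<longleftrightarrow> (\<exists>r. lin R P0 Y r \<and> (\<forall>q\<in>carrier P1. h q = h' q \<oplus>\<^bsub>Y\<^esub> r (i q)))"
proof
  assume eq: "cls Y h = cls Y h'"
  obtain t where "t \<in> cls Y h" using cls_nonempty[OF Y h(1)] by blast
  with eq have "t \<in> cls Y h" "t \<in> cls Y h'" by auto
  then show "\<exists>r. lin R P0 Y r \<and> (\<forall>q\<in>carrier P1. h q = h' q \<oplus>\<^bsub>Y\<^esub> r (i q))"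
    using cocycle_unique[of t h h'] by (auto simp: cls_def)
next
  assume "\<exists>r. lin R P0 Y r \<and> (\<forall>q\<in>carrier P1. h q = h' q \<oplus>\<^bsub>Y\<^esub> r (i q))"
  then obtain r where r: "lin R P0 Y r" "\<And>q. q \<in> carrier P1 \<Longrightarrow> h q = h' q \<oplus>\<^bsub>Y\<^esub> r (i q)" by blast
  obtain t where t: "t \<in> cls Y h'" using cls_nonempty[OF Y h(2)] by blast
  then have "cocycle t h"
    using cocycle_shift[of t h' r] r cocycle_cong[of t "\<lambda>q. h' q \<oplus>\<^bsub>Y\<^esub> r (i q)" h] by (auto simp: cls_def)
  then show "cls Y h = cls Y h'"
    using ext_class_cls[of t Y h] ext_class_cls[of t Y h'] t by (auto simp: cls_def)
qed

lemma cls_cong: "(\<And>q. q \<in> carrier P1 \<Longrightarrow> h q = h' q) \<Longrightarrow> cls Y h = cls Y h'"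
  using cocycle_cong[of _ h h'] cocycle_cong[of _ h' h] by (fastforce simp: cls_def)

lemma Ext1_carrier:
  fixes Y :: "('r, 'y) module"
  assumes Y: "left_module R Y"
  shows "carrier (Ext1 R X Y) = cls Y ` {h. lin R P1 Y h}"
proof
  show "carrier (Ext1 R X Y) \<subseteq> cls Y ` {h. lin R P1 Y h}"
  proof
    fix c assume "c \<in> carrier (Ext1 R X Y)"
    then obtain s :: "('r, 'y, 'y \<times> 'x, 'x) ses"
      where s: "short_exact R s" "ses_left s = Y" "ses_right s = X" "c = ext_class R s"
      by (auto simp: Ext1_def)
    obtain h where h: "cocycle s h" using cocycle_exists[OF s(1,3)] by blast
    then have "lin R P1 Y h" using s by (simp add: cocycle_def)
    then show "c \<in> cls Y ` {h. lin R P1 Y h}" using ext_class_cls[OF s(1-3) h] s(4) by blast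
  qed
  show "cls Y ` {h. lin R P1 Y h} \<subseteq> carrier (Ext1 R X Y)"
  proof
    fix c assume "c \<in> cls Y ` {h. lin R P1 Y h}"
    then obtain h where h: "lin R P1 Y h" "c = cls Y h" by blast
    obtain t where "t \<in> cls Y h" using cls_nonempty[OF Y h(1)] by blast
    then have t: "short_exact R t" "ses_left t = Y" "ses_right t = X" "cocycle t h" by (auto simp: cls_def)
    then show "c \<in> carrier (Ext1 R X Y)" using ext_class_cls[OF t] h(2) by (auto simp: Ext1_def)
  qed
qed

lemma Ext1_zero: "left_module R Y \<Longrightarrow> \<zero>\<^bsub>Ext1 R X Y\<^esub> = cls Y (\<lambda>_. \<zero>\<^bsub>Y\<^esub>)"
  using ext_class_cls[OF split_ses_exact[OF res(3), of Y] _ _ split_ses_cocycle[of Y], of Y]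
  by (simp add: Ext1_def) (simp add: split_ses_def)

text \<open>All choices of representatives give the same class, so the union in the definition of
  \<open>Ext1\<close> collapses to it; \<open>cls_nonempty\<close> ensures that there are
  representatives. The same argument serves \<open>Ext1_smult\<close>.\<close>

lemma Ext1_add:
  assumes Y: "left_module R Y" and h: "lin R P1 Y h" "lin R P1 Y h'"
  shows "cls Y h \<oplus>\<^bsub>Ext1 R X Y\<^esub> cls Y h' = cls Y (\<lambda>q. h q \<oplus>\<^bsub>Y\<^esub> h' q)"
proof -
  have "ext_class R (baer_sum s t) = cls Y (\<lambda>q. h q \<oplus>\<^bsub>Y\<^esub> h' q)" if "s \<in> cls Y h" "t \<in> cls Y h'" for s t
  proof -
    have "short_exact R s" "ses_left s = Y" "ses_right s = X" "cocycle s h"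
      "short_exact R t" "ses_left t = Y" "ses_right t = X" "cocycle t h'"
      using that by (auto simp: cls_def)
    then show ?thesis
      by (intro ext_class_cls baer_sum_cocycle) (auto simp: baer_sum_def)
  qed
  then show ?thesis using cls_nonempty[OF Y h(1)] cls_nonempty[OF Y h(2)] by (auto simp: Ext1_def)
qed

lemma Ext1_smult:
  assumes Y: "left_module R Y" and h: "lin R P1 Y h" and f: "lin R X X f" "lifts_to f f0 f1"
  shows "f \<odot>\<^bsub>Ext1 R X Y\<^esub> cls Y h = cls Y (\<lambda>q. h (f1 q))"
proof -
  have "ext_class R (ses_pullback X f s) = cls Y (\<lambda>q. h (f1 q))" if "s \<in> cls Y h" for s
  proof -
    have "short_exact R s" "ses_left s = Y" "ses_right s = X" "cocycle s h"
      using that by (auto simp: cls_def)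
    then show ?thesis
      using f by (intro ext_class_cls cocycle_pullback pullback_exact res(3)) auto
  qed
  then show ?thesis using cls_nonempty[OF Y h] by (auto simp: Ext1_def)
qed

text \<open>Each law is the pointwise law for cocycles. It makes the rules for finite sums available
  in \<open>Ext1\<close>.\<close>

lemma Ext1_abelian_monoid:
  assumes Y: "left_module R Y"
  shows "abelian_monoid (Ext1 R X Y)"
proof -
  interpret Y: abelian_group Y using Y by (rule left_module_abelian_group)
  note c = Ext1_carrier[OF Y] and z = Ext1_zero[OF Y] and a = Ext1_add[OF Y]
  show ?thesis
  proof (rule abelian_monoidI)
    fix x y assume "x \<in> carrier (Ext1 R X Y)" "y \<in> carrier (Ext1 R X Y)"
    then obtain h k where h: "lin R P1 Y h" "x = cls Y h" and k: "lin R P1 Y k" "y = cls Y k" by (auto simp: c)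
    show "x \<oplus>\<^bsub>Ext1 R X Y\<^esub> y \<in> carrier (Ext1 R X Y)"
      using a[OF h(1) k(1)] h k lin_add_map[OF Y h(1) k(1)] by (auto simp: c)
    show "x \<oplus>\<^bsub>Ext1 R X Y\<^esub> y = y \<oplus>\<^bsub>Ext1 R X Y\<^esub> x"
      using a[OF h(1) k(1)] a[OF k(1) h(1)] h k lin_closed[OF h(1)] lin_closed[OF k(1)]
        cls_cong[of "\<lambda>q. h q \<oplus>\<^bsub>Y\<^esub> k q" "\<lambda>q. k q \<oplus>\<^bsub>Y\<^esub> h q"] by (simp add: Y.a_comm)
    fix w assume "w \<in> carrier (Ext1 R X Y)"
    then obtain l where l: "lin R P1 Y l" "w = cls Y l" by (auto simp: c)
    show "x \<oplus>\<^bsub>Ext1 R X Y\<^esub> y \<oplus>\<^bsub>Ext1 R X Y\<^esub> w = x \<oplus>\<^bsub>Ext1 R X Y\<^esub> (y \<oplus>\<^bsub>Ext1 R X Y\<^esub> w)"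
      using a[OF h(1) k(1)] a[OF k(1) l(1)] a[OF lin_add_map[OF Y h(1) k(1)] l(1)]
        a[OF h(1) lin_add_map[OF Y k(1) l(1)]] h k l lin_closed[OF h(1)] lin_closed[OF k(1)] lin_closed[OF l(1)]
        cls_cong[of "\<lambda>q. h q \<oplus>\<^bsub>Y\<^esub> k q \<oplus>\<^bsub>Y\<^esub> l q" "\<lambda>q. h q \<oplus>\<^bsub>Y\<^esub> (k q \<oplus>\<^bsub>Y\<^esub> l q)"]
      by (simp add: Y.a_assoc)
  next
    show "\<zero>\<^bsub>Ext1 R X Y\<^esub> \<in> carrier (Ext1 R X Y)" using z lin_zero_map[OF Y] by (auto simp: c)
    fix x assume "x \<in> carrier (Ext1 R X Y)"
    then obtain h where h: "lin R P1 Y h" "x = cls Y h" by (auto simp: c)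
    then show "\<zero>\<^bsub>Ext1 R X Y\<^esub> \<oplus>\<^bsub>Ext1 R X Y\<^esub> x = x"
      using a[OF lin_zero_map[OF Y] h(1)] z lin_closed[OF h(1)] cls_cong[of "\<lambda>q. \<zero>\<^bsub>Y\<^esub> \<oplus>\<^bsub>Y\<^esub> h q" h] by simp
  qed
qed

lemma Ext1_finsum:
  assumes Y: "left_module R Y" and h: "\<And>j. j \<in> A \<Longrightarrow> lin R P1 Y (h j)" and A: "finite A"
  shows "finsum (Ext1 R X Y) (\<lambda>j. cls Y (h j)) A = cls Y (\<lambda>q. finsum Y (\<lambda>j. h j q) A)"
proof -
  interpret Y: abelian_group Y using Y by (rule left_module_abelian_group)
  interpret E: abelian_monoid "Ext1 R X Y" using Ext1_abelian_monoid[OF Y] .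
  show ?thesis using A h
  proof (induct A rule: finite_induct)
    case empty
    then show ?case using Ext1_zero[OF Y] by simp
  next
    case (insert j A)
    have hl: "lin R P1 Y (\<lambda>q. finsum Y (\<lambda>j. h j q) A)" using insert by (intro lin_finsum_map[OF Y]) auto
    have c: "cls Y (h k) \<in> carrier (Ext1 R X Y)" if "k \<in> insert j A" for k
      using insert(4)[OF that] by (auto simp: Ext1_carrier[OF Y])
    have "finsum (Ext1 R X Y) (\<lambda>j. cls Y (h j)) (insert j A) =
        cls Y (h j) \<oplus>\<^bsub>Ext1 R X Y\<^esub> cls Y (\<lambda>q. finsum Y (\<lambda>j. h j q) A)"
      using insert c by (subst E.finsum_insert) auto
    also have "\<dots> = cls Y (\<lambda>q. h j q \<oplus>\<^bsub>Y\<^esub> finsum Y (\<lambda>j. h j q) A)"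
      using Ext1_add[OF Y _ hl] insert by simp
    also have "\<dots> = cls Y (\<lambda>q. finsum Y (\<lambda>j. h j q) (insert j A))"
    proof (rule cls_cong)
      fix q assume "q \<in> carrier P1"
      then show "h j q \<oplus>\<^bsub>Y\<^esub> finsum Y (\<lambda>j. h j q) A = finsum Y (\<lambda>j. h j q) (insert j A)"
        using insert lin_closed[OF insert(4)] by (subst Y.finsum_insert) auto
    qed
    finally show ?case .
  qed
qed

end

section \<open>Universal inclusions\<close>

text \<open>For a brick every nonzero endomorphism is a unit of End(X). The last claim keeps the
  half of this that splits off summands: a retraction \<open>g\<close> of \<open>f\<close>.\<close>

lemma brickD:
  assumes "brick R X"
  shows "left_module R X" "finitely_presented R X" "\<exists>x\<in>carrier X. x \<noteq> \<zero>\<^bsub>X\<^esub>"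
    "\<And>f x. lin R X X f \<Longrightarrow> x \<in> carrier X \<Longrightarrow> f x \<noteq> \<zero>\<^bsub>X\<^esub> \<Longrightarrow>
      \<exists>g. lin R X X g \<and> (\<forall>y\<in>carrier X. g (f y) = y)"
proof -
  show fp: "finitely_presented R X" and X: "left_module R X"
    using assms by (simp_all add: brick_def finitely_presented_def)
  have dr: "\<one>\<^bsub>End_ring R X\<^esub> \<noteq> \<zero>\<^bsub>End_ring R X\<^esub>" "Units (End_ring R X) = carrier (End_ring R X) - {\<zero>\<^bsub>End_ring R X\<^esub>}"
    using assms by (simp_all add: brick_def division_ring_def)
  show "\<exists>x\<in>carrier X. x \<noteq> \<zero>\<^bsub>X\<^esub>"
  proof (rule ccontr)
    assume "\<not> ?thesis"
    then have "(\<lambda>x\<in>carrier X. x) = (\<lambda>x\<in>carrier X. \<zero>\<^bsub>X\<^esub>)" by (intro restrict_ext) auto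
    then show False using dr(1) by (simp add: End_ring_def)
  qed
  fix f x assume f: "lin R X X f" and x: "x \<in> carrier X" "f x \<noteq> \<zero>\<^bsub>X\<^esub>"
  let ?f = "restrict f (carrier X)"
  have "?f \<in> carrier (End_ring R X)" using lin_restrict[OF X f] by (simp add: End_ring_def)
  moreover have "?f \<noteq> \<zero>\<^bsub>End_ring R X\<^esub>"
  proof
    assume "?f = \<zero>\<^bsub>End_ring R X\<^esub>"
    then have "?f x = (\<lambda>x\<in>carrier X. \<zero>\<^bsub>X\<^esub>) x" by (simp add: End_ring_def)
    then show False using x by simp
  qed
  ultimately have "?f \<in> Units (End_ring R X)" using dr(2) by blast
  then obtain g where g: "g \<in> mod_hom R X X" "compose (carrier X) g ?f = (\<lambda>x\<in>carrier X. x)"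
    by (auto simp: Units_def End_ring_def)
  have "g (f y) = y" if "y \<in> carrier X" for y
    using fun_cong[OF g(2), of y] that by (simp add: compose_def)
  then show "\<exists>g. lin R X X g \<and> (\<forall>y\<in>carrier X. g (f y) = y)" using mod_hom_lin[OF g(1)] by blast
qed

lemma semibrick_brick: "semibrick R \<X> \<Longrightarrow> X \<in> \<X> \<Longrightarrow> brick R X"
  by (simp add: semibrick_def)

lemma semibrick_left_module: "semibrick R \<X> \<Longrightarrow> X \<in> \<X> \<Longrightarrow> left_module R X"
  using brickD(1)[OF semibrick_brick] .

lemma semibrick_hom_zero:
  assumes sb: "semibrick R \<X>" and X: "X \<in> \<X>" "X' \<in> \<X>" "X \<noteq> X'" and f: "lin R X X' f" and x: "x \<in> carrier X"
  shows "f x = \<zero>\<^bsub>X'\<^esub>"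
proof -
  have "restrict f (carrier X) \<in> mod_hom R X X'" using lin_restrict[OF semibrick_left_module[OF sb X(1)] f] .
  moreover have "mod_hom R X X' = {\<lambda>x\<in>carrier X. \<zero>\<^bsub>X'\<^esub>}" using sb X by (simp add: semibrick_def)
  ultimately have "restrict f (carrier X) x = (\<lambda>x\<in>carrier X. \<zero>\<^bsub>X'\<^esub>) x" by simp
  then show ?thesis using x by simp
qed

lemma direct_sum_lin_eq:
  assumes R: "ring R" and M: "\<And>i. i \<in> I \<Longrightarrow> left_module R (M i)" and N: "left_module R N"
    and f: "lin R (direct_sum I M) N f" and g: "lin R (direct_sum I M) N g"
    and eq: "\<And>i x. i \<in> I \<Longrightarrow> x \<in> carrier (M i) \<Longrightarrow> f (ds_in I M i x) = g (ds_in I M i x)"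
    and v: "v \<in> carrier (direct_sum I M)"
  shows "f v = g v"
proof -
  interpret N: abelian_group N using N by (rule left_module_abelian_group)
  have "f v \<ominus>\<^bsub>N\<^esub> g v \<in> {\<zero>\<^bsub>N\<^esub>}"
  proof (rule lin_direct_sum_in_submodule[OF R M N lin_minus_map[OF N f g] submodule_zero[OF N] _ v])
    fix i x assume ix: "i \<in> I" "x \<in> carrier (M i)"
    then have "ds_in I M i x \<in> carrier (direct_sum I M)" using lin_closed[OF ds_in_lin[of I R M i]] M by blast
    then show "f (ds_in I M i x) \<ominus>\<^bsub>N\<^esub> g (ds_in I M i x) \<in> {\<zero>\<^bsub>N\<^esub>}"
      using eq[OF ix] lin_closed[OF g] by (simp add: N.minus_zero_iff)
  qed
  then show ?thesis using lin_closed[OF f v] lin_closed[OF g v] by (simp add: N.minus_zero_iff)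
qed

lemma direct_sum_cong:
  assumes "\<And>i. i \<in> I \<Longrightarrow> M i = N i"
  shows "direct_sum I M = direct_sum I N"
proof -
  have "PiE I (\<lambda>i. carrier (M i)) = PiE I (\<lambda>i. carrier (N i))" using assms by (intro PiE_cong) simp
  moreover have "{i \<in> I. v i \<noteq> \<zero>\<^bsub>M i\<^esub>} = {i \<in> I. v i \<noteq> \<zero>\<^bsub>N i\<^esub>}" for v using assms by auto
  ultimately show ?thesis unfolding direct_sum_def using assms
    by (auto intro!: restrict_ext ext)
qed

lemma direct_sum_map_in:
  assumes "\<And>i. i \<in> I \<Longrightarrow> \<phi> i \<zero>\<^bsub>M i\<^esub> = \<zero>\<^bsub>N i\<^esub>"
  shows "(\<lambda>i\<in>I. \<phi> i (ds_in I M j x i)) = ds_in I N j (\<phi> j x)"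
  using assms by (auto simp: ds_in_def intro!: restrict_ext)

lemma exact_iso_mid:
  assumes ex: "exact R A M Q a b" and N: "left_module R N" and f: "lin R N M f" "bij_betw f (carrier N) (carrier M)"
    and a': "lin R A N a'" "\<And>x. x \<in> carrier A \<Longrightarrow> f (a' x) = a x"
  shows "exact R A N Q a' (\<lambda>n. b (f n))"
proof -
  note D = exactD[OF ex]
  have ker: "b (f n) = \<zero>\<^bsub>Q\<^esub> \<longleftrightarrow> n \<in> a' ` carrier A" if n: "n \<in> carrier N" for n
  proof -
    have "f n \<in> a ` carrier A \<longleftrightarrow> n \<in> a' ` carrier A"
    proof
      assume "f n \<in> a ` carrier A"
      then obtain x where x: "x \<in> carrier A" "f n = f (a' x)" using a'(2) by auto
      then have "n = a' x" using f(2) n lin_closed[OF a'(1) x(1)] by (meson bij_betw_def inj_onD)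
      then show "n \<in> a' ` carrier A" using x by blast
    qed (use a'(2) in auto)
    then show ?thesis using D(8)[OF lin_closed[OF f(1) n]] by simp
  qed
  have "inj_on a' (carrier A)"
    using D(6) a'(2) by (auto simp: inj_on_def) (metis)
  moreover have "(\<lambda>n. b (f n)) ` carrier N = carrier Q"
    using D(7) f(2) by (auto simp: bij_betw_def image_image[symmetric])
  ultimately show ?thesis unfolding exact_def
    using D(1,3) N a'(1) lin_comp[OF f(1) D(5)] ker by blast
qed

section \<open>Bases of Ext in terms of cocycles\<close>

context resolution
begin

text \<open>Independence over End(X) of the classes of the cocycles \<open>h j\<close>: the
  coefficient \<open>a j\<close> acts by composition with \<open>l1 j\<close>, and a class is zero
  when its cocycle extends to a map \<open>r\<close> on \<open>P0\<close>.\<close>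

definition indep :: "('r, 'y) module \<Rightarrow> 'j set \<Rightarrow> ('j \<Rightarrow> 'p \<Rightarrow> 'y) \<Rightarrow> bool" where
  "indep Y J h \<longleftrightarrow> (\<forall>A a l0 l1 r. finite A \<longrightarrow> A \<subseteq> J \<longrightarrow>
     (\<forall>j\<in>A. lin R X X (a j) \<and> lifts_to (a j) (l0 j) (l1 j)) \<longrightarrow> lin R P0 Y r \<longrightarrow>
     (\<forall>q\<in>carrier P1. finsum Y (\<lambda>j. h j (l1 j q)) A = r (i q)) \<longrightarrow>
     (\<forall>j\<in>A. \<forall>x\<in>carrier X. a j x = \<zero>\<^bsub>X\<^esub>))"

text \<open>The companion of \<open>indep\<close>: generation of Ext^1(X, Y) over End(X), with
  equality of classes expressed as in \<open>cls_eq_iff\<close>.\<close>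

definition spans :: "('r, 'y) module \<Rightarrow> 'j set \<Rightarrow> ('j \<Rightarrow> 'p \<Rightarrow> 'y) \<Rightarrow> bool" where
  "spans Y J h \<longleftrightarrow> (\<forall>h'. lin R P1 Y h' \<longrightarrow> (\<exists>A a l0 l1 r. finite A \<and> A \<subseteq> J \<and>
     (\<forall>j\<in>A. lin R X X (a j) \<and> lifts_to (a j) (l0 j) (l1 j)) \<and> lin R P0 Y r \<and>
     (\<forall>q\<in>carrier P1. finsum Y (\<lambda>j. h j (l1 j q)) A = h' q \<oplus>\<^bsub>Y\<^esub> r (i q))))"

lemma lifts_toD:
  assumes "lifts_to f f0 f1"
  shows "lin R P0 P0 f0" "lin R P1 P1 f1" "\<And>p. p \<in> carrier P0 \<Longrightarrow> e (f0 p) = f (e p)"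
    "\<And>q. q \<in> carrier P1 \<Longrightarrow> f0 (i q) = i (f1 q)"
  using assms by (auto simp: lifts_to_def)

lemma lifts_to_restrict: "lifts_to f f0 f1 \<Longrightarrow> lifts_to (restrict f (carrier X)) f0 f1"
  using lin_closed[OF res(5)] by (simp add: lifts_to_def)

lemma Ext1_lincomb:
  assumes Y: "left_module R Y" and A: "finite A" and h: "\<And>j. j \<in> A \<Longrightarrow> lin R P1 Y (h j)"
    and a: "\<And>j. j \<in> A \<Longrightarrow> lin R X X (a j)" "\<And>j. j \<in> A \<Longrightarrow> lifts_to (a j) (l0 j) (l1 j)"
  shows "finsum (Ext1 R X Y) (\<lambda>j. a j \<odot>\<^bsub>Ext1 R X Y\<^esub> cls Y (h j)) A = cls Y (\<lambda>q. finsum Y (\<lambda>j. h j (l1 j q)) A)"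
proof -
  interpret E: abelian_monoid "Ext1 R X Y" using Ext1_abelian_monoid[OF Y] .
  have l: "lin R P1 Y (\<lambda>q. h j (l1 j q))" if "j \<in> A" for j
    using lin_comp[OF lifts_toD(2)[OF a(2)[OF that]] h[OF that]] .
  have "finsum (Ext1 R X Y) (\<lambda>j. a j \<odot>\<^bsub>Ext1 R X Y\<^esub> cls Y (h j)) A
      = finsum (Ext1 R X Y) (\<lambda>j. cls Y (\<lambda>q. h j (l1 j q))) A"
    using Ext1_smult[OF Y h a] l by (intro E.finsum_cong') (auto simp: Ext1_carrier[OF Y])
  also have "\<dots> = cls Y (\<lambda>q. finsum Y (\<lambda>j. h j (l1 j q)) A)" using Ext1_finsum[OF Y l A] .
  finally show ?thesis .
qed

text \<open>A basis is a set of classes, with coefficients indexed by the classes themselves,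
  whereas cocycles come as a family over \<open>J\<close>. Injectivity of the passage from indices
  to classes makes the two indexings interchangeable; the rest is \<open>Ext1_lincomb\<close>
  together with \<open>cls_eq_iff\<close>.\<close>

lemma basis_iff:
  assumes Y: "left_module R Y" and h: "\<And>j. j \<in> J \<Longrightarrow> lin R P1 Y (h j)"
    and inj: "inj_on (\<lambda>j. cls Y (h j)) J"
  shows "basis (End_ring R X) (Ext1 R X Y) ((\<lambda>j. cls Y (h j)) ` J) \<longleftrightarrow> indep Y J h \<and> spans Y J h"
    (is "basis ?D ?E (?\<beta> ` J) \<longleftrightarrow> _")
proof -
  interpret E: abelian_monoid ?E using Ext1_abelian_monoid[OF Y] .
  interpret Y: abelian_group Y using Y by (rule left_module_abelian_group)
  have cE: "?\<beta> j \<in> carrier ?E" if "j \<in> J" for j using h[OF that] by (auto simp: Ext1_carrier[OF Y])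
  have sE: "a \<odot>\<^bsub>?E\<^esub> ?\<beta> j \<in> carrier ?E" if aj: "lin R X X a" "j \<in> J" for a j
  proof -
    obtain a0 a1 where l: "lifts_to a a0 a1" using lift_exists[OF aj(1)] by blast
    show ?thesis using Ext1_smult[OF Y h[OF aj(2)] aj(1) l] lin_comp[OF lifts_toD(2)[OF l] h[OF aj(2)]]
      by (auto simp: Ext1_carrier[OF Y])
  qed
  have zero: "cls Y g = \<zero>\<^bsub>?E\<^esub> \<longleftrightarrow> (\<exists>r. lin R P0 Y r \<and> (\<forall>q\<in>carrier P1. g q = r (i q)))" if "lin R P1 Y g" for g
  proof -
    have "\<zero>\<^bsub>Y\<^esub> \<oplus>\<^bsub>Y\<^esub> r (i q) = r (i q)" if "lin R P0 Y r" "q \<in> carrier P1" for r q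
      using lin_closed[OF that(1) lin_closed[OF res(4) that(2)]] by simp
    then show ?thesis unfolding Ext1_zero[OF Y] cls_eq_iff[OF Y that lin_zero_map[OF Y]] by auto
  qed
  have reidx: "finsum ?E (\<lambda>b. c b \<odot>\<^bsub>?E\<^esub> b) (?\<beta> ` A) = cls Y (\<lambda>q. finsum Y (\<lambda>j. h j (l1 j q)) A)"
    if A: "finite A" "A \<subseteq> J" and c: "\<And>j. j \<in> A \<Longrightarrow> lin R X X (c (?\<beta> j))" "\<And>j. j \<in> A \<Longrightarrow> lifts_to (c (?\<beta> j)) (l0 j) (l1 j)"
    for A c l0 l1
  proof -
    have "finsum ?E (\<lambda>b. c b \<odot>\<^bsub>?E\<^esub> b) (?\<beta> ` A) = finsum ?E (\<lambda>j. c (?\<beta> j) \<odot>\<^bsub>?E\<^esub> ?\<beta> j) A"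
      using A c sE by (intro E.finsum_reindex inj_on_subset[OF inj]) auto
    also have "\<dots> = cls Y (\<lambda>q. finsum Y (\<lambda>j. h j (l1 j q)) A)"
      using A h c by (intro Ext1_lincomb[OF Y]) auto
    finally show ?thesis .
  qed
  have hl: "lin R P1 Y (\<lambda>q. finsum Y (\<lambda>j. h j (l1 j q)) A)"
    if "A \<subseteq> J" "\<And>j. j \<in> A \<Longrightarrow> lifts_to (a j) (l0 j) (l1 j)" for A a l0 l1
    using that h lifts_toD(2)[OF that(2)] by (intro lin_finsum_map[OF Y] lin_comp[where f = "l1 _" and g = "h _"]) auto
  have ind: "(\<forall>A c. finite A \<longrightarrow> A \<subseteq> ?\<beta> ` J \<longrightarrow> c \<in> A \<rightarrow> carrier ?D \<longrightarrow>
        finsum ?E (\<lambda>b. c b \<odot>\<^bsub>?E\<^esub> b) A = \<zero>\<^bsub>?E\<^esub> \<longrightarrow> (\<forall>b\<in>A. c b = \<zero>\<^bsub>?D\<^esub>)) \<longleftrightarrow> indep Y J h" (is "?L \<longleftrightarrow> _")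
  proof
    assume L: ?L
    show "indep Y J h" unfolding indep_def
    proof (intro allI impI ballI)
      fix A a l0 l1 r j x
      assume A: "finite A" "A \<subseteq> J" and a: "\<forall>j\<in>A. lin R X X (a j) \<and> lifts_to (a j) (l0 j) (l1 j)"
        and r: "lin R P0 Y r" "\<forall>q\<in>carrier P1. finsum Y (\<lambda>j. h j (l1 j q)) A = r (i q)"
        and j: "j \<in> A" and x: "x \<in> carrier X"
      \<comment> \<open>The coefficient function moved from indices to classes; restriction makes
        its values extensional, as elements of \<open>End_ring\<close> must be.\<close>
      define c where "c b = restrict (a (inv_into J ?\<beta> b)) (carrier X)" for b
      have cb: "c (?\<beta> j) = restrict (a j) (carrier X)" if "j \<in> A" for j
        using inv_into_f_f[OF inj subsetD[OF A(2) that]] by (simp add: c_def)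
      have c1: "c (?\<beta> j) \<in> mod_hom R X X" if "j \<in> A" for j
        unfolding cb[OF that] using a that by (intro lin_restrict[OF res(3)]) auto
      have c2: "lifts_to (c (?\<beta> j)) (l0 j) (l1 j)" if "j \<in> A" for j
        unfolding cb[OF that] using a that by (intro lifts_to_restrict) auto
      have "finsum ?E (\<lambda>b. c b \<odot>\<^bsub>?E\<^esub> b) (?\<beta> ` A) = \<zero>\<^bsub>?E\<^esub>"
        using reidx[of A c l0 l1, OF A mod_hom_lin[OF c1] c2] zero[OF hl[of A "\<lambda>j. c (?\<beta> j)" l0 l1, OF A(2) c2]] r by auto
      moreover have "c \<in> ?\<beta> ` A \<rightarrow> carrier ?D" using c1 by (auto simp: End_ring_def)
      ultimately have "c (?\<beta> j) = \<zero>\<^bsub>?D\<^esub>"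
        using L[rule_format, of "?\<beta> ` A" c "?\<beta> j"] A j by blast
      then have "restrict (a j) (carrier X) x = (\<lambda>x\<in>carrier X. \<zero>\<^bsub>X\<^esub>) x" using cb[OF j] by (simp add: End_ring_def)
      then show "a j x = \<zero>\<^bsub>X\<^esub>" using x by simp
    qed
  next
    assume I: "indep Y J h"
    show ?L
    proof (intro allI impI ballI)
      fix A c b
      assume A: "finite A" "A \<subseteq> ?\<beta> ` J" and c: "c \<in> A \<rightarrow> carrier ?D"
        and z: "finsum ?E (\<lambda>b. c b \<odot>\<^bsub>?E\<^esub> b) A = \<zero>\<^bsub>?E\<^esub>" and b: "b \<in> A"
      obtain A' where A': "A' \<subseteq> J" "A = ?\<beta> ` A'" "finite A'"
        using finite_subset_image[OF A] by blast
      have cm: "c (?\<beta> j) \<in> mod_hom R X X" if "j \<in> A'" for j using c A' that by (auto simp: End_ring_def)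
      \<comment> \<open>The coefficients are arbitrary endomorphisms here, so lifts to the
        resolution are chosen for each of them.\<close>
      have "\<exists>l0 l1. \<forall>j\<in>A'. lifts_to (c (?\<beta> j)) (l0 j) (l1 j)"
        using lift_exists[OF mod_hom_lin[OF cm]] by metis
      then obtain l0 l1 where l: "\<And>j. j \<in> A' \<Longrightarrow> lifts_to (c (?\<beta> j)) (l0 j) (l1 j)" by blast
      have "cls Y (\<lambda>q. finsum Y (\<lambda>j. h j (l1 j q)) A') = \<zero>\<^bsub>?E\<^esub>"
        using reidx[of A' c l0 l1, OF A'(3,1) mod_hom_lin[OF cm] l] z A'(2) by simp
      then obtain r where r: "lin R P0 Y r" "\<forall>q\<in>carrier P1. finsum Y (\<lambda>j. h j (l1 j q)) A' = r (i q)"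
        using zero[OF hl[of A' "\<lambda>j. c (?\<beta> j)" l0 l1, OF A'(1) l]] by blast
      have *: "\<forall>j\<in>A'. \<forall>x\<in>carrier X. c (?\<beta> j) x = \<zero>\<^bsub>X\<^esub>"
        using I[unfolded indep_def, rule_format, of A' "\<lambda>j. c (?\<beta> j)" l0 l1 r] A'(1,3) l r mod_hom_lin[OF cm] by blast
      obtain j where j: "j \<in> A'" "b = ?\<beta> j" using b A' by blast
      have "c b \<in> extensional (carrier X)" using cm[OF j(1)] j(2) by (simp add: mod_hom_iff)
      then show "c b = \<zero>\<^bsub>?D\<^esub>" using * j
        by (auto simp: End_ring_def intro!: extensionalityI[of _ "carrier X"])
    qed
  qed
  have spn: "(\<forall>v\<in>carrier ?E. \<exists>A c. finite A \<and> A \<subseteq> ?\<beta> ` J \<and> c \<in> A \<rightarrow> carrier ?D \<and>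
        v = finsum ?E (\<lambda>b. c b \<odot>\<^bsub>?E\<^esub> b) A) \<longleftrightarrow> spans Y J h" (is "?L \<longleftrightarrow> _")
  proof
    assume L: ?L
    show "spans Y J h" unfolding spans_def
    proof (intro allI impI)
      fix h' assume h': "lin R P1 Y h'"
      then have hE: "cls Y h' \<in> carrier ?E" by (auto simp: Ext1_carrier[OF Y])
      obtain A c where A: "finite A" "A \<subseteq> ?\<beta> ` J" and c: "c \<in> A \<rightarrow> carrier ?D"
        and v: "cls Y h' = finsum ?E (\<lambda>b. c b \<odot>\<^bsub>?E\<^esub> b) A"
        using bspec[OF L hE] by (elim exE conjE) (rule that; assumption)
      obtain A' where A': "A' \<subseteq> J" "A = ?\<beta> ` A'" "finite A'"
        using finite_subset_image[OF A] by blast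
      have cm: "c (?\<beta> j) \<in> mod_hom R X X" if "j \<in> A'" for j using c A' that by (auto simp: End_ring_def)
      have "\<exists>l0 l1. \<forall>j\<in>A'. lifts_to (c (?\<beta> j)) (l0 j) (l1 j)"
        using lift_exists[OF mod_hom_lin[OF cm]] by metis
      then obtain l0 l1 where l: "\<And>j. j \<in> A' \<Longrightarrow> lifts_to (c (?\<beta> j)) (l0 j) (l1 j)" by blast
      have "cls Y (\<lambda>q. finsum Y (\<lambda>j. h j (l1 j q)) A') = cls Y h'"
        using reidx[of A' c l0 l1, OF A'(3,1) mod_hom_lin[OF cm] l] v A'(2) by simp
      then obtain r where "lin R P0 Y r" "\<forall>q\<in>carrier P1. finsum Y (\<lambda>j. h j (l1 j q)) A' = h' q \<oplus>\<^bsub>Y\<^esub> r (i q)"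
        using cls_eq_iff[OF Y hl[of A' "\<lambda>j. c (?\<beta> j)" l0 l1, OF A'(1) l] h'] by blast
      then show "\<exists>A a l0 l1 r. finite A \<and> A \<subseteq> J \<and> (\<forall>j\<in>A. lin R X X (a j) \<and> lifts_to (a j) (l0 j) (l1 j)) \<and>
          lin R P0 Y r \<and> (\<forall>q\<in>carrier P1. finsum Y (\<lambda>j. h j (l1 j q)) A = h' q \<oplus>\<^bsub>Y\<^esub> r (i q))"
        using A' l mod_hom_lin[OF cm]
        by (intro exI[of _ A'] exI[of _ "\<lambda>j. c (?\<beta> j)"] exI[of _ l0] exI[of _ l1] exI[of _ r]) blast
    qed
  next
    assume S: "spans Y J h"
    show ?L
    proof
      fix v assume "v \<in> carrier ?E"
      then obtain h' where h': "lin R P1 Y h'" "v = cls Y h'" by (auto simp: Ext1_carrier[OF Y])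
      obtain A a l0 l1 r where A: "finite A" "A \<subseteq> J" and a: "\<forall>j\<in>A. lin R X X (a j) \<and> lifts_to (a j) (l0 j) (l1 j)"
        and r: "lin R P0 Y r" "\<forall>q\<in>carrier P1. finsum Y (\<lambda>j. h j (l1 j q)) A = h' q \<oplus>\<^bsub>Y\<^esub> r (i q)"
        using S[unfolded spans_def, rule_format, OF h'(1)] by (elim exE conjE) (rule that; assumption)
      define c where "c b = restrict (a (inv_into J ?\<beta> b)) (carrier X)" for b
      have cb: "c (?\<beta> j) = restrict (a j) (carrier X)" if "j \<in> A" for j
        using inv_into_f_f[OF inj subsetD[OF A(2) that]] by (simp add: c_def)
      have c1: "c (?\<beta> j) \<in> mod_hom R X X" if "j \<in> A" for j
        unfolding cb[OF that] using a that by (intro lin_restrict[OF res(3)]) auto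
      have c2: "lifts_to (c (?\<beta> j)) (l0 j) (l1 j)" if "j \<in> A" for j
        unfolding cb[OF that] using a that by (intro lifts_to_restrict) auto
      have "v = finsum ?E (\<lambda>b. c b \<odot>\<^bsub>?E\<^esub> b) (?\<beta> ` A)"
        using reidx[of A c l0 l1, OF A mod_hom_lin[OF c1] c2] cls_eq_iff[OF Y hl[of A "\<lambda>j. c (?\<beta> j)" l0 l1, OF A(2) c2] h'(1)] r h'(2) by auto
      then show "\<exists>A c. finite A \<and> A \<subseteq> ?\<beta> ` J \<and> c \<in> A \<rightarrow> carrier ?D \<and> v = finsum ?E (\<lambda>b. c b \<odot>\<^bsub>?E\<^esub> b) A"
        using A c1 by (intro exI[of _ "?\<beta> ` A"] exI[of _ c]) (auto simp: End_ring_def)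
    qed
  qed
  show ?thesis unfolding basis_def using ind spn cE by blast
qed

end

text \<open>
  The class of the cocycle \<open>h\<^sub>j\<close> is the image of the \<open>j\<close>-th coordinate inclusion \<open>X \<rightarrow> M/Y\<close> under the
  connecting map \<open>Hom(X, M/Y) \<rightarrow> Ext\<^sup>1(X, Y)\<close>. Since \<open>X\<close> is finitely generated, independence of these classes
  is injectivity of the connecting map, and spanning is its surjectivity.
\<close>

locale ext_data = resolution R X P1 P0 i e
  for R :: "('r, 'z) ring_scheme" and X :: "('r, 'x) module" and P1 :: "('r, 'p) module"
    and P0 :: "('r, 'q) module" and i e +
  fixes \<X> :: "('r, 'x) module set" and Y :: "('r, 'y) module" and M :: "('r, 'm) module"
    and J :: "'j set" and F \<alpha> \<pi> n h
  assumes sb: "semibrick R \<X>" and X: "X \<in> \<X>" and F: "\<And>j. j \<in> J \<Longrightarrow> F j \<in> \<X>"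
    and ex: "exact R Y M (direct_sum J F) \<alpha> \<pi>"
    and n: "\<And>j. j \<in> J \<Longrightarrow> F j = X \<Longrightarrow> lin R P0 M (n j)"
    and pn: "\<And>j p. j \<in> J \<Longrightarrow> F j = X \<Longrightarrow> p \<in> carrier P0 \<Longrightarrow> \<pi> (n j p) = ds_in J F j (e p)"
    and h: "\<And>j. j \<in> J \<Longrightarrow> F j = X \<Longrightarrow> lin R P1 Y (h j)"
    and ni: "\<And>j q. j \<in> J \<Longrightarrow> F j = X \<Longrightarrow> q \<in> carrier P1 \<Longrightarrow> n j (i q) = \<alpha> (h j q)"
begin

lemmas D = exactD[OF ex]

abbreviation "JX \<equiv> {j \<in> J. F j = X}"

lemma F_left_module: "j \<in> J \<Longrightarrow> left_module R (F j)"
  using semibrick_left_module[OF sb F] .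

sublocale Y: abelian_group Y using D(1) by (rule left_module_abelian_group)
sublocale M: abelian_group M using D(2) by (rule left_module_abelian_group)
sublocale Q: abelian_group "direct_sum J F" using D(3) by (rule left_module_abelian_group)
sublocale X: abelian_group X using res(3) by (rule left_module_abelian_group)

text \<open>An explicit form of the connecting map. The \<open>a j\<close> are the coordinates of a
  map from X to M/Y; the combination of the \<open>n j\<close> is a lift of it to \<open>P0\<close>,
  and the restriction of that lift to \<open>P1\<close> is the combination of the cocycles
  \<open>h j\<close>, which represents its image in Ext^1(X, Y).\<close>

lemma comb:
  assumes A: "finite A" "A \<subseteq> JX" and al: "\<forall>j\<in>A. lin R X X (a j) \<and> lifts_to (a j) (l0 j) (l1 j)"
  shows "lin R P0 M (\<lambda>p. finsum M (\<lambda>j. n j (l0 j p)) A)"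
    and "lin R P1 Y (\<lambda>q. finsum Y (\<lambda>j. h j (l1 j q)) A)"
    and "\<And>q. q \<in> carrier P1 \<Longrightarrow>
      finsum M (\<lambda>j. n j (l0 j (i q))) A = \<alpha> (finsum Y (\<lambda>j. h j (l1 j q)) A)"
    and "\<And>p k. p \<in> carrier P0 \<Longrightarrow> k \<in> J \<Longrightarrow>
      \<pi> (finsum M (\<lambda>j. n j (l0 j p)) A) k = (if k \<in> A then a k (e p) else \<zero>\<^bsub>F k\<^esub>)"
proof -
  have AJ: "j \<in> J" "F j = X" if "j \<in> A" for j using that A(2) by auto
  have a: "lin R X X (a j)" "lifts_to (a j) (l0 j) (l1 j)" if "j \<in> A" for j using al that by blast+
  have nl: "lin R P0 M (\<lambda>p. n j (l0 j p))" if "j \<in> A" for j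
    using lin_comp[OF lifts_toD(1)[OF a(2)[OF that]] n[OF AJ[OF that]]] .
  have hl: "lin R P1 Y (\<lambda>q. h j (l1 j q))" if "j \<in> A" for j
    using lin_comp[OF lifts_toD(2)[OF a(2)[OF that]] h[OF AJ[OF that]]] .
  show "lin R P0 M (\<lambda>p. finsum M (\<lambda>j. n j (l0 j p)) A)" using lin_finsum_map[OF D(2) nl] .
  show "lin R P1 Y (\<lambda>q. finsum Y (\<lambda>j. h j (l1 j q)) A)" using lin_finsum_map[OF D(1) hl] .
  show "finsum M (\<lambda>j. n j (l0 j (i q))) A = \<alpha> (finsum Y (\<lambda>j. h j (l1 j q)) A)" if q: "q \<in> carrier P1" for q
  proof -
    have "finsum M (\<lambda>j. n j (l0 j (i q))) A = finsum M (\<lambda>j. \<alpha> (h j (l1 j q))) A"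
    proof (rule M.finsum_cong')
      fix j assume j: "j \<in> A"
      show "n j (l0 j (i q)) = \<alpha> (h j (l1 j q))"
        using lifts_toD(4)[OF a(2)[OF j] q] ni[OF AJ[OF j] lin_closed[OF lifts_toD(2)[OF a(2)[OF j]] q]] by simp
    qed (use lin_closed[OF D(4) lin_closed[OF hl q]] in auto)
    also have "\<dots> = \<alpha> (finsum Y (\<lambda>j. h j (l1 j q)) A)"
      using lin_closed[OF hl q] by (intro lin_finsum[OF D(1,2,4), symmetric]) auto
    finally show ?thesis .
  qed
  show "\<pi> (finsum M (\<lambda>j. n j (l0 j p)) A) k = (if k \<in> A then a k (e p) else \<zero>\<^bsub>F k\<^esub>)"
    if p: "p \<in> carrier P0" and k: "k \<in> J" for p k
  proof -
    interpret Fk: abelian_group "F k" using F_left_module[OF k] by (rule left_module_abelian_group)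
    have "\<pi> (finsum M (\<lambda>j. n j (l0 j p)) A) k = finsum (F k) (\<lambda>j. \<pi> (n j (l0 j p)) k) A"
      using lin_finsum[OF D(2) F_left_module[OF k] lin_comp[OF D(5) direct_sum_coord_lin[OF k]], of A]
        lin_closed[OF nl p] by simp
    \<comment> \<open>The j-th term is concentrated in the j-th coordinate, so at coordinate k only
      the term j = k can be nonzero.\<close>
    also have "\<dots> = finsum (F k) (\<lambda>j. if k = j then (if k \<in> A then a k (e p) else \<zero>\<^bsub>F k\<^esub>) else \<zero>\<^bsub>F k\<^esub>) A"
    proof (rule Fk.finsum_cong')
      fix j assume j: "j \<in> A"
      show "\<pi> (n j (l0 j p)) k = (if k = j then (if k \<in> A then a k (e p) else \<zero>\<^bsub>F k\<^esub>) else \<zero>\<^bsub>F k\<^esub>)"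
        using pn[OF AJ[OF j] lin_closed[OF lifts_toD(1)[OF a(2)[OF j]] p]] lifts_toD(3)[OF a(2)[OF j] p] j k
        by (simp add: ds_in_def)
    qed (use AJ lin_closed[OF a(1) lin_closed[OF res(5) p]] in auto)
    also have "\<dots> = (if k \<in> A then a k (e p) else \<zero>\<^bsub>F k\<^esub>)"
    proof (cases "k \<in> A")
      case True
      then have c: "a k (e p) \<in> carrier (F k)" using AJ lin_closed[OF a(1) lin_closed[OF res(5) p]] by simp
      show ?thesis using True A(1) c Fk.finsum_singleton[of k A "\<lambda>_. a k (e p)"] by simp
    next
      case False
      then show ?thesis by (simp add: Fk.add.finprod_one_eqI)
    qed
    finally show ?thesis .
  qed
qed

text \<open>If a combination of cocycles extends to \<open>r\<close> on \<open>P0\<close>, then the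
  combined lift minus the composite of \<alpha> with \<open>r\<close> vanishes on the image of
  \<open>P1\<close> and descends to a map from X to M. The assumption makes its image in M/Y zero,
  and the coordinates of that image are the coefficients.\<close>

lemma indep_if:
  assumes g: "\<And>g x. lin R X M g \<Longrightarrow> x \<in> carrier X \<Longrightarrow> g x \<in> \<alpha> ` carrier Y"
  shows "indep Y JX h"
  unfolding indep_def
proof (intro allI impI ballI)
  fix A a l0 l1 r j x
  assume A: "finite A" "A \<subseteq> JX" and a: "\<forall>j\<in>A. lin R X X (a j) \<and> lifts_to (a j) (l0 j) (l1 j)"
    and r: "lin R P0 Y r" "\<forall>q\<in>carrier P1. finsum Y (\<lambda>j. h j (l1 j q)) A = r (i q)"
    and j: "j \<in> A" and x: "x \<in> carrier X"
  note C = comb[OF A a]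
  let ?N = "\<lambda>p. finsum M (\<lambda>j. n j (l0 j p)) A"
  have d: "lin R P0 M (\<lambda>p. ?N p \<ominus>\<^bsub>M\<^esub> \<alpha> (r p))" using lin_minus_map[OF D(2) C(1) lin_comp[OF r(1) D(4)]] .
  have "?N p \<ominus>\<^bsub>M\<^esub> \<alpha> (r p) = \<zero>\<^bsub>M\<^esub>" if p: "p \<in> carrier P0" "e p = \<zero>\<^bsub>X\<^esub>" for p
  proof -
    obtain q where q: "q \<in> carrier P1" "p = i q" using res(8)[OF p(1)] p(2) by blast
    then show ?thesis using C(3)[OF q(1)] r(2) lin_closed[OF D(4) lin_closed[OF r(1) p(1)]]
      by (simp add: M.minus_zero_iff)
  qed
  then obtain g' where g': "lin R X M g'" "\<And>p. p \<in> carrier P0 \<Longrightarrow> g' (e p) = ?N p \<ominus>\<^bsub>M\<^esub> \<alpha> (r p)"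
    using lin_factor[OF res(2,3) D(2) res(5,7) d] by blast
  obtain p where p: "p \<in> carrier P0" "x = e p" using res(10)[OF x] by blast
  note c = lin_closed[OF C(1) p(1)] lin_closed[OF D(4) lin_closed[OF r(1) p(1)]]
  have "\<pi> (?N p \<ominus>\<^bsub>M\<^esub> \<alpha> (r p)) = \<zero>\<^bsub>direct_sum J F\<^esub>"
    using g[OF g'(1) x] g'(2)[OF p(1)] p(2) D(8)[of "?N p \<ominus>\<^bsub>M\<^esub> \<alpha> (r p)"] c by simp
  then have "\<pi> (?N p) = \<pi> (\<alpha> (r p))"
    using lin_minus[OF D(2,3,5) c] Q.minus_zero_iff[OF lin_closed[OF D(5) c(1)] lin_closed[OF D(5) c(2)]] by metis
  then have "\<pi> (?N p) = \<zero>\<^bsub>direct_sum J F\<^esub>" using D(9)[OF lin_closed[OF r(1) p(1)]] by simp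
  moreover have jJ: "j \<in> J" "F j = X" using j A(2) by auto
  ultimately show "a j x = \<zero>\<^bsub>X\<^esub>" using C(4)[OF p(1) jJ(1)] j p(2) by simp
qed

text \<open>Finite presentation leaves finitely many nonzero coordinates, and the semibrick property
  restricts them to summands equal to X, where they are endomorphisms. So \<open>comb\<close> covers
  every map from X to M/Y.\<close>

lemma hom_to_sum:
  assumes f: "lin R X (direct_sum J F) f"
  obtains A l0 l1 where "finite A" "A \<subseteq> JX"
    "\<forall>j\<in>A. lin R X X (\<lambda>x. f x j) \<and> lifts_to (\<lambda>x. f x j) (l0 j) (l1 j)"
    "\<forall>p\<in>carrier P0. \<pi> (finsum M (\<lambda>j. n j (l0 j p)) A) = f (e p)"
    "A = {j \<in> J. \<exists>x\<in>carrier X. f x j \<noteq> \<zero>\<^bsub>F j\<^esub>}"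
proof -
  define A where "A = {j \<in> J. \<exists>x\<in>carrier X. f x j \<noteq> \<zero>\<^bsub>F j\<^esub>}"
  have fin: "finite A" unfolding A_def
    using finitely_presented_coords[OF brickD(2)[OF semibrick_brick[OF sb X]] F_left_module f] .
  have fl: "lin R X (F j) (\<lambda>x. f x j)" if "j \<in> J" for j using lin_comp[OF f direct_sum_coord_lin[OF that]] .
  have AJX: "A \<subseteq> JX"
  proof
    fix j assume "j \<in> A"
    then obtain x where j: "j \<in> J" and x: "x \<in> carrier X" "f x j \<noteq> \<zero>\<^bsub>F j\<^esub>" by (auto simp: A_def)
    then show "j \<in> JX" using semibrick_hom_zero[OF sb X F[OF j] _ fl[OF j] x(1)] by auto
  qed
  then have al: "lin R X X (\<lambda>x. f x j)" if "j \<in> A" for j using fl[of j] that by auto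
  have "\<exists>l0 l1. \<forall>j\<in>A. lifts_to (\<lambda>x. f x j) (l0 j) (l1 j)" using lift_exists[OF al] by metis
  then obtain l0 l1 where l: "\<And>j. j \<in> A \<Longrightarrow> lifts_to (\<lambda>x. f x j) (l0 j) (l1 j)" by blast
  have a: "\<forall>j\<in>A. lin R X X (\<lambda>x. f x j) \<and> lifts_to (\<lambda>x. f x j) (l0 j) (l1 j)" using al l by blast
  note C = comb[OF fin AJX a]
  have "\<pi> (finsum M (\<lambda>j. n j (l0 j p)) A) = f (e p)" if p: "p \<in> carrier P0" for p
  proof (rule extensionalityI[of _ J])
    show "\<pi> (finsum M (\<lambda>j. n j (l0 j p)) A) \<in> extensional J"
      using lin_closed[OF D(5) lin_closed[OF C(1) p]] by (simp add: direct_sum_carrier)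
    show "f (e p) \<in> extensional J"
      using lin_closed[OF f lin_closed[OF res(5) p]] by (simp add: direct_sum_carrier)
    fix k assume k: "k \<in> J"
    show "\<pi> (finsum M (\<lambda>j. n j (l0 j p)) A) k = f (e p) k"
      using C(4)[OF p k] k lin_closed[OF res(5) p] by (auto simp: A_def)
  qed
  then show thesis using that[OF fin AJX a _ A_def] by blast
qed

text \<open>The combined lift of the image of \<open>g\<close> in M/Y and the composite of
  \<open>g\<close> with \<open>e\<close> differ by a map \<open>r\<close> into Y. On
  \<open>P1\<close> the latter vanishes, so there \<open>r\<close> is the combination of the
  cocycles, and independence makes all coordinates of that image zero.\<close>

lemma hom_image_if_indep:
  assumes I: "indep Y JX h" and g: "lin R X M g" and x: "x \<in> carrier X"
  shows "g x \<in> \<alpha> ` carrier Y"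
proof -
  have f: "lin R X (direct_sum J F) (\<lambda>x. \<pi> (g x))" using lin_comp[OF g D(5)] .
  obtain A l0 l1 where A: "finite A" "A \<subseteq> JX" and a: "\<forall>j\<in>A. lin R X X (\<lambda>x. \<pi> (g x) j) \<and> lifts_to (\<lambda>x. \<pi> (g x) j) (l0 j) (l1 j)"
    and Np: "\<forall>p\<in>carrier P0. \<pi> (finsum M (\<lambda>j. n j (l0 j p)) A) = \<pi> (g (e p))"
    and Ad: "A = {j \<in> J. \<exists>x\<in>carrier X. \<pi> (g x) j \<noteq> \<zero>\<^bsub>F j\<^esub>}"
    by (rule hom_to_sum[OF f])
  note C = comb[OF A a]
  let ?N = "\<lambda>p. finsum M (\<lambda>j. n j (l0 j p)) A"
  note ge = lin_comp[OF res(5) g]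
  have d: "lin R P0 M (\<lambda>p. ?N p \<ominus>\<^bsub>M\<^esub> g (e p))" using lin_minus_map[OF D(2) C(1) ge] .
  have "\<pi> (?N p \<ominus>\<^bsub>M\<^esub> g (e p)) = \<zero>\<^bsub>direct_sum J F\<^esub>" if p: "p \<in> carrier P0" for p
    using lin_minus[OF D(2,3,5) lin_closed[OF C(1) p] lin_closed[OF ge p]] bspec[OF Np p]
      Q.minus_zero_iff[of "\<pi> (g (e p))" "\<pi> (g (e p))"] lin_closed[OF D(5) lin_closed[OF ge p]] by simp
  then obtain r where r: "lin R P0 Y r" "\<And>p. p \<in> carrier P0 \<Longrightarrow> \<alpha> (r p) = ?N p \<ominus>\<^bsub>M\<^esub> g (e p)"
    using exact_factor_left[OF ex res(2) d] by blast
  have "finsum Y (\<lambda>j. h j (l1 j q)) A = r (i q)" if q: "q \<in> carrier P1" for q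
  proof -
    have iq: "i q \<in> carrier P0" using lin_closed[OF res(4) q] .
    have "g (e (i q)) = \<zero>\<^bsub>M\<^esub>" using res(9)[OF q] lin_zero[OF res(3) D(2) g] by simp
    then have "\<alpha> (r (i q)) = \<alpha> (finsum Y (\<lambda>j. h j (l1 j q)) A)"
      using r(2)[OF iq] C(3)[OF q] lin_closed[OF D(4) lin_closed[OF C(2) q]] by (simp add: M.minus_eq)
    then show ?thesis using D(6) lin_closed[OF C(2) q] lin_closed[OF r(1) iq] by (metis inj_onD)
  qed
  then have z: "\<forall>j\<in>A. \<forall>x\<in>carrier X. \<pi> (g x) j = \<zero>\<^bsub>X\<^esub>"
    using I[unfolded indep_def, rule_format, of A "\<lambda>j x. \<pi> (g x) j" l0 l1 r] A a r(1) by blast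
  have "\<pi> (g x) k = \<zero>\<^bsub>F k\<^esub>" if k: "k \<in> J" for k
    using z Ad A(2) x k by auto
  then have "\<pi> (g x) = \<zero>\<^bsub>direct_sum J F\<^esub>"
    using lin_closed[OF f x] by (intro extensionalityI[of _ J]) (auto simp: direct_sum_carrier)
  then show ?thesis using D(8)[OF lin_closed[OF g x]] by simp
qed

text \<open>An extension \<open>k\<close> of the given map on \<open>P1\<close> induces a map
  \<open>f\<close> from X to M/Y. The combined lift of \<open>f\<close> agrees with \<open>k\<close>
  modulo Y, and their difference \<open>r\<close> exhibits h' as a combination of the
  \<open>h j\<close>.\<close>

lemma spans_if:
  assumes k: "\<And>h'. lin R P1 Y h' \<Longrightarrow> \<exists>k. lin R P0 M k \<and> (\<forall>q\<in>carrier P1. k (i q) = \<alpha> (h' q))"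
  shows "spans Y JX h"
  unfolding spans_def
proof (intro allI impI)
  fix h' assume h': "lin R P1 Y h'"
  obtain k where k: "lin R P0 M k" "\<And>q. q \<in> carrier P1 \<Longrightarrow> k (i q) = \<alpha> (h' q)" using k[OF h'] by blast
  have "\<pi> (k p) = \<zero>\<^bsub>direct_sum J F\<^esub>" if p: "p \<in> carrier P0" "e p = \<zero>\<^bsub>X\<^esub>" for p
  proof -
    obtain q where q: "q \<in> carrier P1" "p = i q" using res(8)[OF p(1)] p(2) by blast
    then show ?thesis using k(2)[OF q(1)] D(9)[OF lin_closed[OF h' q(1)]] by simp
  qed
  then obtain f where f: "lin R X (direct_sum J F) f" "\<And>p. p \<in> carrier P0 \<Longrightarrow> f (e p) = \<pi> (k p)"
    using lin_factor[OF res(2,3) D(3) res(5,7) lin_comp[OF k(1) D(5)]] by blast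
  obtain A l0 l1 where A: "finite A" "A \<subseteq> JX" and a: "\<forall>j\<in>A. lin R X X (\<lambda>x. f x j) \<and> lifts_to (\<lambda>x. f x j) (l0 j) (l1 j)"
    and Np: "\<forall>p\<in>carrier P0. \<pi> (finsum M (\<lambda>j. n j (l0 j p)) A) = f (e p)"
    and "A = {j \<in> J. \<exists>x\<in>carrier X. f x j \<noteq> \<zero>\<^bsub>F j\<^esub>}"
    by (rule hom_to_sum[OF f(1)])
  note C = comb[OF A a]
  let ?N = "\<lambda>p. finsum M (\<lambda>j. n j (l0 j p)) A"
  have d: "lin R P0 M (\<lambda>p. ?N p \<ominus>\<^bsub>M\<^esub> k p)" using lin_minus_map[OF D(2) C(1) k(1)] .
  have "\<pi> (?N p \<ominus>\<^bsub>M\<^esub> k p) = \<zero>\<^bsub>direct_sum J F\<^esub>" if p: "p \<in> carrier P0" for p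
    using lin_minus[OF D(2,3,5) lin_closed[OF C(1) p] lin_closed[OF k(1) p]] bspec[OF Np p] f(2)[OF p]
      Q.minus_zero_iff[of "\<pi> (k p)" "\<pi> (k p)"] lin_closed[OF D(5) lin_closed[OF k(1) p]] by simp
  then obtain r where r: "lin R P0 Y r" "\<And>p. p \<in> carrier P0 \<Longrightarrow> \<alpha> (r p) = ?N p \<ominus>\<^bsub>M\<^esub> k p"
    using exact_factor_left[OF ex res(2) d] by blast
  have "finsum Y (\<lambda>j. h j (l1 j q)) A = h' q \<oplus>\<^bsub>Y\<^esub> r (i q)" if q: "q \<in> carrier P1" for q
  proof -
    have iq: "i q \<in> carrier P0" using lin_closed[OF res(4) q] .
    note c = lin_closed[OF h' q] lin_closed[OF r(1) iq]
    have "\<alpha> (h' q \<oplus>\<^bsub>Y\<^esub> r (i q)) = k (i q) \<oplus>\<^bsub>M\<^esub> (?N (i q) \<ominus>\<^bsub>M\<^esub> k (i q))"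
      using lin_add[OF D(4) c] r(2)[OF iq] k(2)[OF q] by simp
    also have "\<dots> = \<alpha> (finsum Y (\<lambda>j. h j (l1 j q)) A)"
      using M.add_minus_cancel[OF lin_closed[OF C(1) iq] lin_closed[OF k(1) iq]] C(3)[OF q] by simp
    finally have eq: "\<alpha> (h' q \<oplus>\<^bsub>Y\<^esub> r (i q)) = \<alpha> (finsum Y (\<lambda>j. h j (l1 j q)) A)" .
    show ?thesis using inj_onD[OF D(6) eq Y.a_closed[OF c] lin_closed[OF C(2) q]] by simp
  qed
  then show "\<exists>A a l0 l1 r. finite A \<and> A \<subseteq> JX \<and> (\<forall>j\<in>A. lin R X X (a j) \<and> lifts_to (a j) (l0 j) (l1 j)) \<and>
      lin R P0 Y r \<and> (\<forall>q\<in>carrier P1. finsum Y (\<lambda>j. h j (l1 j q)) A = h' q \<oplus>\<^bsub>Y\<^esub> r (i q))"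
    using A a r(1) by (intro exI[of _ A] exI[of _ "\<lambda>j x. f x j"] exI[of _ l0] exI[of _ l1] exI[of _ r]) blast
qed

text \<open>Once h' is a combination of the \<open>h j\<close> up to the restriction of
  \<open>r\<close>, the combined lift minus the composite of \<alpha> with \<open>r\<close> is the
  required extension.\<close>

lemma extend_if_spans:
  assumes S: "spans Y JX h" and h': "lin R P1 Y h'"
  shows "\<exists>k. lin R P0 M k \<and> (\<forall>q\<in>carrier P1. k (i q) = \<alpha> (h' q))"
proof -
  obtain A a l0 l1 r where A: "finite A" "A \<subseteq> JX" and a: "\<forall>j\<in>A. lin R X X (a j) \<and> lifts_to (a j) (l0 j) (l1 j)"
    and r: "lin R P0 Y r" "\<forall>q\<in>carrier P1. finsum Y (\<lambda>j. h j (l1 j q)) A = h' q \<oplus>\<^bsub>Y\<^esub> r (i q)"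
    using S[unfolded spans_def, rule_format, OF h'] by (elim exE conjE) (rule that; assumption)
  note C = comb[OF A a]
  let ?N = "\<lambda>p. finsum M (\<lambda>j. n j (l0 j p)) A"
  have "lin R P0 M (\<lambda>p. ?N p \<ominus>\<^bsub>M\<^esub> \<alpha> (r p))" using lin_minus_map[OF D(2) C(1) lin_comp[OF r(1) D(4)]] .
  moreover have "?N (i q) \<ominus>\<^bsub>M\<^esub> \<alpha> (r (i q)) = \<alpha> (h' q)" if q: "q \<in> carrier P1" for q
  proof -
    have iq: "i q \<in> carrier P0" using lin_closed[OF res(4) q] .
    note c = lin_closed[OF D(4) lin_closed[OF h' q]] lin_closed[OF D(4) lin_closed[OF r(1) iq]]
    have "?N (i q) = \<alpha> (h' q) \<oplus>\<^bsub>M\<^esub> \<alpha> (r (i q))"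
      using C(3)[OF q] bspec[OF r(2) q] lin_add[OF D(4) lin_closed[OF h' q] lin_closed[OF r(1) iq]] by simp
    then show ?thesis using c by (simp add: M.minus_eq M.a_assoc M.r_neg)
  qed
  ultimately show ?thesis by blast
qed

lemma lifts_to_id: "lifts_to (\<lambda>x. x) (\<lambda>p. p) (\<lambda>q. q)"
  by (simp add: lifts_to_def lin_id)

lemma lifts_to_neg: "lin R X X (a_inv X)" "lifts_to (a_inv X) (a_inv P0) (a_inv P1)"
proof -
  have neg: "lin R N N (a_inv N)" if N: "left_module R N" for N :: "('r, 'n) module"
  proof -
    interpret N: abelian_group N using N by (rule left_module_abelian_group)
    show ?thesis using left_module_smult_neg[OF N] by (auto intro!: linI simp: N.minus_add N.a_comm)
  qed
  show "lin R X X (a_inv X)" using neg[OF res(3)] .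
  show "lifts_to (a_inv X) (a_inv P0) (a_inv P1)"
    unfolding lifts_to_def using neg[OF res(1)] neg[OF res(2)] lin_neg[OF res(2,3,5)] lin_neg[OF res(1,2,4)] by simp
qed

text \<open>Two indices with the same class would give a relation with coefficients 1 and -1,
  although the identity of X is nonzero. Bases are sets of classes, so the family must not repeat
  any of them.\<close>

lemma cls_inj_if_indep:
  assumes I: "indep Y JX h"
  shows "inj_on (\<lambda>j. cls Y (h j)) JX"
proof (rule inj_onI, rule ccontr)
  fix j k assume jk: "j \<in> JX" "k \<in> JX" "cls Y (h j) = cls Y (h k)" "j \<noteq> k"
  have hl: "lin R P1 Y (h j)" "lin R P1 Y (h k)" using jk h by auto
  obtain r where r: "lin R P0 Y r" "\<And>q. q \<in> carrier P1 \<Longrightarrow> h j q = h k q \<oplus>\<^bsub>Y\<^esub> r (i q)"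
    using cls_eq_iff[OF D(1) hl] jk(3) by blast
  define a where "a l = (if l = j then (\<lambda>x. x) else a_inv X)" for l
  define l0 where "l0 l = (if l = j then (\<lambda>x. x) else a_inv P0)" for l
  define l1 where "l1 l = (if l = j then (\<lambda>x. x) else a_inv P1)" for l
  have al: "lin R X X (a l) \<and> lifts_to (a l) (l0 l) (l1 l)" for l
    using lifts_to_id lifts_to_neg lin_id by (auto simp: a_def l0_def l1_def)
  have "finsum Y (\<lambda>l. h l (l1 l q)) {j, k} = r (i q)" if q: "q \<in> carrier P1" for q
  proof -
    interpret P1: abelian_group P1 using res(1) by (rule left_module_abelian_group)
    note c = lin_closed[OF hl(1) q] lin_closed[OF hl(2) q] lin_closed[OF r(1) lin_closed[OF res(4) q]]
    have nk: "h k (\<ominus>\<^bsub>P1\<^esub> q) = \<ominus>\<^bsub>Y\<^esub> h k q" using lin_neg[OF res(1) D(1) hl(2) q] .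
    have "finsum Y (\<lambda>l. h l (l1 l q)) {j, k} = h j q \<oplus>\<^bsub>Y\<^esub> \<ominus>\<^bsub>Y\<^esub> h k q"
      using jk(4) c nk by (simp add: l1_def)
    also have "\<dots> = r (i q)" using r(2)[OF q] c by (simp add: Y.a_comm[of "h k q"] Y.a_assoc Y.r_neg)
    finally show ?thesis .
  qed
  then have z: "\<forall>l\<in>{j, k}. \<forall>x\<in>carrier X. a l x = \<zero>\<^bsub>X\<^esub>"
    using I[unfolded indep_def, rule_format, of "{j, k}" a l0 l1 r] jk al r(1) by blast
  then have "x = \<zero>\<^bsub>X\<^esub>" if "x \<in> carrier X" for x
  proof -
    have "a j x = \<zero>\<^bsub>X\<^esub>" using z that by blast
    then show ?thesis by (simp add: a_def)
  qed
  then show False using brickD(3)[OF semibrick_brick[OF sb X]] by blast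
qed

end

text \<open>
  For a resolution \<open>0 \<rightarrow> P\<^sub>1 \<rightarrow> P\<^sub>0 \<rightarrow> X \<rightarrow> 0\<close> the two clauses say that the connecting map
  \<open>Hom(X, M/Y) \<rightarrow> Ext\<^sup>1(X, Y)\<close> is injective and surjective.
\<close>

definition universal_at :: "('r, 'z) ring_scheme \<Rightarrow> ('r, 'x) module \<Rightarrow> ('r, 'p) module \<Rightarrow> ('r, 'q) module \<Rightarrow>
    ('p \<Rightarrow> 'q) \<Rightarrow> ('r, 'y) module \<Rightarrow> ('r, 'm) module \<Rightarrow> ('y \<Rightarrow> 'm) \<Rightarrow> bool" where
  "universal_at R X P1 P0 i Y M \<alpha> \<longleftrightarrow>
     (\<forall>g x. lin R X M g \<longrightarrow> x \<in> carrier X \<longrightarrow> g x \<in> \<alpha> ` carrier Y) \<and>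
     (\<forall>h. lin R P1 Y h \<longrightarrow> (\<exists>k. lin R P0 M k \<and> (\<forall>q\<in>carrier P1. k (i q) = \<alpha> (h q))))"

section \<open>Universal inclusions in terms of the connecting map\<close>

lemma Ext1_mem_classD:
  assumes "c \<in> carrier (Ext1 R X Y)" "t \<in> c"
  shows "short_exact R t" "ses_left t = Y" "ses_right t = X"
  using assms by (auto simp: Ext1_def ext_class_def ses_equiv_def)

text \<open>The chosen bases are forgotten, and only the properties that can be carried over to
  quotients are kept. The summands are indexed by pairs (X, b) of a member and a basis class. For
  fixed X, lifts into the chosen sequences \<open>E X b\<close> supply the data of
  \<open>ext_data\<close>, with cocycles that represent precisely the basis elements.\<close>

lemma universal_inclusionD:
  fixes R :: "('r, 'z) ring_scheme" and \<X> :: "('r, 'x) module set" and Y :: "('r, 'y) module"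
    and M :: "('r, 'm) module"
  assumes sb: "semibrick R \<X>" and u: "universal_inclusion R \<X> Y M \<alpha>"
  obtains J :: "(('r, 'x) module \<times> ('r, 'y, 'y \<times> 'x, 'x) ses set) set" and F \<pi>
  where "\<And>j. j \<in> J \<Longrightarrow> F j \<in> \<X>" "exact R Y M (direct_sum J F) \<alpha> \<pi>"
    "\<And>X (P1 :: ('r, 'p) module) (P0 :: ('r, 'q) module) i e.
       X \<in> \<X> \<Longrightarrow> resolution R X P1 P0 i e \<Longrightarrow> universal_at R X P1 P0 i Y M \<alpha>"
proof -
  obtain B E where Y: "left_module R Y" and M: "left_module R M" and al: "lin R Y M \<alpha>"
    and be: "ext_bases R \<X> Y B E" and iso: "ses_iso_under R
          \<lparr>ses_left = Y, ses_mid = M, ses_right = quot_mod M (\<alpha> ` carrier Y),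
           ses_inj = \<alpha>, ses_proj = quot_proj M (\<alpha> ` carrier Y)\<rparr>
          (universal_ses \<X> Y B E)"
    using u mod_hom_lin unfolding universal_inclusion_def by blast
  have R: "ring R" using Y by (rule left_module_ring)
  define J where "J = (SIGMA X:\<X>. B X)"
  define s where "s = (\<lambda>(X, b). E X b)"
  define F where "F j = ses_right (s j)" for j
  have bas: "basis (End_ring R X) (Ext1 R X Y) (B X)" "\<And>b. b \<in> B X \<Longrightarrow> E X b \<in> b" if "X \<in> \<X>" for X
    using be that by (auto simp: ext_bases_def)
  have sJ: "short_exact R (s j)" "ses_left (s j) = Y" "F j = fst j" "fst j \<in> \<X>" "snd j \<in> B (fst j)"
      "s j \<in> snd j" if "j \<in> J" for j
  proof -
    obtain X b where j: "j = (X, b)" "X \<in> \<X>" "b \<in> B X" using \<open>j \<in> J\<close> by (auto simp: J_def)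
    have "b \<in> carrier (Ext1 R X Y)" using bas(1)[OF j(2)] j(3) by (auto simp: basis_def)
    then show "short_exact R (s j)" "ses_left (s j) = Y" "F j = fst j" "fst j \<in> \<X>" "snd j \<in> B (fst j)"
      "s j \<in> snd j"
      using Ext1_mem_classD[of b R X Y "E X b"] bas(2)[OF j(2,3)] j by (auto simp: s_def F_def)
  qed
  define S where "S = ses_sum J s"
  have S: "short_exact R S" unfolding S_def using ses_sum_exact[OF R sJ(1)] .
  have Sl: "ses_left S = direct_sum J (\<lambda>_. Y)" unfolding S_def using sJ(2) by (simp cong: direct_sum_cong)
  have Sr: "ses_right S = direct_sum J F" by (simp add: S_def F_def[abs_def])
  have smap: "lin R (ses_left S) Y (summation_map J Y)" unfolding Sl using summation_map_lin[OF Y] .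
  define U where "U = universal_ses \<X> Y B E"
  have Ueq: "U = ses_pushout Y (summation_map J Y) S"
    by (simp add: U_def universal_ses_def J_def s_def S_def Let_def)
  have U: "short_exact R U" unfolding Ueq using pushout_exact(1)[OF S Y smap] .
  obtain m where m: "lin R (ses_mid S) (ses_mid U) m"
    "\<And>y. y \<in> carrier (ses_left S) \<Longrightarrow> m (ses_inj S y) = ses_inj U (summation_map J Y y)"
    "\<And>x. x \<in> carrier (ses_mid S) \<Longrightarrow> ses_proj U (m x) = ses_proj S x"
    using pushout_exact(2)[OF S Y smap] unfolding Ueq by blast
  have exU: "exact R Y (ses_mid U) (direct_sum J F) (ses_inj U) (ses_proj U)"
    using U Sr by (simp add: short_exact_iff Ueq)
  note DU = exactD[OF exU]
  obtain \<phi> where ph: "lin R M (ses_mid U) \<phi>" "bij_betw \<phi> (carrier M) (carrier (ses_mid U))"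
    "\<And>y. y \<in> carrier Y \<Longrightarrow> \<phi> (\<alpha> y) = ses_inj U y"
    using iso unfolding U_def ses_iso_under_def by (auto simp: mod_iso_def mod_hom_iff)
  define \<pi> where "\<pi> x = ses_proj U (\<phi> x)" for x
  have ex: "exact R Y M (direct_sum J F) \<alpha> \<pi>"
    unfolding \<pi>_def using exact_iso_mid[OF exU M ph(1,2) al ph(3)] .
  have F: "F j \<in> \<X>" if "j \<in> J" for j using sJ that by simp
  show thesis
  proof (rule that[OF F ex])
    fix X and P1 :: "('r, 'p) module" and P0 :: "('r, 'q) module" and i e
    assume X: "X \<in> \<X>" and "resolution R X P1 P0 i e"
    then interpret resolution R X P1 P0 i e by simp
    let ?JX = "{j \<in> J. F j = X}"
    have jx: "fst j = X" "snd j \<in> B X" if "j \<in> ?JX" for j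
      using that sJ(3)[of j] sJ(5)[of j] by simp_all
    \<comment> \<open>A cocycle of the sequence \<open>s j\<close> that represents the class
      \<open>snd j\<close>, together with the lift witnessing it.\<close>
    define good where "good j h k \<longleftrightarrow> lin R P1 Y h \<and> snd j = cls Y h \<and> lin R P0 (ses_mid (s j)) k \<and>
        (\<forall>p\<in>carrier P0. ses_proj (s j) (k p) = e p) \<and> (\<forall>q\<in>carrier P1. k (i q) = ses_inj (s j) (h q))"
      for j h k
    have "\<exists>h k. good j h k" if j: "j \<in> ?JX" for j
    proof -
      have "snd j \<in> carrier (Ext1 R X Y)" using bas(1)[OF X] jx[OF j] by (auto simp: basis_def)
      then obtain h where h: "lin R P1 Y h" "snd j = cls Y h" by (auto simp: Ext1_carrier[OF Y])
      have "cocycle (s j) h" using sJ(6)[of j] j h(2) by (simp add: cls_def)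
      then show ?thesis using h by (auto simp: cocycle_def good_def)
    qed
    then have "\<forall>j\<in>?JX. \<exists>hk. good j (fst hk) (snd hk)" by simp
    from bchoice[OF this] obtain hk where hk: "\<forall>j\<in>?JX. good j (fst (hk j)) (snd (hk j))" by blast
    define h k where "h j = fst (hk j)" and "k j = snd (hk j)" for j
    have "good j (h j) (k j)" if "j \<in> ?JX" for j using hk that unfolding h_def k_def by blast
    then have h: "\<And>j. j \<in> ?JX \<Longrightarrow> lin R P1 Y (h j)" "\<And>j. j \<in> ?JX \<Longrightarrow> snd j = cls Y (h j)"
      and k: "\<And>j. j \<in> ?JX \<Longrightarrow> lin R P0 (ses_mid (s j)) (k j)"
        "\<And>j p. j \<in> ?JX \<Longrightarrow> p \<in> carrier P0 \<Longrightarrow> ses_proj (s j) (k j p) = e p"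
        "\<And>j q. j \<in> ?JX \<Longrightarrow> q \<in> carrier P1 \<Longrightarrow> k j (i q) = ses_inj (s j) (h j q)"
      unfolding good_def by blast+
    let ?E = "\<lambda>j. ses_mid (s j)"
    define \<psi> where "\<psi> = inv_into (carrier M) \<phi>"
    have psi: "lin R (ses_mid U) M \<psi>" unfolding \<psi>_def using lin_inv_into[OF M DU(2) ph(1,2)] .
    have \<phi>\<psi>: "\<phi> (\<psi> u) = u" if "u \<in> carrier (ses_mid U)" for u
      using that ph(2) by (simp add: \<psi>_def bij_betw_def f_inv_into_f)
    have \<psi>\<phi>: "\<psi> (\<phi> x) = x" if "x \<in> carrier M" for x
      using that ph(2) by (simp add: \<psi>_def bij_betw_def)
    \<comment> \<open>The lift into the j-th sequence, carried through the direct sum, its push-out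
      and the isomorphism with \<open>M\<close>.\<close>
    define n where "n j p = \<psi> (m (ds_in J ?E j (k j p)))" for j p
    have Dj: "exact R Y (?E j) (F j) (ses_inj (s j)) (ses_proj (s j))" if "j \<in> J" for j
      using sJ(1,2)[OF that] by (simp add: short_exact_iff F_def)
    have din: "lin R (?E j) (ses_mid S) (ds_in J ?E j)" if "j \<in> J" for j
      unfolding S_def ses_sum_simps using ds_in_lin[of J R ?E j] exactD(2)[OF Dj] that by blast
    have diny: "ds_in J (\<lambda>_. Y) j y \<in> carrier (direct_sum J (\<lambda>_. Y))" if "j \<in> J" "y \<in> carrier Y" for j y
      using lin_closed[OF ds_in_lin[of J R "\<lambda>_. Y" j]] Y that by blast
    have nl: "lin R P0 M (n j)" if "j \<in> ?JX" for j
      unfolding n_def using that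
      by (intro lin_comp[OF _ psi] lin_comp[OF _ m(1)] lin_comp[OF k(1) din]) auto
    have pn: "\<pi> (n j p) = ds_in J F j (e p)" if j: "j \<in> ?JX" and p: "p \<in> carrier P0" for j p
    proof -
      have jJ: "j \<in> J" using j by simp
      have c: "ds_in J ?E j (k j p) \<in> carrier (ses_mid S)" using lin_closed[OF din[OF jJ] lin_closed[OF k(1)[OF j] p]] .
      have "\<pi> (n j p) = ses_proj S (ds_in J ?E j (k j p))"
        using \<phi>\<psi>[OF lin_closed[OF m(1) c]] m(3)[OF c] by (simp add: \<pi>_def n_def)
      also have "\<dots> = (\<lambda>l\<in>J. ses_proj (s l) (ds_in J ?E j (k j p) l))"
        using c by (simp add: S_def ses_sum_def Let_def)
      also have "\<dots> = ds_in J F j (ses_proj (s j) (k j p))"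
        using lin_zero[OF exactD(2,3,5)[OF Dj]] by (intro direct_sum_map_in) auto
      finally show ?thesis using k(2)[OF j p] by simp
    qed
    \<comment> \<open>Summation restricted to one copy of Y is the identity, so passing to the
      direct sum and its push-out does not alter the cocycle of the j-th sequence.\<close>
    have ni: "n j (i q) = \<alpha> (h j q)" if j: "j \<in> ?JX" and q: "q \<in> carrier P1" for j q
    proof -
      have jJ: "j \<in> J" using j by simp
      have hq: "h j q \<in> carrier Y" using lin_closed[OF h(1)[OF j] q] .
      have "ds_in J ?E j (k j (i q)) = ds_in J ?E j (ses_inj (s j) (h j q))" using k(3)[OF j q] by simp
      also have "\<dots> = (\<lambda>l\<in>J. ses_inj (s l) (ds_in J (\<lambda>_. Y) j (h j q) l))"
        using lin_zero[OF exactD(1,2,4)[OF Dj]] by (intro direct_sum_map_in[symmetric]) auto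
      also have "\<dots> = ses_inj S (ds_in J (\<lambda>_. Y) j (h j q))"
        using diny[OF jJ hq] Sl by (simp add: S_def ses_sum_def Let_def)
      finally have "m (ds_in J ?E j (k j (i q))) = ses_inj U (h j q)"
        using m(2)[of "ds_in J (\<lambda>_. Y) j (h j q)"] diny[OF jJ hq] Sl summation_map_in[OF Y jJ hq] by simp
      then show ?thesis using ph(3)[OF hq] \<psi>\<phi>[OF lin_closed[OF al hq]] by (simp add: n_def)
    qed
    note hh = h
    interpret ext_data R X P1 P0 i e \<X> Y M J F \<alpha> \<pi> n h
      using sb X F ex nl pn hh(1) ni by unfold_locales auto
    \<comment> \<open>The cocycles represent exactly the chosen basis, so \<open>basis_iff\<close>
      turns the basis property into independence and spanning.\<close>
    have img: "(\<lambda>j. cls Y (h j)) ` ?JX = B X"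
    proof
      show "(\<lambda>j. cls Y (h j)) ` ?JX \<subseteq> B X" using hh(2) jx(2) by force
      show "B X \<subseteq> (\<lambda>j. cls Y (h j)) ` ?JX"
      proof
        fix b assume "b \<in> B X"
        then have "(X, b) \<in> ?JX" using X sJ(3)[of "(X, b)"] by (auto simp: J_def)
        then show "b \<in> (\<lambda>j. cls Y (h j)) ` ?JX" using hh(2)[of "(X, b)"] by (intro image_eqI[of _ _ "(X, b)"]) auto
      qed
    qed
    have inj: "inj_on (\<lambda>j. cls Y (h j)) ?JX"
    proof (rule inj_onI)
      fix j l assume jl: "j \<in> ?JX" "l \<in> ?JX" "cls Y (h j) = cls Y (h l)"
      show "j = l" using hh(2)[OF jl(1)] hh(2)[OF jl(2)] jx(1)[OF jl(1)] jx(1)[OF jl(2)] jl(3)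
        by (intro prod_eqI) simp_all
    qed
    have "indep Y ?JX h \<and> spans Y ?JX h"
      using basis_iff[OF Y _ inj] hh(1) bas(1)[OF X] unfolding img by simp
    then show "universal_at R X P1 P0 i Y M \<alpha>"
      unfolding universal_at_def using hom_image_if_indep extend_if_spans by blast
  qed
qed

lemma direct_sum_reindex:
  assumes R: "ring R" and F: "\<And>j. j \<in> J \<Longrightarrow> left_module R (F j)" and th: "bij_betw \<theta> J J'"
    and eq: "\<And>j. j \<in> J \<Longrightarrow> F' (\<theta> j) = F j"
  shows "lin R (direct_sum J' F') (direct_sum J F) (\<lambda>v. \<lambda>j\<in>J. v (\<theta> j))"
    and "bij_betw (\<lambda>v. \<lambda>j\<in>J. v (\<theta> j)) (carrier (direct_sum J' F')) (carrier (direct_sum J F))"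
proof -
  have t: "\<theta> j \<in> J'" if "j \<in> J" for j using that th by (auto simp: bij_betw_def)
  let ?\<tau> = "inv_into J \<theta>"
  have ta: "?\<tau> k \<in> J" "\<theta> (?\<tau> k) = k" if "k \<in> J'" for k
    using that th by (auto simp: bij_betw_def inv_into_into f_inv_into_f)
  have tt: "?\<tau> (\<theta> j) = j" if "j \<in> J" for j using that th by (simp add: bij_betw_def)
  have inj: "inj_on \<theta> J" using th by (simp add: bij_betw_def)
  have eq': "F (?\<tau> k) = F' k" if "k \<in> J'" for k using eq[OF ta(1)[OF that]] ta(2)[OF that] by simp
  have c1: "(\<lambda>j\<in>J. v (\<theta> j)) \<in> carrier (direct_sum J F)" if v: "v \<in> carrier (direct_sum J' F')" for v
  proof -
    have "\<theta> ` {j \<in> J. v (\<theta> j) \<noteq> \<zero>\<^bsub>F j\<^esub>} \<subseteq> {k \<in> J'. v k \<noteq> \<zero>\<^bsub>F' k\<^esub>}" using t eq by auto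
    then have "finite (\<theta> ` {j \<in> J. v (\<theta> j) \<noteq> \<zero>\<^bsub>F j\<^esub>})"
      using v by (auto simp: direct_sum_carrier intro: finite_subset)
    then have "finite {j \<in> J. v (\<theta> j) \<noteq> \<zero>\<^bsub>F j\<^esub>}"
      by (rule finite_imageD) (rule inj_on_subset[OF inj], auto)
    moreover have "v (\<theta> j) \<in> carrier (F j)" if "j \<in> J" for j
      using v t[OF that] eq[OF that] by (auto simp: direct_sum_carrier)
    ultimately show ?thesis by (auto simp: direct_sum_carrier cong: conj_cong)
  qed
  have c2: "(\<lambda>k\<in>J'. w (?\<tau> k)) \<in> carrier (direct_sum J' F')" if w: "w \<in> carrier (direct_sum J F)" for w
  proof -
    have "{k \<in> J'. w (?\<tau> k) \<noteq> \<zero>\<^bsub>F' k\<^esub>} \<subseteq> \<theta> ` {j \<in> J. w j \<noteq> \<zero>\<^bsub>F j\<^esub>}"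
    proof
      fix k assume "k \<in> {k \<in> J'. w (?\<tau> k) \<noteq> \<zero>\<^bsub>F' k\<^esub>}"
      then have "?\<tau> k \<in> {j \<in> J. w j \<noteq> \<zero>\<^bsub>F j\<^esub>}" "k = \<theta> (?\<tau> k)" using ta eq' by auto
      then show "k \<in> \<theta> ` {j \<in> J. w j \<noteq> \<zero>\<^bsub>F j\<^esub>}" by blast
    qed
    then have "finite {k \<in> J'. w (?\<tau> k) \<noteq> \<zero>\<^bsub>F' k\<^esub>}"
      using w by (auto simp: direct_sum_carrier intro: finite_subset)
    moreover have "w (?\<tau> k) \<in> carrier (F' k)" if "k \<in> J'" for k
      using w ta(1)[OF that] eq'[OF that] by (auto simp: direct_sum_carrier)
    ultimately show ?thesis by (auto simp: direct_sum_carrier cong: conj_cong)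
  qed
  show "lin R (direct_sum J' F') (direct_sum J F) (\<lambda>v. \<lambda>j\<in>J. v (\<theta> j))"
    using c1 t eq by (intro linI) (auto intro!: restrict_ext)
  show "bij_betw (\<lambda>v. \<lambda>j\<in>J. v (\<theta> j)) (carrier (direct_sum J' F')) (carrier (direct_sum J F))"
  proof (rule bij_betw_byWitness[where f' = "\<lambda>w. \<lambda>k\<in>J'. w (?\<tau> k)"])
    show "\<forall>v\<in>carrier (direct_sum J' F'). (\<lambda>k\<in>J'. (\<lambda>j\<in>J. v (\<theta> j)) (?\<tau> k)) = v"
      using ta by (auto simp: direct_sum_carrier intro!: extensionalityI[of _ J'])
    show "\<forall>w\<in>carrier (direct_sum J F). (\<lambda>j\<in>J. (\<lambda>k\<in>J'. w (?\<tau> k)) (\<theta> j)) = w"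
      using t tt by (auto simp: direct_sum_carrier intro!: extensionalityI[of _ J])
  qed (use c1 c2 in auto)
qed

text \<open>The bases are manufactured: lifting the coordinate inclusions of M/Y gives cocycles, and
  by \<open>universal_at\<close> their classes form a basis of Ext^1(X, Y) for every X. The
  universal sequence for these bases is compared with M through the universal property of its
  push-out, and the five lemma makes the comparison an isomorphism.\<close>

lemma universal_inclusionI:
  fixes R :: "('r, 'z) ring_scheme" and \<X> :: "('r, 'x) module set" and Y :: "('r, 'y) module"
    and M :: "('r, 'm) module" and P1 :: "('r, 'x) module \<Rightarrow> ('r, 'p) module"
    and P0 :: "('r, 'x) module \<Rightarrow> ('r, 'q) module"
  assumes sb: "semibrick R \<X>" and F: "\<And>j. j \<in> J \<Longrightarrow> F j \<in> \<X>"
    and ex: "exact R Y M (direct_sum J F) \<alpha> \<pi>" and ext: "\<alpha> \<in> extensional (carrier Y)"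
    and rs: "\<And>X. X \<in> \<X> \<Longrightarrow> resolution R X (P1 X) (P0 X) (i X) (e X)"
    and un: "\<And>X. X \<in> \<X> \<Longrightarrow> universal_at R X (P1 X) (P0 X) (i X) Y M \<alpha>"
  shows "universal_inclusion R \<X> Y M \<alpha>"
proof -
  note D = exactD[OF ex]
  have R: "ring R" using D(1) by (rule left_module_ring)
  have FL: "left_module R (F j)" if "j \<in> J" for j using semibrick_left_module[OF sb F[OF that]] .
  \<comment> \<open>Projectivity lifts the inclusion of the j-th summand to a map \<open>n\<close>
    into M; its part \<open>h\<close> on \<open>P1\<close> represents the image of that inclusion
    under the connecting map.\<close>
  have "\<exists>n h. lin R (P0 (F j)) M n \<and> (\<forall>p\<in>carrier (P0 (F j)). \<pi> (n p) = ds_in J F j (e (F j) p)) \<and>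
      lin R (P1 (F j)) Y h \<and> (\<forall>q\<in>carrier (P1 (F j)). n (i (F j) q) = \<alpha> (h q))" if j: "j \<in> J" for j
  proof -
    interpret resolution R "F j" "P1 (F j)" "P0 (F j)" "i (F j)" "e (F j)" using rs[OF F[OF j]] .
    have din: "lin R (F j) (direct_sum J F) (ds_in J F j)" using ds_in_lin[of J R F j] FL j by blast
    obtain n where n: "lin R (P0 (F j)) M n" "\<And>p. p \<in> carrier (P0 (F j)) \<Longrightarrow> \<pi> (n p) = ds_in J F j (e (F j) p)"
      using projective_lift[OF proj0 D(2,3,5,7) lin_comp[OF res(5) din]] by blast
    have "\<pi> (n (i (F j) q)) = \<zero>\<^bsub>direct_sum J F\<^esub>" if q: "q \<in> carrier (P1 (F j))" for q
      using n(2)[OF lin_closed[OF res(4) q]] res(9)[OF q] lin_zero[OF res(3) D(3) din] by simp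
    then obtain h where h: "lin R (P1 (F j)) Y h" "\<And>q. q \<in> carrier (P1 (F j)) \<Longrightarrow> \<alpha> (h q) = n (i (F j) q)"
      using exact_factor_left[OF ex res(1) lin_comp[OF res(4) n(1)]] by blast
    show ?thesis by (intro exI[of _ n] exI[of _ h]) (simp add: n h)
  qed
  then obtain n h where n: "\<And>j. j \<in> J \<Longrightarrow> lin R (P0 (F j)) M (n j)"
      "\<And>j p. j \<in> J \<Longrightarrow> p \<in> carrier (P0 (F j)) \<Longrightarrow> \<pi> (n j p) = ds_in J F j (e (F j) p)"
    and h: "\<And>j. j \<in> J \<Longrightarrow> lin R (P1 (F j)) Y (h j)"
      "\<And>j q. j \<in> J \<Longrightarrow> q \<in> carrier (P1 (F j)) \<Longrightarrow> n j (i (F j) q) = \<alpha> (h j q)"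
    by metis
  have ED: "ext_data R X (P1 X) (P0 X) (i X) (e X) \<X> Y M J F \<alpha> \<pi> n h" if X: "X \<in> \<X>" for X
    unfolding ext_data_def ext_data_axioms_def
    using rs[OF X] sb X F ex n h by blast
  define \<beta> where "\<beta> j = resolution.cls R (F j) (P1 (F j)) (P0 (F j)) (i (F j)) (e (F j)) Y (h j)" for j
  define B where "B X = \<beta> ` {j \<in> J. F j = X}" for X
  \<comment> \<open>Any representative of a basis class serves, since all of them have the cocycle
    \<open>h j\<close>.\<close>
  define E where "E X b = (SOME t. t \<in> b)" for X :: "('r, 'x) module" and b :: "('r, 'y, 'y \<times> 'x, 'x) ses set"
  have ne: "E (F j) (\<beta> j) \<in> \<beta> j" if j: "j \<in> J" for j
    unfolding E_def \<beta>_def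
    using resolution.cls_nonempty[OF rs[OF F[OF j]] D(1) h(1)[OF j]] by (rule someI_ex)
  have bas: "basis (End_ring R X) (Ext1 R X Y) (B X) \<and> inj_on \<beta> {j \<in> J. F j = X}" if X: "X \<in> \<X>" for X
  proof -
    interpret ext_data R X "P1 X" "P0 X" "i X" "e X" \<X> Y M J F \<alpha> \<pi> n h using ED[OF X] .
    have eq: "\<beta> j = cls Y (h j)" if "j \<in> {j \<in> J. F j = X}" for j using that by (auto simp: \<beta>_def)
    have I: "indep Y {j \<in> J. F j = X} h"
      by (rule indep_if) (use un[OF X] in \<open>auto simp: universal_at_def\<close>)
    have S: "spans Y {j \<in> J. F j = X} h"
      by (rule spans_if) (use un[OF X] in \<open>auto simp: universal_at_def\<close>)
    have inj: "inj_on (\<lambda>j. cls Y (h j)) {j \<in> J. F j = X}" using cls_inj_if_indep[OF I] .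
    have "B X = (\<lambda>j. cls Y (h j)) ` {j \<in> J. F j = X}" unfolding B_def using eq by (rule image_cong[OF refl])
    moreover have "basis (End_ring R X) (Ext1 R X Y) ((\<lambda>j. cls Y (h j)) ` {j \<in> J. F j = X})"
      using basis_iff[OF D(1) _ inj] I S h(1) by auto
    ultimately show ?thesis using inj inj_on_cong[of "{j \<in> J. F j = X}" \<beta> "\<lambda>j. cls Y (h j)"] eq by simp
  qed
  have be: "ext_bases R \<X> Y B E"
    unfolding ext_bases_def using bas ne by (auto simp: B_def)
  define J' where "J' = (SIGMA X:\<X>. B X)"
  \<comment> \<open>\<open>universal_ses\<close> indexes its summands by pairs of a member and a
    class, the given decomposition by \<open>J\<close>. Injectivity of \<theta> holds because the
    classes belonging to one X are distinct.\<close>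
  define \<theta> where "\<theta> j = (F j, \<beta> j)" for j
  have th: "bij_betw \<theta> J J'"
  proof (rule bij_betw_imageI)
    show "inj_on \<theta> J" using bas F by (auto simp: inj_on_def \<theta>_def)
    show "\<theta> ` J = J'" using F by (auto simp: \<theta>_def J'_def B_def)
  qed
  define \<tau> where "\<tau> = inv_into J \<theta>"
  have ta: "\<tau> k \<in> J" "\<theta> (\<tau> k) = k" if "k \<in> J'" for k
    using that th by (auto simp: \<tau>_def bij_betw_def inv_into_into f_inv_into_f)
  have tt: "\<tau> (\<theta> j) = j" "\<theta> j \<in> J'" if "j \<in> J" for j using that th by (auto simp: \<tau>_def bij_betw_def)
  define s where "s = (\<lambda>(X, b). E X b)"
  have sth: "s (\<theta> j) = E (F j) (\<beta> j)" for j by (simp add: s_def \<theta>_def)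
  have sj: "short_exact R (s (\<theta> j))" "ses_left (s (\<theta> j)) = Y" "ses_right (s (\<theta> j)) = F j"
    "resolution.cocycle R (P1 (F j)) (P0 (F j)) (i (F j)) (e (F j)) (s (\<theta> j)) (h j)" if j: "j \<in> J" for j
    using ne[OF j] resolution.cls_def[OF rs[OF F[OF j]]] by (auto simp: \<beta>_def sth)
  define F' where "F' k = ses_right (s k)" for k
  have sJ: "short_exact R (s k)" "ses_left (s k) = Y" "F' k = F (\<tau> k)" if "k \<in> J'" for k
    using sj[OF ta(1)[OF that]] ta(2)[OF that] by (auto simp: F'_def)
  \<comment> \<open>The k-th sequence is the push-out of the resolution along its cocycle, so
    \<alpha> and the lift \<open>n\<close> combine to a map from its middle term to M that covers
    the inclusion of the summand.\<close>
  have mu: "\<exists>\<mu>. lin R (ses_mid (s k)) M \<mu> \<and> (\<forall>y\<in>carrier Y. \<mu> (ses_inj (s k) y) = \<alpha> y) \<and>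
      (\<forall>x\<in>carrier (ses_mid (s k)). \<pi> (\<mu> x) = ds_in J F (\<tau> k) (ses_proj (s k) x))" if k: "k \<in> J'" for k
  proof -
    let ?j = "\<tau> k"
    have j: "?j \<in> J" "\<theta> ?j = k" using ta[OF k] by auto
    note sk = sj[OF j(1), unfolded j(2)]
    have al: "lin R (ses_left (s k)) M \<alpha>" using D(4) sk(2) by simp
    have din: "lin R (F ?j) (direct_sum J F) (ds_in J F ?j)" using ds_in_lin[of J R F ?j] FL j by blast
    show ?thesis
      using resolution.cocycle_univ[OF rs[OF F[OF j(1)]] sk(1,3,4) D(2) al n(1)[OF j(1)] h(2)[OF j(1)]
          D(3,5) din _ n(2)[OF j(1)]] D(9) sk(2) by metis
  qed
  then obtain \<mu> where mu: "\<And>k. k \<in> J' \<Longrightarrow> lin R (ses_mid (s k)) M (\<mu> k)"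
    "\<And>k y. k \<in> J' \<Longrightarrow> y \<in> carrier Y \<Longrightarrow> \<mu> k (ses_inj (s k) y) = \<alpha> y"
    "\<And>k x. k \<in> J' \<Longrightarrow> x \<in> carrier (ses_mid (s k)) \<Longrightarrow> \<pi> (\<mu> k x) = ds_in J F (\<tau> k) (ses_proj (s k) x)"
    by metis
  define S where "S = ses_sum J' s"
  have S: "short_exact R S" unfolding S_def using ses_sum_exact[OF R sJ(1)] .
  have Sl: "ses_left S = direct_sum J' (\<lambda>_. Y)" unfolding S_def using sJ(2) by (simp cong: direct_sum_cong)
  have Sr: "ses_right S = direct_sum J' F'" by (simp add: S_def F'_def[abs_def])
  have Sm: "ses_mid S = direct_sum J' (\<lambda>k. ses_mid (s k))" by (simp add: S_def)
  have smap: "lin R (ses_left S) Y (summation_map J' Y)" unfolding Sl using summation_map_lin[OF D(1)] .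
  define U where "U = universal_ses \<X> Y B E"
  have Ueq: "U = ses_pushout Y (summation_map J' Y) S"
    by (simp add: U_def universal_ses_def J'_def s_def S_def Let_def)
  have U: "short_exact R U" unfolding Ueq using pushout_exact(1)[OF S D(1) smap] .
  obtain m where m: "lin R (ses_mid S) (ses_mid U) m"
    "\<And>y. y \<in> carrier (ses_left S) \<Longrightarrow> m (ses_inj S y) = ses_inj U (summation_map J' Y y)"
    "\<And>x. x \<in> carrier (ses_mid S) \<Longrightarrow> ses_proj U (m x) = ses_proj S x"
    using pushout_exact(2)[OF S D(1) smap] unfolding Ueq by blast
  have exU: "exact R Y (ses_mid U) (direct_sum J' F') (ses_inj U) (ses_proj U)"
    using U Sr by (simp add: short_exact_iff Ueq)
  note DU = exactD[OF exU]
  have exS: "exact R (ses_left S) (ses_mid S) (direct_sum J' F') (ses_inj S) (ses_proj S)"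
    using S Sr by (simp add: short_exact_iff)
  note DS = exactD[OF exS]
  have Dk: "exact R Y (ses_mid (s k)) (F' k) (ses_inj (s k)) (ses_proj (s k))" if "k \<in> J'" for k
    using sJ(1,2)[OF that] by (simp add: short_exact_iff F'_def)
  have F'L: "left_module R (F' k)" if "k \<in> J'" for k using exactD(3)[OF Dk[OF that]] .
  let ?E = "\<lambda>k. ses_mid (s k)"
  define \<mu>S where "\<mu>S = ds_map J' ?E M \<mu>"
  have muS: "lin R (ses_mid S) M \<mu>S" unfolding Sm \<mu>S_def
    using exactD(2)[OF Dk] mu(1) by (intro ds_map_lin[OF R _ D(2)]) auto
  have muSin: "\<mu>S (ds_in J' ?E k x) = \<mu> k x" if "k \<in> J'" "x \<in> carrier (?E k)" for k x
    unfolding \<mu>S_def using exactD(2)[OF Dk] mu(1) that by (intro ds_map_in[OF _ D(2)]) auto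
  have Sinj: "ses_inj S (ds_in J' (\<lambda>_. Y) k y) = ds_in J' ?E k (ses_inj (s k) y)"
    if ky: "k \<in> J'" "y \<in> carrier Y" for k y
  proof -
    have "ds_in J' (\<lambda>_. Y) k y \<in> carrier (ses_left S)"
      unfolding Sl using lin_closed[OF ds_in_lin[of J' R "\<lambda>_. Y" k]] D(1) ky by blast
    then have "ses_inj S (ds_in J' (\<lambda>_. Y) k y) = (\<lambda>l\<in>J'. ses_inj (s l) (ds_in J' (\<lambda>_. Y) k y l))"
      by (simp add: S_def ses_sum_def Let_def)
    also have "\<dots> = ds_in J' ?E k (ses_inj (s k) y)"
      using lin_zero[OF exactD(1,2,4)[OF Dk]] by (intro direct_sum_map_in) auto
    finally show ?thesis .
  qed
  have Sproj: "ses_proj S (ds_in J' ?E k x) = ds_in J' F' k (ses_proj (s k) x)"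
    if kx: "k \<in> J'" "x \<in> carrier (?E k)" for k x
  proof -
    have "ds_in J' ?E k x \<in> carrier (ses_mid S)"
      unfolding Sm using lin_closed[OF ds_in_lin[of J' R ?E k]] exactD(2)[OF Dk] kx by blast
    then have "ses_proj S (ds_in J' ?E k x) = (\<lambda>l\<in>J'. ses_proj (s l) (ds_in J' ?E k x l))"
      by (simp add: S_def ses_sum_def Let_def)
    also have "\<dots> = ds_in J' F' k (ses_proj (s k) x)"
      using lin_zero[OF exactD(2,3,5)[OF Dk]] by (intro direct_sum_map_in) auto
    finally show ?thesis .
  qed
  \<comment> \<open>Compatibility with the summation map, checked on one summand at a time, is what
    lets \<mu>S factor through the push-out.\<close>
  have comp: "\<mu>S (ses_inj S v) = \<alpha> (summation_map J' Y v)" if v: "v \<in> carrier (ses_left S)" for v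
  proof (rule direct_sum_lin_eq[OF R _ D(2) _ _ _ v[unfolded Sl]])
    show "lin R (direct_sum J' (\<lambda>_. Y)) M (\<lambda>v. \<mu>S (ses_inj S v))" using lin_comp[OF DS(4) muS] by (simp add: Sl)
    show "lin R (direct_sum J' (\<lambda>_. Y)) M (\<lambda>v. \<alpha> (summation_map J' Y v))"
      using lin_comp[OF summation_map_lin[OF D(1)] D(4)] .
    fix k y assume ky: "k \<in> J'" "y \<in> carrier Y"
    show "\<mu>S (ses_inj S (ds_in J' (\<lambda>_. Y) k y)) = \<alpha> (summation_map J' Y (ds_in J' (\<lambda>_. Y) k y))"
      using Sinj[OF ky] muSin[OF ky(1) lin_closed[OF exactD(4)[OF Dk[OF ky(1)]] ky(2)]] mu(2)[OF ky]
        summation_map_in[OF D(1) ky] by simp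
  qed (rule D(1))
  have "\<exists>\<Phi>. lin R (ses_mid U) M \<Phi> \<and> (\<forall>t\<in>carrier Y. \<Phi> (ses_inj U t) = \<alpha> t) \<and>
      (\<forall>x\<in>carrier (ses_mid S). \<Phi> (m x) = \<mu>S x)"
    by (rule pushout_univ[OF exS exU smap m(1) _ _ D(2,4) muS]) (use m(2,3) comp in auto)
  then obtain \<Phi> where Ph: "lin R (ses_mid U) M \<Phi>" "\<And>t. t \<in> carrier Y \<Longrightarrow> \<Phi> (ses_inj U t) = \<alpha> t"
    "\<And>x. x \<in> carrier (ses_mid S) \<Longrightarrow> \<Phi> (m x) = \<mu>S x"
    by blast
  define \<rho> where "\<rho> v = (\<lambda>j\<in>J. v (\<theta> j))" for v :: "('r, 'x) module \<times> ('r, 'y, 'y \<times> 'x, 'x) ses set \<Rightarrow> 'x"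
  have F'th: "F' (\<theta> j) = F j" if "j \<in> J" for j using sJ(3)[of "\<theta> j"] tt[OF that] by simp
  have rho: "lin R (direct_sum J' F') (direct_sum J F) \<rho>"
    "bij_betw \<rho> (carrier (direct_sum J' F')) (carrier (direct_sum J F))"
    unfolding \<rho>_def
    by (rule direct_sum_reindex[OF R _ th], use FL F'th in auto)+
  have pm: "\<pi> (\<mu>S x) = \<rho> (ses_proj S x)" if x: "x \<in> carrier (ses_mid S)" for x
  proof (rule direct_sum_lin_eq[OF R _ D(3) _ _ _ x[unfolded Sm]])
    show "lin R (direct_sum J' ?E) (direct_sum J F) (\<lambda>x. \<pi> (\<mu>S x))" using lin_comp[OF muS D(5)] by (simp add: Sm)
    show "lin R (direct_sum J' ?E) (direct_sum J F) (\<lambda>x. \<rho> (ses_proj S x))"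
      using lin_comp[OF DS(5) rho(1)] by (simp add: Sm)
    fix k x assume kx: "k \<in> J'" "x \<in> carrier (?E k)"
    have "\<rho> (ds_in J' F' k z) = ds_in J F (\<tau> k) z" for z
      unfolding \<rho>_def ds_in_def
    proof (rule restrict_ext)
      fix j assume j: "j \<in> J"
      have "\<theta> j = k \<longleftrightarrow> j = \<tau> k" using tt[OF j] ta[OF kx(1)] by auto
      then show "(\<lambda>j\<in>J'. if j = k then z else \<zero>\<^bsub>F' j\<^esub>) (\<theta> j) = (if j = \<tau> k then z else \<zero>\<^bsub>F j\<^esub>)"
        using tt(2)[OF j] F'th[OF j] by simp
    qed
    then show "\<pi> (\<mu>S (ds_in J' ?E k x)) = \<rho> (ses_proj S (ds_in J' ?E k x))"
      using muSin[OF kx] Sproj[OF kx] mu(3)[OF kx] by simp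
  qed (rule exactD(2)[OF Dk])
  have pPh: "\<pi> (\<Phi> u) = \<rho> (ses_proj U u)" if u: "u \<in> carrier (ses_mid U)" for u
  proof -
    obtain t x where t: "t \<in> carrier Y" "x \<in> carrier (ses_mid S)" "u = ses_inj U t \<oplus>\<^bsub>ses_mid U\<^esub> m x"
      using pushout_generate[OF exS exU m(1,3) u] by blast
    note c = lin_closed[OF DU(4) t(1)] lin_closed[OF m(1) t(2)]
    have "\<pi> (\<Phi> u) = \<pi> (\<alpha> t) \<oplus>\<^bsub>direct_sum J F\<^esub> \<pi> (\<mu>S x)"
      using lin_add[OF lin_comp[OF Ph(1) D(5)] c] t Ph(2,3) by metis
    also have "\<dots> = \<rho> (ses_proj U (ses_inj U t)) \<oplus>\<^bsub>direct_sum J F\<^esub> \<rho> (ses_proj U (m x))"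
      using D(9)[OF t(1)] DU(9)[OF t(1)] lin_zero[OF DU(3) D(3) rho(1)] pm[OF t(2)] m(3)[OF t(2)] by metis
    also have "\<dots> = \<rho> (ses_proj U u)" using lin_add[OF lin_comp[OF DU(5) rho(1)] c] t(3) by metis
    finally show ?thesis .
  qed
  \<comment> \<open>\<Phi> is the identity on Y and induces the reindexing isomorphism \<rho> on
    quotients.\<close>
  have Phb: "bij_betw \<Phi> (carrier (ses_mid U)) (carrier M)"
    by (rule five_lemma[OF exU ex Ph(1) rho(2,1)]) (use Ph(2) pPh in auto)
  define \<phi> where "\<phi> = inv_into (carrier (ses_mid U)) \<Phi>"
  have ph: "lin R M (ses_mid U) \<phi>" unfolding \<phi>_def using lin_inv_into[OF DU(2) D(2) Ph(1) Phb] .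
  have phb: "bij_betw \<phi> (carrier M) (carrier (ses_mid U))" unfolding \<phi>_def using bij_betw_inv_into[OF Phb] .
  have ph\<alpha>: "\<phi> (\<alpha> y) = ses_inj U y" if "y \<in> carrier Y" for y
    using Ph(2)[OF that] lin_closed[OF DU(4) that] Phb by (metis \<phi>_def bij_betw_inv_into_left)
  let ?Q = "quot_mod M (\<alpha> ` carrier Y)" and ?q = "quot_proj M (\<alpha> ` carrier Y)"
  have exQ: "exact R Y M ?Q \<alpha> ?q" using quot_exact[OF D(1,2,4,6)] .
  note DQ = exactD[OF exQ]
  note prph = lin_comp[OF ph DU(5)]
  have exM: "exact R Y M (direct_sum J' F') \<alpha> (\<lambda>x. ses_proj U (\<phi> x))"
    using exact_iso_mid[OF exU D(2) ph phb D(4) ph\<alpha>] .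
  note DM = exactD[OF exM]
  have "ses_proj U (\<phi> x) = \<zero>\<^bsub>direct_sum J' F'\<^esub>" if "x \<in> carrier M" "?q x = \<zero>\<^bsub>?Q\<^esub>" for x
    using DQ(8)[OF that(1)] that(2) DM(8)[OF that(1)] by blast
  \<comment> \<open>The definition of a universal inclusion refers to the quotient by the image of
    \<alpha>, so the isomorphism of right-hand terms has to start from
    \<open>quot_mod\<close>.\<close>
  then obtain \<psi> where psi: "lin R ?Q (direct_sum J' F') \<psi>" "\<And>x. x \<in> carrier M \<Longrightarrow> \<psi> (?q x) = ses_proj U (\<phi> x)"
    using lin_factor[OF D(2) DQ(3) DU(3) DQ(5,7) prph] by blast
  have psib: "bij_betw \<psi> (carrier ?Q) (carrier (direct_sum J' F'))"
  proof (rule bij_betw_imageI)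
    show "inj_on \<psi> (carrier ?Q)" unfolding lin_inj_iff[OF DQ(3) DU(3) psi(1)]
    proof (intro ballI impI)
      fix c assume "c \<in> carrier ?Q" and z: "\<psi> c = \<zero>\<^bsub>direct_sum J' F'\<^esub>"
      then obtain x where x: "x \<in> carrier M" "?q x = c" using DQ(10) by blast
      then have "x \<in> \<alpha> ` carrier Y" using z psi(2)[OF x(1)] DM(8)[OF x(1)] by metis
      then show "c = \<zero>\<^bsub>?Q\<^esub>" using DQ(8)[OF x(1)] x(2) by blast
    qed
    have "\<psi> ` (?q ` carrier M) = (\<lambda>x. ses_proj U (\<phi> x)) ` carrier M"
      unfolding image_image using psi(2) by (rule image_cong[OF refl])
    then show "\<psi> ` carrier ?Q = carrier (direct_sum J' F')" using DQ(7) DM(7) by metis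
  qed
  have Ul: "ses_left U = Y" "ses_right U = direct_sum J' F'" by (simp_all add: Ueq Sr)
  have "ses_iso_under R \<lparr>ses_left = Y, ses_mid = M, ses_right = ?Q, ses_inj = \<alpha>, ses_proj = ?q\<rparr> U"
    unfolding ses_iso_under_def
  proof (intro conjI bexI[of _ "restrict \<phi> (carrier M)"] bexI[of _ "restrict \<psi> (carrier ?Q)"])
    show "restrict \<phi> (carrier M) \<in> mod_iso R (ses_mid \<lparr>ses_left = Y, ses_mid = M, ses_right = ?Q, ses_inj = \<alpha>, ses_proj = ?q\<rparr>) (ses_mid U)"
      using lin_restrict[OF D(2) ph] phb by (simp add: mod_iso_def bij_betw_restrict_eq)
    show "restrict \<psi> (carrier ?Q) \<in> mod_iso R (ses_right \<lparr>ses_left = Y, ses_mid = M, ses_right = ?Q, ses_inj = \<alpha>, ses_proj = ?q\<rparr>) (ses_right U)"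
      using lin_restrict[OF DQ(3) psi(1)] psib unfolding Ul(2) mod_iso_def bij_betw_restrict_eq by simp
  qed (use Ul ph\<alpha> psi(2) lin_closed[OF D(4)] lin_closed[OF DQ(5)] in auto)
  moreover have "\<alpha> \<in> mod_hom R Y M" using D(4) ext by (simp add: mod_hom_iff)
  ultimately show ?thesis unfolding universal_inclusion_def using D(1,2,6) be U_def by blast
qed

section \<open>Filtrations\<close>

lemma submodule_submod_of:
  assumes M: "left_module R M" and N: "submodule N R M" and K: "submodule K R M" "K \<subseteq> N"
  shows "submodule K R (submod_of M N)"
  using submoduleD[OF M K(1)] K(2) by (intro submoduleI'[OF submod_of_left_module[OF M N]]) auto

text \<open>A factor N/K is isomorphic to X exactly when N maps onto X with kernel K. In this form a
  factor can be moved along a homomorphism by composition, without handling isomorphisms between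
  quotients.\<close>

lemma isomorphic_quot_iff:
  assumes M: "left_module R M" and N: "submodule N R M" and K: "submodule K R M" "K \<subseteq> N" and X: "left_module R X"
  shows "isomorphic R (quot_mod (submod_of M N) K) X \<longleftrightarrow>
    (\<exists>g. lin R (submod_of M N) X g \<and> g ` N = carrier X \<and> (\<forall>x\<in>N. g x = \<zero>\<^bsub>X\<^esub> \<longleftrightarrow> x \<in> K))"
proof -
  have N': "left_module R (submod_of M N)" using submod_of_left_module[OF M N] .
  have K': "submodule K R (submod_of M N)" using submodule_submod_of[OF M N K] .
  let ?Q = "quot_mod (submod_of M N) K" and ?q = "quot_proj (submod_of M N) K"
  have Q: "left_module R ?Q" using quot_mod_left_module[OF N' K'] .
  have q: "lin R (submod_of M N) ?Q ?q" using quot_proj_lin[OF N' K'] .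
  have qs: "?q ` N = carrier ?Q" using quot_proj_image[of "submod_of M N" K] by simp
  have q0: "?q x = \<zero>\<^bsub>?Q\<^esub> \<longleftrightarrow> x \<in> K" if "x \<in> N" for x using quot_proj_zero_iff[OF N' K', of x] that by simp
  show ?thesis
  proof
    assume "isomorphic R ?Q X"
    then obtain h where h: "lin R ?Q X h" "bij_betw h (carrier ?Q) (carrier X)"
      by (auto simp: isomorphic_def mod_iso_def mod_hom_iff)
    have "h (?q x) = \<zero>\<^bsub>X\<^esub> \<longleftrightarrow> x \<in> K" if x: "x \<in> N" for x
    proof -
      have c: "?q x \<in> carrier ?Q" using x qs by blast
      have "h (?q x) = \<zero>\<^bsub>X\<^esub> \<longleftrightarrow> ?q x = \<zero>\<^bsub>?Q\<^esub>"
        using lin_inj_iff[OF Q X h(1)] h(2) lin_zero[OF Q X h(1)] c by (auto simp: bij_betw_def)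
      then show ?thesis using q0[OF x] by simp
    qed
    moreover have "(\<lambda>x. h (?q x)) ` N = carrier X"
      using qs h(2) by (metis bij_betw_imp_surj_on image_image)
    ultimately show "\<exists>g. lin R (submod_of M N) X g \<and> g ` N = carrier X \<and> (\<forall>x\<in>N. g x = \<zero>\<^bsub>X\<^esub> \<longleftrightarrow> x \<in> K)"
      using lin_comp[OF q h(1)] by (intro exI[of _ "\<lambda>x. h (?q x)"]) auto
  next
    assume "\<exists>g. lin R (submod_of M N) X g \<and> g ` N = carrier X \<and> (\<forall>x\<in>N. g x = \<zero>\<^bsub>X\<^esub> \<longleftrightarrow> x \<in> K)"
    then obtain g where g: "lin R (submod_of M N) X g" "g ` N = carrier X" "\<And>x. x \<in> N \<Longrightarrow> g x = \<zero>\<^bsub>X\<^esub> \<longleftrightarrow> x \<in> K"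
      by blast
    have z: "g x = \<zero>\<^bsub>X\<^esub>" if "x \<in> carrier (submod_of M N)" "?q x = \<zero>\<^bsub>?Q\<^esub>" for x
      using that q0 g(3) by auto
    obtain h where h: "lin R ?Q X h" "\<And>x. x \<in> carrier (submod_of M N) \<Longrightarrow> h (?q x) = g x"
      using lin_factor[OF N' Q X q quot_proj_image g(1) z] by blast
    have hq: "h (?q x) = g x" if "x \<in> N" for x using h(2)[of x] that by simp
    have "inj_on h (carrier ?Q)" unfolding lin_inj_iff[OF Q X h(1)]
    proof (intro ballI impI)
      fix c assume "c \<in> carrier ?Q" and hc: "h c = \<zero>\<^bsub>X\<^esub>"
      then obtain x where x: "x \<in> N" "c = ?q x" using qs by (metis imageE)
      then show "c = \<zero>\<^bsub>?Q\<^esub>" using hq[OF x(1)] hc g(3)[OF x(1)] q0[OF x(1)] by metis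
    qed
    moreover have "h ` carrier ?Q = carrier X"
    proof -
      have "h ` (?q ` N) = g ` N" unfolding image_image using hq by (rule image_cong[OF refl])
      then show ?thesis using qs g(2) by metis
    qed
    ultimately have "restrict h (carrier ?Q) \<in> mod_iso R ?Q X"
      by (intro lin_restrict_iso[OF Q h(1)] bij_betw_imageI)
    then show "isomorphic R ?Q X" unfolding isomorphic_def by blast
  qed
qed

section \<open>Sums of images of homomorphisms\<close>

fun sumim :: "('r, 'm) module \<Rightarrow> (('r, 'x) module \<times> ('x \<Rightarrow> 'm)) list \<Rightarrow> 'm set" where
  "sumim Q [] = {\<zero>\<^bsub>Q\<^esub>}"
| "sumim Q ((X, f) # L) = {f x \<oplus>\<^bsub>Q\<^esub> m | x m. x \<in> carrier X \<and> m \<in> sumim Q L}"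

lemma sumim_subset:
  assumes Q: "left_module R Q" and "\<And>X f. (X, f) \<in> set L \<Longrightarrow> lin R X Q f"
  shows "sumim Q L \<subseteq> carrier Q"
proof -
  interpret Q: abelian_group Q using Q by (rule left_module_abelian_group)
  show ?thesis using assms(2)
  proof (induction L)
    case (Cons a L)
    obtain X f where a: "a = (X, f)" by (cases a)
    have "lin R X Q f" using Cons.prems a by simp
    moreover have "sumim Q L \<subseteq> carrier Q" using Cons by simp
    ultimately show ?case using a by (auto simp: lin_closed)
  qed simp
qed

lemma sumim_map:
  assumes Q: "left_module R Q" and T: "lin R Q Q T" and "\<And>X f. (X, f) \<in> set L \<Longrightarrow> lin R X Q f"
  shows "sumim Q (map (\<lambda>(X, f). (X, \<lambda>x. T (f x))) L) = T ` sumim Q L"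
  using assms(3)
proof (induction L)
  case Nil
  then show ?case using lin_zero[OF Q Q T] by simp
next
  case (Cons a L)
  obtain X f where a: "a = (X, f)" by (cases a)
  have f: "lin R X Q f" using Cons.prems a by simp
  have sub: "sumim Q L \<subseteq> carrier Q" using sumim_subset[OF Q, of L] Cons.prems by simp
  have add: "T (f x \<oplus>\<^bsub>Q\<^esub> m) = T (f x) \<oplus>\<^bsub>Q\<^esub> T m" if "x \<in> carrier X" "m \<in> sumim Q L" for x m
    using lin_add[OF T lin_closed[OF f that(1)]] sub that(2) by blast
  have IH: "sumim Q (map (\<lambda>(X, f). (X, \<lambda>x. T (f x))) L) = T ` sumim Q L" using Cons by simp
  show ?case
  proof (intro Set.set_eqI iffI)
    fix q assume "q \<in> sumim Q (map (\<lambda>(X, f). (X, \<lambda>x. T (f x))) (a # L))"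
    then obtain x m where "x \<in> carrier X" "m \<in> sumim Q L" "q = T (f x) \<oplus>\<^bsub>Q\<^esub> T m" using a IH by auto
    then have "q = T (f x \<oplus>\<^bsub>Q\<^esub> m)" "f x \<oplus>\<^bsub>Q\<^esub> m \<in> sumim Q (a # L)" using add a by auto
    then show "q \<in> T ` sumim Q (a # L)" by blast
  next
    fix q assume "q \<in> T ` sumim Q (a # L)"
    then obtain x m where "x \<in> carrier X" "m \<in> sumim Q L" "q = T (f x \<oplus>\<^bsub>Q\<^esub> m)" using a by auto
    then show "q \<in> sumim Q (map (\<lambda>(X, f). (X, \<lambda>x. T (f x))) (a # L))" using a IH add by auto
  qed
qed

text \<open>
  The induction splits off the image of the first map of the list and passes to the complementary idempotent.
\<close>

lemma sumim_dichotomy: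
  assumes Q: "left_module R Q"
    and split: "\<And>X f x. X \<in> \<X> \<Longrightarrow> lin R X Q f \<Longrightarrow> x \<in> carrier X \<Longrightarrow> f x \<noteq> \<zero>\<^bsub>Q\<^esub> \<Longrightarrow>
      \<exists>r. lin R Q X r \<and> (\<forall>y\<in>carrier X. r (f y) = y)"
    and LM: "\<And>X. X \<in> \<X> \<Longrightarrow> left_module R X"
    and L: "\<And>X f. (X, f) \<in> set L \<Longrightarrow> X \<in> \<X> \<and> lin R X Q f"
    and g: "X' \<in> \<X>" "lin R X' Q g" and x: "x \<in> carrier X'" "x \<noteq> \<zero>\<^bsub>X'\<^esub>" "g x \<in> sumim Q L" and z: "z \<in> carrier X'"
  shows "g z \<in> sumim Q L"
proof -
  interpret Q: abelian_group Q using Q by (rule left_module_abelian_group)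
  show ?thesis using L g(2) x(3) z
  \<comment> \<open>Induction on the length, since the list passed to the induction hypothesis has
    its maps composed with an endomorphism of \<open>Q\<close>.\<close>
  proof (induction L arbitrary: g z rule: length_induct)
    case (1 L)
    note IH = "1.IH"[rule_format] and L = "1.prems"(1) and gl = "1.prems"(2) and gx = "1.prems"(3) and zc = "1.prems"(4)
    show ?case
    proof (cases L)
      case Nil
      then have gx0: "g x = \<zero>\<^bsub>Q\<^esub>" using gx by simp
      \<comment> \<open>A nonzero \<open>g\<close> has a retraction and is therefore injective, but
        \<open>g\<close> kills the nonzero \<open>x\<close>.\<close>
      have "g z = \<zero>\<^bsub>Q\<^esub>"
      proof (rule ccontr)
        assume "g z \<noteq> \<zero>\<^bsub>Q\<^esub>"
        then obtain r where r: "lin R Q X' r" "\<forall>y\<in>carrier X'. r (g y) = y" using split[OF g(1) gl zc] by blast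
        then have "x = r \<zero>\<^bsub>Q\<^esub>" using x(1) gx0 by metis
        then show False using x(2) lin_zero[OF Q LM[OF g(1)] r(1)] by simp
      qed
      then show ?thesis using Nil by simp
    next
      case (Cons a L')
      obtain X f where a: "a = (X, f)" by (cases a)
      have X: "X \<in> \<X>" and f: "lin R X Q f" using L[of X f] Cons a by auto
      have L': "\<And>X f. (X, f) \<in> set L' \<Longrightarrow> X \<in> \<X> \<and> lin R X Q f" using L Cons by auto
      have sub: "sumim Q L' \<subseteq> carrier Q" using sumim_subset[OF Q, of L'] L' by blast
      obtain y m where y: "y \<in> carrier X" "m \<in> sumim Q L'" "g x = f y \<oplus>\<^bsub>Q\<^esub> m" using gx Cons a by auto
      have mc: "m \<in> carrier Q" using y(2) sub by blast
      have XM: "left_module R X" using LM[OF X] .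
      interpret X: abelian_group X using XM by (rule left_module_abelian_group)
      show ?thesis
      proof (cases "\<exists>u\<in>carrier X. f u \<noteq> \<zero>\<^bsub>Q\<^esub>")
        case False
        then have "g x = m" using y mc by simp
        then have "g z \<in> sumim Q L'" using IH[of L' g z] L' gl y(2) zc Cons by auto
        then have "f \<zero>\<^bsub>X\<^esub> \<oplus>\<^bsub>Q\<^esub> g z \<in> sumim Q L" using Cons a by auto
        then show ?thesis using lin_zero[OF XM Q f] lin_closed[OF gl zc] by simp
      next
        case True
        then obtain r where r: "lin R Q X r" "\<And>u. u \<in> carrier X \<Longrightarrow> r (f u) = u" using split[OF X f] by blast
        \<comment> \<open>The idempotent whose kernel is the image of \<open>f\<close>.\<close>
        define T where "T q = q \<ominus>\<^bsub>Q\<^esub> f (r q)" for q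
        have T: "lin R Q Q T" unfolding T_def using lin_minus_map[OF Q lin_id lin_comp[OF r(1) f]] .
        have Tf: "T (f u) = \<zero>\<^bsub>Q\<^esub>" if "u \<in> carrier X" for u
          using r(2)[OF that] lin_closed[OF f that] by (simp add: T_def Q.minus_zero_iff)
        let ?L = "map (\<lambda>(X, f). (X, \<lambda>x. T (f x))) L'"
        have sT: "sumim Q ?L = T ` sumim Q L'" using sumim_map[OF Q T, of L'] L' by blast
        have "T (g x) = T m" using lin_add[OF T lin_closed[OF f y(1)] mc] Tf[OF y(1)] y(3) lin_closed[OF T mc] by simp
        then have "T (g x) \<in> sumim Q ?L" using sT y(2) by simp
        moreover have "X \<in> \<X> \<and> lin R X Q f" if "(X, f) \<in> set ?L" for X f
          using that L' lin_comp[OF _ T] by auto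
        ultimately have "T (g z) \<in> sumim Q ?L"
          using IH[of ?L "\<lambda>z. T (g z)" z] lin_comp[OF gl T] zc Cons by simp
        then obtain m' where m': "m' \<in> sumim Q L'" "T (g z) = T m'" using sT by auto
        have m'c: "m' \<in> carrier Q" using m'(1) sub by blast
        note c = lin_closed[OF gl zc]
        have rc: "r (g z) \<in> carrier X" "r m' \<in> carrier X" using lin_closed[OF r(1)] c m'c by auto
        note fc = lin_closed[OF f rc(1)] lin_closed[OF f rc(2)]
        \<comment> \<open>Equality of T (g z) and T m' means that g z and m' differ by an element of
          the image of \<open>f\<close>, the head of the list.\<close>
        have "g z = f (r (g z)) \<oplus>\<^bsub>Q\<^esub> T (g z)" unfolding T_def using Q.add_minus_cancel[OF c fc(1)] by simp
        also have "\<dots> = f (r (g z)) \<oplus>\<^bsub>Q\<^esub> (m' \<ominus>\<^bsub>Q\<^esub> f (r m'))" using m'(2) by (simp add: T_def)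
        also have "\<dots> = f (r (g z) \<ominus>\<^bsub>X\<^esub> r m') \<oplus>\<^bsub>Q\<^esub> m'"
          using lin_minus[OF XM Q f rc] fc m'c by (simp add: Q.minus_eq Q.a_ac)
        finally show ?thesis using rc m'(1) Cons a X.minus_closed by fastforce
      qed
    qed
  qed
qed

text \<open>The submodule generated by the images of a possibly infinite family, as a union over
  finite lists of its members.\<close>

definition family_sum :: "('r, 'm) module \<Rightarrow> (('r, 'x) module \<times> ('x \<Rightarrow> 'm)) set \<Rightarrow> 'm set" where
  "family_sum Q S = {q. \<exists>L. set L \<subseteq> S \<and> q \<in> sumim Q L}"

lemma family_sum_mono: "S \<subseteq> S' \<Longrightarrow> family_sum Q S \<subseteq> family_sum Q S'"
  by (auto simp: family_sum_def)

lemma sumim_append_add: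
  assumes Q: "left_module R Q" and L: "\<And>X f. (X, f) \<in> set L \<union> set L' \<Longrightarrow> lin R X Q f"
    and u: "u \<in> sumim Q L" and v: "v \<in> sumim Q L'"
  shows "u \<oplus>\<^bsub>Q\<^esub> v \<in> sumim Q (L @ L')"
proof -
  interpret Q: abelian_group Q using Q by (rule left_module_abelian_group)
  have vc: "v \<in> carrier Q" using v sumim_subset[OF Q, of L'] L by blast
  show ?thesis using L u
  proof (induction L arbitrary: u)
    case Nil
    then show ?case using v vc by simp
  next
    case (Cons a L)
    obtain X f where a: "a = (X, f)" by (cases a)
    have f: "lin R X Q f" using Cons.prems a by auto
    obtain x m where x: "x \<in> carrier X" "m \<in> sumim Q L" "u = f x \<oplus>\<^bsub>Q\<^esub> m" using Cons.prems a by auto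
    have mc: "m \<in> carrier Q" using x(2) sumim_subset[OF Q, of L] Cons.prems(1) by auto
    have "m \<oplus>\<^bsub>Q\<^esub> v \<in> sumim Q (L @ L')" using Cons.IH[of m] Cons.prems(1) x(2) by auto
    moreover have "u \<oplus>\<^bsub>Q\<^esub> v = f x \<oplus>\<^bsub>Q\<^esub> (m \<oplus>\<^bsub>Q\<^esub> v)" using x mc vc lin_closed[OF f x(1)] by (simp add: Q.a_assoc)
    ultimately show ?case using a x(1) by auto
  qed
qed

lemma family_sum_submodule:
  assumes Q: "left_module R Q" and S: "\<And>X f. (X, f) \<in> S \<Longrightarrow> left_module R X \<and> lin R X Q f"
  shows "submodule (family_sum Q S) R Q"
proof (rule submoduleI'[OF Q])
  show "family_sum Q S \<subseteq> carrier Q" using sumim_subset[OF Q] S by (fastforce simp: family_sum_def)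
  show "\<zero>\<^bsub>Q\<^esub> \<in> family_sum Q S" by (auto simp: family_sum_def intro!: exI[of _ "[]"])
  fix u v assume "u \<in> family_sum Q S" "v \<in> family_sum Q S"
  then obtain L L' where L: "set L \<subseteq> S" "u \<in> sumim Q L" "set L' \<subseteq> S" "v \<in> sumim Q L'" by (auto simp: family_sum_def)
  then have "u \<oplus>\<^bsub>Q\<^esub> v \<in> sumim Q (L @ L')" using S by (intro sumim_append_add[OF Q]) auto
  then show "u \<oplus>\<^bsub>Q\<^esub> v \<in> family_sum Q S" using L by (auto simp: family_sum_def intro!: exI[of _ "L @ L'"])
next
  fix a u assume a: "a \<in> carrier R" and "u \<in> family_sum Q S"
  then obtain L where L: "set L \<subseteq> S" "u \<in> sumim Q L" by (auto simp: family_sum_def)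
  then have "a \<odot>\<^bsub>Q\<^esub> u \<in> sumim Q L"
  proof (induction L arbitrary: u)
    case Nil
    then show ?case using left_module_smult_zero[OF Q a] by simp
  next
    case (Cons b L)
    obtain X f where b: "b = (X, f)" by (cases b)
    have f: "lin R X Q f" "left_module R X" using Cons.prems b S by auto
    obtain x m where x: "x \<in> carrier X" "m \<in> sumim Q L" "u = f x \<oplus>\<^bsub>Q\<^esub> m" using Cons.prems b by auto
    have mc: "m \<in> carrier Q" using x(2) sumim_subset[OF Q, of L] Cons.prems(1) S by force
    have "a \<odot>\<^bsub>Q\<^esub> m \<in> sumim Q L" using Cons.IH[of m] Cons.prems(1) x(2) by auto
    moreover have "a \<odot>\<^bsub>Q\<^esub> u = f (a \<odot>\<^bsub>X\<^esub> x) \<oplus>\<^bsub>Q\<^esub> a \<odot>\<^bsub>Q\<^esub> m"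
      using x mc lin_closed[OF f(1) x(1)] lin_smult[OF f(1) a x(1)] left_module.smult_r_distr[OF Q a] by simp
    ultimately show ?case using b left_module.smult_closed[OF f(2) a x(1)] by auto
  qed
  then show "a \<odot>\<^bsub>Q\<^esub> u \<in> family_sum Q S" using L by (auto simp: family_sum_def)
qed

lemma family_sum_image:
  assumes Q: "left_module R Q" and "(X, f) \<in> S" "lin R X Q f" "x \<in> carrier X"
  shows "f x \<in> family_sum Q S"
proof -
  interpret Q: abelian_group Q using Q by (rule left_module_abelian_group)
  have "f x \<in> sumim Q [(X, f)]" using assms lin_closed[OF assms(3,4)] by auto (metis Q.r_zero)
  then show ?thesis using assms(2) unfolding family_sum_def by (intro CollectI exI[of _ "[(X, f)]"]) simp
qed

text \<open>The contributions of \<open>f'\<close> to a list are collected into a single element of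
  its domain, however often \<open>f'\<close> occurs.\<close>

lemma family_sum_insert:
  assumes Q: "left_module R Q" and f': "left_module R X'" "lin R X' Q f'"
    and u: "u \<in> family_sum Q (insert (X', f') S)"
    and S': "\<And>X f. (X, f) \<in> S \<Longrightarrow> left_module R X \<and> lin R X Q f"
  shows "\<exists>x\<in>carrier X'. \<exists>m\<in>family_sum Q S. u = f' x \<oplus>\<^bsub>Q\<^esub> m"
proof -
  interpret Q: abelian_group Q using Q by (rule left_module_abelian_group)
  interpret X': abelian_group X' using f'(1) by (rule left_module_abelian_group)
  have FS: "submodule (family_sum Q S) R Q" using family_sum_submodule[OF Q S'] .
  note D = submoduleD[OF Q FS]
  obtain L where "set L \<subseteq> insert (X', f') S" "u \<in> sumim Q L" using u by (auto simp: family_sum_def)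
  then show ?thesis
  proof (induction L arbitrary: u)
    case Nil
    then show ?case using D(2) lin_zero[OF f'(1) Q f'(2)]
      by (intro bexI[of _ "\<zero>\<^bsub>X'\<^esub>"] bexI[of _ "\<zero>\<^bsub>Q\<^esub>"]) auto
  next
    case (Cons b L)
    obtain X f where b: "b = (X, f)" by (cases b)
    obtain y m where y: "y \<in> carrier X" "m \<in> sumim Q L" "u = f y \<oplus>\<^bsub>Q\<^esub> m" using Cons.prems b by auto
    obtain x m' where x: "x \<in> carrier X'" "m' \<in> family_sum Q S" "m = f' x \<oplus>\<^bsub>Q\<^esub> m'"
      using Cons.IH[of m] Cons.prems(1) y(2) by auto
    have m'c: "m' \<in> carrier Q" using x(2) D(1) by blast
    note fx = lin_closed[OF f'(2) x(1)]
    show ?case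
    proof (cases "b = (X', f')")
      case True
      then have "u = f' (y \<oplus>\<^bsub>X'\<^esub> x) \<oplus>\<^bsub>Q\<^esub> m'" "y \<oplus>\<^bsub>X'\<^esub> x \<in> carrier X'"
        using b y x fx m'c lin_closed[OF f'(2), of y] lin_add[OF f'(2), of y x] by (auto simp: Q.a_assoc)
      then show ?thesis using x(2) by blast
    next
      case False
      then have bS: "(X, f) \<in> S" using Cons.prems(1) b by auto
      then have f: "lin R X Q f" using S' by blast
      have "f y \<oplus>\<^bsub>Q\<^esub> m' \<in> family_sum Q S" using D(3)[OF family_sum_image[OF Q bS f y(1)] x(2)] .
      moreover have "u = f' x \<oplus>\<^bsub>Q\<^esub> (f y \<oplus>\<^bsub>Q\<^esub> m')"
        using y(3) x(3) fx m'c lin_closed[OF f y(1)] by (simp add: Q.a_ac)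
      ultimately show ?thesis using x(1) by blast
    qed
  qed
qed

text \<open>The initial segments of a well-order. They index the filtration constructed below, with
  inclusion of segments in the role of the order of ordinals.\<close>

definition downsets :: "'a set \<Rightarrow> 'a rel \<Rightarrow> 'a set set" where
  "downsets A r = {S. S \<subseteq> A \<and> (\<forall>s\<in>S. \<forall>t\<in>A. (t, s) \<in> r \<longrightarrow> t \<in> S)}"

lemma downsetsI:
  "S \<subseteq> A \<Longrightarrow> (\<And>s t. s \<in> S \<Longrightarrow> t \<in> A \<Longrightarrow> (t, s) \<in> r \<Longrightarrow> t \<in> S) \<Longrightarrow> S \<in> downsets A r"
  by (simp add: downsets_def)

lemma downsetsD: "S \<in> downsets A r \<Longrightarrow> s \<in> S \<Longrightarrow> t \<in> A \<Longrightarrow> (t, s) \<in> r \<Longrightarrow> t \<in> S"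
  by (simp add: downsets_def)

text \<open>Suppose that no member of the family is least. In a member \<open>S0\<close> take the
  first element \<open>s\<close> outside the intersection. A member \<open>S1\<close> missing
  \<open>s\<close> contains only elements before \<open>s\<close>; these lie in \<open>S0\<close>
  and, by the choice of \<open>s\<close>, in the intersection. So \<open>S1\<close> is least after
  all.\<close>

lemma downsets_least:
  assumes wo: "well_order_on A r" and D: "\<D> \<subseteq> downsets A r" "\<D> \<noteq> {}"
  shows "\<exists>S\<in>\<D>. \<forall>S'\<in>\<D>. S \<subseteq> S'"
proof (rule ccontr)
  assume no: "\<not> ?thesis"
  have rt: "total_on A r" "antisym r" "wf (r - Id)" "refl_on A r"
    using wo by (auto simp: well_order_on_def linear_order_on_def partial_order_on_def preorder_on_def)
  obtain S0 where S0: "S0 \<in> \<D>" using D(2) by blast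
  have "S0 - \<Inter>\<D> \<noteq> {}" using no S0 by blast
  then obtain s where s: "s \<in> S0 - \<Inter>\<D>" "\<And>t. (t, s) \<in> r - Id \<Longrightarrow> t \<notin> S0 - \<Inter>\<D>"
    using wfE_min'[OF rt(3), of "S0 - \<Inter>\<D>"] by metis
  then obtain S1 where S1: "S1 \<in> \<D>" "s \<notin> S1" by blast
  have "S1 \<subseteq> \<Inter>\<D>"
  proof
    fix t assume t: "t \<in> S1"
    have A: "t \<in> A" "s \<in> A" using t s S0 S1 D(1) by (auto simp: downsets_def)
    have "(s, t) \<notin> r" using S1 t A D(1) by (auto simp: downsets_def)
    then have ts: "(t, s) \<in> r" "t \<noteq> s" using rt(1) A S1 t by (auto simp: total_on_def)
    moreover have "S0 \<in> downsets A r" using S0 D(1) by blast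
    ultimately have "t \<in> S0" using s(1) A(1) unfolding downsets_def by blast
    then show "t \<in> \<Inter>\<D>" using s(2)[of t] ts by blast
  qed
  then show False using no S1 by blast
qed

text \<open>All homomorphisms from members of \<open>\<X>\<close> to \<open>Q\<close> are
  well-ordered, and the filtration consists of the sums of images over initial segments. By
  \<open>sumim_dichotomy\<close> the image of a split monomorphism either is contained in the sum of
  the earlier ones or meets it in zero, so a step adds nothing or a full copy of the member.\<close>

lemma filtered_by_split:
  fixes R :: "('r, 'z) ring_scheme" and \<X> :: "('r, 'x) module set" and Q :: "('r, 'm) module"
  assumes Q: "left_module R Q"
    and split: "\<And>X f x. X \<in> \<X> \<Longrightarrow> lin R X Q f \<Longrightarrow> x \<in> carrier X \<Longrightarrow> f x \<noteq> \<zero>\<^bsub>Q\<^esub> \<Longrightarrow>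
      \<exists>r. lin R Q X r \<and> (\<forall>y\<in>carrier X. r (f y) = y)"
    and LM: "\<And>X. X \<in> \<X> \<Longrightarrow> left_module R X"
    and gen: "\<And>K. submodule K R Q \<Longrightarrow> (\<And>X f x. X \<in> \<X> \<Longrightarrow> lin R X Q f \<Longrightarrow> x \<in> carrier X \<Longrightarrow> f x \<in> K) \<Longrightarrow> K = carrier Q"
  shows "filtered_by R \<X> Q"
proof -
  interpret Q: abelian_group Q using Q by (rule left_module_abelian_group)
  define A where "A = {(X, f). X \<in> \<X> \<and> lin R X Q f}"
  obtain r where wo: "well_order_on A r" using well_order_on by blast
  have rt: "total_on A r" "antisym r" "refl_on A r" "trans r"
    using wo by (auto simp: well_order_on_def linear_order_on_def partial_order_on_def preorder_on_def)
  have tot: "(x, y) \<in> r \<or> (y, x) \<in> r" if "x \<in> A" "y \<in> A" for x y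
    using that rt(1,3) by (cases "x = y") (auto simp: total_on_def refl_on_def)
  let ?N = "family_sum Q" and ?D = "downsets A r"
  have Sx: "X \<in> \<X> \<and> left_module R X \<and> lin R X Q f" if "S \<in> ?D" "(X, f) \<in> S" for S X f
    using that LM by (auto simp: downsets_def A_def)
  have sub: "submodule (?N S) R Q" if "S \<in> ?D" for S using family_sum_submodule[OF Q, of S] Sx[OF that] by blast
  have AD: "A \<in> ?D" "{} \<in> ?D" by (auto simp: downsets_def)
  have cmp: "S \<subseteq> S' \<or> S' \<subseteq> S" if "S \<in> ?D" "S' \<in> ?D" for S S'
    using downsets_least[OF wo, of "{S, S'}"] that by blast
  have NA: "?N A = carrier Q"
  proof (rule gen[OF sub[OF AD(1)]])
    fix X f x assume "X \<in> \<X>" "lin R X Q f" "x \<in> carrier X"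
    then show "f x \<in> ?N A" by (intro family_sum_image[OF Q]) (auto simp: A_def)
  qed
  have N0: "?N {} = {\<zero>\<^bsub>Q\<^esub>}" by (auto simp: family_sum_def)
  have main: "N = \<Union>{K \<in> ?N ` ?D. K \<subset> N} \<or>
        (\<exists>K\<in>?N ` ?D. K \<subset> N \<and> (\<forall>L\<in>?N ` ?D. L \<subset> N \<longrightarrow> L \<subseteq> K) \<and>
           (\<exists>X\<in>\<X>. isomorphic R (quot_mod (submod_of Q N) K) X))" if N: "N \<in> ?N ` ?D" "N \<noteq> {\<zero>\<^bsub>Q\<^esub>}" for N
  proof -
    \<comment> \<open>Several segments may have the sum \<open>N\<close>; the least of them is
      taken, so that every proper subsegment has a strictly smaller sum.\<close>
    obtain S where "S \<in> {S \<in> ?D. ?N S = N}" and least: "\<forall>S'\<in>{S \<in> ?D. ?N S = N}. S \<subseteq> S'"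
      using downsets_least[OF wo, of "{S \<in> ?D. ?N S = N}"] N(1) by blast
    then have S: "S \<in> ?D" "?N S = N" by auto
    have strict: "?N S' \<subset> N" if "S' \<in> ?D" "S' \<subset> S" for S'
      using that least family_sum_mono[of S' S Q] S(2) by blast
    have smaller: "S' \<subset> S" if "S' \<in> ?D" "?N S' \<subset> N" for S'
      using that cmp[OF that(1) S(1)] family_sum_mono[of S S' Q] S(2) by blast
    have Sne: "S \<noteq> {}" using S(2) N0 N(2) by auto
    have SA: "S \<subseteq> A" using S(1) by (auto simp: downsets_def)
    show ?thesis
    \<comment> \<open>A last element of \<open>S\<close> makes \<open>N\<close> a successor, the
      lack of one makes it a limit.\<close>
    proof (cases "\<exists>s\<in>S. \<forall>t\<in>S. (t, s) \<in> r")
      case True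
      then obtain X f where s: "(X, f) \<in> S" "\<And>t. t \<in> S \<Longrightarrow> (t, (X, f)) \<in> r" by auto
      let ?S = "S - {(X, f)}"
      have D': "?S \<in> ?D"
      proof (rule downsetsI)
        fix u t assume ut: "u \<in> ?S" "t \<in> A" "(t, u) \<in> r"
        have "t \<in> S" using downsetsD[OF S(1) _ ut(2,3)] ut(1) by blast
        moreover have "t \<noteq> (X, f)" using antisymD[OF rt(2), of u "(X, f)"] s(2)[of u] ut by blast
        ultimately show "t \<in> ?S" by blast
      qed (use SA in blast)
      have st: "?N ?S \<subset> N" using strict[OF D'] s(1) by blast
      have max: "L \<subseteq> ?N ?S" if L: "L \<in> ?N ` ?D" "L \<subset> N" for L
      proof -
        obtain S' where S': "S' \<in> ?D" "L = ?N S'" using L(1) by blast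
        then have lt: "S' \<subset> S" using smaller L(2) by blast
        have "(X, f) \<notin> S'"
        proof
          assume "(X, f) \<in> S'"
          then have "S \<subseteq> S'" using downsetsD[OF S'(1)] s(2) SA by blast
          then show False using lt by blast
        qed
        then show ?thesis using lt S'(2) family_sum_mono[of S' ?S Q] by blast
      qed
      have X: "X \<in> \<X>" "left_module R X" "lin R X Q f" using Sx[OF S(1) s(1)] by auto
      have fN: "f x \<in> N" if "x \<in> carrier X" for x using family_sum_image[OF Q s(1) X(3) that] S(2) by simp
      have subN: "submodule N R Q" using sub[OF S(1)] S(2) by simp
      note ND = submoduleD[OF Q subN] and KD = submoduleD[OF Q sub[OF D']]
      have dec: "\<exists>x\<in>carrier X. \<exists>m\<in>?N ?S. u = f x \<oplus>\<^bsub>Q\<^esub> m" if "u \<in> N" for u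
      proof -
        have "u \<in> ?N (insert (X, f) ?S)" using that S(2) insert_Diff[OF s(1)] by simp
        then show ?thesis using Sx[OF D'] by (intro family_sum_insert[OF Q X(2,3)]) auto
      qed
      \<comment> \<open>If the image of \<open>f\<close> met the earlier sum nontrivially, the
        dichotomy would place all of it there, and \<open>N\<close> would equal the sum over the
        smaller segment.\<close>
      have fK: "x = \<zero>\<^bsub>X\<^esub>" if x: "x \<in> carrier X" "f x \<in> ?N ?S" for x
      proof (rule ccontr)
        assume x0: "x \<noteq> \<zero>\<^bsub>X\<^esub>"
        obtain L where L: "set L \<subseteq> ?S" "f x \<in> sumim Q L" using x(2) by (auto simp: family_sum_def)
        have "f z \<in> sumim Q L" if "z \<in> carrier X" for z
          by (rule sumim_dichotomy[OF Q _ _ _ X(1,3) x(1) x0 L(2) that])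
            (use split LM L(1) Sx[OF D'] in blast)+
        then have "f z \<in> ?N ?S" if "z \<in> carrier X" for z using that L(1) by (auto simp: family_sum_def)
        then have "N \<subseteq> ?N ?S" using dec KD(3) by blast
        then show False using st by blast
      qed
      let ?K = "?N ?S"
      have subK: "submodule ?K R Q" "?K \<subseteq> N" using sub[OF D'] st by auto
      have N': "left_module R (submod_of Q N)" using submod_of_left_module[OF Q subN] .
      have K': "submodule ?K R (submod_of Q N)" using submodule_submod_of[OF Q subN subK] .
      let ?Q = "quot_mod (submod_of Q N) ?K" and ?q = "quot_proj (submod_of Q N) ?K"
      have QM: "left_module R ?Q" using quot_mod_left_module[OF N' K'] .
      interpret QM: abelian_group ?Q using QM by (rule left_module_abelian_group)
      have q: "lin R (submod_of Q N) ?Q ?q" using quot_proj_lin[OF N' K'] .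
      have fl: "lin R X (submod_of Q N) f" using X(3) fN by (auto simp: lin_def)
      have g: "lin R X ?Q (\<lambda>x. ?q (f x))" using lin_comp[OF fl q] .
      have "inj_on (\<lambda>x. ?q (f x)) (carrier X)"
        unfolding lin_inj_iff[OF X(2) QM g]
        using quot_proj_zero_iff[OF N' K'] fN fK by auto
      moreover have "(\<lambda>x. ?q (f x)) ` carrier X = carrier ?Q"
      proof
        show "(\<lambda>x. ?q (f x)) ` carrier X \<subseteq> carrier ?Q" using lin_closed[OF g] by blast
        show "carrier ?Q \<subseteq> (\<lambda>x. ?q (f x)) ` carrier X"
        proof
          fix c assume c: "c \<in> carrier ?Q"
          have "?q ` N = carrier ?Q" using quot_proj_image[of "submod_of Q N" ?K] by simp
          then obtain u where u: "u \<in> N" "c = ?q u" using c by blast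
          obtain x m where x: "x \<in> carrier X" "m \<in> ?K" "u = f x \<oplus>\<^bsub>Q\<^esub> m" using dec[OF u(1)] by blast
          have mN: "m \<in> N" using x(2) subK by blast
          have "?q u = ?q (f x) \<oplus>\<^bsub>?Q\<^esub> ?q m" using lin_add[OF q, of "f x" m] fN[OF x(1)] mN x(3) by simp
          moreover have "?q m = \<zero>\<^bsub>?Q\<^esub>" using quot_proj_zero_iff[OF N' K', of m] mN x(2) by simp
          ultimately have "c = ?q (f x)" using u(2) QM.r_zero[OF lin_closed[OF g x(1)]] by metis
          then show "c \<in> (\<lambda>x. ?q (f x)) ` carrier X" using x(1) by blast
        qed
      qed
      ultimately have bij: "bij_betw (\<lambda>x. ?q (f x)) (carrier X) (carrier ?Q)" by (simp add: bij_betw_def)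
      let ?h = "inv_into (carrier X) (\<lambda>x. ?q (f x))"
      have "restrict ?h (carrier ?Q) \<in> mod_iso R ?Q X"
        using lin_restrict_iso[OF QM lin_inv_into[OF X(2) QM g bij] bij_betw_inv_into[OF bij]] .
      then have "isomorphic R ?Q X" unfolding isomorphic_def by blast
      then show ?thesis using st max X(1) D' by blast
    next
      case False
      have above: "\<exists>t\<in>S. (s, t) \<in> r \<and> s \<noteq> t" if s: "s \<in> S" for s
      proof -
        obtain t where t: "t \<in> S" "(t, s) \<notin> r" using False s by blast
        then have "t \<noteq> s" using rt(3) s SA by (auto simp: refl_on_def)
        then show ?thesis using t s SA rt(1) unfolding total_on_def by blast
      qed
      \<comment> \<open>Without a last element, every finite list in \<open>S\<close> has a strict
        upper bound in \<open>S\<close>; hence an element of \<open>N\<close> already lies in the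
        sum over a proper initial segment.\<close>
      have bound: "\<exists>t\<in>S. \<forall>u\<in>set L. (u, t) \<in> r \<and> u \<noteq> t" if "set L \<subseteq> S" for L
        using that
      proof (induction L)
        case Nil
        then show ?case using Sne by auto
      next
        case (Cons a L)
        then obtain t where t: "t \<in> S" "\<forall>u\<in>set L. (u, t) \<in> r \<and> u \<noteq> t" by auto
        have a: "a \<in> S" using Cons by simp
        obtain b where b: "b \<in> S" "(a, b) \<in> r" "a \<noteq> b" using above[OF a] by blast
        show ?case
        proof (cases "(b, t) \<in> r")
          case True
          then have "(a, t) \<in> r" using b rt(4) by (auto dest: transD)
          moreover have "a \<noteq> t" using True b rt(2) by (auto dest: antisymD)
          ultimately show ?thesis using t by auto
        next
          case F: False
          then have "(t, b) \<in> r" using tot[OF subsetD[OF SA b(1)] subsetD[OF SA t(1)]] by blast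
          then have "(u, b) \<in> r \<and> u \<noteq> b" if "u \<in> set L" for u
            using transD[OF rt(4), of u t b] antisymD[OF rt(2), of t b] t(2) F that by blast
          then have "\<forall>u\<in>set (a # L). (u, b) \<in> r \<and> u \<noteq> b" using b by simp
          then show ?thesis using b(1) by blast
        qed
      qed
      have "N \<subseteq> \<Union>{K \<in> ?N ` ?D. K \<subset> N}"
      proof
        fix q assume "q \<in> N"
        then obtain L where L: "set L \<subseteq> S" "q \<in> sumim Q L" using S(2) by (auto simp: family_sum_def)
        obtain t where t: "t \<in> S" "\<forall>u\<in>set L. (u, t) \<in> r \<and> u \<noteq> t" using bound[OF L(1)] by blast
        let ?S = "{u \<in> S. (u, t) \<in> r \<and> u \<noteq> t}"
        have D': "?S \<in> ?D"
        proof (rule downsetsI)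
          fix u v assume uv: "u \<in> ?S" "v \<in> A" "(v, u) \<in> r"
          have "v \<in> S" using downsetsD[OF S(1) _ uv(2,3)] uv(1) by blast
          moreover have "(v, t) \<in> r" using transD[OF rt(4) uv(3)] uv(1) by blast
          moreover have "v \<noteq> t" using antisymD[OF rt(2), of u t] uv by blast
          ultimately show "v \<in> ?S" by blast
        qed (use SA in blast)
        have "?N ?S \<subset> N" using strict[OF D'] t(1) by blast
        moreover have "q \<in> ?N ?S" using L t(2) unfolding family_sum_def by blast
        ultimately show "q \<in> \<Union>{K \<in> ?N ` ?D. K \<subset> N}" using D' by blast
      qed
      then show ?thesis by blast
    qed
  qed
  have wl: "\<exists>N\<in>\<S>. \<forall>K\<in>\<S>. N \<subseteq> K" if wS: "\<S> \<subseteq> ?N ` ?D" "\<S> \<noteq> {}" for \<S>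
  proof -
    have "{S \<in> ?D. ?N S \<in> \<S>} \<noteq> {}" using wS by blast
    then obtain S where S: "S \<in> {S \<in> ?D. ?N S \<in> \<S>}" "\<forall>S'\<in>{S \<in> ?D. ?N S \<in> \<S>}. S \<subseteq> S'"
      using downsets_least[OF wo, of "{S \<in> ?D. ?N S \<in> \<S>}"] by blast
    show ?thesis
    proof (intro bexI ballI)
      fix K assume "K \<in> \<S>"
      then obtain S' where "S' \<in> ?D" "K = ?N S'" using wS(1) by blast
      then show "?N S \<subseteq> K" using S(2) \<open>K \<in> \<S>\<close> family_sum_mono[of S S' Q] by blast
    qed (use S in blast)
  qed
  have "filtration_by R \<X> Q (?N ` ?D)"
    unfolding filtration_by_def
  proof (intro conjI)
    show "\<forall>N\<in>?N ` ?D. submodule N R Q" using sub by blast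
    show "\<forall>\<S>\<subseteq>?N ` ?D. \<S> \<noteq> {} \<longrightarrow> (\<exists>N\<in>\<S>. \<forall>K\<in>\<S>. N \<subseteq> K)" using wl by blast
    show "{\<zero>\<^bsub>Q\<^esub>} \<in> ?N ` ?D" using N0 AD(2) by (metis imageI)
    show "carrier Q \<in> ?N ` ?D" using NA AD(1) by (metis imageI)
  qed (intro ballI impI main; assumption)
  then show ?thesis using Q by (auto simp: filtered_by_def)
qed

text \<open>If f x is nonzero for a map f from X to \<open>Q\<close>, then some coordinate of s (f
  x) is nonzero; its summand must be X, and the resulting nonzero endomorphism of X is invertible,
  which gives a retraction of f. The images generate \<open>Q\<close> because \<open>p\<close> maps
  the direct sum onto it. A direct summand is thus treated without showing that it is a direct sum
  itself.\<close>

lemma filtered_by_retract: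
  assumes sb: "semibrick R \<X>" and Q: "left_module R Q" and F: "\<And>i. i \<in> I \<Longrightarrow> F i \<in> \<X>"
    and s: "lin R Q (direct_sum I F) s" and p: "lin R (direct_sum I F) Q p"
    and ps: "\<And>q. q \<in> carrier Q \<Longrightarrow> p (s q) = q"
  shows "filtered_by R \<X> Q"
proof (rule filtered_by_split[OF Q])
  have R: "ring R" using Q by (rule left_module_ring)
  have FL: "\<And>i. i \<in> I \<Longrightarrow> left_module R (F i)" using semibrick_left_module[OF sb F] .
  show "left_module R X" if "X \<in> \<X>" for X using semibrick_left_module[OF sb that] .
  show "\<exists>r. lin R Q X r \<and> (\<forall>y\<in>carrier X. r (f y) = y)"
    if X: "X \<in> \<X>" and f: "lin R X Q f" and x: "x \<in> carrier X" "f x \<noteq> \<zero>\<^bsub>Q\<^esub>" for X f x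
  proof -
    have sfc: "s (f x) \<in> carrier (direct_sum I F)" using lin_closed[OF s lin_closed[OF f x(1)]] .
    have DS: "left_module R (direct_sum I F)" using direct_sum_left_module[OF R FL] .
    have "\<exists>i\<in>I. s (f x) i \<noteq> \<zero>\<^bsub>F i\<^esub>"
    proof (rule ccontr)
      assume "\<not> ?thesis"
      then have "s (f x) = \<zero>\<^bsub>direct_sum I F\<^esub>"
        using sfc by (intro extensionalityI[of _ I]) (auto simp: direct_sum_carrier)
      then have "p (s (f x)) = \<zero>\<^bsub>Q\<^esub>" using lin_zero[OF DS Q p] by simp
      then show False using ps[OF lin_closed[OF f x(1)]] x(2) by simp
    qed
    then obtain i where i: "i \<in> I" "s (f x) i \<noteq> \<zero>\<^bsub>F i\<^esub>" by blast
    have si: "lin R Q (F i) (\<lambda>q. s q i)" using lin_comp[OF s direct_sum_coord_lin[OF i(1)]] .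
    have sfi: "lin R X (F i) (\<lambda>x. s (f x) i)" using lin_comp[OF f si] .
    have eq: "F i = X" using semibrick_hom_zero[OF sb X F[OF i(1)] _ sfi x(1)] i(2) by auto
    obtain g where g: "lin R X X g" "\<forall>y\<in>carrier X. g (s (f y) i) = y"
      using brickD(4)[OF semibrick_brick[OF sb X] sfi[unfolded eq] x(1)] i(2) eq by auto
    then show ?thesis using lin_comp[OF si[unfolded eq] g(1)] by (intro exI[of _ "\<lambda>q. g (s q i)"]) auto
  qed
  show "K = carrier Q" if K: "submodule K R Q"
    and im: "\<And>X f x. X \<in> \<X> \<Longrightarrow> lin R X Q f \<Longrightarrow> x \<in> carrier X \<Longrightarrow> f x \<in> K" for K
  proof
    show "K \<subseteq> carrier Q" using submoduleD(1)[OF Q K] .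
    show "carrier Q \<subseteq> K"
    proof
      fix q assume q: "q \<in> carrier Q"
      have "p (s q) \<in> K"
      proof (rule lin_direct_sum_in_submodule[OF R FL Q p K _ lin_closed[OF s q]])
        fix i x assume ix: "i \<in> I" "x \<in> carrier (F i)"
        have din: "lin R (F i) (direct_sum I F) (ds_in I F i)" using ds_in_lin[of I R F i] FL ix(1) by blast
        show "p (ds_in I F i x) \<in> K" using im[OF F[OF ix(1)] lin_comp[OF din p] ix(2)] .
      qed
      then show "q \<in> K" using ps[OF q] by simp
    qed
  qed
qed

text \<open>Concatenation: the images of the terms for \<open>Y\<close> come first, then the
  preimages of the terms for \<open>Q\<close>, every term of the first kind being contained in every
  term of the second. Factors are transferred by \<open>isomorphic_quot_iff\<close>.\<close>

lemma filtered_by_extension: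
  assumes ex: "exact R Y M Q a b" and LM: "\<And>X. X \<in> \<X> \<Longrightarrow> left_module R X"
    and fY: "filtered_by R \<X> Y" and fQ: "filtered_by R \<X> Q"
  shows "filtered_by R \<X> M"
proof -
  note D = exactD[OF ex]
  interpret Y: abelian_group Y using D(1) by (rule left_module_abelian_group)
  interpret M: abelian_group M using D(2) by (rule left_module_abelian_group)
  interpret Q: abelian_group Q using D(3) by (rule left_module_abelian_group)
  obtain \<F>Y where FY: "filtration_by R \<X> Y \<F>Y" using fY by (auto simp: filtered_by_def)
  obtain \<F>Q where FQ: "filtration_by R \<X> Q \<F>Q" using fQ by (auto simp: filtered_by_def)
  have Y1: "\<And>N. N \<in> \<F>Y \<Longrightarrow> submodule N R Y" and Yw: "\<And>\<S>. \<S> \<subseteq> \<F>Y \<Longrightarrow> \<S> \<noteq> {} \<Longrightarrow> \<exists>N\<in>\<S>. \<forall>K\<in>\<S>. N \<subseteq> K"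
    and Y0: "{\<zero>\<^bsub>Y\<^esub>} \<in> \<F>Y" "carrier Y \<in> \<F>Y"
    and Ys: "\<And>N. N \<in> \<F>Y \<Longrightarrow> N \<noteq> {\<zero>\<^bsub>Y\<^esub>} \<Longrightarrow> N = \<Union>{K \<in> \<F>Y. K \<subset> N} \<or>
        (\<exists>K\<in>\<F>Y. K \<subset> N \<and> (\<forall>L\<in>\<F>Y. L \<subset> N \<longrightarrow> L \<subseteq> K) \<and> (\<exists>X\<in>\<X>. isomorphic R (quot_mod (submod_of Y N) K) X))"
    using FY unfolding filtration_by_def by simp_all
  have Q1: "\<And>N. N \<in> \<F>Q \<Longrightarrow> submodule N R Q" and Qw: "\<And>\<S>. \<S> \<subseteq> \<F>Q \<Longrightarrow> \<S> \<noteq> {} \<Longrightarrow> \<exists>N\<in>\<S>. \<forall>K\<in>\<S>. N \<subseteq> K"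
    and Q0: "{\<zero>\<^bsub>Q\<^esub>} \<in> \<F>Q" "carrier Q \<in> \<F>Q"
    and Qs: "\<And>N. N \<in> \<F>Q \<Longrightarrow> N \<noteq> {\<zero>\<^bsub>Q\<^esub>} \<Longrightarrow> N = \<Union>{K \<in> \<F>Q. K \<subset> N} \<or>
        (\<exists>K\<in>\<F>Q. K \<subset> N \<and> (\<forall>L\<in>\<F>Q. L \<subset> N \<longrightarrow> L \<subseteq> K) \<and> (\<exists>X\<in>\<X>. isomorphic R (quot_mod (submod_of Q N) K) X))"
    using FQ unfolding filtration_by_def by simp_all
  define pre where "pre N = {x \<in> carrier M. b x \<in> N}" for N
  define \<F> where "\<F> = (`) a ` \<F>Y \<union> pre ` \<F>Q"
  have Yc: "N \<subseteq> carrier Y" "\<zero>\<^bsub>Y\<^esub> \<in> N" if "N \<in> \<F>Y" for N using submoduleD[OF D(1) Y1[OF that]] by auto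
  have Qc: "N \<subseteq> carrier Q" "\<zero>\<^bsub>Q\<^esub> \<in> N" if "N \<in> \<F>Q" for N using submoduleD[OF D(3) Q1[OF that]] by auto
  have am: "a ` N \<subseteq> a ` N' \<longleftrightarrow> N \<subseteq> N'" if NN: "N \<in> \<F>Y" "N' \<in> \<F>Y" for N N'
  proof
    assume p: "a ` N \<subseteq> a ` N'"
    show "N \<subseteq> N'"
    proof
      fix y assume y: "y \<in> N"
      then show "y \<in> N'" using p inj_on_image_mem_iff[OF D(6), of y N'] Yc(1)[OF NN(1)] Yc(1)[OF NN(2)] by blast
    qed
  qed blast
  have pm: "pre N \<subseteq> pre N' \<longleftrightarrow> N \<subseteq> N'" if NN: "N \<in> \<F>Q" "N' \<in> \<F>Q" for N N'
  proof
    assume p: "pre N \<subseteq> pre N'"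
    show "N \<subseteq> N'"
    proof
      fix q assume q: "q \<in> N"
      then obtain x where "x \<in> carrier M" "b x = q" using D(10) Qc(1)[OF NN(1)] by blast
      then show "q \<in> N'" using p q by (auto simp: pre_def)
    qed
  qed (auto simp: pre_def)
  have as: "a ` N \<subset> a ` N' \<longleftrightarrow> N \<subset> N'" if "N \<in> \<F>Y" "N' \<in> \<F>Y" for N N'
    using am[OF that] am[OF that(2,1)] by blast
  have ps: "pre N \<subset> pre N' \<longleftrightarrow> N \<subset> N'" if "N \<in> \<F>Q" "N' \<in> \<F>Q" for N N'
    using pm[OF that] pm[OF that(2,1)] by blast
  have ap: "a ` N \<subseteq> pre N'" if NN: "N \<in> \<F>Y" "N' \<in> \<F>Q" for N N'
  proof
    fix x assume "x \<in> a ` N"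
    then obtain y where y: "y \<in> carrier Y" "x = a y" using Yc(1)[OF NN(1)] by blast
    then show "x \<in> pre N'" using D(9)[OF y(1)] lin_closed[OF D(4) y(1)] Qc(2)[OF NN(2)] by (simp add: pre_def)
  qed
  \<comment> \<open>The two pieces share this term: it is the last one coming from \<open>Y\<close>
    and the first one coming from \<open>Q\<close>. Whether it is a successor or a limit is decided
    by the filtration of \<open>Y\<close>.\<close>
  have p0: "pre {\<zero>\<^bsub>Q\<^esub>} = a ` carrier Y"
  proof
    show "pre {\<zero>\<^bsub>Q\<^esub>} \<subseteq> a ` carrier Y" using D(8) by (auto simp: pre_def)
  qed (rule ap[OF Y0(2) Q0(1)])
  have subm: "submodule N R M" if "N \<in> \<F>" for N
    using that unfolding \<F>_def pre_def
    using submodule_image[OF D(1,2,4) Y1] submodule_vimage[OF D(2,3,5) Q1] by blast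
  have wl: "\<exists>N\<in>\<S>. \<forall>K\<in>\<S>. N \<subseteq> K" if S: "\<S> \<subseteq> \<F>" "\<S> \<noteq> {}" for \<S>
  proof (cases "{N \<in> \<F>Y. a ` N \<in> \<S>} = {}")
    case False
    then obtain N where N: "N \<in> \<F>Y" "a ` N \<in> \<S>" "\<And>K. K \<in> \<F>Y \<Longrightarrow> a ` K \<in> \<S> \<Longrightarrow> N \<subseteq> K"
      using Yw[of "{N \<in> \<F>Y. a ` N \<in> \<S>}"] by blast
    have "a ` N \<subseteq> K" if K: "K \<in> \<S>" for K
    proof -
      consider K0 where "K0 \<in> \<F>Y" "K = a ` K0" | K1 where "K1 \<in> \<F>Q" "K = pre K1" using S(1) K by (auto simp: \<F>_def)
      then show ?thesis
      proof cases
        case 1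
        then show ?thesis using N(3)[of K0] K by blast
      next
        case 2
        then show ?thesis using ap[OF N(1)] by blast
      qed
    qed
    then show ?thesis using N(2) by blast
  next
    case True
    then have pS: "\<exists>K1\<in>\<F>Q. K = pre K1" if "K \<in> \<S>" for K using that S(1) by (auto simp: \<F>_def)
    then have "{N \<in> \<F>Q. pre N \<in> \<S>} \<noteq> {}" using S(2) by blast
    then obtain N where N: "N \<in> \<F>Q" "pre N \<in> \<S>" "\<And>K. K \<in> \<F>Q \<Longrightarrow> pre K \<in> \<S> \<Longrightarrow> N \<subseteq> K"
      using Qw[of "{N \<in> \<F>Q. pre N \<in> \<S>}"] by blast
    have "pre N \<subseteq> K" if K: "K \<in> \<S>" for K
    proof -
      obtain K1 where K1: "K1 \<in> \<F>Q" "K = pre K1" using pS[OF K] by blast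
      then show ?thesis using pm[OF N(1) K1(1)] N(3)[OF K1(1)] K by blast
    qed
    then show ?thesis using N(2) by blast
  qed
  define goal where "goal N \<longleftrightarrow> N = \<Union>{K \<in> \<F>. K \<subset> N} \<or>
        (\<exists>K\<in>\<F>. K \<subset> N \<and> (\<forall>L\<in>\<F>. L \<subset> N \<longrightarrow> L \<subseteq> K) \<and>
           (\<exists>X\<in>\<X>. isomorphic R (quot_mod (submod_of M N) K) X))" for N
  have mY: "goal (a ` N)" if N: "N \<in> \<F>Y" "N \<noteq> {\<zero>\<^bsub>Y\<^esub>}" for N
    using Ys[OF N]
  proof
    assume U: "N = \<Union>{K \<in> \<F>Y. K \<subset> N}"
    have "a ` N \<subseteq> \<Union>{K \<in> \<F>. K \<subset> a ` N}"
    proof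
      fix x assume "x \<in> a ` N"
      then obtain y where y: "y \<in> N" "x = a y" by blast
      then obtain K where K: "K \<in> \<F>Y" "K \<subset> N" "y \<in> K" using U by blast
      then have "a ` K \<in> \<F>" "a ` K \<subset> a ` N" "x \<in> a ` K" using as[OF K(1) N(1)] y by (auto simp: \<F>_def)
      then show "x \<in> \<Union>{K \<in> \<F>. K \<subset> a ` N}" by blast
    qed
    then show ?thesis unfolding goal_def by blast
  next
    assume "\<exists>K\<in>\<F>Y. K \<subset> N \<and> (\<forall>L\<in>\<F>Y. L \<subset> N \<longrightarrow> L \<subseteq> K) \<and> (\<exists>X\<in>\<X>. isomorphic R (quot_mod (submod_of Y N) K) X)"
    then obtain K X where K: "K \<in> \<F>Y" "K \<subset> N" "\<forall>L\<in>\<F>Y. L \<subset> N \<longrightarrow> L \<subseteq> K"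
      and X: "X \<in> \<X>" "isomorphic R (quot_mod (submod_of Y N) K) X" by (elim bexE conjE) (rule that; assumption)
    have aKF: "a ` K \<in> \<F>" "a ` N \<in> \<F>" using K(1) N(1) by (auto simp: \<F>_def)
    have lt: "a ` K \<subset> a ` N" using as[OF K(1) N(1)] K(2) by blast
    have mx: "L \<subseteq> a ` K" if L: "L \<in> \<F>" "L \<subset> a ` N" for L
    proof -
      consider L0 where "L0 \<in> \<F>Y" "L = a ` L0" | L1 where "L1 \<in> \<F>Q" "L = pre L1" using L(1) by (auto simp: \<F>_def)
      then show ?thesis
      proof cases
        case 1
        then have "L0 \<subseteq> K" using K(3) as[OF 1(1) N(1)] L(2) by blast
        then show ?thesis using 1(2) by blast
      next
        case 2
        then show ?thesis using ap[OF N(1) 2(1)] L(2) by blast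
      qed
    qed
    obtain g where g: "lin R (submod_of Y N) X g" "g ` N = carrier X" "\<And>x. x \<in> N \<Longrightarrow> g x = \<zero>\<^bsub>X\<^esub> \<longleftrightarrow> x \<in> K"
      using X(2) isomorphic_quot_iff[OF D(1) Y1[OF N(1)] Y1[OF K(1)] _ LM[OF X(1)]] K(2) by blast
    let ?c = "inv_into (carrier Y) a"
    have ca: "?c (a y) = y" if "y \<in> N" for y using that D(6) Yc(1)[OF N(1)] by (auto simp: inv_into_f_f)
    have Nd: "y \<in> carrier Y" if "y \<in> N" for y using that Yc(1)[OF N(1)] by blast
    note ND = submoduleD[OF D(1) Y1[OF N(1)]]
    have gl: "lin R (submod_of M (a ` N)) X (\<lambda>x. g (?c x))"
    proof (rule linI)
      fix x assume "x \<in> carrier (submod_of M (a ` N))"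
      then obtain y where "y \<in> N" "x = a y" by auto
      then show "g (?c x) \<in> carrier X" using ca g(2) by auto
    next
      fix x x' assume "x \<in> carrier (submod_of M (a ` N))" "x' \<in> carrier (submod_of M (a ` N))"
      then obtain y y' where y: "y \<in> N" "x = a y" "y' \<in> N" "x' = a y'" by auto
      have "x \<oplus>\<^bsub>M\<^esub> x' = a (y \<oplus>\<^bsub>Y\<^esub> y')" using lin_add[OF D(4) Nd[OF y(1)] Nd[OF y(3)]] y by simp
      then show "g (?c (x \<oplus>\<^bsub>submod_of M (a ` N)\<^esub> x')) = g (?c x) \<oplus>\<^bsub>X\<^esub> g (?c x')"
        using ca[OF y(1)] ca[OF y(3)] ca[OF ND(3)[OF y(1,3)]] y lin_add[OF g(1), of y y'] by simp
    next
      fix r x assume r: "r \<in> carrier R" and "x \<in> carrier (submod_of M (a ` N))"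
      then obtain y where y: "y \<in> N" "x = a y" by auto
      have "r \<odot>\<^bsub>M\<^esub> x = a (r \<odot>\<^bsub>Y\<^esub> y)" using lin_smult[OF D(4) r Nd[OF y(1)]] y by simp
      then show "g (?c (r \<odot>\<^bsub>submod_of M (a ` N)\<^esub> x)) = r \<odot>\<^bsub>X\<^esub> g (?c x)"
        using ca[OF y(1)] ca[OF ND(4)[OF r y(1)]] y lin_smult[OF g(1) r, of y] by simp
    qed
    have "(\<lambda>x. g (?c x)) ` (a ` N) = g ` N" unfolding image_image using ca by (intro image_cong) auto
    then have gs: "(\<lambda>x. g (?c x)) ` (a ` N) = carrier X" using g(2) by simp
    have "g (?c x) = \<zero>\<^bsub>X\<^esub> \<longleftrightarrow> x \<in> a ` K" if "x \<in> a ` N" for x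
    proof -
      obtain y where y: "y \<in> N" "x = a y" using \<open>x \<in> a ` N\<close> by blast
      have "a y \<in> a ` K \<longleftrightarrow> y \<in> K" using inj_on_image_mem_iff[OF D(6) Nd[OF y(1)] Yc(1)[OF K(1)]] .
      then show ?thesis using y ca[OF y(1)] g(3)[OF y(1)] by simp
    qed
    then have iso: "isomorphic R (quot_mod (submod_of M (a ` N)) (a ` K)) X"
      using isomorphic_quot_iff[OF D(2) subm[OF aKF(2)] subm[OF aKF(1)] _ LM[OF X(1)]] lt gl gs by blast
    show ?thesis unfolding goal_def
    proof (intro disjI2 bexI[OF _ aKF(1)] conjI)
      show "\<forall>L\<in>\<F>. L \<subset> a ` N \<longrightarrow> L \<subseteq> a ` K" using mx by blast
    qed (use lt iso X(1) in auto)
  qed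
  have mQ: "goal (pre N)" if N: "N \<in> \<F>Q" "N \<noteq> {\<zero>\<^bsub>Q\<^esub>}" for N
    using Qs[OF N]
  proof
    assume U: "N = \<Union>{K \<in> \<F>Q. K \<subset> N}"
    have "pre N \<subseteq> \<Union>{K \<in> \<F>. K \<subset> pre N}"
    proof
      fix x assume "x \<in> pre N"
      then have x: "x \<in> carrier M" "b x \<in> N" by (auto simp: pre_def)
      then obtain K where K: "K \<in> \<F>Q" "K \<subset> N" "b x \<in> K" using U by blast
      then have "pre K \<in> \<F>" "pre K \<subset> pre N" "x \<in> pre K" using ps[OF K(1) N(1)] x by (auto simp: \<F>_def pre_def)
      then show "x \<in> \<Union>{K \<in> \<F>. K \<subset> pre N}" by blast
    qed
    then show ?thesis unfolding goal_def by blast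
  next
    assume "\<exists>K\<in>\<F>Q. K \<subset> N \<and> (\<forall>L\<in>\<F>Q. L \<subset> N \<longrightarrow> L \<subseteq> K) \<and> (\<exists>X\<in>\<X>. isomorphic R (quot_mod (submod_of Q N) K) X)"
    then obtain K X where K: "K \<in> \<F>Q" "K \<subset> N" "\<forall>L\<in>\<F>Q. L \<subset> N \<longrightarrow> L \<subseteq> K"
      and X: "X \<in> \<X>" "isomorphic R (quot_mod (submod_of Q N) K) X" by (elim bexE conjE) (rule that; assumption)
    have pKF: "pre K \<in> \<F>" "pre N \<in> \<F>" using K(1) N(1) by (auto simp: \<F>_def)
    have lt: "pre K \<subset> pre N" using ps[OF K(1) N(1)] K(2) by blast
    have mx: "L \<subseteq> pre K" if L: "L \<in> \<F>" "L \<subset> pre N" for L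
    proof -
      consider L0 where "L0 \<in> \<F>Y" "L = a ` L0" | L1 where "L1 \<in> \<F>Q" "L = pre L1" using L(1) by (auto simp: \<F>_def)
      then show ?thesis
      proof cases
        case 1
        then show ?thesis using ap[OF 1(1) K(1)] by blast
      next
        case 2
        then have "L1 \<subseteq> K" using K(3) ps[OF 2(1) N(1)] L(2) by blast
        then show ?thesis using 2 pm[OF 2(1) K(1)] by blast
      qed
    qed
    obtain g where g: "lin R (submod_of Q N) X g" "g ` N = carrier X" "\<And>x. x \<in> N \<Longrightarrow> g x = \<zero>\<^bsub>X\<^esub> \<longleftrightarrow> x \<in> K"
      using X(2) isomorphic_quot_iff[OF D(3) Q1[OF N(1)] Q1[OF K(1)] _ LM[OF X(1)]] K(2) by blast
    have bl: "lin R (submod_of M (pre N)) (submod_of Q N) b"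
      using D(5) by (auto simp: lin_def pre_def)
    have gl: "lin R (submod_of M (pre N)) X (\<lambda>x. g (b x))" using lin_comp[OF bl g(1)] .
    have "b ` pre N = N"
    proof
      show "b ` pre N \<subseteq> N" by (auto simp: pre_def)
      show "N \<subseteq> b ` pre N"
      proof
        fix q assume q: "q \<in> N"
        then obtain x where "x \<in> carrier M" "b x = q" using D(10) Qc(1)[OF N(1)] by blast
        then show "q \<in> b ` pre N" using q by (intro image_eqI[of _ _ x]) (auto simp: pre_def)
      qed
    qed
    then have gs: "(\<lambda>x. g (b x)) ` pre N = carrier X" using g(2) by (metis image_image)
    have "g (b x) = \<zero>\<^bsub>X\<^esub> \<longleftrightarrow> x \<in> pre K" if "x \<in> pre N" for x
      using that g(3)[of "b x"] by (simp add: pre_def)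
    then have iso: "isomorphic R (quot_mod (submod_of M (pre N)) (pre K)) X"
      using isomorphic_quot_iff[OF D(2) subm[OF pKF(2)] subm[OF pKF(1)] _ LM[OF X(1)]] lt gl gs by blast
    show ?thesis unfolding goal_def
    proof (intro disjI2 bexI[OF _ pKF(1)] conjI)
      show "\<forall>L\<in>\<F>. L \<subset> pre N \<longrightarrow> L \<subseteq> pre K" using mx by blast
    qed (use lt iso X(1) in auto)
  qed
  have a0: "a ` {\<zero>\<^bsub>Y\<^esub>} = {\<zero>\<^bsub>M\<^esub>}" using lin_zero[OF D(1,2,4)] by simp
  have main: "goal N" if N: "N \<in> \<F>" "N \<noteq> {\<zero>\<^bsub>M\<^esub>}" for N
  proof -
    consider N0 where "N0 \<in> \<F>Y" "N = a ` N0" | N1 where "N1 \<in> \<F>Q" "N = pre N1" using N(1) by (auto simp: \<F>_def)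
    then show ?thesis
    proof cases
      case 1
      then have "N0 \<noteq> {\<zero>\<^bsub>Y\<^esub>}" using N(2) a0 by blast
      then show ?thesis using mY 1 by blast
    next
      case 2
      show ?thesis
      proof (cases "N1 = {\<zero>\<^bsub>Q\<^esub>}")
        case True
        then have "N = a ` carrier Y" using 2 p0 by simp
        moreover then have "carrier Y \<noteq> {\<zero>\<^bsub>Y\<^esub>}" using N(2) a0 by metis
        ultimately show ?thesis using mY[OF Y0(2)] by blast
      next
        case False
        then show ?thesis using mQ 2 by blast
      qed
    qed
  qed
  have "filtration_by R \<X> M \<F>"
    unfolding filtration_by_def
  proof (intro conjI)
    show "\<forall>N\<in>\<F>. submodule N R M" using subm by blast
    show "\<forall>\<S>\<subseteq>\<F>. \<S> \<noteq> {} \<longrightarrow> (\<exists>N\<in>\<S>. \<forall>K\<in>\<S>. N \<subseteq> K)" using wl by blast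
    show "{\<zero>\<^bsub>M\<^esub>} \<in> \<F>" using Y0(1) a0 unfolding \<F>_def by blast
    have "pre (carrier Q) = carrier M" using lin_closed[OF D(5)] by (auto simp: pre_def)
    then show "carrier M \<in> \<F>" using Q0(2) unfolding \<F>_def by blast
    show "\<forall>N\<in>\<F>. N \<noteq> {\<zero>\<^bsub>M\<^esub>} \<longrightarrow> N = \<Union>{K \<in> \<F>. K \<subset> N} \<or>
        (\<exists>K\<in>\<F>. K \<subset> N \<and> (\<forall>L\<in>\<F>. L \<subset> N \<longrightarrow> L \<subseteq> K) \<and>
           (\<exists>X\<in>\<X>. isomorphic R (quot_mod (submod_of M N) K) X))"
      using main unfolding goal_def by blast
  qed
  then show ?thesis using D(2) by (auto simp: filtered_by_def)
qed

section \<open>Chains of universal inclusions\<close>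

text \<open>Third isomorphism theorem: dividing \<open>A\<close> and its image in \<open>M\<close>
  by \<open>N\<close> leaves the cokernel \<open>Q\<close> unchanged. So successive quotients of the
  induced chain are the direct sums known from the given chain.\<close>

lemma exact_quot:
  assumes ex: "exact R A M Q a b" and N: "submodule N R A"
  obtains b' where
    "exact R (quot_mod A N) (quot_mod M (a ` N)) Q (quot_map A N M (a ` N) a) b'"
    "\<And>x. x \<in> carrier A \<Longrightarrow> quot_map A N M (a ` N) a (quot_proj A N x) = quot_proj M (a ` N) (a x)"
proof -
  note D = exactD[OF ex]
  have N': "submodule (a ` N) R M" using submodule_image[OF D(1,2,4) N] .
  let ?A = "quot_mod A N" and ?M = "quot_mod M (a ` N)" and ?p = "quot_proj A N" and ?q = "quot_proj M (a ` N)"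
    and ?\<mu> = "quot_map A N M (a ` N) a"
  have AM: "left_module R ?A" and MM: "left_module R ?M"
    using quot_mod_left_module[OF D(1) N] quot_mod_left_module[OF D(2) N'] .
  have p: "lin R A ?A ?p" and q: "lin R M ?M ?q" using quot_proj_lin[OF D(1) N] quot_proj_lin[OF D(2) N'] .
  have p0: "?p x = \<zero>\<^bsub>?A\<^esub> \<longleftrightarrow> x \<in> N" if "x \<in> carrier A" for x using quot_proj_zero_iff[OF D(1) N that] .
  have q0: "?q x = \<zero>\<^bsub>?M\<^esub> \<longleftrightarrow> x \<in> a ` N" if "x \<in> carrier M" for x using quot_proj_zero_iff[OF D(2) N' that] .
  have NA: "N \<subseteq> carrier A" using submoduleD(1)[OF D(1) N] .
  have mup: "?\<mu> (?p x) = ?q (a x)" if x: "x \<in> carrier A" for x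
  proof -
    have "?\<mu> (?p x) = a ` N <+>\<^bsub>M\<^esub> a ` (N +>\<^bsub>A\<^esub> x)"
      unfolding quot_map_def using lin_closed[OF p x] quot_proj_apply[OF x, of N] by (simp del: quot_mod_simps(1))
    also have "\<dots> = a ` N +>\<^bsub>M\<^esub> a x"
      by (rule coset_set_add_image[OF D(1) N D(2) N']) (use lin_add[OF D(4)] lin_closed[OF D(4)] x in auto)
    finally show ?thesis using quot_proj_apply[OF lin_closed[OF D(4) x]] by simp
  qed
  have z: "?q (a x) = \<zero>\<^bsub>?M\<^esub>" if "x \<in> carrier A" "?p x = \<zero>\<^bsub>?A\<^esub>" for x
    using p0[OF that(1)] that(2) q0[OF lin_closed[OF D(4) that(1)]] by blast
  obtain \<mu> where mu: "lin R ?A ?M \<mu>" "\<And>x. x \<in> carrier A \<Longrightarrow> \<mu> (?p x) = ?q (a x)"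
    using lin_factor[OF D(1) AM MM p quot_proj_image lin_comp[OF D(4) q] z] by blast
  have mul: "lin R ?A ?M ?\<mu>"
  proof -
    have "?\<mu> c = \<mu> c" if c: "c \<in> carrier ?A" for c
    proof -
      obtain x where "x \<in> carrier A" "c = ?p x" using c quot_proj_image[of A N] by (metis imageE)
      then show ?thesis using mup mu(2) by simp
    qed
    then show ?thesis using lin_cong[OF AM, of ?\<mu> \<mu> ?M] mu(1) by blast
  qed
  have z': "b m = \<zero>\<^bsub>Q\<^esub>" if "m \<in> carrier M" "?q m = \<zero>\<^bsub>?M\<^esub>" for m
    using q0[OF that(1)] that(2) D(8)[OF that(1)] NA by blast
  obtain b' where b': "lin R ?M Q b'" "\<And>m. m \<in> carrier M \<Longrightarrow> b' (?q m) = b m"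
    using lin_factor[OF D(2) MM D(3) q quot_proj_image D(5) z'] by blast
  have "exact R ?A ?M Q ?\<mu> b'"
    unfolding exact_def
  proof (intro conjI AM MM D(3) mul b'(1) ballI)
    show "inj_on ?\<mu> (carrier ?A)"
      unfolding lin_inj_iff[OF AM MM mul]
    proof (intro ballI impI)
      fix c assume c: "c \<in> carrier ?A" "?\<mu> c = \<zero>\<^bsub>?M\<^esub>"
      obtain x where x: "x \<in> carrier A" "c = ?p x" using c(1) quot_proj_image[of A N] by (metis imageE)
      then have "a x \<in> a ` N" using c(2) mup[OF x(1)] q0[OF lin_closed[OF D(4) x(1)]] by metis
      then have "x \<in> N" using inj_on_image_mem_iff[OF D(6) x(1) NA] by blast
      then show "c = \<zero>\<^bsub>?A\<^esub>" using p0[OF x(1)] x(2) by blast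
    qed
    have "b' ` (?q ` carrier M) = b ` carrier M" unfolding image_image using b'(2) by (rule image_cong[OF refl])
    then show "b' ` carrier ?M = carrier Q" using D(7) quot_proj_image[of M "a ` N"] by metis
    fix c assume "c \<in> carrier ?M"
    then obtain m where m: "m \<in> carrier M" "c = ?q m" using quot_proj_image[of M "a ` N"] by (metis imageE)
    show "(b' c = \<zero>\<^bsub>Q\<^esub>) = (c \<in> ?\<mu> ` carrier ?A)"
    proof
      assume "b' c = \<zero>\<^bsub>Q\<^esub>"
      then obtain x where x: "x \<in> carrier A" "m = a x" using b'(2)[OF m(1)] m D(8)[OF m(1)] by auto
      then have "c = ?\<mu> (?p x)" using mup m(2) by simp
      then show "c \<in> ?\<mu> ` carrier ?A" using lin_closed[OF p x(1)] by blast
    next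
      assume "c \<in> ?\<mu> ` carrier ?A"
      then obtain d where d: "d \<in> carrier ?A" "c = ?\<mu> d" by blast
      obtain x where x: "x \<in> carrier A" "d = ?p x" using d(1) quot_proj_image[of A N] by (metis imageE)
      then have "c = ?q (a x)" using mup d(2) by simp
      then show "b' c = \<zero>\<^bsub>Q\<^esub>" using b'(2)[OF lin_closed[OF D(4) x(1)]] D(9)[OF x(1)] by simp
    qed
  qed
  then show thesis using that mup by blast
qed

text \<open>The restriction of \<open>f\<close> to a summand is a map from a member of
  \<open>\<X>\<close>, so its image lies in the socle, and the images of the summands generate the
  image of \<open>f\<close>.\<close>

lemma sum_image_in_socle:
  assumes sb: "semibrick R \<X>" and N: "left_module R N" and F: "\<And>j. j \<in> J \<Longrightarrow> F j \<in> \<X>"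
    and f: "lin R (direct_sum J F) N f" and v: "v \<in> carrier (direct_sum J F)"
  shows "f v \<in> socle R \<X> N"
  unfolding socle_def mod_span_def
proof (rule InterI)
  have R: "ring R" using N by (rule left_module_ring)
  have FL: "\<And>j. j \<in> J \<Longrightarrow> left_module R (F j)" using semibrick_left_module[OF sb F] .
  fix T assume "T \<in> {T. submodule T R N \<and> (\<Union>X\<in>\<X>. \<Union>f\<in>mod_hom R X N. f ` carrier X) \<subseteq> T}"
  then have T: "submodule T R N" "\<And>X f x. X \<in> \<X> \<Longrightarrow> f \<in> mod_hom R X N \<Longrightarrow> x \<in> carrier X \<Longrightarrow> f x \<in> T" by auto
  show "f v \<in> T"
  proof (rule lin_direct_sum_in_submodule[OF R FL N f T(1) _ v])
    fix j x assume jx: "j \<in> J" "x \<in> carrier (F j)"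
    have din: "lin R (F j) (direct_sum J F) (ds_in J F j)" using ds_in_lin[of J R F j] FL jx(1) by blast
    show "f (ds_in J F j x) \<in> T"
      using T(2)[OF F[OF jx(1)] lin_restrict[OF FL[OF jx(1)] lin_comp[OF din f]] jx(2)] jx(2) by simp
  qed
qed

lemma socle_subset:
  assumes "submodule T R N" "\<And>X f x. X \<in> \<X> \<Longrightarrow> lin R X N f \<Longrightarrow> x \<in> carrier X \<Longrightarrow> f x \<in> T"
  shows "socle R \<X> N \<subseteq> T"
  unfolding socle_def mod_span_def using assms mod_hom_lin by blast

lemma chain_comp_add: "chain_comp \<alpha> j (k + l) = chain_comp \<alpha> (j + k) l \<circ> chain_comp \<alpha> j k"
  by (induction l) (simp_all add: comp_assoc add.assoc)

locale universal_chain_data =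
  fixes R :: "('r, 'z) ring_scheme" and \<X> :: "('r, 'x) module set" and Y :: "nat \<Rightarrow> ('r, 'm) module"
    and \<alpha> :: "nat \<Rightarrow> 'm \<Rightarrow> 'm" and P1 :: "('r, 'x) module \<Rightarrow> ('r, 'p) module"
    and P0 :: "('r, 'x) module \<Rightarrow> ('r, 'q) module" and i e
  assumes sb: "semibrick R \<X>" and uc: "universal_chain R \<X> Y \<alpha>"
    and rs: "\<And>X. X \<in> \<X> \<Longrightarrow> resolution R X (P1 X) (P0 X) (i X) (e X)"
begin

lemma chain_step:
  assumes "j \<ge> 1"
  shows "\<exists>(J :: (('r, 'x) module \<times> ('r, 'm, 'm \<times> 'x, 'x) ses set) set) F \<pi>. (\<forall>k\<in>J. F k \<in> \<X>) \<and>
    exact R (Y j) (Y (Suc j)) (direct_sum J F) (\<alpha> j) \<pi> \<and>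
    (\<forall>X\<in>\<X>. universal_at R X (P1 X) (P0 X) (i X) (Y j) (Y (Suc j)) (\<alpha> j))"
proof -
  have u: "universal_inclusion R \<X> (Y j) (Y (Suc j)) (\<alpha> j)" using uc assms by (simp add: universal_chain_def)
  show ?thesis
  proof (rule universal_inclusionD[OF sb u])
    fix J :: "(('r, 'x) module \<times> ('r, 'm, 'm \<times> 'x, 'x) ses set) set" and F \<pi>
    assume F: "\<And>j. j \<in> J \<Longrightarrow> F j \<in> \<X>" and ex: "exact R (Y j) (Y (Suc j)) (direct_sum J F) (\<alpha> j) \<pi>"
      and ua: "\<And>X (P1 :: ('r, 'p) module) (P0 :: ('r, 'q) module) i e.
       X \<in> \<X> \<Longrightarrow> resolution R X P1 P0 i e \<Longrightarrow> universal_at R X P1 P0 i (Y j) (Y (Suc j)) (\<alpha> j)"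
    have "\<forall>X\<in>\<X>. universal_at R X (P1 X) (P0 X) (i X) (Y j) (Y (Suc j)) (\<alpha> j)"
      using ua[OF _ rs] by blast
    then show ?thesis using F ex by blast
  qed
qed

lemma chain_modules:
  assumes "j \<ge> 1"
  shows "left_module R (Y j)" "lin R (Y j) (Y (Suc j)) (\<alpha> j)" "inj_on (\<alpha> j) (carrier (Y j))"
proof -
  obtain J :: "(('r, 'x) module \<times> ('r, 'm, 'm \<times> 'x, 'x) ses set) set" and F \<pi>
    where "\<forall>k\<in>J. F k \<in> \<X>" and ex: "exact R (Y j) (Y (Suc j)) (direct_sum J F) (\<alpha> j) \<pi>"
    using chain_step[OF assms] by blast
  show "left_module R (Y j)" "lin R (Y j) (Y (Suc j)) (\<alpha> j)" "inj_on (\<alpha> j) (carrier (Y j))"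
    using exactD(1,4,6)[OF ex] .
qed

lemma chain_comp_lin:
  assumes "j \<ge> 1"
  shows "lin R (Y j) (Y (j + k)) (chain_comp \<alpha> j k)" "inj_on (chain_comp \<alpha> j k) (carrier (Y j))"
proof (induction k)
  case (Suc k)
  have m: "lin R (Y (j + k)) (Y (Suc (j + k))) (\<alpha> (j + k))" "inj_on (\<alpha> (j + k)) (carrier (Y (j + k)))"
    using chain_modules[of "j + k"] assms by auto
  { case 1
    show ?case using lin_comp[OF Suc(1) m(1)] by (simp add: comp_def)
  next
    case 2
    have "chain_comp \<alpha> j k ` carrier (Y j) \<subseteq> carrier (Y (j + k))" using lin_closed[OF Suc(1)] by blast
    then show ?case unfolding chain_comp.simps using comp_inj_on[OF Suc(2) inj_on_subset[OF m(2)]] by blast }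
qed (simp_all add: lin_id[unfolded id_def[symmetric]] id_def lin_id)

section \<open>Images of earlier terms and homomorphisms into later ones\<close>

abbreviation "im \<equiv> chain_image Y \<alpha>"

lemma im_eq: "im j (j + k) = chain_comp \<alpha> j k ` carrier (Y j)"
  by (simp add: chain_image_def)

lemma im_submodule:
  assumes "1 \<le> j" "j \<le> n"
  shows "submodule (im j n) R (Y n)"
proof -
  obtain k where n: "n = j + k" using assms(2) le_Suc_ex by blast
  have "1 \<le> n" using assms by simp
  then show ?thesis
    unfolding n im_eq using chain_modules(1)[of j] chain_modules(1)[of n] chain_comp_lin(1)[of j k] n assms(1)
    by (intro submodule_image[OF _ _ _ submodule_carrier]) auto
qed

lemma im_self: "im n n = carrier (Y n)"
  by (simp add: chain_image_def)

lemma im_mono: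
  assumes "1 \<le> j" "j \<le> j'" "j' \<le> n"
  shows "im j n \<subseteq> im j' n"
proof -
  obtain k where j': "j' = j + k" using assms(2) le_Suc_ex by blast
  obtain l where n: "n = j' + l" using assms(3) le_Suc_ex by blast
  have "chain_comp \<alpha> j (k + l) ` carrier (Y j) = chain_comp \<alpha> j' l ` (chain_comp \<alpha> j k ` carrier (Y j))"
    unfolding chain_comp_add j' by (simp add: image_comp)
  also have "\<dots> \<subseteq> chain_comp \<alpha> j' l ` carrier (Y j')"
    using lin_closed[OF chain_comp_lin(1)[OF assms(1), of k]] by (intro image_mono) (auto simp: j')
  finally show ?thesis using im_eq[of j "k + l"] im_eq[of j' l] n j' by (simp add: add.assoc)
qed

lemma im_Suc:
  assumes "1 \<le> j" "j \<le> n"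
  shows "im j (Suc n) = \<alpha> n ` im j n"
proof -
  obtain k where n: "n = j + k" using assms(2) le_Suc_ex by blast
  show ?thesis using im_eq[of j "Suc k"] im_eq[of j k] n by (simp add: image_comp)
qed

text \<open>The first clause of \<open>universal_at\<close> puts the image of a map into Y(n+1)
  inside Y(n); as the inclusion is injective, the map itself factors through Y(n), and induction
  takes it down to Y(1).\<close>

lemma hom_in_first:
  assumes X: "X \<in> \<X>" and n: "n \<ge> 1" and g: "lin R X (Y n) g" and x: "x \<in> carrier X"
  shows "g x \<in> im 1 n"
  using n g x
proof (induction n arbitrary: g x rule: dec_induct)
  case base
  show ?case using lin_closed[OF base.prems] im_self[of 1] by simp
next
  case (step n)
  obtain J :: "(('r, 'x) module \<times> ('r, 'm, 'm \<times> 'x, 'x) ses set) set" and F \<pi>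
    where "\<forall>k\<in>J. F k \<in> \<X>" and ex: "exact R (Y n) (Y (Suc n)) (direct_sum J F) (\<alpha> n) \<pi>"
    and ua: "universal_at R X (P1 X) (P0 X) (i X) (Y n) (Y (Suc n)) (\<alpha> n)"
    using chain_step[OF step(1)] X by blast
  note D = exactD[OF ex]
  have XM: "left_module R X" using semibrick_left_module[OF sb X] .
  have "\<pi> (g y) = \<zero>\<^bsub>direct_sum J F\<^esub>" if y: "y \<in> carrier X" for y
    using ua step.prems(1) y D(8)[OF lin_closed[OF step.prems(1) y]] unfolding universal_at_def by blast
  then obtain g' where g': "lin R X (Y n) g'" "\<And>y. y \<in> carrier X \<Longrightarrow> \<alpha> n (g' y) = g y"
    using exact_factor_left[OF ex XM step.prems(1)] by blast
  have "g' x \<in> im 1 n" using step.IH[OF g'(1) step.prems(2)] .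
  then show ?case using im_Suc[of 1 n] step(1) g'(2)[OF step.prems(2)] by force
qed

text \<open>Stated for a representative \<open>m\<close> in Y(n), so that it serves both the clause
  on homomorphisms for the quotient chain and the computation of the socle.\<close>

lemma hom_quot_in_next:
  assumes X: "X \<in> \<X>" and j: "1 \<le> j" "j < n" and g: "lin R X (quot_mod (Y n) (im j n)) g"
    and x: "x \<in> carrier X" and m: "m \<in> carrier (Y n)" "quot_proj (Y n) (im j n) m = g x"
  shows "m \<in> im (Suc j) n"
proof -
  interpret resolution R X "P1 X" "P0 X" "i X" "e X" using rs[OF X] .
  let ?N = "im j n" and ?q = "quot_proj (Y n) (im j n)"
  obtain l where n: "n = Suc j + l" using j(2) less_iff_Suc_add by auto
  have n1: "n \<ge> 1" using j by simp
  have Yn: "left_module R (Y n)" using chain_modules(1)[OF n1] .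
  have Yj: "left_module R (Y j)" using chain_modules(1)[OF j(1)] .
  interpret Yn: abelian_group "Y n" using Yn by (rule left_module_abelian_group)
  have N: "submodule ?N R (Y n)" using im_submodule[of j n] j by simp
  define c where "c = chain_comp \<alpha> j (Suc l)"
  define c' where "c' = chain_comp \<alpha> (Suc j) l"
  have cc: "c y = c' (\<alpha> j y)" for y
    using chain_comp_add[of \<alpha> j 1 l] by (simp add: c_def c'_def)
  have cl: "lin R (Y j) (Y n) c" "inj_on c (carrier (Y j))"
    using chain_comp_lin[OF j(1), of "Suc l"] n by (simp_all add: c_def)
  have c'l: "lin R (Y (Suc j)) (Y n) c'"
    using chain_comp_lin(1)[of "Suc j" l] n by (simp add: c'_def)
  have Nc: "?N = c ` carrier (Y j)" using im_eq[of j "Suc l"] n by (simp add: c_def)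
  have N'c: "im (Suc j) n = c' ` carrier (Y (Suc j))" using im_eq[of "Suc j" l] n by (simp add: c'_def)
  have exq: "exact R (Y j) (Y n) (quot_mod (Y n) ?N) c ?q"
    unfolding Nc using quot_exact[OF Yj Yn cl] .
  note E = exactD[OF exq]
  obtain k where k: "lin R (P0 X) (Y n) k" "\<And>p. p \<in> carrier (P0 X) \<Longrightarrow> ?q (k p) = g (e X p)"
    using projective_lift[OF proj0 E(2,3,5,7) lin_comp[OF res(5) g]] by blast
  have "?q (k (i X q)) = \<zero>\<^bsub>quot_mod (Y n) ?N\<^esub>" if q: "q \<in> carrier (P1 X)" for q
    using k(2)[OF lin_closed[OF res(4) q]] res(9)[OF q] lin_zero[OF res(3) E(3) g] by metis
  then obtain h where h: "lin R (P1 X) (Y j) h" "\<And>q. q \<in> carrier (P1 X) \<Longrightarrow> c (h q) = k (i X q)"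
    using exact_factor_left[OF exq res(1) lin_comp[OF res(4) k(1)]] by blast
  have "universal_at R X (P1 X) (P0 X) (i X) (Y j) (Y (Suc j)) (\<alpha> j)" using chain_step[OF j(1)] X by blast
  then obtain k' where k': "lin R (P0 X) (Y (Suc j)) k'" "\<And>q. q \<in> carrier (P1 X) \<Longrightarrow> k' (i X q) = \<alpha> j (h q)"
    using h(1) unfolding universal_at_def by blast
  note kc = lin_comp[OF k'(1) c'l]
  have d: "lin R (P0 X) (Y n) (\<lambda>p. k p \<ominus>\<^bsub>Y n\<^esub> c' (k' p))" using lin_minus_map[OF Yn k(1) kc] .
  have "k p \<ominus>\<^bsub>Y n\<^esub> c' (k' p) = \<zero>\<^bsub>Y n\<^esub>" if p: "p \<in> carrier (P0 X)" "e X p = \<zero>\<^bsub>X\<^esub>" for p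
  proof -
    obtain q where q: "q \<in> carrier (P1 X)" "p = i X q" using res(8)[OF p(1)] p(2) by blast
    have "c' (k' p) = k p" using k'(2)[OF q(1)] h(2)[OF q(1)] q(2) cc by simp
    then show ?thesis using lin_closed[OF k(1) p(1)] by (simp add: Yn.minus_zero_iff)
  qed
  \<comment> \<open>After the correction the lift vanishes on the image of \<open>P1\<close> and
    descends to a map from X to Y(n) itself, to which \<open>hom_in_first\<close> applies.\<close>
  then obtain d' where d': "lin R X (Y n) d'" "\<And>p. p \<in> carrier (P0 X) \<Longrightarrow> d' (e X p) = k p \<ominus>\<^bsub>Y n\<^esub> c' (k' p)"
    using lin_factor[OF res(2,3) Yn res(5,7) d] by blast
  obtain p where p: "p \<in> carrier (P0 X)" "x = e X p" using res(10)[OF x] by blast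
  have S: "submodule (im (Suc j) n) R (Y n)" using im_submodule[of "Suc j" n] j by simp
  note SD = submoduleD[OF Yn S]
  have "d' x \<in> im (Suc j) n" using hom_in_first[OF X n1 d'(1) x] im_mono[of 1 "Suc j" n] j by auto
  moreover have "c' (k' p) \<in> im (Suc j) n" unfolding N'c using lin_closed[OF k'(1) p(1)] by blast
  ultimately have "c' (k' p) \<oplus>\<^bsub>Y n\<^esub> (k p \<ominus>\<^bsub>Y n\<^esub> c' (k' p)) \<in> im (Suc j) n"
    using SD(3) d'(2)[OF p(1)] p(2) by simp
  then have kp: "k p \<in> im (Suc j) n"
    using Yn.add_minus_cancel[OF lin_closed[OF k(1) p(1)] lin_closed[OF kc p(1)]] by simp
  have kpc: "k p \<in> carrier (Y n)" using lin_closed[OF k(1) p(1)] .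
  \<comment> \<open>\<open>m\<close> and \<open>k p\<close> represent the same coset
    \<open>g x\<close>, so they differ by an element of the image of Y(j), which lies in that of
    Y(j+1).\<close>
  have "?q (m \<ominus>\<^bsub>Y n\<^esub> k p) = \<zero>\<^bsub>quot_mod (Y n) ?N\<^esub>"
  proof -
    interpret QN: abelian_group "quot_mod (Y n) ?N" using E(3) by (rule left_module_abelian_group)
    have eq: "?q m = ?q (k p)" using m(2) k(2)[OF p(1)] p(2) by simp
    show ?thesis using lin_minus[OF E(2,3,5) m(1) kpc] eq QN.minus_zero_iff[OF lin_closed[OF E(5) kpc] lin_closed[OF E(5) kpc]] by metis
  qed
  then have "m \<ominus>\<^bsub>Y n\<^esub> k p \<in> ?N" using quot_proj_zero_iff[OF Yn N, of "m \<ominus>\<^bsub>Y n\<^esub> k p"] m(1) kpc by blast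
  then have "m \<ominus>\<^bsub>Y n\<^esub> k p \<in> im (Suc j) n" using im_mono[of j "Suc j" n] j by auto
  then have "k p \<oplus>\<^bsub>Y n\<^esub> (m \<ominus>\<^bsub>Y n\<^esub> k p) \<in> im (Suc j) n" using SD(3) kp by blast
  then show ?thesis using Yn.add_minus_cancel[OF m(1) kpc] by simp
qed

theorem induced_chain:
  assumes j: "j \<ge> 1"
  shows "universal_chain R \<X> (induced_chain_mod Y \<alpha> j) (induced_chain_map Y \<alpha> j)"
  unfolding universal_chain_def
proof (intro allI impI)
  fix k :: nat assume k: "k \<ge> 1"
  define n where "n = j + k"
  have n1: "n \<ge> 1" and jn: "j < n" using j k by (auto simp: n_def)
  let ?N = "im j n" and ?N' = "im j (Suc n)"
  have N: "submodule ?N R (Y n)" using im_submodule[of j n] j jn by simp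
  have N': "?N' = \<alpha> n ` ?N" using im_Suc[of j n] j jn by simp
  obtain J :: "(('r, 'x) module \<times> ('r, 'm, 'm \<times> 'x, 'x) ses set) set" and F \<pi>
    where F: "\<And>k. k \<in> J \<Longrightarrow> F k \<in> \<X>" and ex: "exact R (Y n) (Y (Suc n)) (direct_sum J F) (\<alpha> n) \<pi>"
    and ua: "\<And>X. X \<in> \<X> \<Longrightarrow> universal_at R X (P1 X) (P0 X) (i X) (Y n) (Y (Suc n)) (\<alpha> n)"
    using chain_step[OF n1] by blast
  note D = exactD[OF ex]
  let ?A = "quot_mod (Y n) ?N" and ?M = "quot_mod (Y (Suc n)) ?N'" and ?\<mu> = "quot_map (Y n) ?N (Y (Suc n)) ?N' (\<alpha> n)"
  let ?p = "quot_proj (Y n) ?N" and ?q = "quot_proj (Y (Suc n)) ?N'"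
  obtain \<pi>' where ex': "exact R ?A ?M (direct_sum J F) ?\<mu> \<pi>'"
    and mup: "\<And>x. x \<in> carrier (Y n) \<Longrightarrow> ?\<mu> (?p x) = ?q (\<alpha> n x)"
    using exact_quot[OF ex N] unfolding N' by blast
  have N's: "submodule ?N' R (Y (Suc n))" using im_submodule[of j "Suc n"] j jn by simp
  have p: "lin R (Y n) ?A ?p" and q: "lin R (Y (Suc n)) ?M ?q"
    using quot_proj_lin[OF D(1) N] quot_proj_lin[OF D(2) N's] .
  have AM: "left_module R ?A" using quot_mod_left_module[OF D(1) N] .
  have "universal_inclusion R \<X> ?A ?M ?\<mu>"
  \<comment> \<open>The quotients have carrier type \<open>'m set\<close>, for which no bases of Ext
    are given; they are constructed by this rule.\<close>
  proof (rule universal_inclusionI[OF sb F ex' _ rs])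
    show "?\<mu> \<in> extensional (carrier ?A)" by (simp add: quot_map_def del: quot_mod_simps)
    fix X assume X: "X \<in> \<X>"
    interpret resolution R X "P1 X" "P0 X" "i X" "e X" using rs[OF X] .
    show "universal_at R X (P1 X) (P0 X) (i X) ?A ?M ?\<mu>"
      unfolding universal_at_def
    proof (intro conjI allI impI)
      fix g x assume g: "lin R X ?M g" and x: "x \<in> carrier X"
      obtain m where m: "m \<in> carrier (Y (Suc n))" "?q m = g x"
        using lin_closed[OF g x] quot_proj_image[of "Y (Suc n)" ?N'] by (metis imageE)
      have "m \<in> im (Suc j) (Suc n)" using hom_quot_in_next[OF X j _ g x m] jn by simp
      \<comment> \<open>Here k \<ge> 1 enters: it gives j + 1 \<le> n, so the image of Y(j+1) in
        Y(n+1) is contained in that of Y(n).\<close>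
      then have "m \<in> im n (Suc n)" using im_mono[of "Suc j" n "Suc n"] jn by auto
      then obtain y where y: "y \<in> carrier (Y n)" "m = \<alpha> n y" using im_Suc[of n n] n1 im_self by auto
      then have "g x = ?\<mu> (?p y)" using m(2) mup by simp
      then show "g x \<in> ?\<mu> ` carrier ?A" using lin_closed[OF p y(1)] by blast
    next
      fix h assume h: "lin R (P1 X) ?A h"
      \<comment> \<open>On the level of cocycles this is surjectivity of Ext^1(X, Y(n))
        \<rightarrow> Ext^1(X, Y(n)/Y(j)), the place where projective dimension at most one is
        used.\<close>
      obtain h' where h': "lin R (P1 X) (Y n) h'" "\<And>q. q \<in> carrier (P1 X) \<Longrightarrow> ?p (h' q) = h q"
        using projective_lift[OF proj1 D(1) AM p quot_proj_image h] by blast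
      obtain k where k: "lin R (P0 X) (Y (Suc n)) k" "\<And>q. q \<in> carrier (P1 X) \<Longrightarrow> k (i X q) = \<alpha> n (h' q)"
        using ua[OF X] h'(1) unfolding universal_at_def by blast
      have "?q (k (i X q)) = ?\<mu> (h q)" if q': "q \<in> carrier (P1 X)" for q
        using k(2)[OF q'] mup[OF lin_closed[OF h'(1) q']] h'(2)[OF q'] by simp
      then show "\<exists>k. lin R (P0 X) ?M k \<and> (\<forall>q\<in>carrier (P1 X). k (i X q) = ?\<mu> (h q))"
        using lin_comp[OF k(1) q] by (intro exI[of _ "\<lambda>p. ?q (k p)"]) auto
    qed
  qed
  then show "universal_inclusion R \<X> (induced_chain_mod Y \<alpha> j k) (induced_chain_mod Y \<alpha> j (Suc k)) (induced_chain_map Y \<alpha> j k)"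
    by (simp add: induced_chain_mod_def induced_chain_map_def n_def)
qed

section \<open>The socle filtration of Y(r)\<close>

lemma chain_filtered:
  assumes Y1: "Y 1 \<in> Add R \<X>" and r: "r \<ge> 1"
  shows "filtered_by R \<X> (Y r)"
  using r
proof (induction r rule: dec_induct)
  case base
  obtain I :: "('m \<times> nat) set" and F s p where F: "\<And>i. i \<in> I \<Longrightarrow> F i \<in> \<X>"
    and s: "s \<in> mod_hom R (Y 1) (direct_sum I F)" and p: "p \<in> mod_hom R (direct_sum I F) (Y 1)"
    and ps: "\<And>y. y \<in> carrier (Y 1) \<Longrightarrow> p (s y) = y" and L: "left_module R (Y 1)"
    using Y1 unfolding Add_def by blast
  show ?case using filtered_by_retract[OF sb L F mod_hom_lin[OF s] mod_hom_lin[OF p] ps] .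
next
  case (step n)
  obtain J :: "(('r, 'x) module \<times> ('r, 'm, 'm \<times> 'x, 'x) ses set) set" and F \<pi>
    where F: "\<And>k. k \<in> J \<Longrightarrow> F k \<in> \<X>" and ex: "exact R (Y n) (Y (Suc n)) (direct_sum J F) (\<alpha> n) \<pi>"
    using chain_step[OF step(1)] by blast
  note D = exactD[OF ex]
  \<comment> \<open>A direct sum is a retract of itself, which settles the successive
    quotients.\<close>
  have "filtered_by R \<X> (direct_sum J F)"
    using filtered_by_retract[OF sb D(3) F lin_id lin_id] by simp
  then show ?case using filtered_by_extension[OF ex _ step.IH] semibrick_left_module[OF sb] by blast
qed

text \<open>\<open>sub\<close> puts W/V into the socle, and \<open>sup\<close> puts the image of
  every map from a member of \<open>\<X>\<close> into W/V. Since \<open>V\<close> is contained in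
  \<open>W\<close>, membership in \<open>W\<close> depends only on the coset modulo
  \<open>V\<close>, so the preimage of W/V is \<open>W\<close> itself.\<close>

lemma socle_step:
  assumes r: "r \<ge> 1" and W: "submodule W R (Y r)" and V: "submodule V R (Y r)" "V \<subseteq> W"
    and sub: "\<And>w. w \<in> W \<Longrightarrow> quot_proj (Y r) V w \<in> socle R \<X> (quot_mod (Y r) V)"
    and sup: "\<And>X g x m. X \<in> \<X> \<Longrightarrow> lin R X (quot_mod (Y r) V) g \<Longrightarrow> x \<in> carrier X \<Longrightarrow> m \<in> carrier (Y r) \<Longrightarrow>
      quot_proj (Y r) V m = g x \<Longrightarrow> m \<in> W"
  shows "W = {x \<in> carrier (Y r). quot_proj (Y r) V x \<in> socle R \<X> (quot_mod (Y r) V)}"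
proof
  have Yr: "left_module R (Y r)" using chain_modules(1)[OF r] .
  interpret Yr: abelian_group "Y r" using Yr by (rule left_module_abelian_group)
  let ?Q = "quot_mod (Y r) V" and ?q = "quot_proj (Y r) V"
  have Q: "left_module R ?Q" using quot_mod_left_module[OF Yr V(1)] .
  have q: "lin R (Y r) ?Q ?q" using quot_proj_lin[OF Yr V(1)] .
  note WD = submoduleD[OF Yr W]
  show "W \<subseteq> {x \<in> carrier (Y r). ?q x \<in> socle R \<X> ?Q}" using WD(1) sub by blast
  have T: "submodule (?q ` W) R ?Q" using submodule_image[OF Yr Q q W] .
  have soc: "socle R \<X> ?Q \<subseteq> ?q ` W"
  proof (rule socle_subset[OF T])
    fix X f x assume X: "X \<in> \<X>" and f: "lin R X ?Q f" and x: "x \<in> carrier X"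
    obtain m where m: "m \<in> carrier (Y r)" "?q m = f x"
      using lin_closed[OF f x] quot_proj_image[of "Y r" V] by (metis imageE)
    show "f x \<in> ?q ` W" using sup[OF X f x m] m(2) by (metis imageI)
  qed
  show "{x \<in> carrier (Y r). ?q x \<in> socle R \<X> ?Q} \<subseteq> W"
  proof
    fix x assume "x \<in> {x \<in> carrier (Y r). ?q x \<in> socle R \<X> ?Q}"
    then obtain w where x: "x \<in> carrier (Y r)" and w: "w \<in> W" "?q x = ?q w" using soc by auto
    interpret QQ: abelian_group ?Q using Q by (rule left_module_abelian_group)
    have wc: "w \<in> carrier (Y r)" using w(1) WD(1) by blast
    have "?q (x \<ominus>\<^bsub>Y r\<^esub> w) = \<zero>\<^bsub>?Q\<^esub>"
      using lin_minus[OF Yr Q q x wc] w(2) QQ.minus_zero_iff[OF lin_closed[OF q wc] lin_closed[OF q wc]] by metis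
    then have "x \<ominus>\<^bsub>Y r\<^esub> w \<in> W" using quot_proj_zero_iff[OF Yr V(1), of "x \<ominus>\<^bsub>Y r\<^esub> w"] x wc V(2) by blast
    then have "w \<oplus>\<^bsub>Y r\<^esub> (x \<ominus>\<^bsub>Y r\<^esub> w) \<in> W" using WD(3) w(1) by blast
    then show "x \<in> W" using Yr.add_minus_cancel[OF x wc] by simp
  qed
qed

theorem chain_socle_filtration:
  assumes Y1: "Y 1 \<in> Add R \<X>" and r: "r \<ge> 1"
  shows "socle_filtration R \<X> (Y r) (chain_filtration Y \<alpha> r)"
proof -
  have Yr: "left_module R (Y r)" using chain_modules(1)[OF r] .
  let ?V = "chain_filtration Y \<alpha> r"
  have V0: "?V 0 = {\<zero>\<^bsub>Y r\<^esub>}" by (simp add: chain_filtration_def)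
  have Vk: "?V k = im k r" if "1 \<le> k" "k \<le> r" for k using that by (simp add: chain_filtration_def)
  have Vr: "?V k = carrier (Y r)" if "r \<le> k" for k
    using that r im_self by (cases "k = r") (auto simp: chain_filtration_def)
  have succ: "?V (Suc k) = {x \<in> carrier (Y r). quot_proj (Y r) (?V k) x \<in> socle R \<X> (quot_mod (Y r) (?V k))}" for k
  proof -
    \<comment> \<open>The step from 0 to Y(1) uses that Y(1) lies in Add, the steps up to r use
      universality, and from r on the filtration is stationary.\<close>
    consider "k = 0" | "1 \<le> k" "k < r" | "r \<le> k" using not_less by fastforce
    then show ?thesis
    proof cases
      case 1
      have VV: "?V (Suc k) = im 1 r" "?V k = {\<zero>\<^bsub>Y r\<^esub>}" using 1 Vk[of 1] r V0 by auto
      have W: "submodule (im 1 r) R (Y r)" using im_submodule[of 1 r] r by simp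
      have V: "submodule {\<zero>\<^bsub>Y r\<^esub>} R (Y r)" using submodule_zero[OF Yr] .
      let ?Q = "quot_mod (Y r) {\<zero>\<^bsub>Y r\<^esub>}" and ?q = "quot_proj (Y r) {\<zero>\<^bsub>Y r\<^esub>}"
      have Q: "left_module R ?Q" using quot_mod_left_module[OF Yr V] .
      have q: "lin R (Y r) ?Q ?q" using quot_proj_lin[OF Yr V] .
      show ?thesis unfolding VV
      proof (rule socle_step[OF r W V])
        show "{\<zero>\<^bsub>Y r\<^esub>} \<subseteq> im 1 r" using submoduleD(2)[OF Yr W] by blast
        fix w assume "w \<in> im 1 r"
        then obtain y where y: "y \<in> carrier (Y 1)" "w = chain_comp \<alpha> 1 (r - 1) y" by (auto simp: chain_image_def)
        obtain I :: "('m \<times> nat) set" and F s p where F: "\<And>i. i \<in> I \<Longrightarrow> F i \<in> \<X>"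
          and s: "s \<in> mod_hom R (Y 1) (direct_sum I F)" and p: "p \<in> mod_hom R (direct_sum I F) (Y 1)"
          and ps: "\<And>y. y \<in> carrier (Y 1) \<Longrightarrow> p (s y) = y"
          using Y1 unfolding Add_def by blast
        have c: "lin R (Y 1) (Y r) (chain_comp \<alpha> 1 (r - 1))" using chain_comp_lin(1)[of 1 "r - 1"] r by simp
        have f: "lin R (direct_sum I F) ?Q (\<lambda>v. ?q (chain_comp \<alpha> 1 (r - 1) (p v)))"
          using lin_comp[OF lin_comp[OF mod_hom_lin[OF p] c] q] .
        \<comment> \<open>Since y = p (s y), every element of Y(1) is reached from a direct sum of
          members of \<open>\<X>\<close>.\<close>
        have "?q (chain_comp \<alpha> 1 (r - 1) (p (s y))) \<in> socle R \<X> ?Q"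
          using sum_image_in_socle[OF sb Q F f lin_closed[OF mod_hom_lin[OF s] y(1)]] .
        then show "?q w \<in> socle R \<X> ?Q" using ps[OF y(1)] y(2) by simp
      next
        fix X g x m assume X: "X \<in> \<X>" and g: "lin R X ?Q g" and x: "x \<in> carrier X" and m: "m \<in> carrier (Y r)" "?q m = g x"
        have "inj_on ?q (carrier (Y r))"
          unfolding lin_inj_iff[OF Yr Q q] using quot_proj_zero_iff[OF Yr V] by blast
        then have bij: "bij_betw ?q (carrier (Y r)) (carrier ?Q)"
          using quot_proj_image[of "Y r" "{\<zero>\<^bsub>Y r\<^esub>}"] by (rule bij_betw_imageI)
        \<comment> \<open>The quotient by zero is a different module from Y(r), so \<open>g\<close>
          is composed with the inverse of the projection before \<open>hom_in_first\<close> is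
          applied.\<close>
        have "inv_into (carrier (Y r)) ?q (g x) \<in> im 1 r"
          using hom_in_first[OF X r lin_comp[OF g lin_inv_into[OF Yr Q q bij]] x] .
        then show "m \<in> im 1 r" using bij_betw_inv_into_left[OF bij m(1)] m(2) by simp
      qed
    next
      case 2
      have VV: "?V (Suc k) = im (Suc k) r" "?V k = im k r" using 2 Vk[of k] Vk[of "Suc k"] by auto
      have W: "submodule (im (Suc k) r) R (Y r)" and V: "submodule (im k r) R (Y r)"
        using im_submodule[of "Suc k" r] im_submodule[of k r] 2 by auto
      let ?Q = "quot_mod (Y r) (im k r)" and ?q = "quot_proj (Y r) (im k r)"
      have Q: "left_module R ?Q" using quot_mod_left_module[OF Yr V] .
      have q: "lin R (Y r) ?Q ?q" using quot_proj_lin[OF Yr V] .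
      show ?thesis unfolding VV
      proof (rule socle_step[OF r W V])
        show "im k r \<subseteq> im (Suc k) r" using im_mono[of k "Suc k" r] 2 by simp
        obtain l where l: "r = Suc k + l" using 2 less_iff_Suc_add by auto
        obtain J :: "(('r, 'x) module \<times> ('r, 'm, 'm \<times> 'x, 'x) ses set) set" and F \<pi>
          where F: "\<And>k. k \<in> J \<Longrightarrow> F k \<in> \<X>" and ex: "exact R (Y k) (Y (Suc k)) (direct_sum J F) (\<alpha> k) \<pi>"
          using chain_step[OF 2(1)] by blast
        note D = exactD[OF ex]
        define c where "c = chain_comp \<alpha> (Suc k) l"
        have c: "lin R (Y (Suc k)) (Y r) c" using chain_comp_lin(1)[of "Suc k" l] l by (simp add: c_def)
        have cz: "c (\<alpha> k z) \<in> im k r" if "z \<in> carrier (Y k)" for z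
        proof -
          have "c (\<alpha> k z) = chain_comp \<alpha> k (Suc l) z"
            using chain_comp_add[of \<alpha> k 1 l] by (simp add: c_def)
          then show ?thesis using im_eq[of k "Suc l"] l that by auto
        qed
        note qc = lin_comp[OF c q]
        have "?q (c y) = \<zero>\<^bsub>?Q\<^esub>" if y: "y \<in> carrier (Y (Suc k))" "\<pi> y = \<zero>\<^bsub>direct_sum J F\<^esub>" for y
        proof -
          obtain z where "z \<in> carrier (Y k)" "y = \<alpha> k z" using D(8)[OF y(1)] y(2) by blast
          then have "c y \<in> im k r" using cz by simp
          then show ?thesis using quot_proj_zero_iff[OF Yr V lin_closed[OF c y(1)]] by blast
        qed
        \<comment> \<open>The direct sum is isomorphic to Y(k+1)/Y(k); \<psi> is its embedding into
          Y(r)/Y(k), whose image lies in the socle.\<close>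
        then obtain \<psi> where psi: "lin R (direct_sum J F) ?Q \<psi>" "\<And>y. y \<in> carrier (Y (Suc k)) \<Longrightarrow> \<psi> (\<pi> y) = ?q (c y)"
          using lin_factor[OF D(2,3) Q D(5,7) qc] by blast
        fix w assume "w \<in> im (Suc k) r"
        then obtain y where y: "y \<in> carrier (Y (Suc k))" "w = c y" using im_eq[of "Suc k" l] l by (auto simp: c_def)
        show "?q w \<in> socle R \<X> ?Q"
          using sum_image_in_socle[OF sb Q F psi(1) lin_closed[OF D(5) y(1)]] psi(2)[OF y(1)] y(2) by simp
      next
        fix X g x m assume "X \<in> \<X>" "lin R X ?Q g" "x \<in> carrier X" "m \<in> carrier (Y r)" "?q m = g x"
        then show "m \<in> im (Suc k) r" using hom_quot_in_next 2 by blast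
      qed
    next
      \<comment> \<open>The quotient Y(r)/Y(r) is zero, so its socle is everything and the
        filtration stays at Y(r).\<close>
      case 3
      have VV: "?V (Suc k) = carrier (Y r)" "?V k = carrier (Y r)" using 3 Vr by auto
      have V: "submodule (carrier (Y r)) R (Y r)" using submodule_carrier[OF Yr] .
      let ?Q = "quot_mod (Y r) (carrier (Y r))" and ?q = "quot_proj (Y r) (carrier (Y r))"
      have Q: "left_module R ?Q" using quot_mod_left_module[OF Yr V] .
      have "\<zero>\<^bsub>?Q\<^esub> \<in> socle R \<X> ?Q"
        unfolding socle_def mod_span_def using submoduleD(2)[OF Q] by blast
      then have "?q x \<in> socle R \<X> ?Q" if "x \<in> carrier (Y r)" for x
        using quot_proj_zero_iff[OF Yr V that] that by metis
      then show ?thesis unfolding VV by blast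
    qed
  qed
  show ?thesis unfolding socle_filtration_def
  proof (intro conjI allI impI)
    show "filtered_by R \<X> (Y r)" using chain_filtered[OF Y1 r] .
  next
    fix l :: nat assume "\<forall>k. l \<le> k"
    then have "l = 0" by blast
    then show "?V l = {\<zero>\<^bsub>Y r\<^esub>}" using V0 by simp
  next
    fix k l :: nat assume "k < l \<and> (\<forall>i<l. i \<le> k)"
    then have "l = Suc k" by (metis Suc_lessI less_Suc_eq_le less_irrefl_nat)
    then show "?V l = {x \<in> carrier (Y r). quot_proj (Y r) (?V k) x \<in> socle R \<X> (quot_mod (Y r) (?V k))}"
      using succ by simp
  next
    \<comment> \<open>A positive natural number is a successor, so the limit clause is vacuous:
      nothing lies strictly between l - 1 and l.\<close>
    fix l :: nat assume l: "(\<exists>k. k < l) \<and> (\<forall>k<l. \<exists>i. k < i \<and> i < l)"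
    then have "l - 1 < l" by auto
    then obtain i where "l - 1 < i" "i < l" using l by blast
    then show "?V l = (\<Union>k\<in>{..<l}. ?V k)" by simp
  qed
qed

end

theorem proposition4p7:
  fixes R :: "('r, 'z) ring_scheme"
    and \<X> :: "('r, 'x) module set"
    and Y :: "nat \<Rightarrow> ('r, 'm) module"
    and \<alpha> :: "nat \<Rightarrow> 'm \<Rightarrow> 'm"
  assumes "ring R"
    and "semibrick R \<X>"
    and "\<forall>X\<in>\<X>. proj_dim_le_one R X"
    and "universal_chain R \<X> Y \<alpha>"
  shows "(\<forall>j\<ge>1. universal_chain R \<X> (induced_chain_mod Y \<alpha> j) (induced_chain_map Y \<alpha> j)) \<and>
    (Y 1 \<in> Add R \<X> \<longrightarrow> (\<forall>r\<ge>1. socle_filtration R \<X> (Y r) (chain_filtration Y \<alpha> r)))"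
proof -
  have "\<forall>X\<in>\<X>. \<exists>s :: ('r, 'x \<Rightarrow> 'r, 'x \<Rightarrow> 'r, 'x) ses. short_exact R s \<and> ses_right s = X \<and>
      projective R (ses_left s) \<and> projective R (ses_mid s)"
    using assms(3) by (simp add: proj_dim_le_one_def)
  \<comment> \<open>\<open>proj_dim_le_one\<close> asserts existence only; one resolution is fixed
    for each member of \<open>\<X>\<close>.\<close>
  from bchoice[OF this] obtain s :: "('r, 'x) module \<Rightarrow> ('r, 'x \<Rightarrow> 'r, 'x \<Rightarrow> 'r, 'x) ses"
    where s: "\<forall>X\<in>\<X>. short_exact R (s X) \<and> ses_right (s X) = X \<and>
      projective R (ses_left (s X)) \<and> projective R (ses_mid (s X))"
    by blast
  interpret universal_chain_data R \<X> Y \<alpha> "\<lambda>X. ses_left (s X)" "\<lambda>X. ses_mid (s X)"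
    "\<lambda>X. ses_inj (s X)" "\<lambda>X. ses_proj (s X)"
  proof (rule universal_chain_data.intro)
    fix X assume "X \<in> \<X>"
    then have sX: "short_exact R (s X)" "ses_right (s X) = X"
      "projective R (ses_left (s X))" "projective R (ses_mid (s X))" using s by blast+
    then have "exact R (ses_left (s X)) (ses_mid (s X)) X (ses_inj (s X)) (ses_proj (s X))"
      using short_exact_iff[of R "s X"] by simp
    with sX show "resolution R X (ses_left (s X)) (ses_mid (s X)) (ses_inj (s X)) (ses_proj (s X))"
      by (simp add: resolution_def)
  qed (use assms in auto)
  show ?thesis using induced_chain chain_socle_filtration by blast
qed

end
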